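(* Let $\mathcal{F}_4^{\mathrm{mon}}$ be the set of monic quartic polynomials $f(x)=x^4+a_1x^3+a_2x^2+a_3x+a_4\in\mathbb{Z}[x]$ with nonzero discriminant, with height $H_r(f)=\max_i|a_i|^{1/i}$ and with $\psi(f)$ the pair $(R,C)$ described below. Then $(\mathcal{F}_4^{\mathrm{mon}},H_r,\psi)$ corresponds to $(1/12,1/6,1/4,1/6,1/3)$.
   Context: By Bhargava's parametrization, pairs $(A,B)$ of integral ternary quadratic forms correspond to pairs $(R,C)$ of a quartic ring $R$ and a cubic resolvent ring $C$. For a binary quartic form $f=f_0x^4+f_1x^3y+f_2x^2y^2+f_3xy^3+f_4y^4$, let $A(x,y,z)=f_0x^2+f_1xy+f_2y^2+f_3yz+f_4z^2$ and $B(x,y,z)=y^2+xz$, and let $\psi(f)$ be the associated pair $(R,C)$; for monic $f(x)$ apply this to its homogenization (so $R\cong\mathbb{Z}[x]/(f)$). For a nondegenerate rank $n$ ring with homomorphisms $\sigma_i$ to $\mathbb{C}$, $|x|=\sqrt{\frac1n\sum|\sigma_i(x)|^2}$, $\lambda_i$ is the smallest $r$ with $i+1$ linearly independent elements of length $\le r$; $\Delta=|\mathrm{Disc}(R)|$. For $p=(p_1,p_2,p_3,q_1,q_2)$, $(R,C)$ is $(\varepsilon,X)$-close to $p$ if $\max_{i\le3}|\log_\Delta\lambda_i(R)-p_i|\le\varepsilon/\log X$ and $\max_{i\le2}|\log_\Delta\lambda_i(C)-q_i|\le\varepsilon/\log X$. $\mathcal{F}_4(p,\varepsilon,X)$: isomorphism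 classes of pairs $(R,C)$ ($R$ nondegenerate quartic, $C$ a cubic resolvent) with $\Delta\le X$ that are $(\varepsilon,X)$-close to $p$. For an infinite set $\mathcal{F}$ with height $H$ with finite sublevel sets and a map $\psi$ to such pairs, $(\mathcal{F},H,\psi)$ corresponds to $p$ if $\lim_{\varepsilon\to\infty}\liminf_{X\to\infty}\frac{\#\{f:H(f)\le X,\ \psi(f)\ (\varepsilon,X)\text{-close to }p\}}{\#\{f:H(f)\le X\}}=1$ and there is $M$ with $\liminf_X\frac{\#\{(R,C)\in\mathcal{F}_4(p,\varepsilon,X):(R,C)\in\psi(\mathcal{F})\}}{\#\mathcal{F}_4(p,\varepsilon,X)}>0$ for all $\varepsilon>M$.
   Formalization: The form B is taken as y^2-xz instead of the printed y^2+xz: only this sign gives R isomorphic to Z[x]/(f); the printed one gives the pair of f with a_3 negated, degenerate e.g. for f=x^4-2x^3+2x^2+2x+1, whose discriminant is nonzero. *)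

theory Defs
  imports
    Complex_Main
    "HOL-Library.Extended_Real"
    "HOL-Library.Liminf_Limsup"
    "HOL-Algebra.Algebraic_Closure_Type"
    "Subresultants.Resultant_Prelim"
begin

section \<open>Rings of rank n\<close>

definition int_comb :: "('a, 'm) ring_scheme \<Rightarrow> nat \<Rightarrow> (nat \<Rightarrow> 'a) \<Rightarrow> (nat \<Rightarrow> int) \<Rightarrow> 'a" where
  "int_comb R n b c = (\<Oplus>\<^bsub>R\<^esub>i\<in>{..<n}. [c i] \<cdot>\<^bsub>R\<^esub> b i)"

definition int_basis :: "('a, 'm) ring_scheme \<Rightarrow> nat \<Rightarrow> (nat \<Rightarrow> 'a) \<Rightarrow> bool" where
  "int_basis R n b \<longleftrightarrow> b \<in> {..<n} \<rightarrow> carrier R \<and>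
     (\<forall>x\<in>carrier R. \<exists>!c. c \<in> extensional {..<n} \<and> x = int_comb R n b c)"

definition int_independent :: "('a, 'm) ring_scheme \<Rightarrow> nat \<Rightarrow> (nat \<Rightarrow> 'a) \<Rightarrow> bool" where
  "int_independent R n v \<longleftrightarrow>
     (\<forall>c. int_comb R n v c = \<zero>\<^bsub>R\<^esub> \<longrightarrow> (\<forall>i<n. c i = 0))"

definition rank_ring :: "nat \<Rightarrow> ('a, 'm) ring_scheme \<Rightarrow> bool" where
  "rank_ring n R \<longleftrightarrow> cring R \<and> (\<exists>b. int_basis R n b)"

definition coord :: "('a, 'm) ring_scheme \<Rightarrow> nat \<Rightarrow> (nat \<Rightarrow> 'a) \<Rightarrow> 'a \<Rightarrow> nat \<Rightarrow> int" where
  "coord R n b x = (THE c. c \<in> extensional {..<n} \<and> x = int_comb R n b c)"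

text \<open>Trace of multiplication by \<open>x\<close>, and the discriminant \<open>det (Tr (b i * b j))\<close>; neither
  depends on the basis.\<close>

definition ring_trace :: "nat \<Rightarrow> ('a, 'm) ring_scheme \<Rightarrow> 'a \<Rightarrow> int" where
  "ring_trace n R x =
     (let b = (SOME b. int_basis R n b) in \<Sum>i<n. coord R n b (x \<otimes>\<^bsub>R\<^esub> b i) i)"

definition ring_disc :: "nat \<Rightarrow> ('a, 'm) ring_scheme \<Rightarrow> int" where
  "ring_disc n R =
     (let b = (SOME b. int_basis R n b)
      in Determinant.det (mat n n (\<lambda>(i, j). ring_trace n R (b i \<otimes>\<^bsub>R\<^esub> b j))))"

definition nondegenerate :: "nat \<Rightarrow> ('a, 'm) ring_scheme \<Rightarrow> bool" where
  "nondegenerate n R \<longleftrightarrow> ring_disc n R \<noteq> 0"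

text \<open>Extensionality makes homomorphisms that agree on the carrier equal, so that a nondegenerate
  ring of rank \<open>n\<close> has exactly \<open>n\<close> of them.\<close>

definition complex_homs :: "('a, 'm) ring_scheme \<Rightarrow> ('a \<Rightarrow> complex) set" where
  "complex_homs R = Ring.ring_hom R (ring_of_type_algebra :: complex ring) \<inter> extensional (carrier R)"

definition ring_length :: "nat \<Rightarrow> ('a, 'm) ring_scheme \<Rightarrow> 'a \<Rightarrow> real" where
  "ring_length n R x = sqrt ((\<Sum>\<sigma>\<in>complex_homs R. (cmod (\<sigma> x))\<^sup>2) / real n)"

text \<open>The infimum is attained for a nondegenerate ring of rank \<open>n > i\<close>, since such a ring is
  discrete in \<open>\<complex>\<^sup>n\<close>.\<close>

definition succ_min :: "nat \<Rightarrow> ('a, 'm) ring_scheme \<Rightarrow> nat \<Rightarrow> real" where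
  "succ_min n R i = Inf {r. \<exists>v\<in>{..<i + 1} \<rightarrow> carrier R.
     int_independent R (i + 1) v \<and> (\<forall>j<i + 1. ring_length n R (v j) \<le> r)}"


section \<open>Quartic rings with a cubic resolvent ring\<close>

text \<open>For a nondegenerate quartic ring \<open>R\<close>, Bhargava's cubic invariant ring is generated by the
  elements \<open>\<phi>(x) = x x' + x'' x'''\<close>, where \<open>x, x', x'', x'''\<close> are the conjugates of \<open>x\<close>, and a
  cubic resolvent ring is a cubic ring which contains it and has the discriminant of \<open>R\<close>.
  In complex coordinates, \<open>\<phi>(x)\<close> is the triple displayed below. The containment of an abstract
  cubic ring \<open>C\<close> is recorded by the map \<open>\<phi> : R \<rightarrow> C\<close>.\<close>

definition cubic_resolvent ::
  "('a, 'm) ring_scheme \<Rightarrow> ('b, 'k) ring_scheme \<Rightarrow> ('a \<Rightarrow> 'b) \<Rightarrow> bool" where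
  "cubic_resolvent R C \<phi> \<longleftrightarrow>
     rank_ring 3 C \<and> ring_disc 3 C = ring_disc 4 R \<and> \<phi> \<in> carrier R \<rightarrow> carrier C \<and>
     (\<exists>\<sigma> \<tau>. bij_betw \<sigma> {0,1,2,3::nat} (complex_homs R) \<and>
            bij_betw \<tau> {0,1,2::nat} (complex_homs C) \<and>
            (\<forall>x\<in>carrier R.
               \<tau> 0 (\<phi> x) = \<sigma> 0 x * \<sigma> 1 x + \<sigma> 2 x * \<sigma> 3 x \<and>
               \<tau> 1 (\<phi> x) = \<sigma> 0 x * \<sigma> 2 x + \<sigma> 1 x * \<sigma> 3 x \<and>
               \<tau> 2 (\<phi> x) = \<sigma> 0 x * \<sigma> 3 x + \<sigma> 1 x * \<sigma> 2 x))"

text \<open>Isomorphism classes are formed over the carrier type \<open>int list\<close>. This loses nothing: every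
  ring of rank \<open>n\<close> has an isomorphic copy with carrier \<open>{xs. length xs = n}\<close>.\<close>

type_synonym res_pair = "int list ring \<times> int list ring \<times> (int list \<Rightarrow> int list)"

definition quartic_pairs :: "res_pair set" where
  "quartic_pairs =
     {(R, C, \<phi>). rank_ring 4 R \<and> nondegenerate 4 R \<and> cubic_resolvent R C \<phi>}"

definition pair_iso :: "(res_pair \<times> res_pair) set" where
  "pair_iso = {((R, C, \<phi>), (R', C', \<phi>')).
     (R, C, \<phi>) \<in> quartic_pairs \<and> (R', C', \<phi>') \<in> quartic_pairs \<and>
     (\<exists>\<alpha>\<in>ring_iso R R'. \<exists>\<gamma>\<in>ring_iso C C'. \<forall>x\<in>carrier R. \<gamma> (\<phi> x) = \<phi>' (\<alpha> x))}"

definition pair_disc :: "res_pair \<Rightarrow> real" where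
  "pair_disc = (\<lambda>(R, C, \<phi>). real_of_int \<bar>ring_disc 4 R\<bar>)"

type_synonym ternary_form = "int \<Rightarrow> int \<Rightarrow> int \<Rightarrow> int"

text \<open>Bhargava's parametrization: \<open>(A, B)\<close> are the coordinates of the quadratic map
  \<open>R/\<int> \<rightarrow> C/\<int>\<close> induced by \<open>\<phi>\<close>, in bases of \<open>R\<close> and \<open>C\<close> that begin with \<open>1\<close>.\<close>

definition has_forms :: "res_pair \<Rightarrow> ternary_form \<Rightarrow> ternary_form \<Rightarrow> bool" where
  "has_forms = (\<lambda>(R, C, \<phi>) A B. \<exists>\<alpha> \<omega>.
     int_basis R 4 \<alpha> \<and> \<alpha> 0 = \<one>\<^bsub>R\<^esub> \<and> int_basis C 3 \<omega> \<and> \<omega> 0 = \<one>\<^bsub>C\<^esub> \<and>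
     (\<forall>x y z. \<exists>k :: int.
        \<phi> ([x] \<cdot>\<^bsub>R\<^esub> \<alpha> 1 \<oplus>\<^bsub>R\<^esub> [y] \<cdot>\<^bsub>R\<^esub> \<alpha> 2 \<oplus>\<^bsub>R\<^esub> [z] \<cdot>\<^bsub>R\<^esub> \<alpha> 3) =
        [k] \<cdot>\<^bsub>C\<^esub> \<one>\<^bsub>C\<^esub> \<oplus>\<^bsub>C\<^esub> [A x y z] \<cdot>\<^bsub>C\<^esub> \<omega> 1 \<oplus>\<^bsub>C\<^esub> [B x y z] \<cdot>\<^bsub>C\<^esub> \<omega> 2))"

text \<open>The isomorphism class of pairs which corresponds to \<open>(A, B)\<close>.\<close>

definition pair_class :: "ternary_form \<Rightarrow> ternary_form \<Rightarrow> res_pair set" where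
  "pair_class A B = {P \<in> quartic_pairs. has_forms P A B}"


section \<open>Closeness and correspondence\<close>

text \<open>The bound usually written \<open>X\<close> is called \<open>T\<close>, since HOL-Algebra reserves \<open>X\<close> as syntax.\<close>

type_synonym exponents = "real \<times> real \<times> real \<times> real \<times> real"

definition close :: "exponents \<Rightarrow> real \<Rightarrow> real \<Rightarrow> res_pair \<Rightarrow> bool" where
  "close = (\<lambda>(p1, p2, p3, q1, q2) \<epsilon> T (R, C, \<phi>).
     let \<Delta> = pair_disc (R, C, \<phi>) in
       Max {\<bar>log \<Delta> (succ_min 4 R 1) - p1\<bar>,
            \<bar>log \<Delta> (succ_min 4 R 2) - p2\<bar>,
            \<bar>log \<Delta> (succ_min 4 R 3) - p3\<bar>} \<le> \<epsilon> / ln T \<and>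
       Max {\<bar>log \<Delta> (succ_min 3 C 1) - q1\<bar>,
            \<bar>log \<Delta> (succ_min 3 C 2) - q2\<bar>} \<le> \<epsilon> / ln T)"

text \<open>Closeness is invariant under isomorphism, so one representative decides it.\<close>

definition class_close :: "exponents \<Rightarrow> real \<Rightarrow> real \<Rightarrow> res_pair set \<Rightarrow> bool" where
  "class_close p \<epsilon> T K \<longleftrightarrow> (\<exists>P\<in>K. close p \<epsilon> T P)"

definition F4 :: "exponents \<Rightarrow> real \<Rightarrow> real \<Rightarrow> res_pair set set" where
  "F4 p \<epsilon> T = {P \<in> quartic_pairs. pair_disc P \<le> T \<and> close p \<epsilon> T P} // pair_iso"

text \<open>The first three conjuncts are the standing assumptions on \<open>(F, H, \<psi>)\<close>: an infinite family,
  a height with finite sublevel sets, and values in the isomorphism classes of pairs.\<close>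

definition corresponds_to ::
  "'f set \<Rightarrow> ('f \<Rightarrow> real) \<Rightarrow> ('f \<Rightarrow> res_pair set) \<Rightarrow> exponents \<Rightarrow> bool" where
  "corresponds_to F H \<psi> p \<longleftrightarrow>
     infinite F \<and>
     (\<forall>T. finite {f \<in> F. H f \<le> T}) \<and>
     \<psi> ` F \<subseteq> quartic_pairs // pair_iso \<and>
     ((\<lambda>\<epsilon>. Liminf at_top (\<lambda>T. ereal
         (real (card {f \<in> F. H f \<le> T \<and> class_close p \<epsilon> T (\<psi> f)}) /
          real (card {f \<in> F. H f \<le> T})))) \<longlongrightarrow> 1) at_top \<and>
     (\<exists>M. \<forall>\<epsilon>>M. Liminf at_top (\<lambda>T. ereal
         (real (card {K \<in> F4 p \<epsilon> T. K \<in> \<psi> ` F}) /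
          real (card (F4 p \<epsilon> T)))) > 0)"


section \<open>Monic quartic polynomials\<close>

text \<open>A binary quartic form \<open>f 0 x^4 + f 1 x^3 y + f 2 x^2 y^2 + f 3 x y^3 + f 4 y^4\<close> is given by
  its coefficients. The sign in \<open>form_B\<close> is forced by the requirement that a monic \<open>f\<close> yield
  \<open>R \<cong> \<int>[t]/(f)\<close>: in the basis \<open>1, t, t^2 + f 1 t, t^3 + f 1 t^2 + f 2 t\<close> of \<open>\<int>[t]/(f)\<close> and
  the basis \<open>1, w, w^2 - f 2 w\<close> of \<open>\<int>[w]\<close>, \<open>w = \<phi>(t)\<close>, the map \<open>\<phi>\<close> has coordinates exactly
  \<open>(form_A f, form_B)\<close>. On the conic \<open>form_B = 0\<close>, parametrized by \<open>(s^2, s u, u^2)\<close>, the form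
  \<open>form_A f\<close> restricts to \<open>f(s, u)\<close>. The form \<open>y^2 + x z\<close> in place of \<open>form_B\<close> would give the pair
  of \<open>f\<close> with \<open>f 3\<close> negated, whose discriminant is in general different and may vanish.\<close>

definition form_A :: "(nat \<Rightarrow> int) \<Rightarrow> ternary_form" where
  "form_A f x y z = f 0 * x\<^sup>2 + f 1 * x * y + f 2 * y\<^sup>2 + f 3 * y * z + f 4 * z\<^sup>2"

definition form_B :: ternary_form where
  "form_B x y z = y\<^sup>2 - x * z"

definition psi_form :: "(nat \<Rightarrow> int) \<Rightarrow> res_pair set" where
  "psi_form f = pair_class (form_A f) form_B"

definition homogenization :: "int poly \<Rightarrow> nat \<Rightarrow> int" where
  "homogenization f i = coeff f (4 - i)"

definition psi_mon :: "int poly \<Rightarrow> res_pair set" where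
  "psi_mon f = psi_form (homogenization f)"

definition monic_disc :: "int poly \<Rightarrow> int" where
  "monic_disc f = (-1) ^ (degree f * (degree f - 1) div 2) * resultant f (pderiv f)"

definition F4_mon :: "int poly set" where
  "F4_mon = {f. degree f = 4 \<and> lead_coeff f = 1 \<and> monic_disc f \<noteq> 0}"

text \<open>The coefficient \<open>a_i\<close> of \<open>x^4 + a_1 x^3 + a_2 x^2 + a_3 x + a_4\<close> is \<open>coeff f (4 - i)\<close>.\<close>

definition H_r :: "int poly \<Rightarrow> real" where
  "H_r f = Max ((\<lambda>i. root i (real_of_int \<bar>coeff f (4 - i)\<bar>)) ` {1..4})"

end

theory Submission
  imports Defs "Jordan_Normal_Form.Char_Poly" "Subresultants.Subresultant_Gcd"
begin

text \<open>
  A nondegenerate ring is a lattice in \<open>\<complex>\<^sup>n\<close>, closed under multiplication, and its discriminant is the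
  squared covolume. For a monic quartic \<open>f\<close> of height at most \<open>h\<close>, the basis \<open>1, t, t\<^sup>2 + \<dots>, t\<^sup>3 + \<dots>\<close> of
  \<open>\<int>[t]/(f)\<close> and the basis \<open>1, w, w\<^sup>2 - \<dots>\<close> of its resolvent have vectors of length \<open>O(h\<^sup>k)\<close> and
  \<open>O(h\<^sup>2\<^sup>k)\<close>. If the discriminant is at least \<open>\<delta> h\<^sup>1\<^sup>2\<close>, Cramer's rule shows that they attain the successive
  minima up to constants, so that the pair is close to \<open>(1/12, 1/6, 1/4, 1/6, 1/3)\<close>. As a polynomial in
  the constant coefficient, the discriminant is \<open>256\<close> times a product of three linear factors; hence it is
  that large for all but a proportion \<open>O(\<delta>\<^bsup>1/3\<^esup>)\<close> of the box. This gives the first limit.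

  For the second limit, both counts have order \<open>T\<^bsup>3/4\<^esup>\<close>. The polynomials with \<open>a\<^sub>1 = 0\<close> and height about
  \<open>T\<^bsup>1/12\<^esup>\<close> number about \<open>T\<^bsup>9/12\<^esup>\<close>. If two of them give isomorphic pairs, then so are their rings, and since
  the second minimum of such a ring is much larger than the first, a root of one is \<open>\<plusminus>\<close> a root of the other.

  Conversely, a close pair of discriminant about \<open>s\<^sup>1\<^sup>2\<close> has reduced bases whose lengths are of the
  expected order, and the coefficients of its forms \<open>A\<close> and \<open>B\<close> are \<open>O(s\<^bsup>k+l-2\<^esup>)\<close> and \<open>O(s\<^bsup>k+l-4\<^esup>)\<close>, which leaves
  \<open>O(s\<^bsup>15\<^esup>)\<close> pairs of forms. The forms determine the pair, and each pair is met for about \<open>s\<^sup>6\<close> bases, since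
  adding to a basis vector bounded multiples of the shorter ones keeps the lengths in order. So there are
  \<open>O(s\<^sup>9)\<close> such pairs, and a sum over dyadic \<open>s\<close> bounds the total.
\<close>

section \<open>Rings of finite rank in complex coordinates\<close>

text \<open>Both explicit bases span lattices of covolume about \<open>h ^ 6\<close>, because 0 + 1
  + 2 + 3 = 0 + 2 + 4 = 6. This balance makes Cramer's rule sharp in both rings at once, and it is
  why the exponents are \<open>k / 12\<close> in the quartic ring and \<open>2 * k / 12\<close> in
  the cubic one. Translating the variable does not change the ring, so about \<open>h\<close> of the
  roughly \<open>h ^ 10\<close> polynomials in a box share a class; the normalization of the cubic
  coefficient to 0 picks one of them, up to sign, and leaves \<open>h ^ 9\<close>. Of Bhargava's
  parametrization only injectivity is used: pairs are constructed from forms solely for monic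
  quartics, where everything is explicit. Injectivity comes from geometry: the conics given by the
  two forms meet in four points, which are the idempotents of \<open>R\<close> tensored with
  \<complex>, taken modulo constants. So the forms determine the embedding up to relabelling and an
  affine map. The obstacle in the upper bound is that the box of forms exceeds the number of classes
  by \<open>s ^ 6\<close>. Averaging over unipotent changes of basis removes this excess, without
  choosing canonical reduced forms.\<close>

abbreviation complex_ring :: "complex ring" where
  "complex_ring \<equiv> ring_of_type_algebra"

lemma complex_ring_simps [simp]:
  "carrier complex_ring = UNIV" "monoid.mult complex_ring = (*)" "one complex_ring = 1"
  "zero complex_ring = 0" "add complex_ring = (+)"
  by (auto simp: ring_of_type_algebra_def)

context
  fixes R :: "('a, 'm) ring_scheme" and h :: "'a \<Rightarrow> complex"
  assumes cring: "cring R" and hom: "h \<in> Ring.ring_hom R complex_ring"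
begin

interpretation cring R by (rule cring)

lemma complex_hom_add: "x \<in> carrier R \<Longrightarrow> y \<in> carrier R \<Longrightarrow> h (x \<oplus>\<^bsub>R\<^esub> y) = h x + h y"
  using ring_hom_add[OF hom] by simp

lemma complex_hom_mult: "x \<in> carrier R \<Longrightarrow> y \<in> carrier R \<Longrightarrow> h (x \<otimes>\<^bsub>R\<^esub> y) = h x * h y"
  using ring_hom_mult[OF hom] by simp

lemma complex_hom_one: "h \<one>\<^bsub>R\<^esub> = 1"
  using ring_hom_one[OF hom] by simp

lemma complex_hom_zero: "h \<zero>\<^bsub>R\<^esub> = 0"
  using complex_hom_add[OF zero_closed zero_closed] by simp

lemma complex_hom_uminus: "x \<in> carrier R \<Longrightarrow> h (\<ominus>\<^bsub>R\<^esub> x) = - h x"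
  using complex_hom_add[of x "\<ominus>\<^bsub>R\<^esub> x"] complex_hom_zero r_neg[of x]
  by (simp add: eq_neg_iff_add_eq_0 add.commute)

lemma complex_hom_nat_mult: "x \<in> carrier R \<Longrightarrow> h ([(k::nat)] \<cdot>\<^bsub>R\<^esub> x) = of_nat k * h x"
  by (induction k) (auto simp: complex_hom_zero complex_hom_add algebra_simps)

lemma complex_hom_int_mult:
  assumes "x \<in> carrier R" shows "h ([(k::int)] \<cdot>\<^bsub>R\<^esub> x) = of_int k * h x"
proof (cases "k \<ge> 0")
  case True
  then show ?thesis using complex_hom_nat_mult[OF assms, of "nat k"]
    by (simp add: add_pow_int_ge)
next
  case False
  then show ?thesis using complex_hom_nat_mult[OF assms, of "nat (-k)"]
    by (simp add: add_pow_int_lt complex_hom_uminus assms)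
qed

lemma complex_hom_finsum:
  "finite A \<Longrightarrow> f \<in> A \<rightarrow> carrier R \<Longrightarrow> h (\<Oplus>\<^bsub>R\<^esub>i\<in>A. f i) = (\<Sum>i\<in>A. h (f i))"
  by (induction A rule: finite_induct) (auto simp: complex_hom_zero complex_hom_add Pi_def finsum_closed)

lemma int_comb_closed: "b \<in> {..<k} \<rightarrow> carrier R \<Longrightarrow> int_comb R k b c \<in> carrier R"
  unfolding int_comb_def by (intro finsum_closed) auto

lemma complex_hom_int_comb:
  assumes "b \<in> {..<k} \<rightarrow> carrier R"
  shows "h (int_comb R k b c) = (\<Sum>i<k. of_int (c i) * h (b i))"
proof -
  have "h (int_comb R k b c) = (\<Sum>i<k. h ([c i] \<cdot>\<^bsub>R\<^esub> b i))"
    unfolding int_comb_def using assms by (intro complex_hom_finsum) auto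
  also have "\<dots> = (\<Sum>i<k. of_int (c i) * h (b i))"
    using assms by (intro sum.cong refl complex_hom_int_mult) auto
  finally show ?thesis .
qed

end

lemma complex_homs_hom: "h \<in> complex_homs R \<Longrightarrow> h \<in> Ring.ring_hom R complex_ring"
  by (simp add: complex_homs_def)

lemma complex_homs_eqI:
  assumes "g \<in> complex_homs R" "h \<in> complex_homs R" "\<And>x. x \<in> carrier R \<Longrightarrow> g x = h x"
  shows "g = h"
  using assms by (auto simp: complex_homs_def intro: extensionalityI)

text \<open>Dedekind's independence of characters: subtracting \<open>g y\<close> times the relation
  at \<open>x\<close> from the relation at the product of \<open>x\<close> and \<open>y\<close>
  removes \<open>g\<close>, and \<open>y\<close> is chosen so that the coefficient of
  \<open>h\<close> keeps a nonzero factor.\<close>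

lemma complex_homs_independent:
  assumes R: "cring R" and "finite H" "H \<subseteq> complex_homs R"
    and "\<And>x. x \<in> carrier R \<Longrightarrow> (\<Sum>h\<in>H. c h * h x) = 0" and "h \<in> H"
  shows "c h = 0"
  using assms(2-)
proof (induction H arbitrary: c h rule: finite_induct)
  case empty
  then show ?case by simp
next
  case (insert g H c)
  interpret cring R by (rule R)
  have g: "g \<in> complex_homs R" using insert.prems by simp
  have zero: "c h = 0" if h: "h \<in> H" for h
  proof -
    have "h \<noteq> g" using h insert.hyps by auto
    moreover have "h \<in> complex_homs R" using insert.prems(1) h by auto
    ultimately obtain y where y: "y \<in> carrier R" "h y \<noteq> g y"
      using complex_homs_eqI[OF _ g, of h] by auto
    have "(\<Sum>h\<in>H. (c h * (h y - g y)) * h x) = 0" if x: "x \<in> carrier R" for x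
    proof -
      have "c g * g (x \<otimes>\<^bsub>R\<^esub> y) + (\<Sum>h\<in>H. c h * h (x \<otimes>\<^bsub>R\<^esub> y)) = 0"
        using insert.prems(2)[of "x \<otimes>\<^bsub>R\<^esub> y"] insert.hyps x y by simp
      moreover have "h (x \<otimes>\<^bsub>R\<^esub> y) = h x * h y" if "h \<in> insert g H" for h
        using complex_hom_mult[OF R complex_homs_hom] insert.prems(1) that x y by blast
      ultimately have 1: "c g * (g x * g y) + (\<Sum>h\<in>H. c h * (h x * h y)) = 0"
        by (simp cong: sum.cong)
      have 2: "g y * (c g * g x + (\<Sum>h\<in>H. c h * h x)) = 0"
        using insert.prems(2)[of x] insert.hyps x by simp
      show ?thesis
        using arg_cong2[OF 1 2, of "(-)"]
        by (simp add: algebra_simps sum_distrib_left sum_subtractf)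
    qed
    from insert.IH[OF _ this h] insert.prems(1) have "c h * (h y - g y) = 0" by auto
    then show ?thesis using y by simp
  qed
  have "c g * g \<one>\<^bsub>R\<^esub> = 0"
    using insert.prems(2)[of "\<one>\<^bsub>R\<^esub>"] insert.hyps zero by simp
  then have "c g = 0" using complex_hom_one[OF R complex_homs_hom[OF g]] by simp
  then show ?case using zero insert.prems(3) by auto
qed

section \<open>Determinants as tests for linear dependence\<close>

lemma det_nonzero_solve:
  fixes A :: "complex mat"
  assumes A: "A \<in> carrier_mat n n" and d: "det A \<noteq> 0"
  obtains B where "B \<in> carrier_mat n n" "A * B = 1\<^sub>m n" "B * A = 1\<^sub>m n"
proof -
  have "A \<in> Units (ring_mat TYPE(complex) n ())"
    using det_non_zero_imp_unit[OF A d] .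
  then show ?thesis using that by (auto simp: Units_def ring_mat_simps)
qed

lemma det_zero_left_kernel:
  fixes f :: "nat \<Rightarrow> nat \<Rightarrow> 'a::field"
  assumes "det (mat n n (\<lambda>(i, k). f i k)) = 0"
  obtains c where "\<exists>i<n. c i \<noteq> 0" "\<And>k. k < n \<Longrightarrow> (\<Sum>i<n. c i * f i k) = 0"
proof -
  let ?A = "mat n n (\<lambda>(i, k). f i k)"
  have "det (?A\<^sup>T) = 0" using assms by (simp add: det_transpose[of _ n])
  then obtain v where v: "v \<in> carrier_vec n" "v \<noteq> 0\<^sub>v n" "?A\<^sup>T *\<^sub>v v = 0\<^sub>v n"
    using det_0_iff_vec_prod_zero_field[of "?A\<^sup>T" n] by auto
  have "(\<Sum>i<n. v $ i * f i k) = 0" if k: "k < n" for k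
  proof -
    have "(?A\<^sup>T *\<^sub>v v) $ k = 0" using v k by simp
    then show ?thesis using v(1) k
      by (simp add: scalar_prod_def atLeast0LessThan mult.commute)
  qed
  moreover have "\<exists>i<n. v $ i \<noteq> 0" using v(1,2) by (metis carrier_vecD eq_vecI index_zero_vec)
  ultimately show ?thesis using that[of "\<lambda>i. v $ i"] by blast
qed

lemma det_zero_right_kernel:
  fixes f :: "nat \<Rightarrow> nat \<Rightarrow> 'a::idom"
  assumes "det (mat n n (\<lambda>(i, k). f i k)) = 0"
  obtains c where "\<exists>i<n. c i \<noteq> 0" "\<And>i. i < n \<Longrightarrow> (\<Sum>k<n. c k * f i k) = 0"
proof -
  let ?A = "mat n n (\<lambda>(i, k). f i k)"
  obtain v where v: "v \<in> carrier_vec n" "v \<noteq> 0\<^sub>v n" "?A *\<^sub>v v = 0\<^sub>v n"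
    using det_0_iff_vec_prod_zero[of "?A" n] assms by auto
  have "(\<Sum>i<n. v $ i * f k i) = 0" if k: "k < n" for k
  proof -
    have "(?A *\<^sub>v v) $ k = 0" using v k by simp
    then show ?thesis using v(1) k
      by (simp add: scalar_prod_def atLeast0LessThan mult.commute)
  qed
  moreover have "\<exists>i<n. v $ i \<noteq> 0" using v(1,2) by (metis carrier_vecD eq_vecI index_zero_vec)
  ultimately show ?thesis using that[of "\<lambda>i. v $ i"] by blast
qed

lemma det_nonzero_kernel:
  fixes f :: "nat \<Rightarrow> nat \<Rightarrow> 'a::idom"
  assumes d: "det (mat n n (\<lambda>(i, k). f i k)) \<noteq> 0"
    and "\<And>i. i < n \<Longrightarrow> (\<Sum>k<n. c k * f i k) = 0" and "k < n"
  shows "c k = 0"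
proof (rule ccontr)
  assume "c k \<noteq> 0"
  then have "vec n c \<noteq> 0\<^sub>v n" using assms(3) by (metis index_vec index_zero_vec(1))
  moreover have "mat n n (\<lambda>(i, k). f i k) *\<^sub>v vec n c = 0\<^sub>v n"
    using assms(2) by (intro eq_vecI) (auto simp: scalar_prod_def atLeast0LessThan mult.commute)
  ultimately show False
    using d det_0_iff_vec_prod_zero[of "mat n n (\<lambda>(i, k). f i k)" n]
    by (meson mat_carrier vec_carrier)
qed

text \<open>The missing coordinates are padded with zeros to apply determinants.\<close>

lemma dependent_if_more_vectors:
  fixes f :: "nat \<Rightarrow> nat \<Rightarrow> 'a::idom"
  assumes "k < n"
  obtains c where "\<exists>j<n. c j \<noteq> 0" "\<And>i. i < k \<Longrightarrow> (\<Sum>j<n. c j * f j i) = 0"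
proof -
  let ?f = "\<lambda>i j. if i < k then f j i else 0"
  have "(\<Sum>k<n. (if k = n - 1 then 1 else 0) * ?f k i) = 0" for i
    using assms by (intro sum.neutral) auto
  from det_nonzero_kernel[of n "\<lambda>i k. ?f k i" "\<lambda>k. if k = n - 1 then 1 else 0" "n - 1", OF _ this] assms
  have "det (mat n n (\<lambda>(i, k). ?f k i)) = 0" by fastforce
  moreover have "mat n n (\<lambda>(i, k). ?f k i) = (mat n n (\<lambda>(i, j). ?f i j))\<^sup>T"
    by (rule eq_matI) auto
  ultimately have "det (mat n n (\<lambda>(i, j). ?f i j)) = 0"
    by (simp add: det_transpose[of _ n])
  then obtain c where "\<exists>i<n. c i \<noteq> 0" "\<And>i. i < n \<Longrightarrow> (\<Sum>j<n. c j * ?f i j) = 0"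
    using det_zero_right_kernel[of n ?f] by blast
  then have c: "\<exists>j<n. c j \<noteq> 0" "\<And>i. i < n \<Longrightarrow> (\<Sum>j<n. c j * ?f i j) = 0" by blast+
  have "(\<Sum>j<n. c j * f j i) = 0" if "i < k" for i
    using c(2)[of i] that assms by simp
  then show ?thesis using that[of c] c(1) by blast
qed

text \<open>Every Leibniz term takes one entry from each column, so bounds that vary with the column
  enter as their product. The columns will be basis vectors of different lengths.\<close>

lemma det_bound:
  fixes f :: "nat \<Rightarrow> nat \<Rightarrow> complex"
  assumes "\<And>i k. i < n \<Longrightarrow> k < n \<Longrightarrow> cmod (f i k) \<le> B k"
  shows "cmod (det (mat n n (\<lambda>(i, k). f i k))) \<le> fact n * (\<Prod>k<n. B k)"
proof -
  have s: "\<bar>real_of_int (sign p)\<bar> = 1" for p :: "nat \<Rightarrow> nat" by (simp add: sign_def)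
  have "cmod (det (mat n n (\<lambda>(i, k). f i k)))
      = cmod (\<Sum>p\<in>{p. p permutes {0..<n}}. signof p * (\<Prod>i = 0..<n. f i (p i)))"
    by (subst det_def'[of _ n]) (auto intro!: arg_cong[of _ _ cmod] sum.cong prod.cong
        simp: permutes_in_image[of _ "{0..<n}", simplified])
  also have "\<dots> \<le> (\<Sum>p\<in>{p. p permutes {0..<n}}. \<Prod>k<n. B k)"
  proof (rule sum_norm_le)
    fix p assume p: "p \<in> {p. p permutes {0..<n}}"
    then have bij: "bij_betw p {0..<n} {0..<n}" by (auto intro: permutes_imp_bij)
    have "cmod (signof p * (\<Prod>i = 0..<n. f i (p i))) = (\<Prod>i = 0..<n. cmod (f i (p i)))"
      by (simp add: norm_mult s prod_norm)
    also have "\<dots> \<le> (\<Prod>i = 0..<n. B (p i))"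
      using p assms by (intro prod_mono) (auto simp: permutes_in_image[of _ "{0..<n}", simplified])
    also have "\<dots> = (\<Prod>k<n. B k)"
      using prod.reindex_bij_betw[OF bij, of B] by (simp add: atLeast0LessThan)
    finally show "cmod (signof p * (\<Prod>i = 0..<n. f i (p i))) \<le> (\<Prod>k<n. B k)" .
  qed
  also have "\<dots> = fact n * (\<Prod>k<n. B k)"
    by (simp add: card_permutations[of "{0..<n}" n])
  finally show ?thesis .
qed

text \<open>Replacing column \<open>k\<close> by the given combination multiplies the determinant by
  \<open>c k\<close>. This turns a lower bound for a discriminant into upper bounds for
  coordinates.\<close>

lemma cramer_bound:
  fixes f :: "nat \<Rightarrow> nat \<Rightarrow> complex"
  assumes B: "\<And>i j. i < n \<Longrightarrow> j < n \<Longrightarrow> cmod (f i j) \<le> B j"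
    and v: "\<And>i. i < n \<Longrightarrow> cmod (\<Sum>j<n. c j * f i j) \<le> r" and k: "k < n"
  shows "cmod (c k) * cmod (det (mat n n (\<lambda>(i, k). f i k))) \<le> fact n * r * (\<Prod>j\<in>{..<n}-{k}. B j)"
proof -
  let ?A = "mat n n (\<lambda>(i, k). f i k)"
  let ?x = "vec n c"
  let ?g = "\<lambda>i j. if j = k then (\<Sum>j<n. c j * f i j) else f i j"
  have "replace_col ?A (?A *\<^sub>v ?x) k = mat n n (\<lambda>(i, j). ?g i j)"
    using k by (intro eq_matI)
      (auto simp: replace_col_def scalar_prod_def atLeast0LessThan mult.commute intro!: sum.cong)
  then have "det (mat n n (\<lambda>(i, j). ?g i j)) = c k * det ?A"
    using cramer_lemma_mat[of ?A n ?x k] k by simp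
  moreover have "cmod (det (mat n n (\<lambda>(i, j). ?g i j))) \<le> fact n * (\<Prod>j<n. if j = k then r else B j)"
    using B v by (intro det_bound) auto
  moreover have "(\<Prod>j<n. if j = k then r else B j) = r * (\<Prod>j\<in>{..<n}-{k}. B j)"
    using k by (subst prod.remove[of _ k]) (auto intro!: prod.cong)
  ultimately show ?thesis by (simp add: norm_mult mult.assoc)
qed

lemma mat_mult_entry:
  "A \<in> carrier_mat n n \<Longrightarrow> B \<in> carrier_mat n n \<Longrightarrow> i < n \<Longrightarrow> j < n \<Longrightarrow>
    (A * B) $$ (i, j) = (\<Sum>k<n. A $$ (i, k) * B $$ (k, j))"
  by (simp add: scalar_prod_def atLeast0LessThan)

text \<open>That there are exactly \<open>n\<close> homomorphisms to \<complex> stands in for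
  nondegeneracy, which follows in \<open>disc_nonzero\<close>. The labelling \<sigma> makes the ring
  a lattice in complex \<open>n\<close>-space.\<close>

locale embedded_ring =
  fixes n :: nat and R :: "('a, 'm) ring_scheme" and \<sigma> :: "nat \<Rightarrow> 'a \<Rightarrow> complex"
  assumes rank: "rank_ring n R" and enum: "bij_betw \<sigma> {..<n} (complex_homs R)"
begin

definition emb :: "(nat \<Rightarrow> 'a) \<Rightarrow> complex mat" where
  "emb b = mat n n (\<lambda>(i, k). \<sigma> i (b k))"

lemma cring_R: "cring R"
  using rank by (simp add: rank_ring_def)

sublocale cring R by (rule cring_R)

lemma emb_carrier [simp]: "emb b \<in> carrier_mat n n"
  by (simp add: emb_def)

lemma hom: "i < n \<Longrightarrow> \<sigma> i \<in> Ring.ring_hom R complex_ring"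
  using enum by (auto simp: bij_betw_def intro: complex_homs_hom)

lemmas emb_add = complex_hom_add[OF cring_R hom]
  and emb_mult = complex_hom_mult[OF cring_R hom]
  and emb_one = complex_hom_one[OF cring_R hom]
  and emb_zero = complex_hom_zero[OF cring_R hom]
  and emb_uminus = complex_hom_uminus[OF cring_R hom]
  and emb_int_mult = complex_hom_int_mult[OF cring_R hom]
  and emb_int_comb = complex_hom_int_comb[OF cring_R hom]

lemma closed_int_comb: "b \<in> {..<k} \<rightarrow> carrier R \<Longrightarrow> int_comb R k b c \<in> carrier R"
  unfolding int_comb_def by (intro finsum_closed) auto

lemma basis_closed: "int_basis R n b \<Longrightarrow> b \<in> {..<n} \<rightarrow> carrier R"
  by (simp add: int_basis_def)

lemma basis_comb:
  assumes "int_basis R n b" "x \<in> carrier R"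
  obtains c where "x = int_comb R n b c"
  using assms by (metis int_basis_def)

lemma basis_coords:
  assumes "int_basis R n b" "x \<in> carrier R"
  obtains c :: "nat \<Rightarrow> int" where "\<And>i. i < n \<Longrightarrow> \<sigma> i x = (\<Sum>k<n. of_int (c k) * \<sigma> i (b k))"
proof -
  obtain c where "x = int_comb R n b c" using basis_comb[OF assms] .
  then show ?thesis using that[of c] emb_int_comb[OF _ basis_closed[OF assms(1)]] by simp
qed

lemma obtain_basis: obtains b where "int_basis R n b"
  using rank by (auto simp: rank_ring_def)

text \<open>A left kernel vector of the matrix is a linear relation between the \<open>n\<close>
  homomorphisms on a basis, hence on all of \<open>R\<close>.\<close>

lemma det_emb_nonzero:
  assumes b: "int_basis R n b"
  shows "det (emb b) \<noteq> 0"
proof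
  assume "det (emb b) = 0"
  then obtain c where c: "\<exists>i<n. c i \<noteq> 0" "\<And>k. k < n \<Longrightarrow> (\<Sum>i<n. c i * \<sigma> i (b k)) = 0"
    unfolding emb_def by (rule det_zero_left_kernel[of n "\<lambda>i k. \<sigma> i (b k)"]) blast
  have van: "(\<Sum>i<n. c i * \<sigma> i x) = 0" if x: "x \<in> carrier R" for x
  proof -
    obtain m :: "nat \<Rightarrow> int" where "\<And>i. i < n \<Longrightarrow> \<sigma> i x = (\<Sum>k<n. of_int (m k) * \<sigma> i (b k))"
      using basis_coords[OF b x] by blast
    then have "(\<Sum>i<n. c i * \<sigma> i x) = (\<Sum>i<n. \<Sum>k<n. of_int (m k) * (c i * \<sigma> i (b k)))"
      by (simp add: sum_distrib_left mult_ac)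
    also have "\<dots> = (\<Sum>k<n. of_int (m k) * (\<Sum>i<n. c i * \<sigma> i (b k)))"
      by (subst sum.swap) (simp add: sum_distrib_left)
    finally show ?thesis using c(2) by simp
  qed
  define c' where "c' h = c (inv_into {..<n} \<sigma> h)" for h
  have c': "c' (\<sigma> i) = c i" if "i < n" for i
    using that enum by (simp add: c'_def bij_betw_def)
  have "(\<Sum>h\<in>complex_homs R. c' h * h x) = 0" if "x \<in> carrier R" for x
    using sum.reindex_bij_betw[OF enum, of "\<lambda>h. c' h * h x"] van[OF that] c' by simp
  moreover have "finite (complex_homs R)" using enum bij_betw_finite by blast
  ultimately have "c' h = 0" if "h \<in> complex_homs R" for h
    using complex_homs_independent[OF cring_R _ subset_refl, of c' h] that by blast
  then have "c i = 0" if "i < n" for i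
    using that c' enum by (metis bij_betwE lessThan_iff)
  then show False using c(1) by blast
qed

lemma int_comb_cong: "(\<And>k. k < n \<Longrightarrow> c k = c' k) \<Longrightarrow> b \<in> {..<n} \<rightarrow> carrier R \<Longrightarrow>
   int_comb R n b c = int_comb R n b c'"
  unfolding int_comb_def by (intro add.finprod_cong') auto

lemma emb_inj:
  assumes "x \<in> carrier R" "y \<in> carrier R" "\<And>i. i < n \<Longrightarrow> \<sigma> i x = \<sigma> i y"
  shows "x = y"
proof -
  obtain b where b: "int_basis R n b" using obtain_basis .
  obtain c where c: "x = int_comb R n b c" using basis_comb[OF b assms(1)] .
  obtain d where d: "y = int_comb R n b d" using basis_comb[OF b assms(2)] .
  have "(\<Sum>k<n. of_int (c k - d k) * \<sigma> i (b k)) = 0" if "i < n" for i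
    using assms(3)[OF that] emb_int_comb[OF that basis_closed[OF b]]
    by (simp add: c d left_diff_distrib sum_subtractf)
  from det_nonzero_kernel[OF det_emb_nonzero[OF b, unfolded emb_def] this]
  have "c k = d k" if "k < n" for k using that by fastforce
  then show ?thesis unfolding c d by (intro int_comb_cong basis_closed[OF b])
qed

text \<open>Spanning elements express a known basis, so multiplicativity of the determinant makes
  their own matrix nonsingular, and this gives uniqueness of coordinates.\<close>

lemma int_basisI:
  assumes closed: "b \<in> {..<n} \<rightarrow> carrier R"
    and span: "\<And>x. x \<in> carrier R \<Longrightarrow>
      \<exists>c :: nat \<Rightarrow> int. \<forall>i<n. \<sigma> i x = (\<Sum>k<n. of_int (c k) * \<sigma> i (b k))"
  shows "int_basis R n b"
proof -
  obtain b0 where b0: "int_basis R n b0" using obtain_basis .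
  have "\<forall>j\<in>{..<n}. \<exists>c :: nat \<Rightarrow> int. \<forall>i<n. \<sigma> i (b0 j) = (\<Sum>k<n. of_int (c k) * \<sigma> i (b k))"
    using span basis_closed[OF b0] by auto
  then obtain V :: "nat \<Rightarrow> nat \<Rightarrow> int" where
    V: "\<And>i j. j < n \<Longrightarrow> i < n \<Longrightarrow> \<sigma> i (b0 j) = (\<Sum>k<n. of_int (V j k) * \<sigma> i (b k))"
    by (metis lessThan_iff)
  have "emb b0 = emb b * mat n n (\<lambda>(k, j). of_int (V j k))"
    by (intro eq_matI) (auto simp: emb_def V scalar_prod_def atLeast0LessThan mult.commute)
  then have "det (emb b0) = det (emb b) * det (mat n n (\<lambda>(k, j). complex_of_int (V j k)))"
    by (simp add: det_mult[of _ n])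
  then have d: "det (emb b) \<noteq> 0" using det_emb_nonzero[OF b0] by auto
  have "\<exists>!c. c \<in> extensional {..<n} \<and> x = int_comb R n b c" if x: "x \<in> carrier R" for x
  proof -
    obtain c :: "nat \<Rightarrow> int" where c: "\<And>i. i < n \<Longrightarrow> \<sigma> i x = (\<Sum>k<n. of_int (c k) * \<sigma> i (b k))"
      using span[OF x] by blast
    have "x = int_comb R n b (restrict c {..<n})"
      by (rule emb_inj) (auto simp: x c emb_int_comb[OF _ closed] closed_int_comb[OF closed])
    moreover have "d = d'" if d': "d \<in> extensional {..<n}" "x = int_comb R n b d"
        "d' \<in> extensional {..<n}" "x = int_comb R n b d'" for d d'
    proof -
      have "(\<Sum>k<n. of_int (d k - d' k) * \<sigma> i (b k)) = 0" if "i < n" for i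
        using d'(2,4) emb_int_comb[OF that closed]
        by (simp add: left_diff_distrib sum_subtractf) (metis)
      from det_nonzero_kernel[OF d[unfolded emb_def] this]
      have "d k = d' k" if "k < n" for k using that by fastforce
      then show ?thesis using d'(1,3) by (intro extensionalityI[of d "{..<n}"]) auto
    qed
    ultimately show ?thesis by (intro ex1I[of _ "restrict c {..<n}"]) auto
  qed
  then show ?thesis using closed by (auto simp: int_basis_def)
qed

lemma coord_comb:
  assumes "int_basis R n b" "x \<in> carrier R"
  shows "x = int_comb R n b (coord R n b x)"
proof -
  have "\<exists>!c. c \<in> extensional {..<n} \<and> x = int_comb R n b c"
    using assms by (auto simp: int_basis_def)
  from theI'[OF this] show ?thesis unfolding coord_def by blast
qed

lemma emb_coord:
  assumes "int_basis R n b" "x \<in> carrier R" "i < n"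
  shows "\<sigma> i x = (\<Sum>k<n. of_int (coord R n b x k) * \<sigma> i (b k))"
  using coord_comb[OF assms(1,2)] emb_int_comb[OF assms(3) basis_closed[OF assms(1)]] by metis

text \<open>With \<open>E = emb b\<close>, multiplication by \<open>x\<close> has the matrix \<open>E\<inverse> diag(\<sigma> i x) E\<close>.\<close>

lemma mult_matrix:
  assumes b: "int_basis R n b" and x: "x \<in> carrier R"
  shows "mat n n (\<lambda>(i, j). if i = j then \<sigma> i x else 0) * emb b
    = emb b * mat n n (\<lambda>(k, j). of_int (coord R n b (x \<otimes>\<^bsub>R\<^esub> b j) k))"
proof (intro eq_matI)
  fix i j assume "i < dim_row (emb b * mat n n (\<lambda>(k, j). complex_of_int (coord R n b (x \<otimes>\<^bsub>R\<^esub> b j) k)))"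
    "j < dim_col (emb b * mat n n (\<lambda>(k, j). complex_of_int (coord R n b (x \<otimes>\<^bsub>R\<^esub> b j) k)))"
  then have ij: "i < n" "j < n" by (auto simp: emb_def)
  have bj: "b j \<in> carrier R" using basis_closed[OF b] ij by auto
  have "(\<Sum>k = 0..<n. (if i = k then \<sigma> i x else 0) * \<sigma> k (b j)) = \<sigma> i x * \<sigma> i (b j)"
    using ij by (simp add: if_distrib[of "\<lambda>y. y * _"] cong: if_cong)
  also have "\<dots> = \<sigma> i (x \<otimes>\<^bsub>R\<^esub> b j)" using emb_mult[OF ij(1) x bj] by simp
  also have "\<dots> = (\<Sum>k = 0..<n. \<sigma> i (b k) * of_int (coord R n b (x \<otimes>\<^bsub>R\<^esub> b j) k))"
    using emb_coord[OF b, of "x \<otimes>\<^bsub>R\<^esub> b j" i] x bj ij by (simp add: atLeast0LessThan mult.commute)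
  finally show "(mat n n (\<lambda>(i, j). if i = j then \<sigma> i x else 0) * emb b) $$ (i, j) =
      (emb b * mat n n (\<lambda>(k, j). of_int (coord R n b (x \<otimes>\<^bsub>R\<^esub> b j) k))) $$ (i, j)"
    using ij by (simp add: emb_def scalar_prod_def)
qed (auto simp: emb_def)

text \<open>Multiplication by \<open>x\<close> is conjugate to the diagonal matrix of the values
  \<open>\<sigma> i x\<close>. In particular the basis picked by \<open>SOME\<close> has no
  influence.\<close>

lemma ring_trace_eq:
  assumes x: "x \<in> carrier R"
  shows "of_int (ring_trace n R x) = (\<Sum>i<n. \<sigma> i x)"
proof -
  define b where "b = (SOME b. int_basis R n b)"
  have b: "int_basis R n b" unfolding b_def using obtain_basis by (metis someI)
  let ?M = "mat n n (\<lambda>(k, j). complex_of_int (coord R n b (x \<otimes>\<^bsub>R\<^esub> b j) k))"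
  let ?D = "mat n n (\<lambda>(i, j). if i = j then \<sigma> i x else 0)"
  obtain F where F: "F \<in> carrier_mat n n" "emb b * F = 1\<^sub>m n" "F * emb b = 1\<^sub>m n"
    using det_nonzero_solve[OF emb_carrier det_emb_nonzero[OF b]] .
  have "?M = (F * emb b) * ?M" using F by simp
  also have "\<dots> = F * (emb b * ?M)" by (rule assoc_mult_mat[OF F(1) emb_carrier]) auto
  also have "\<dots> = F * (?D * emb b)" by (simp add: mult_matrix[OF b x])
  finally have M: "?M = F * (?D * emb b)" .
  have DE: "(?D * emb b) $$ (i, j) = \<sigma> i x * \<sigma> i (b j)" if "i < n" "j < n" for i j
    using that by (simp add: emb_def scalar_prod_def if_distrib[of "\<lambda>y. y * _"] cong: if_cong)
  have "of_int (ring_trace n R x) = (\<Sum>j<n. ?M $$ (j, j))"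
    by (simp add: ring_trace_def b_def[symmetric] Let_def)
  also have "\<dots> = (\<Sum>j<n. \<Sum>i<n. F $$ (j, i) * (\<sigma> i x * \<sigma> i (b j)))"
  proof (intro sum.cong refl)
    fix j assume "j \<in> {..<n}"
    then have j: "j < n" by simp
    have "?D * emb b \<in> carrier_mat n n" by (rule mult_carrier_mat[of _ n n]) auto
    from mat_mult_entry[OF F(1) this j j]
    show "?M $$ (j, j) = (\<Sum>i<n. F $$ (j, i) * (\<sigma> i x * \<sigma> i (b j)))"
      unfolding M by (simp only:) (intro sum.cong refl, simp only: DE j lessThan_iff)
  qed
  also have "\<dots> = (\<Sum>i<n. \<sigma> i x * (\<Sum>j<n. \<sigma> i (b j) * F $$ (j, i)))"
    by (subst sum.swap) (simp add: sum_distrib_left mult_ac)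
  also have "\<dots> = (\<Sum>i<n. \<sigma> i x)"
  proof (intro sum.cong refl)
    fix i assume i: "i \<in> {..<n}"
    have "(emb b * F) $$ (i, i) = 1" using F i by simp
    then show "\<sigma> i x * (\<Sum>j<n. \<sigma> i (b j) * F $$ (j, i)) = \<sigma> i x"
      using F(1) i by (simp add: scalar_prod_def emb_def atLeast0LessThan)
  qed
  finally show ?thesis .
qed

lemma basis_change_det:
  assumes b: "int_basis R n b" and b': "int_basis R n b'"
  obtains u :: int where "det (emb b') = det (emb b) * of_int u" 
proof -
  let ?U = "mat n n (\<lambda>(k, j). coord R n b (b' j) k)"
  have "emb b' = emb b * map_mat of_int ?U"
    using basis_closed[OF b'] by (intro eq_matI)
     (auto simp: emb_def emb_coord[OF b, of "b' _"] scalar_prod_def atLeast0LessThan mult.commute Pi_def)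
  then have "det (emb b') = det (emb b) * det (map_mat of_int ?U)"
    by (simp add: det_mult[of _ n])
  also have "\<dots> = det (emb b) * of_int (det ?U)" by simp
  finally show ?thesis using that by blast
qed

lemma ring_disc_eq:
  assumes b': "int_basis R n b'"
  shows "of_int (ring_disc n R) = (det (emb b'))\<^sup>2"
proof -
  define b where "b = (SOME b. int_basis R n b)"
  have b: "int_basis R n b" unfolding b_def using obtain_basis by (metis someI)
  have bc: "b i \<in> carrier R" if "i < n" for i using basis_closed[OF b] that by auto
  let ?M = "mat n n (\<lambda>(i, j). ring_trace n R (b i \<otimes>\<^bsub>R\<^esub> b j))"
  have "of_int (ring_disc n R) = det (map_mat of_int ?M :: complex mat)"
    by (simp add: ring_disc_def b_def[symmetric] Let_def)
  also have "map_mat of_int ?M = (emb b)\<^sup>T * emb b"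
    by (intro eq_matI)
      (auto simp: emb_def ring_trace_eq bc emb_mult scalar_prod_def atLeast0LessThan)
  also have "det \<dots> = (det (emb b))\<^sup>2"
    by (simp add: det_mult[of _ n] det_transpose[of _ n] power2_eq_square)
  finally have 1: "of_int (ring_disc n R) = (det (emb b))\<^sup>2" .
  \<comment> \<open>The picked basis and \<open>b'\<close> express each other integrally, so the two
    integral factors are inverse to each other and equal to 1 or -1.\<close>
  obtain u where u: "det (emb b') = det (emb b) * of_int u" using basis_change_det[OF b b'] .
  obtain v where v: "det (emb b) = det (emb b') * of_int v" using basis_change_det[OF b' b] .
  have "det (emb b) * 1 = det (emb b) * of_int (u * v)" using u v by (metis mult.assoc mult.right_neutral of_int_mult)
  then have "complex_of_int (u * v) = 1" using det_emb_nonzero[OF b] by simp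
  then have "u * v = 1" by (metis of_int_eq_1_iff)
  then have "u\<^sup>2 = 1" by (auto simp: zmult_eq_1_iff)
  then have "(complex_of_int u)\<^sup>2 = 1" by (metis of_int_1 of_int_power)
  then show ?thesis using 1 u by (simp add: power_mult_distrib)
qed

lemma disc_cmod: "int_basis R n b \<Longrightarrow> (cmod (det (emb b)))\<^sup>2 = \<bar>real_of_int (ring_disc n R)\<bar>"
  using arg_cong[OF ring_disc_eq, of b cmod] by (simp add: norm_power)

lemma disc_nonzero: "ring_disc n R \<noteq> 0"
proof -
  obtain b where "int_basis R n b" using obtain_basis .
  then show ?thesis using ring_disc_eq[of b] det_emb_nonzero[of b] by auto
qed

section \<open>Lengths and successive minima\<close>

lemma ring_length_eq: "ring_length n R x = sqrt ((\<Sum>i<n. (cmod (\<sigma> i x))\<^sup>2) / n)"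
  unfolding ring_length_def using sum.reindex_bij_betw[OF enum, of "\<lambda>s. (cmod (s x))\<^sup>2"] by simp

lemma ring_length_nonneg: "ring_length n R x \<ge> 0"
  by (simp add: ring_length_eq sum_nonneg)

lemma ring_length_le:
  assumes "0 < n" "\<And>i. i < n \<Longrightarrow> cmod (\<sigma> i x) \<le> r"
  shows "ring_length n R x \<le> r"
proof -
  have "(\<Sum>i<n. (cmod (\<sigma> i x))\<^sup>2) \<le> (\<Sum>i<n. r\<^sup>2)"
    using assms by (intro sum_mono power_mono) auto
  then have "(\<Sum>i<n. (cmod (\<sigma> i x))\<^sup>2) / n \<le> r\<^sup>2"
    using assms(1) by (simp add: field_simps)
  moreover have "r \<ge> 0" using assms(1) assms(2)[of 0] norm_ge_zero[of "\<sigma> 0 x"] by linarith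
  ultimately show ?thesis unfolding ring_length_eq using real_le_lsqrt by (simp add: sum_nonneg)
qed

lemma emb_le:
  fixes r :: real
  assumes "i < n" "ring_length n R x \<le> r"
  shows "cmod (\<sigma> i x) \<le> n * r"
proof -
  have "(cmod (\<sigma> i x))\<^sup>2 \<le> (\<Sum>i<n. (cmod (\<sigma> i x))\<^sup>2)"
    using assms(1) by (intro member_le_sum) auto
  also have "\<dots> = n * (ring_length n R x)\<^sup>2"
    using assms(1) by (simp add: ring_length_eq sum_nonneg)
  also have "\<dots> \<le> n * r\<^sup>2" using assms(2) ring_length_nonneg by (intro mult_left_mono power_mono) auto
  also have "\<dots> \<le> (n * n) * r\<^sup>2"
    using assms(1) mult_left_mono[of 1 "real n" "real n"] by (intro mult_right_mono) auto
  also have "\<dots> = (n * r)\<^sup>2" by (simp add: power2_eq_square mult_ac)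
  finally show ?thesis
  proof (rule power2_le_imp_le)
    show "0 \<le> real n * r" using ring_length_nonneg[of x] assms(2) by simp
  qed
qed

lemma basis_prefix_independent:
  assumes b: "int_basis R n b" and "k \<le> n"
  shows "int_independent R k b"
  unfolding int_independent_def
proof (intro allI impI)
  fix c i assume c: "int_comb R k b c = \<zero>\<^bsub>R\<^esub>" and i: "i < k"
  have closed: "b \<in> {..<k} \<rightarrow> carrier R" using basis_closed[OF b] assms(2) by auto
  let ?c = "\<lambda>j. if j < k then c j else 0"
  have "(\<Sum>j<n. of_int (?c j) * \<sigma> l (b j)) = 0" if l: "l < n" for l
  proof -
    have "(\<Sum>j<n. of_int (?c j) * \<sigma> l (b j)) = (\<Sum>j<k. of_int (c j) * \<sigma> l (b j))"
      using assms(2) by (intro sum.mono_neutral_cong_right) auto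
    then show ?thesis using emb_int_comb[OF l closed, of c] c emb_zero[OF l] by simp
  qed
  from det_nonzero_kernel[OF det_emb_nonzero[OF b, unfolded emb_def] this, of i]
  show "c i = 0" using i assms(2) by simp
qed

lemma succ_min_le:
  assumes "int_basis R n b" "k < n" "\<And>j. j \<le> k \<Longrightarrow> ring_length n R (b j) \<le> r"
  shows "succ_min n R k \<le> r"
  unfolding succ_min_def
proof (rule cInf_lower)
  show "bdd_below {r. \<exists>v\<in>{..<k + 1} \<rightarrow> carrier R.
     int_independent R (k + 1) v \<and> (\<forall>j<k + 1. ring_length n R (v j) \<le> r)}"
  proof (intro bdd_belowI[of _ 0])
    fix r assume "r \<in> {r. \<exists>v\<in>{..<k + 1} \<rightarrow> carrier R.
     int_independent R (k + 1) v \<and> (\<forall>j<k + 1. ring_length n R (v j) \<le> r)}"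
    then obtain v where "ring_length n R (v 0) \<le> r" by auto
    then show "0 \<le> r" using ring_length_nonneg[of "v 0"] by linarith
  qed
  show "r \<in> {r. \<exists>v\<in>{..<k + 1} \<rightarrow> carrier R.
     int_independent R (k + 1) v \<and> (\<forall>j<k + 1. ring_length n R (v j) \<le> r)}"
    using assms basis_closed[OF assms(1)] basis_prefix_independent[OF assms(1), of "k + 1"]
    by (auto intro!: bexI[of _ b])
qed

text \<open>A lower bound for an infimum of reals needs a nonempty set; the prefix of a basis is a
  witness.\<close>

lemma succ_min_set_nonempty:
  assumes "k < n"
  shows "{r. \<exists>v\<in>{..<k + 1} \<rightarrow> carrier R.
     int_independent R (k + 1) v \<and> (\<forall>j<k + 1. ring_length n R (v j) \<le> r)} \<noteq> {}"
proof -
  obtain b where b: "int_basis R n b" using obtain_basis .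
  have "ring_length n R (b j) \<le> (\<Sum>j<k+1. ring_length n R (b j))" if "j < k + 1" for j
    using that by (intro member_le_sum) (auto intro: ring_length_nonneg)
  moreover have "b \<in> {..<k + 1} \<rightarrow> carrier R" using assms basis_closed[OF b] by auto
  moreover have "int_independent R (k + 1) b"
    using assms basis_prefix_independent[OF b, of "k + 1"] by simp
  ultimately show ?thesis by blast
qed

lemma le_succ_min:
  assumes "k < n" "\<And>v r. v \<in> {..<k + 1} \<rightarrow> carrier R \<Longrightarrow> int_independent R (k + 1) v \<Longrightarrow>
      (\<And>j. j \<le> k \<Longrightarrow> ring_length n R (v j) \<le> r) \<Longrightarrow> c \<le> r"
  shows "c \<le> succ_min n R k"
  unfolding succ_min_def using assms(2) succ_min_set_nonempty[OF assms(1)]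
  by (intro cInf_greatest) auto

text \<open>The strict inequality avoids the question whether the infimum is attained.\<close>

lemma succ_min_lessE:
  assumes "k < n" "succ_min n R k < r"
  obtains v where "v \<in> {..<k + 1} \<rightarrow> carrier R" "int_independent R (k + 1) v"
    "\<And>j. j \<le> k \<Longrightarrow> ring_length n R (v j) \<le> r"
proof -
  from cInf_lessD[OF succ_min_set_nonempty[OF assms(1)] assms(2)[unfolded succ_min_def]]
  obtain s v where "s < r" "v \<in> {..<k + 1} \<rightarrow> carrier R" "int_independent R (k + 1) v"
    "\<forall>j<k + 1. ring_length n R (v j) \<le> s" by blast
  then show ?thesis using that[of v] by (metis add.commute less_Suc_eq_le less_imp_le order_trans plus_1_eq_Suc)
qed

text \<open>Otherwise the \<open>k + 1\<close> vectors would lie in the span of the first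
  \<open>k\<close> basis vectors, and linear algebra over the integers would produce a relation
  between them.\<close>

lemma independent_escapes:
  assumes b: "int_basis R n b" and v: "v \<in> {..<k + 1} \<rightarrow> carrier R" "int_independent R (k + 1) v"
    and "k < n"
  obtains j l c where "j \<le> k" "k \<le> l" "l < n" "c l \<noteq> 0" "v j = int_comb R n b c"
proof -
  have "\<exists>j\<le>k. \<exists>l. k \<le> l \<and> l < n \<and> coord R n b (v j) l \<noteq> 0"
  proof (rule ccontr)
    assume "\<not> ?thesis"
    then have z: "coord R n b (v j) l = 0" if "j \<le> k" "k \<le> l" "l < n" for j l using that by blast
    obtain c where c: "\<exists>j<k+1. c j \<noteq> 0"
      "\<And>i. i < k \<Longrightarrow> (\<Sum>j<k+1. c j * coord R n b (v j) i) = 0"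
      using dependent_if_more_vectors[of k "k+1" "\<lambda>j i. coord R n b (v j) i"] by auto
    have c': "(\<Sum>j<k+1. c j * coord R n b (v j) i) = 0" if "i < n" for i
      using c(2)[of i] z[of _ i] that by (cases "i < k") auto
    have "int_comb R (k+1) v c = \<zero>\<^bsub>R\<^esub>"
    proof (rule emb_inj)
      fix i assume i: "i < n"
      have "\<sigma> i (int_comb R (k+1) v c) = (\<Sum>j<k+1. of_int (c j) * \<sigma> i (v j))"
        using emb_int_comb[OF i v(1)] .
      also have "\<dots> = (\<Sum>j<k+1. of_int (c j) * (\<Sum>l<n. of_int (coord R n b (v j) l) * \<sigma> i (b l)))"
        using emb_coord[OF b _ i] v(1) by (intro sum.cong) (auto simp: Pi_def)
      also have "\<dots> = (\<Sum>j<k+1. \<Sum>l<n. of_int (c j * coord R n b (v j) l) * \<sigma> i (b l))"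
        by (simp add: sum_distrib_left mult_ac)
      also have "\<dots> = (\<Sum>l<n. of_int (\<Sum>j<k+1. c j * coord R n b (v j) l) * \<sigma> i (b l))"
        by (subst sum.swap) (simp only: of_int_sum sum_distrib_right)
      also have "\<dots> = 0" by (intro sum.neutral) (use c' in auto)
      finally show "\<sigma> i (int_comb R (k+1) v c) = \<sigma> i \<zero>\<^bsub>R\<^esub>" using emb_zero[OF i] by simp
    qed (use closed_int_comb[OF v(1)] in auto)
    then show False using v(2) c(1) unfolding int_independent_def by blast
  qed
  then obtain j l where "j \<le> k" "k \<le> l" "l < n" "coord R n b (v j) l \<noteq> 0" by blast
  then show ?thesis using that[of j l "coord R n b (v j)"] coord_comb[OF b] v(1) by (auto simp: Pi_def)
qed

lemma coord_bound:
  assumes b: "int_basis R n b" and B: "\<And>i j. i < n \<Longrightarrow> j < n \<Longrightarrow> cmod (\<sigma> i (b j)) \<le> B j"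
    and v: "\<And>i. i < n \<Longrightarrow> cmod (\<sigma> i (int_comb R n b c)) \<le> r" and k: "k < n"
  shows "\<bar>real_of_int (c k)\<bar> * sqrt \<bar>real_of_int (ring_disc n R)\<bar> \<le> fact n * r * (\<Prod>j\<in>{..<n}-{k}. B j)"
proof -
  have "cmod (of_int (c k)) * cmod (det (mat n n (\<lambda>(i, k). \<sigma> i (b k))))
      \<le> fact n * r * (\<Prod>j\<in>{..<n}-{k}. B j)"
    using v emb_int_comb[OF _ basis_closed[OF b]] by (intro cramer_bound B k) auto
  moreover have "cmod (det (mat n n (\<lambda>(i, k). \<sigma> i (b k)))) = sqrt \<bar>real_of_int (ring_disc n R)\<bar>"
    using disc_cmod[OF b] unfolding emb_def by (metis norm_ge_zero real_sqrt_unique)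
  ultimately show ?thesis by simp
qed

end

section \<open>Orders spanned by complex lattices\<close>

definition lat_eval :: "nat \<Rightarrow> (nat \<Rightarrow> nat \<Rightarrow> complex) \<Rightarrow> int list \<Rightarrow> nat \<Rightarrow> complex" where
  "lat_eval n S xs i = (\<Sum>k<n. of_int (xs ! k) * S i k)"

text \<open>Products are read off in complex coordinates; the choices are unique when the lattice spanned
  by the columns of \<open>S\<close> has full rank and is closed under multiplication.\<close>

definition lat_ring :: "nat \<Rightarrow> (nat \<Rightarrow> nat \<Rightarrow> complex) \<Rightarrow> int list ring" where
  "lat_ring n S = \<lparr> carrier = {xs. length xs = n},
     monoid.mult = (\<lambda>xs ys. SOME zs. length zs = n \<and>
        (\<forall>i<n. lat_eval n S zs i = lat_eval n S xs i * lat_eval n S ys i)),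
     one = map (\<lambda>k. if k = 0 then 1 else 0) [0..<n],
     ring.zero = map (\<lambda>k. 0) [0..<n],
     add = (\<lambda>xs ys. map (\<lambda>k. xs ! k + ys ! k) [0..<n]) \<rparr>"

text \<open>Restriction to the carrier makes the coordinate function extensional, as membership in
  \<open>complex_homs\<close> demands.\<close>

definition lat_hom :: "nat \<Rightarrow> (nat \<Rightarrow> nat \<Rightarrow> complex) \<Rightarrow> nat \<Rightarrow> int list \<Rightarrow> complex" where
  "lat_hom n S i = restrict (\<lambda>xs. lat_eval n S xs i) {xs. length xs = n}"

definition unit_list :: "nat \<Rightarrow> nat \<Rightarrow> int list" where
  "unit_list n k = map (\<lambda>j. if j = k then 1 else 0) [0..<n]"

lemma carrier_lat_ring [simp]: "carrier (lat_ring n S) = {xs. length xs = n}"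
  by (simp add: lat_ring_def)

lemma lat_hom_eq: "length xs = n \<Longrightarrow> lat_hom n S i xs = lat_eval n S xs i"
  by (simp add: lat_hom_def)

lemma lat_eval_map: "lat_eval n S (map c [0..<n]) i = (\<Sum>k<n. of_int (c k) * S i k)"
  by (simp add: lat_eval_def)

lemma lat_eval_unit: "k < n \<Longrightarrow> lat_eval n S (unit_list n k) i = S i k"
  by (simp add: lat_eval_map unit_list_def if_distrib[of of_int] if_distrib[of "\<lambda>y. y * _"] cong: if_cong)

lemma length_unit_list [simp]: "length (unit_list n k) = n"
  by (simp add: unit_list_def)

locale lattice_order =
  fixes n :: nat and S :: "nat \<Rightarrow> nat \<Rightarrow> complex"
  assumes pos: "0 < n" and det_S: "det (mat n n (\<lambda>(i, k). S i k)) \<noteq> 0"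
    and S_one: "i < n \<Longrightarrow> S i 0 = 1"
    and S_mult: "j < n \<Longrightarrow> k < n \<Longrightarrow> \<exists>m :: nat \<Rightarrow> int. \<forall>i<n. S i j * S i k = (\<Sum>l<n. of_int (m l) * S i l)"
begin

abbreviation "\<Lambda> \<equiv> lat_ring n S"
abbreviation "ev \<equiv> lat_eval n S"

lemma ev_inj:
  assumes "length xs = n" "length ys = n" "\<And>i. i < n \<Longrightarrow> ev xs i = ev ys i"
  shows "xs = ys"
proof (rule nth_equalityI)
  fix k assume k: "k < length xs"
  have "(\<Sum>k<n. of_int (xs ! k - ys ! k) * S i k) = 0" if "i < n" for i
    using assms(3)[OF that] by (simp add: lat_eval_def left_diff_distrib sum_subtractf)
  from det_nonzero_kernel[OF det_S this, of k] show "xs ! k = ys ! k" using k assms(1) by simp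
qed (use assms in simp)

lemma mult_ex: "\<exists>zs. length zs = n \<and> (\<forall>i<n. ev zs i = ev xs i * ev ys i)"
proof -
  have "\<forall>j\<in>{..<n}. \<forall>k\<in>{..<n}. \<exists>m :: nat \<Rightarrow> int. \<forall>i<n. S i j * S i k = (\<Sum>l<n. of_int (m l) * S i l)"
    using S_mult by blast
  then obtain M :: "nat \<Rightarrow> nat \<Rightarrow> nat \<Rightarrow> int" where
    M: "\<And>i j k. j < n \<Longrightarrow> k < n \<Longrightarrow> i < n \<Longrightarrow> S i j * S i k = (\<Sum>l<n. of_int (M j k l) * S i l)"
    by (metis lessThan_iff)
  let ?zs = "map (\<lambda>l. \<Sum>j<n. \<Sum>k<n. xs ! j * ys ! k * M j k l) [0..<n]"
  have "ev ?zs i = ev xs i * ev ys i" if i: "i < n" for i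
  proof -
    have "ev xs i * ev ys i = (\<Sum>j<n. \<Sum>k<n. of_int (xs ! j) * of_int (ys ! k) * (S i j * S i k))"
      by (simp add: lat_eval_def sum_product mult_ac)
    also have "\<dots> = (\<Sum>j<n. \<Sum>k<n. \<Sum>l<n. of_int (xs ! j * ys ! k * M j k l) * S i l)"
      using i by (intro sum.cong refl) (simp add: M sum_distrib_left mult_ac)
    also have "\<dots> = (\<Sum>j<n. \<Sum>l<n. \<Sum>k<n. of_int (xs ! j * ys ! k * M j k l) * S i l)"
      by (intro sum.cong refl sum.swap)
    also have "\<dots> = (\<Sum>l<n. \<Sum>j<n. \<Sum>k<n. of_int (xs ! j * ys ! k * M j k l) * S i l)"
      by (rule sum.swap)
    also have "\<dots> = ev ?zs i"
      by (simp only: lat_eval_map of_int_sum sum_distrib_right)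
    finally show ?thesis by simp
  qed
  then show ?thesis by (intro exI[of _ ?zs]) auto
qed

lemma mult_props:
  "length (xs \<otimes>\<^bsub>\<Lambda>\<^esub> ys) = n" "i < n \<Longrightarrow> ev (xs \<otimes>\<^bsub>\<Lambda>\<^esub> ys) i = ev xs i * ev ys i"
  using someI_ex[OF mult_ex[of xs ys]] by (auto simp: lat_ring_def)

lemma add_props:
  "length (xs \<oplus>\<^bsub>\<Lambda>\<^esub> ys) = n" "ev (xs \<oplus>\<^bsub>\<Lambda>\<^esub> ys) i = ev xs i + ev ys i"
  by (auto simp: lat_ring_def lat_eval_map distrib_right sum.distrib) (simp add: lat_eval_def)

lemma one_props: "length \<one>\<^bsub>\<Lambda>\<^esub> = n" "i < n \<Longrightarrow> ev \<one>\<^bsub>\<Lambda>\<^esub> i = 1"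
  using pos S_one
  by (auto simp: lat_ring_def lat_eval_map if_distrib[of of_int] if_distrib[of "\<lambda>y. y * _"] cong: if_cong)

lemma zero_props: "length \<zero>\<^bsub>\<Lambda>\<^esub> = n" "ev \<zero>\<^bsub>\<Lambda>\<^esub> i = 0"
  by (auto simp: lat_ring_def lat_eval_map)

lemma closed: "xs \<otimes>\<^bsub>\<Lambda>\<^esub> ys \<in> carrier \<Lambda>" "xs \<oplus>\<^bsub>\<Lambda>\<^esub> ys \<in> carrier \<Lambda>" "\<one>\<^bsub>\<Lambda>\<^esub> \<in> carrier \<Lambda>" "\<zero>\<^bsub>\<Lambda>\<^esub> \<in> carrier \<Lambda>"
  by (auto simp: mult_props add_props one_props zero_props)

lemma carrier_eqI: "x \<in> carrier \<Lambda> \<Longrightarrow> y \<in> carrier \<Lambda> \<Longrightarrow> (\<And>i. i < n \<Longrightarrow> ev x i = ev y i) \<Longrightarrow> x = y"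
  using ev_inj by simp

lemma cring_lat: "cring \<Lambda>"
proof (rule cringI)
  show "abelian_group \<Lambda>"
  proof (rule abelian_groupI)
    fix x assume x: "x \<in> carrier \<Lambda>"
    show "\<exists>y\<in>carrier \<Lambda>. y \<oplus>\<^bsub>\<Lambda>\<^esub> x = \<zero>\<^bsub>\<Lambda>\<^esub>"
    proof (intro bexI[of _ "map (\<lambda>k. - x ! k) [0..<n]"] carrier_eqI closed)
      fix i
      show "ev (map (\<lambda>k. - x ! k) [0..<n] \<oplus>\<^bsub>\<Lambda>\<^esub> x) i = ev \<zero>\<^bsub>\<Lambda>\<^esub> i"
        by (simp only: add_props zero_props lat_eval_map) (simp add: lat_eval_def sum_negf)
    qed simp
  qed (auto intro!: carrier_eqI closed simp: add_props zero_props algebra_simps simp del: carrier_lat_ring)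
  show "comm_monoid \<Lambda>"
    by (rule comm_monoidI) (auto intro!: carrier_eqI closed simp: mult_props one_props algebra_simps simp del: carrier_lat_ring)
qed (auto intro!: carrier_eqI closed simp: mult_props add_props algebra_simps simp del: carrier_lat_ring)

lemma lat_hom_ring_hom:
  assumes i: "i < n" shows "lat_hom n S i \<in> complex_homs \<Lambda>"
proof -
  have "lat_hom n S i \<in> Ring.ring_hom \<Lambda> complex_ring"
    by (rule ring_hom_memI)
      (use i in \<open>simp_all add: lat_hom_eq mult_props add_props one_props del: One_nat_def\<close>)
  then show ?thesis by (simp add: complex_homs_def lat_hom_def)
qed

lemma lat_int_comb: "int_comb \<Lambda> n (unit_list n) c = map c [0..<n]"
proof (rule ev_inj)
  have b: "unit_list n \<in> {..<n} \<rightarrow> carrier \<Lambda>" by auto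
  have "int_comb \<Lambda> n (unit_list n) c \<in> carrier \<Lambda>"
    by (rule int_comb_closed[OF cring_lat complex_homs_hom[OF lat_hom_ring_hom[OF pos]] b])
  then show l: "length (int_comb \<Lambda> n (unit_list n) c) = n" by simp
  fix i assume i: "i < n"
  have "lat_hom n S i (int_comb \<Lambda> n (unit_list n) c) = (\<Sum>k<n. of_int (c k) * lat_hom n S i (unit_list n k))"
    using complex_hom_int_comb[OF cring_lat complex_homs_hom[OF lat_hom_ring_hom[OF i]] b] .
  then show "ev (int_comb \<Lambda> n (unit_list n) c) i = ev (map c [0..<n]) i"
    using l by (simp add: lat_hom_eq lat_eval_unit lat_eval_map)
qed simp

lemma int_basis_unit: "int_basis \<Lambda> n (unit_list n)"
  unfolding int_basis_def
proof (intro conjI ballI)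
  fix x assume x: "x \<in> carrier \<Lambda>"
  show "\<exists>!c. c \<in> extensional {..<n} \<and> x = int_comb \<Lambda> n (unit_list n) c"
    unfolding lat_int_comb
  proof (rule ex1I[of _ "restrict (\<lambda>k. x ! k) {..<n}"])
    fix c assume c: "c \<in> extensional {..<n} \<and> x = map c [0..<n]"
    show "c = restrict (\<lambda>k. x ! k) {..<n}"
      using c by (intro extensionalityI[of _ "{..<n}"]) auto
  qed (use x in \<open>auto intro: nth_equalityI\<close>)
qed auto

lemma lat_hom_inj: "inj_on (lat_hom n S) {..<n}"
proof (rule inj_onI, rule ccontr)
  let ?E = "mat n n (\<lambda>(i, k). S i k)"
  fix i j assume ij: "i \<in> {..<n}" "j \<in> {..<n}" "lat_hom n S i = lat_hom n S j" "i \<noteq> j"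
  have "S i k = S j k" if "k < n" for k
    using lat_eval_unit[OF that, of S] lat_hom_eq[of "unit_list n k" n S] ij(3) by (metis length_unit_list)
  then have "row ?E i = row ?E j" using ij by (intro eq_vecI) auto
  then have "det ?E = 0" using det_identical_rows[of ?E n i j] ij by auto
  then show False using det_S by simp
qed

text \<open>As the matrix of \<open>S\<close> is invertible, any further homomorphism would be a
  complex combination of the \<open>n\<close> coordinate homomorphisms, against the independence of
  characters.\<close>

lemma lat_homs_surj:
  assumes h: "h \<in> complex_homs \<Lambda>"
  shows "h \<in> lat_hom n S ` {..<n}"
proof (rule ccontr)
  assume nh: "h \<notin> lat_hom n S ` {..<n}"
  let ?E = "mat n n (\<lambda>(i, k). S i k)"
  obtain F where F: "F \<in> carrier_mat n n" "F * ?E = 1\<^sub>m n"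
    using det_nonzero_solve[OF mat_carrier det_S] by blast
  \<comment> \<open>The row of values of \<open>h\<close> on the unit vectors, multiplied by the
    inverse of the matrix of \<open>S\<close>.\<close>
  define c where "c i = (\<Sum>l<n. h (unit_list n l) * F $$ (l, i))" for i
  have hc: "h (unit_list n k) = (\<Sum>i<n. c i * S i k)" if k: "k < n" for k
  proof -
    have FE: "(\<Sum>i<n. F $$ (l, i) * S i k) = (if l = k then 1 else 0)" if l: "l < n" for l
      using mat_mult_entry[OF F(1), of ?E l k] F(2) l k by simp
    have "(\<Sum>i<n. c i * S i k) = (\<Sum>i<n. \<Sum>l<n. h (unit_list n l) * (F $$ (l, i) * S i k))"
      by (simp add: c_def sum_distrib_left sum_distrib_right mult_ac)
    also have "\<dots> = (\<Sum>l<n. h (unit_list n l) * (\<Sum>i<n. F $$ (l, i) * S i k))"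
      by (subst sum.swap) (simp add: sum_distrib_left)
    also have "\<dots> = (\<Sum>l<n. h (unit_list n l) * (if l = k then 1 else 0))"
      by (intro sum.cong refl) (simp add: FE)
    also have "\<dots> = h (unit_list n k)" using k by (simp add: if_distrib cong: if_cong)
    finally show ?thesis ..
  qed
  have hx: "h x = (\<Sum>i<n. c i * lat_hom n S i x)" if x: "x \<in> carrier \<Lambda>" for x
  proof -
    have x': "x = int_comb \<Lambda> n (unit_list n) (\<lambda>k. x ! k)"
      using x by (auto simp: lat_int_comb intro: nth_equalityI)
    have "h x = (\<Sum>k<n. of_int (x ! k) * h (unit_list n k))"
      by (subst x', rule complex_hom_int_comb[OF cring_lat complex_homs_hom[OF h]]) auto
    also have "\<dots> = (\<Sum>k<n. \<Sum>i<n. of_int (x ! k) * (c i * S i k))"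
      by (intro sum.cong refl) (simp add: hc sum_distrib_left)
    also have "\<dots> = (\<Sum>i<n. c i * (\<Sum>k<n. of_int (x ! k) * S i k))"
      by (subst sum.swap) (simp add: sum_distrib_left mult_ac)
    also have "\<dots> = (\<Sum>i<n. c i * lat_hom n S i x)"
      using x by (simp add: lat_hom_eq lat_eval_def)
    finally show ?thesis .
  qed
  let ?H = "insert h (lat_hom n S ` {..<n})"
  let ?d = "\<lambda>g. if g = h then 1 else - c (inv_into {..<n} (lat_hom n S) g)"
  have van: "(\<Sum>g\<in>?H. ?d g * g x) = 0" if x: "x \<in> carrier \<Lambda>" for x
  proof -
    have "(\<Sum>g\<in>?H. ?d g * g x) = h x + (\<Sum>g\<in>lat_hom n S ` {..<n}. ?d g * g x)"
      using nh by simp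
    also have "(\<Sum>g\<in>lat_hom n S ` {..<n}. ?d g * g x) = (\<Sum>i<n. - c i * lat_hom n S i x)"
      using nh lat_hom_inj by (subst sum.reindex[OF lat_hom_inj]) (auto intro!: sum.cong)
    finally show ?thesis using hx[OF x] by (simp add: sum_negf)
  qed
  have sub: "?H \<subseteq> complex_homs \<Lambda>" using h lat_hom_ring_hom by auto
  have "?d h = 0"
    by (rule complex_homs_independent[OF cring_lat _ sub]) (use van in auto)
  then show False by simp
qed

lemma embedded_lat: "embedded_ring n \<Lambda> (lat_hom n S)"
proof
  show "rank_ring n \<Lambda>" unfolding rank_ring_def using cring_lat int_basis_unit by blast
  show "bij_betw (lat_hom n S) {..<n} (complex_homs \<Lambda>)"
    using lat_hom_inj lat_homs_surj lat_hom_ring_hom by (auto simp: bij_betw_def)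
qed

end

context embedded_ring
begin

text \<open>Multiplication by \<open>x\<close> has an integral matrix, which over \<complex> is
  similar to the diagonal matrix of the \<open>\<sigma> i x\<close>; its characteristic polynomial
  has both properties.\<close>

lemma char_poly_ex:
  assumes x: "x \<in> carrier R"
  obtains p :: "int poly" where "Polynomial.degree p = n" "Polynomial.coeff p n = 1"
    "\<And>z. poly (map_poly of_int p) z = (\<Prod>i<n. z - \<sigma> i x)"
proof -
  obtain b where b: "int_basis R n b" using obtain_basis .
  let ?M = "mat n n (\<lambda>(k, j). coord R n b (x \<otimes>\<^bsub>R\<^esub> b j) k)"
  let ?C = "map_mat of_int ?M :: complex mat"
  let ?D = "mat n n (\<lambda>(i, j). if i = j then \<sigma> i x else 0)"
  obtain F where F: "F \<in> carrier_mat n n" "emb b * F = 1\<^sub>m n" "F * emb b = 1\<^sub>m n"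
    using det_nonzero_solve[OF emb_carrier det_emb_nonzero[OF b]] .
  have C: "?C = mat n n (\<lambda>(k, j). of_int (coord R n b (x \<otimes>\<^bsub>R\<^esub> b j) k))"
    by (rule eq_matI) auto
  have "?D = ?D * (emb b * F)" using F by simp
  also have "\<dots> = (?D * emb b) * F" by (rule assoc_mult_mat[symmetric, of _ n n _ n _ n]) (use F in auto)
  also have "\<dots> = emb b * ?C * F" unfolding C mult_matrix[OF b x] ..
  finally have D: "?D = emb b * ?C * F" .
  have "similar_mat ?D ?C"
    by (rule similar_matI[OF _ F(2,3) D]) (use F in auto)
  from char_poly_similar[OF this] have "char_poly ?C = char_poly ?D" ..
  also have "\<dots> = (\<Prod>a\<leftarrow>diag_mat ?D. [:- a, 1:])"
    by (rule char_poly_upper_triangular[of _ n]) auto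
  also have "diag_mat ?D = map (\<lambda>i. \<sigma> i x) [0..<n]" by (auto simp: diag_mat_def)
  finally have cp: "char_poly ?C = (\<Prod>i<n. [:- \<sigma> i x, 1:])"
    by (simp add: comp_def prod.list_conv_set_nth flip: prod.distinct_set_conv_list atLeast0LessThan)
  show ?thesis
  proof (rule that[of "char_poly ?M"])
    show "Polynomial.degree (char_poly ?M) = n" "Polynomial.coeff (char_poly ?M) n = 1"
      using degree_monic_char_poly[of ?M n] by auto
    have "map_poly of_int (char_poly ?M) = char_poly ?C"
      by (rule of_int_hom.char_poly_hom[symmetric, of _ n]) auto
    then show "poly (map_poly of_int (char_poly ?M)) z = (\<Prod>i<n. z - \<sigma> i x)" for z
      by (simp add: cp poly_prod)
  qed
qed

end

text \<open>The constant is rational by the trace, and it is a root of the monic integral polynomial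
  \<open>p\<^sub>y - p\<^sub>y c\<close>, where \<open>p\<^sub>y\<close> is the characteristic polynomial of \<open>y\<close>.\<close>

lemma translation_integral:
  fixes \<kappa> c :: complex
  assumes R: "embedded_ring n R \<sigma>" and R': "embedded_ring n R' \<sigma>'" and n: "0 < n"
    and x: "x \<in> carrier R" and y: "y \<in> carrier R'" and \<kappa>: "\<kappa> = 1 \<or> \<kappa> = -1"
    and eq: "\<And>i. i < n \<Longrightarrow> \<sigma>' i y = \<kappa> * \<sigma> i x + c"
  shows "c \<in> \<int>"
proof -
  interpret R: embedded_ring n R \<sigma> by (rule R)
  interpret R': embedded_ring n R' \<sigma>' by (rule R')
  have k: "\<kappa> \<in> \<int>" using \<kappa> by auto
  have "of_int (ring_trace n R' y) = \<kappa> * of_int (ring_trace n R x) + of_nat n * c"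
    by (simp add: R.ring_trace_eq[OF x] R'.ring_trace_eq[OF y] eq sum.distrib sum_distrib_left)
  then have "c = (of_int (ring_trace n R' y) - \<kappa> * of_int (ring_trace n R x)) / of_nat n"
    using n by (simp add: field_simps)
  then have rat: "c \<in> \<rat>" using k Ints_subset_Rats by (auto intro!: Rats_divide Rats_diff Rats_mult)
  obtain p where p: "degree p = n" "coeff p n = 1" "\<And>z. poly (map_poly of_int p) z = (\<Prod>i<n. z - \<sigma> i x)"
    using R.char_poly_ex[OF x] by blast
  obtain q where q: "degree q = n" "coeff q n = 1" "\<And>z. poly (map_poly of_int q) z = (\<Prod>i<n. z - \<sigma>' i y)"
    using R'.char_poly_ex[OF y] by blast
  have "poly (map_poly of_int q) c = (\<Prod>i<n. \<kappa> * (0 - \<sigma> i x))"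
    unfolding q(3) by (intro prod.cong) (auto simp: eq)
  also have "\<dots> = \<kappa> ^ n * poly (map_poly of_int p) 0"
    by (simp only: p(3) prod.distrib) simp
  also have "poly (map_poly of_int p) (0::complex) = of_int (poly p 0)"
    by (simp add: poly_0_coeff_0 coeff_map_poly)
  also have "\<kappa> ^ n * of_int (poly p 0) \<in> \<int>" using k by (intro Ints_mult Ints_power) auto
  finally obtain m where m: "poly (map_poly of_int q) c = of_int m" by (auto elim: Ints_cases)
  define r where "r = q + [:- m:]"
  have "degree r = n" unfolding r_def using q(1) n by (subst degree_add_eq_left) auto
  moreover have "coeff r n = 1" using q(1,2) n by (simp add: r_def coeff_pCons split: nat.split)
  moreover have "poly (map_poly of_int r) c = 0"
    unfolding r_def of_int_poly_hom.hom_add poly_add m of_int_hom.map_poly_pCons_hom map_poly_0 by simp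
  ultimately have "algebraic_int c" by (auto simp: algebraic_int_altdef_ipoly)
  then show ?thesis using rat by (rule rational_algebraic_int_is_int)
qed

section \<open>The resolvent map in complex coordinates and the rigidity of its special
  points\<close>

definition resolv :: "(nat \<Rightarrow> complex) \<Rightarrow> nat \<Rightarrow> complex" where
  "resolv v j = (if j = 0 then v 0 * v 1 + v 2 * v 3
     else if j = 1 then v 0 * v 2 + v 1 * v 3 else v 0 * v 3 + v 1 * v 2)"

lemma less_4_cases: "(i::nat) < 4 \<longleftrightarrow> i = 0 \<or> i = 1 \<or> i = 2 \<or> i = 3"
  by auto

lemma less_3_cases: "(i::nat) < 3 \<longleftrightarrow> i = 0 \<or> i = 1 \<or> i = 2"
  by auto

lemma resolv_cong: "(\<And>i. i < 4 \<Longrightarrow> v i = w i) \<Longrightarrow> resolv v j = resolv w j"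
  by (simp add: resolv_def)

text \<open>Since \<open>resolv v 0 - resolv v 1 = (v 0 - v 3) * (v 1 - v 2)\<close> and so on, the common zeros of
  the pencil are, modulo constants, the multiples of the four idempotents.\<close>

lemma resolv_const_iff:
  "(\<forall>j<3. resolv v j = resolv v 0) \<longleftrightarrow> (\<exists>p<4. \<exists>c. \<forall>i<4. i \<noteq> p \<longrightarrow> v i = c)"
proof
  assume r: "\<forall>j<3. resolv v j = resolv v 0"
  have "resolv v 1 = resolv v 0" "resolv v 2 = resolv v 0"
    by (rule r[rule_format], simp)+
  then have "(v 0 - v 3) * (v 1 - v 2) = 0" "(v 0 - v 2) * (v 1 - v 3) = 0"
    by (auto simp: resolv_def algebra_simps)
  then consider "v 0 = v 3" "v 0 = v 2" | "v 0 = v 3" "v 1 = v 3" | "v 1 = v 2" "v 0 = v 2" | "v 1 = v 2" "v 1 = v 3"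
    by auto
  then show "\<exists>p<4. \<exists>c. \<forall>i<4. i \<noteq> p \<longrightarrow> v i = c"
  proof cases
    case 1 then show ?thesis by (intro exI[of _ 1] conjI exI[of _ "v 0"]) (auto simp: less_4_cases)
  next
    case 2 then show ?thesis by (intro exI[of _ 2] conjI exI[of _ "v 0"]) (auto simp: less_4_cases)
  next
    case 3 then show ?thesis by (intro exI[of _ 3] conjI exI[of _ "v 0"]) (auto simp: less_4_cases)
  next
    case 4 then show ?thesis by (intro exI[of _ 0] conjI exI[of _ "v 1"]) (auto simp: less_4_cases)
  qed
next
  assume "\<exists>p<4. \<exists>c. \<forall>i<4. i \<noteq> p \<longrightarrow> v i = c"
  then obtain p c where p: "p < 4" and v: "\<And>i. i < 4 \<Longrightarrow> i \<noteq> p \<Longrightarrow> v i = c" by blast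
  have v': "p \<noteq> 0 \<Longrightarrow> v 0 = c" "p \<noteq> 1 \<Longrightarrow> v 1 = c" "p \<noteq> 2 \<Longrightarrow> v 2 = c" "p \<noteq> 3 \<Longrightarrow> v 3 = c"
    using v by auto
  have "resolv v 1 = resolv v 0 \<and> resolv v 2 = resolv v 0"
    using p v' unfolding less_4_cases resolv_def
    by (elim disjE) (simp_all add: mult.commute add.commute)
  then show "\<forall>j<3. resolv v j = resolv v 0"
    unfolding less_3_cases by metis
qed

text \<open>Complex coefficients are allowed because the idempotents, on which the rigidity argument
  rests, lie in general outside the lattice.\<close>

definition val :: "(nat \<Rightarrow> nat \<Rightarrow> complex) \<Rightarrow> (nat \<Rightarrow> complex) \<Rightarrow> nat \<Rightarrow> complex" where
  "val S c i = (\<Sum>k<4. c k * S i k)"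

lemma val_unit: "k < 4 \<Longrightarrow> val S (\<lambda>l. if l = k then 1 else 0) i = S i k"
  by (simp add: val_def if_distrib[of "\<lambda>y. y * _"] cong: if_cong)

lemma val_sum: "val S (\<lambda>l. \<Sum>k\<in>A. c k l) i = (\<Sum>k\<in>A. val S (c k) i)"
  unfolding val_def by (subst sum.swap) (simp add: sum_distrib_right)

lemma val_scale: "val S (\<lambda>l. a * c l) i = a * val S c i"
  unfolding val_def by (simp add: sum_distrib_left mult_ac)

lemma val_diff: "val S (\<lambda>l. c l - d l) i = val S c i - val S d i"
  unfolding val_def by (simp add: sum_subtractf left_diff_distrib)

text \<open>By \<open>resolv_const_iff\<close>, the map from \<open>val S c\<close> to
  \<open>val S' c\<close> sends each line spanned by an idempotent, modulo constants, to such a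
  line. As it is injective and fixes 1, it permutes the four lines; since the idempotents add up to
  1, all scaling factors coincide.\<close>

lemma rigid_linear:
  assumes d: "det (mat 4 4 (\<lambda>(i, k). S i k)) \<noteq> 0" and d': "det (mat 4 4 (\<lambda>(i, k). S' i k)) \<noteq> 0"
    and one: "\<And>i. i < 4 \<Longrightarrow> S i 0 = 1" "\<And>i. i < 4 \<Longrightarrow> S' i 0 = 1"
    and special: "\<And>c. (\<forall>j<3. resolv (val S c) j = resolv (val S c) 0) \<Longrightarrow>
       (\<forall>j<3. resolv (val S' c) j = resolv (val S' c) 0)"
  obtains \<pi> \<kappa> \<delta> where "bij_betw \<pi> {..<4} {..<4}" "\<kappa> \<noteq> 0"
    "\<And>i k. i < 4 \<Longrightarrow> k < 4 \<Longrightarrow> S' (\<pi> i) k = \<kappa> * S i k + \<delta> k"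
proof -
  let ?E = "mat 4 4 (\<lambda>(i, k). S i k)"
  obtain F where F: "F \<in> carrier_mat 4 4" "?E * F = 1\<^sub>m 4" "F * ?E = 1\<^sub>m 4"
    using det_nonzero_solve[OF mat_carrier d] by blast
  \<comment> \<open>Column \<open>k\<close> of the inverse matrix holds the coordinates of the
    \<open>k\<close>-th idempotent.\<close>
  define e where "e k l = F $$ (l, k)" for k l
  have ve: "val S (e k) i = (if i = k then 1 else 0)" if "i < 4" "k < 4" for i k
    using mat_mult_entry[OF mat_carrier F(1) that, of "\<lambda>(i, k). S i k"] F(2) that
    by (simp add: val_def e_def mult.commute)
  have "\<exists>p c x. p < 4 \<and> (\<forall>i<4. val S' (e k) i = c + (if i = p then x else 0))" if k: "k < 4" for k
  proof -
    have "\<exists>p<4. \<exists>c. \<forall>i<4. i \<noteq> p \<longrightarrow> val S (e k) i = c"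
      using k by (intro exI[of _ k] conjI exI[of _ 0]) (auto simp: ve)
    then obtain p c where "p < 4" "\<forall>i<4. i \<noteq> p \<longrightarrow> val S' (e k) i = c"
      using special[of "e k"] unfolding resolv_const_iff by blast
    then show ?thesis by (intro exI[of _ p] exI[of _ c] exI[of _ "val S' (e k) p - c"]) auto
  qed
  then obtain p c x where p: "\<And>k. k < 4 \<Longrightarrow> p k < 4" and
    v': "\<And>k i. k < 4 \<Longrightarrow> i < 4 \<Longrightarrow> val S' (e k) i = c k + (if i = p k then x k else 0)"
    by metis
  have recon: "val S' m i = (\<Sum>k<4. val S m k * (c k + (if i = p k then x k else 0)))" if i: "i < 4" for m i
  proof -
    have FE: "(\<Sum>k<4. F $$ (l, k) * S k j) = (if l = j then 1 else 0)" if "l < 4" "j < 4" for l j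
      using mat_mult_entry[OF F(1) mat_carrier that, of "\<lambda>(i, k). S i k"] F(3) that by simp
    have m: "m l = (\<Sum>k<4. val S m k * e k l)" if l: "l < 4" for l
    proof -
      have "(\<Sum>k<4. val S m k * e k l) = (\<Sum>k<4. \<Sum>j<4. m j * (F $$ (l, k) * S k j))"
        by (simp add: val_def e_def sum_distrib_right sum_distrib_left mult_ac)
      also have "\<dots> = (\<Sum>j<4. m j * (\<Sum>k<4. F $$ (l, k) * S k j))"
        by (subst sum.swap) (simp add: sum_distrib_left)
      also have "\<dots> = (\<Sum>j<4. m j * (if l = j then 1 else 0))"
        by (intro sum.cong refl) (simp add: FE l)
      also have "\<dots> = m l" using l by (simp add: if_distrib cong: if_cong)
      finally show ?thesis ..
    qed
    have "val S' m i = val S' (\<lambda>l. \<Sum>k<4. val S m k * e k l) i"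
      unfolding val_def[of S'] by (intro sum.cong refl) (simp add: m)
    also have "\<dots> = (\<Sum>k<4. val S m k * val S' (e k) i)" by (simp only: val_sum val_scale)
    finally show ?thesis using i by (simp add: v')
  qed
  let ?u = "\<lambda>l::nat. if l = 0 then 1 else (0::complex)"
  have u: "val S ?u i = 1" "val S' ?u i = 1" if "i < 4" for i
    using that val_unit[of 0] one by auto
  have ker: "val S m i = 0" if "\<And>i. i < 4 \<Longrightarrow> val S' m i = 0" for m i
  proof -
    have "m k = 0" if "k < 4" for k
      using det_nonzero_kernel[OF d', of m k] that \<open>\<And>i. i < 4 \<Longrightarrow> val S' m i = 0\<close>
      by (simp add: val_def)
    then show ?thesis by (simp add: val_def)
  qed
  \<comment> \<open>With \<open>x k = 0\<close>, the idempotent and a multiple of 1 would have the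
    same image, although the map is injective.\<close>
  have x0: "x k \<noteq> 0" if k: "k < 4" for k
  proof
    assume "x k = 0"
    then have "val S' (\<lambda>l. e k l - c k * ?u l) i = 0" if "i < 4" for i
      unfolding val_diff val_scale using that k by (simp add: v' u)
    from ker[OF this] have "val S (e k) i = c k" if "i < 4" for i
      unfolding val_diff val_scale using that by (simp add: u)
    then have "(if i = k then 1 else 0) = c k" if "i < 4" for i using ve that k by metis
    from this[of k] this[of "(k + 1) mod 4"] k show False
      by (auto simp: less_4_cases split: if_splits)
  qed
  have inj: "inj_on p {..<4}"
  proof (rule inj_onI, rule ccontr)
    fix k l assume kl: "k \<in> {..<4}" "l \<in> {..<4}" "p k = p l" "k \<noteq> l"
    \<comment> \<open>If two idempotents went to the same line, this combination would be sent to 0.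
      An index other than \<open>k\<close> and \<open>l\<close> then shows that its constant part
      vanishes, and the index \<open>k\<close> that \<open>x l\<close> does.\<close>
    let ?m = "\<lambda>t. (x l * e k t - x k * e l t) - (x l * c k - x k * c l) * ?u t"
    have "val S' ?m i = 0" if "i < 4" for i
      unfolding val_diff val_scale using that kl by (simp add: v' u algebra_simps)
    note z' = ker[OF this]
    have z: "x l * (if i = k then 1 else 0) - x k * (if i = l then 1 else 0) = x l * c k - x k * c l"
      if "i < 4" for i
      using z'[of i] that kl unfolding val_diff val_scale by (simp add: ve u)
    obtain i where i: "i < 4" "i \<noteq> k" "i \<noteq> l"
      using kl by (metis less_4_cases zero_neq_numeral one_eq_numeral_iff numeral_eq_iff
          zero_neq_one num.distinct(1) num.distinct(3) num.distinct(5) verit_eq_simplify(14))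
    from z[OF i(1)] i z[of k] kl have "x l = 0" by simp
    then show False using x0 kl by auto
  qed
  then have bij: "bij_betw p {..<4} {..<4}"
    using p by (simp add: bij_betw_def) (metis card_subset_eq card_image finite_lessThan image_subset_iff lessThan_iff)
  define \<kappa> where "\<kappa> = 1 - (\<Sum>k<4. c k)"
  have sel: "(\<Sum>k<4. f k * (if p i = p k then x k else 0)) = f i * x i" if "i < 4" for i f
  proof -
    have "(\<Sum>k<4. f k * (if p i = p k then x k else 0)) = (\<Sum>k<4. if k = i then f i * x i else 0)"
      using inj that by (intro sum.cong refl) (auto simp: inj_on_def)
    then show ?thesis using that by simp
  qed
  \<comment> \<open>The image of 1, as the sum of the images of the idempotents, is read off at
    position \<open>p k\<close>.\<close>
  have x\<kappa>: "x k = \<kappa>" if k: "k < 4" for k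
  proof -
    have "1 = (\<Sum>j<4. 1 * (c j + (if p k = p j then x j else 0)))"
      using recon[of "p k" ?u] p[OF k] u by simp
    also have "\<dots> = (\<Sum>j<4. c j) + x k"
      using sel[OF k, of "\<lambda>_. 1"] by (simp add: sum.distrib)
    finally show ?thesis unfolding \<kappa>_def by (metis add_diff_cancel_left')
  qed
  show ?thesis
  proof (rule that[OF bij])
    show "\<kappa> \<noteq> 0" using x\<kappa>[of 0] x0[of 0] by simp
    fix i k :: nat assume ik: "i < 4" "k < 4"
    let ?v = "\<lambda>l. if l = k then 1 else (0::complex)"
    have "S' (p i) k = val S' ?v (p i)" by (simp only: val_unit[OF ik(2)])
    also have "\<dots> = (\<Sum>j<4. S j k * (c j + (if p i = p j then x j else 0)))"
      using recon[OF p[OF ik(1)], of ?v] by (simp only: val_unit[OF ik(2)])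
    also have "\<dots> = (\<Sum>j<4. S j k * c j) + S i k * x i"
      using sel[OF ik(1), of "\<lambda>j. S j k"] by (simp add: distrib_left sum.distrib)
    finally show "S' (p i) k = \<kappa> * S i k + (\<Sum>j<4. S j k * c j)"
      using x\<kappa>[OF ik(1)] by simp
  qed
qed

text \<open>The column of ones absorbs the translations \<open>\<delta> k\<close>, and each of the
  other \<open>n - 1\<close> columns contributes a factor \<kappa>.\<close>

lemma det_affine:
  fixes f g :: "nat \<Rightarrow> nat \<Rightarrow> complex"
  assumes "0 < n" "\<And>i. i < n \<Longrightarrow> f i 0 = 1" "\<And>i. i < n \<Longrightarrow> g i 0 = 1"
    and "\<And>i k. i < n \<Longrightarrow> 0 < k \<Longrightarrow> k < n \<Longrightarrow> g i k = \<kappa> * f i k + \<delta> k"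
  shows "det (mat n n (\<lambda>(i, k). g i k)) = \<kappa> ^ (n - 1) * det (mat n n (\<lambda>(i, k). f i k))"
proof -
  let ?u = "\<lambda>k l. if l = 0 then (if k = 0 then 1 else 0) else if k = l then \<kappa> else if k = 0 then \<delta> l else 0"
  let ?U = "mat n n (\<lambda>(k, l). ?u k l)"
  have "mat n n (\<lambda>(i, k). g i k) = mat n n (\<lambda>(i, k). f i k) * ?U"
  proof (rule eq_matI)
    fix i l assume "i < dim_row (mat n n (\<lambda>(i, k). f i k) * ?U)" "l < dim_col (mat n n (\<lambda>(i, k). f i k) * ?U)"
    then have il: "i < n" "l < n" by auto
    have "(mat n n (\<lambda>(i, k). f i k) * ?U) $$ (i, l) = (\<Sum>k<n. f i k * ?u k l)"
      using mat_mult_entry[OF mat_carrier mat_carrier il, of "\<lambda>(i, k). f i k" "\<lambda>(k, l). ?u k l"] il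
      by simp
    also have "\<dots> = g i l"
    proof (cases "l = 0")
      case True
      then show ?thesis using assms(1,2,3) il by (simp add: if_distrib cong: if_cong)
    next
      case False
      then have "(\<Sum>k<n. f i k * ?u k l) = (\<Sum>k<n. (if k = l then f i k * \<kappa> else 0) + (if k = 0 then f i k * \<delta> l else 0))"
        by (intro sum.cong) auto
      then show ?thesis using assms il False by (simp add: sum.distrib)
    qed
    finally show "mat n n (\<lambda>(i, k). g i k) $$ (i, l) = (mat n n (\<lambda>(i, k). f i k) * ?U) $$ (i, l)"
      using il by simp
  qed auto
  then have "det (mat n n (\<lambda>(i, k). g i k)) = det (mat n n (\<lambda>(i, k). f i k)) * det ?U"
    by (simp add: det_mult[of _ n])
  also have "det ?U = prod_list (diag_mat ?U)"
    by (rule det_upper_triangular[of _ n]) auto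
  also have "diag_mat ?U = map (\<lambda>k. ?u k k) [0..<n]" by (auto simp: diag_mat_def)
  also have "\<dots> = 1 # map (\<lambda>k. \<kappa>) [1..<n]"
    using assms(1) by (subst upt_rec) (auto intro!: map_cong)
  also have "prod_list \<dots> = \<kappa> ^ (n - 1)" by (simp add: map_replicate_const prod_list_replicate)
  finally show ?thesis by simp
qed

section \<open>Pairs are determined by their forms\<close>

locale embedded_pair = R: embedded_ring 4 R \<sigma> + C: embedded_ring 3 C \<tau>
  for R :: "('a, 'm) ring_scheme" and \<sigma> :: "nat \<Rightarrow> 'a \<Rightarrow> complex"
    and C :: "('b, 'k) ring_scheme" and \<tau> :: "nat \<Rightarrow> 'b \<Rightarrow> complex" +
  fixes \<phi> :: "'a \<Rightarrow> 'b"
  assumes disc_eq: "ring_disc 3 C = ring_disc 4 R" and \<phi>_closed: "\<phi> \<in> carrier R \<rightarrow> carrier C"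
    and \<phi>_eq: "x \<in> carrier R \<Longrightarrow> j < 3 \<Longrightarrow> \<tau> j (\<phi> x) = resolv (\<lambda>i. \<sigma> i x) j"

lemma lessThan_numerals: "{0, 1, 2, 3 :: nat} = {..<4}" "{0, 1, 2 :: nat} = {..<3}"
  by auto

lemma quartic_pairsE:
  assumes "(R, C, \<phi>) \<in> quartic_pairs"
  obtains \<sigma> \<tau> where "embedded_pair R \<sigma> C \<tau> \<phi>"
proof -
  from assms have r: "rank_ring 4 R" "cubic_resolvent R C \<phi>" by (auto simp: quartic_pairs_def)
  then obtain \<sigma> \<tau> :: "nat \<Rightarrow> _" where st: "rank_ring 3 C" "ring_disc 3 C = ring_disc 4 R" "\<phi> \<in> carrier R \<rightarrow> carrier C"
    "bij_betw \<sigma> {..<4} (complex_homs R)" "bij_betw \<tau> {..<3} (complex_homs C)"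
    and f: "\<And>x. x \<in> carrier R \<Longrightarrow> \<tau> 0 (\<phi> x) = \<sigma> 0 x * \<sigma> 1 x + \<sigma> 2 x * \<sigma> 3 x \<and>
               \<tau> 1 (\<phi> x) = \<sigma> 0 x * \<sigma> 2 x + \<sigma> 1 x * \<sigma> 3 x \<and>
               \<tau> 2 (\<phi> x) = \<sigma> 0 x * \<sigma> 3 x + \<sigma> 1 x * \<sigma> 2 x"
    unfolding cubic_resolvent_def lessThan_numerals by blast
  have "embedded_pair R \<sigma> C \<tau> \<phi>"
    by unfold_locales (use r(1) st f in \<open>auto simp: less_3_cases resolv_def\<close>)
  then show ?thesis by (rule that)
qed

lemma (in embedded_pair) cubic_resolvent: "cubic_resolvent R C \<phi>"
  unfolding cubic_resolvent_def lessThan_numerals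
  using C.rank disc_eq \<phi>_closed R.enum C.enum \<phi>_eq
  by (auto simp: resolv_def intro!: exI[of _ \<sigma>] exI[of _ \<tau>])

lemma quartic_pairsI: "embedded_pair R \<sigma> C \<tau> \<phi> \<Longrightarrow> (R, C, \<phi>) \<in> quartic_pairs"
  using embedded_pair.cubic_resolvent embedded_ring.disc_nonzero embedded_ring.rank
  by (fastforce simp: quartic_pairs_def nondegenerate_def embedded_pair_def)

text \<open>Component \<open>j\<close> of \<open>resolv\<close> belongs to the pairing in which 0
  has the partner \<open>j + 1\<close>. If 0 is neither \<open>a\<close> nor \<open>b\<close>, its
  partner is \<open>6 - a - b\<close>, because all four labels add up to 6.\<close>

lemma resolv_partition:
  fixes a b c d :: nat
  assumes "a < 4" "b < 4" "c < 4" "d < 4" "a \<noteq> b" "a \<noteq> c" "a \<noteq> d" "b \<noteq> c" "b \<noteq> d" "c \<noteq> d"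
  shows "resolv v (if a = 0 then b - 1 else if b = 0 then a - 1 else 5 - a - b) = v a * v b + v c * v d"
proof -
  have "\<forall>a\<in>{0, 1, 2, 3}. \<forall>b\<in>{0, 1, 2, 3}. \<forall>c\<in>{0, 1, 2, 3 :: nat}. \<forall>d\<in>{0, 1, 2, 3 :: nat}.
    a \<noteq> b \<longrightarrow> a \<noteq> c \<longrightarrow> a \<noteq> d \<longrightarrow> b \<noteq> c \<longrightarrow> b \<noteq> d \<longrightarrow> c \<noteq> d \<longrightarrow>
    resolv v (if a = 0 then b - 1 else if b = 0 then a - 1 else 5 - a - b) = v a * v b + v c * v d"
    by (simp add: resolv_def mult.commute add.commute)
  then show ?thesis using assms unfolding lessThan_iff[symmetric] lessThan_numerals(1) by blast
qed

lemma partition_index: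
  fixes a b c :: nat
  assumes "a < 4" "b < 4" "c < 4" "a \<noteq> b" "a \<noteq> c" "b \<noteq> c"
  shows "(if a = 0 then b - 1 else if b = 0 then a - 1 else 5 - a - b) < 3"
    "(if a = 0 then b - 1 else if b = 0 then a - 1 else 5 - a - b)
      \<noteq> (if a = 0 then c - 1 else if c = 0 then a - 1 else 5 - a - c)"
proof -
  have "\<forall>a\<in>{0, 1, 2, 3}. \<forall>b\<in>{0, 1, 2, 3}. \<forall>c\<in>{0, 1, 2, 3 :: nat}. a \<noteq> b \<longrightarrow> a \<noteq> c \<longrightarrow> b \<noteq> c \<longrightarrow>
    (if a = 0 then b - 1 else if b = 0 then a - 1 else 5 - a - b) < 3 \<and>
    (if a = 0 then b - 1 else if b = 0 then a - 1 else 5 - a - b)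
      \<noteq> (if a = 0 then c - 1 else if c = 0 then a - 1 else 5 - a - c)"
    by simp
  then show "(if a = 0 then b - 1 else if b = 0 then a - 1 else 5 - a - b) < 3"
    "(if a = 0 then b - 1 else if b = 0 then a - 1 else 5 - a - b)
      \<noteq> (if a = 0 then c - 1 else if c = 0 then a - 1 else 5 - a - c)"
    using assms unfolding lessThan_iff[symmetric] lessThan_numerals(1) by blast+
qed

text \<open>This is the action of the permutations of four letters on the three ways to split them
  into two pairs.\<close>

lemma resolv_permute:
  assumes "bij_betw \<pi> {..<4} {..<4::nat}"
  obtains \<rho> where "bij_betw \<rho> {..<3} {..<3::nat}" "\<And>v j. j < 3 \<Longrightarrow> resolv (\<lambda>i. v (\<pi> i)) j = resolv v (\<rho> j)"
proof -
  have lt: "\<pi> 0 < 4" "\<pi> 1 < 4" "\<pi> 2 < 4" "\<pi> 3 < 4"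
    using bij_betwE[OF assms] by auto
  have inj: "inj_on \<pi> {..<4}" using assms by (simp add: bij_betw_def)
  have ne: "\<pi> 0 \<noteq> \<pi> 1" "\<pi> 0 \<noteq> \<pi> 2" "\<pi> 0 \<noteq> \<pi> 3" "\<pi> 1 \<noteq> \<pi> 2" "\<pi> 1 \<noteq> \<pi> 3" "\<pi> 2 \<noteq> \<pi> 3"
    by (simp_all add: inj_on_eq_iff[OF inj])
  let ?idx = "\<lambda>a b::nat. if a = 0 then b - 1 else if b = 0 then a - 1 else 5 - a - b"
  define \<rho> where "\<rho> j = ?idx (\<pi> 0) (\<pi> (Suc j))" for j
  have \<rho>: "\<rho> 0 = ?idx (\<pi> 0) (\<pi> 1)" "\<rho> 1 = ?idx (\<pi> 0) (\<pi> 2)" "\<rho> 2 = ?idx (\<pi> 0) (\<pi> 3)"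
    by (simp_all add: \<rho>_def numeral_2_eq_2 numeral_3_eq_3)
  have r3: "\<rho> 0 < 3 \<and> \<rho> 1 < 3 \<and> \<rho> 2 < 3 \<and> \<rho> 0 \<noteq> \<rho> 1 \<and> \<rho> 0 \<noteq> \<rho> 2 \<and> \<rho> 1 \<noteq> \<rho> 2"
    unfolding \<rho> by (intro conjI partition_index[of "\<pi> 0" "\<pi> 1" "\<pi> 2"] partition_index[of "\<pi> 0" "\<pi> 1" "\<pi> 3"]
      partition_index[of "\<pi> 0" "\<pi> 2" "\<pi> 3"] partition_index(1)[of "\<pi> 0" "\<pi> 3" "\<pi> 1"] lt ne ne[symmetric])
  have "inj_on \<rho> {..<3}" using r3 by (auto simp: inj_on_def less_3_cases)
  moreover have "\<rho> ` {..<3} \<subseteq> {..<3}" using r3 by (auto simp: less_3_cases)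
  ultimately have bij: "bij_betw \<rho> {..<3} {..<3}"
    by (simp add: bij_betw_def card_image card_subset_eq)
  have part: "resolv v (\<rho> 0) = v (\<pi> 0) * v (\<pi> 1) + v (\<pi> 2) * v (\<pi> 3)"
     "resolv v (\<rho> 1) = v (\<pi> 0) * v (\<pi> 2) + v (\<pi> 1) * v (\<pi> 3)"
     "resolv v (\<rho> 2) = v (\<pi> 0) * v (\<pi> 3) + v (\<pi> 1) * v (\<pi> 2)" for v
    unfolding \<rho> by (intro resolv_partition lt ne ne[symmetric])+
  have "resolv (\<lambda>i. v (\<pi> i)) j = resolv v (\<rho> j)" if "j < 3" for v j
    using that unfolding less_3_cases by (elim disjE) (simp_all only: part, simp_all add: resolv_def)
  with bij show ?thesis by (rule that)
qed

lemma (in embedded_pair) relabel: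
  assumes \<pi>: "bij_betw \<pi> {..<4} {..<4::nat}"
  obtains \<rho> where "bij_betw \<rho> {..<3} {..<3::nat}" "embedded_pair R (\<lambda>i. \<sigma> (\<pi> i)) C (\<lambda>j. \<tau> (\<rho> j)) \<phi>"
proof -
  obtain \<rho> where \<rho>: "bij_betw \<rho> {..<3} {..<3::nat}" "\<And>v j. j < 3 \<Longrightarrow> resolv (\<lambda>i. v (\<pi> i)) j = resolv v (\<rho> j)"
    using resolv_permute[OF \<pi>] by blast
  have "\<rho> j < 3" if "j < 3" for j using bij_betwE[OF \<rho>(1)] that by auto
  then have "embedded_pair R (\<lambda>i. \<sigma> (\<pi> i)) C (\<lambda>j. \<tau> (\<rho> j)) \<phi>"
    using bij_betw_trans[OF \<pi> R.enum] bij_betw_trans[OF \<rho>(1) C.enum] \<phi>_closed disc_eq R.rank C.rank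
    by unfold_locales (simp_all add: comp_def \<phi>_eq \<rho>(2)[symmetric])
  with \<rho>(1) show ?thesis by (rule that)
qed

text \<open>The coefficients of the quadratic form which is the \<open>m\<close>-th coordinate of \<open>\<phi>\<close> modulo
  constants, read off at the points \<open>\<alpha> k\<close> and \<open>\<alpha> k + \<alpha> l\<close>.\<close>

definition form_coeff ::
  "('a, 'm) ring_scheme \<Rightarrow> ('b, 'k) ring_scheme \<Rightarrow> ('a \<Rightarrow> 'b) \<Rightarrow> (nat \<Rightarrow> 'a) \<Rightarrow> (nat \<Rightarrow> 'b) \<Rightarrow> nat \<Rightarrow> nat \<Rightarrow> nat \<Rightarrow> int" where
  "form_coeff R C \<phi> \<alpha> \<omega> m k l = (if k = l then coord C 3 \<omega> (\<phi> (\<alpha> k)) m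
     else coord C 3 \<omega> (\<phi> (\<alpha> k \<oplus>\<^bsub>R\<^esub> \<alpha> l)) m - coord C 3 \<omega> (\<phi> (\<alpha> k)) m - coord C 3 \<omega> (\<phi> (\<alpha> l)) m)"

text \<open>The form is evaluated at complex points to reach the common zeros of the pencil. The
  coordinate \<open>v 0\<close> is absent because the form lives on \<open>R\<close> modulo the
  integers.\<close>

definition qform :: "(nat \<Rightarrow> nat \<Rightarrow> int) \<Rightarrow> (nat \<Rightarrow> complex) \<Rightarrow> complex" where
  "qform a v = of_int (a 1 1) * (v 1)\<^sup>2 + of_int (a 2 2) * (v 2)\<^sup>2 + of_int (a 3 3) * (v 3)\<^sup>2
     + of_int (a 1 2) * v 1 * v 2 + of_int (a 1 3) * v 1 * v 3 + of_int (a 2 3) * v 2 * v 3"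

text \<open>All terms with \<open>v0\<close> are independent of \<open>j\<close>: they are the
  constants divided out in the passage to forms. The rest is polarization of a quadratic
  map.\<close>

lemma resolv_expand:
  "resolv (\<lambda>i. v0 + v1 * a i + v2 * b i + v3 * c i) j = 2 * v0\<^sup>2
     + v0 * (v1 * (a 0 + a 1 + a 2 + a 3) + v2 * (b 0 + b 1 + b 2 + b 3) + v3 * (c 0 + c 1 + c 2 + c 3))
     + v1\<^sup>2 * resolv a j + v2\<^sup>2 * resolv b j + v3\<^sup>2 * resolv c j
     + v1 * v2 * (resolv (\<lambda>i. a i + b i) j - resolv a j - resolv b j)
     + v1 * v3 * (resolv (\<lambda>i. a i + c i) j - resolv a j - resolv c j)
     + v2 * v3 * (resolv (\<lambda>i. b i + c i) j - resolv b j - resolv c j)"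
  unfolding resolv_def by (simp add: algebra_simps power2_eq_square)

lemma sum_lessThan_4: "(\<Sum>k<4. f k) = f 0 + f 1 + f 2 + f (3::nat)"
  by (simp add: eval_nat_numeral)

lemma sum_lessThan_3: "(\<Sum>k<3. f k) = f 0 + f 1 + f (2::nat)"
  by (simp add: eval_nat_numeral)

definition unital_basis :: "nat \<Rightarrow> ('a, 'm) ring_scheme \<Rightarrow> (nat \<Rightarrow> 'a) \<Rightarrow> bool" where
  "unital_basis n R b \<longleftrightarrow> int_basis R n b \<and> b 0 = \<one>\<^bsub>R\<^esub>"

text \<open>Since \<open>q\<close> does not depend on \<open>j\<close>, the two forms are the
  coordinates of the resolvent map modulo constants. The point is that this persists for complex
  coordinates.\<close>

lemma (in embedded_pair) resolv_qform:
  assumes \<alpha>: "unital_basis 4 R \<alpha>" and \<omega>: "unital_basis 3 C \<omega>"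
  obtains q where "\<And>j. j < 3 \<Longrightarrow> resolv (val (\<lambda>i k. \<sigma> i (\<alpha> k)) v) j = q
     + qform (form_coeff R C \<phi> \<alpha> \<omega> 1) v * \<tau> j (\<omega> 1) + qform (form_coeff R C \<phi> \<alpha> \<omega> 2) v * \<tau> j (\<omega> 2)"
proof -
  let ?K = "\<lambda>x. of_int (coord C 3 \<omega> (\<phi> x) 0)"
  have \<alpha>c: "\<alpha> 1 \<in> carrier R" "\<alpha> 2 \<in> carrier R" "\<alpha> 3 \<in> carrier R"
    using R.basis_closed[of \<alpha>] \<alpha> by (auto simp: unital_basis_def Pi_def)
  have e: "resolv (\<lambda>i. \<sigma> i x) j = ?K x + of_int (coord C 3 \<omega> (\<phi> x) 1) * \<tau> j (\<omega> 1)
      + of_int (coord C 3 \<omega> (\<phi> x) 2) * \<tau> j (\<omega> 2)" if "x \<in> carrier R" "j < 3" for x j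
    using C.emb_coord[of \<omega> "\<phi> x" j] that \<omega> \<phi>_closed \<phi>_eq[OF that] C.emb_one[OF that(2)]
    by (simp add: unital_basis_def sum_lessThan_3 Pi_def)
  have ep: "resolv (\<lambda>i. \<sigma> i x + \<sigma> i y) j = ?K (x \<oplus>\<^bsub>R\<^esub> y) + of_int (coord C 3 \<omega> (\<phi> (x \<oplus>\<^bsub>R\<^esub> y)) 1) * \<tau> j (\<omega> 1)
      + of_int (coord C 3 \<omega> (\<phi> (x \<oplus>\<^bsub>R\<^esub> y)) 2) * \<tau> j (\<omega> 2)" if "x \<in> carrier R" "y \<in> carrier R" "j < 3" for x y j
    using e[of "x \<oplus>\<^bsub>R\<^esub> y" j] that
    by (subst resolv_cong[of _ "\<lambda>i. \<sigma> i (x \<oplus>\<^bsub>R\<^esub> y)"]) (simp_all add: R.emb_add)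
  have v: "resolv (val (\<lambda>i k. \<sigma> i (\<alpha> k)) v) j
      = resolv (\<lambda>i. v 0 + v 1 * \<sigma> i (\<alpha> 1) + v 2 * \<sigma> i (\<alpha> 2) + v 3 * \<sigma> i (\<alpha> 3)) j" for j
    using \<alpha> R.emb_one by (intro resolv_cong) (simp add: val_def sum_lessThan_4 unital_basis_def)
  let ?tr = "\<lambda>k. \<sigma> 0 (\<alpha> k) + \<sigma> 1 (\<alpha> k) + \<sigma> 2 (\<alpha> k) + \<sigma> 3 (\<alpha> k)"
  let ?P = "\<lambda>k l. ?K (\<alpha> k \<oplus>\<^bsub>R\<^esub> \<alpha> l) - ?K (\<alpha> k) - ?K (\<alpha> l)"
  show ?thesis
    by (rule that[of "2 * (v 0)\<^sup>2 + v 0 * (v 1 * ?tr 1 + v 2 * ?tr 2 + v 3 * ?tr 3)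
        + (v 1)\<^sup>2 * ?K (\<alpha> 1) + (v 2)\<^sup>2 * ?K (\<alpha> 2) + (v 3)\<^sup>2 * ?K (\<alpha> 3)
        + v 1 * v 2 * ?P 1 2 + v 1 * v 3 * ?P 1 3 + v 2 * v 3 * ?P 2 3"], unfold v resolv_expand)
      (simp add: e ep \<alpha>c qform_def form_coeff_def algebra_simps del: One_nat_def)
qed

lemma resolv_affine:
  assumes "\<And>i. i < 4 \<Longrightarrow> w i = \<kappa> * v i + l"
  shows "resolv w j = \<kappa>\<^sup>2 * resolv v j + (2 * l\<^sup>2 + \<kappa> * l * (v 0 + v 1 + v 2 + v 3))"
proof -
  have "w 0 = \<kappa> * v 0 + l" "w 1 = \<kappa> * v 1 + l" "w 2 = \<kappa> * v 2 + l" "w 3 = \<kappa> * v 3 + l"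
    using assms by auto
  then show ?thesis by (simp add: resolv_def algebra_simps power2_eq_square)
qed

lemma (in embedded_ring) det_val: "int_basis R n b \<Longrightarrow> det (mat n n (\<lambda>(i, k). \<sigma> i (b k))) \<noteq> 0"
  using det_emb_nonzero by (simp add: emb_def)

lemma (in embedded_pair) pencil_zero:
  assumes \<omega>: "unital_basis 3 C \<omega>"
    and eq: "\<And>j. j < 3 \<Longrightarrow> q + a * \<tau> j (\<omega> 1) + b * \<tau> j (\<omega> 2) = 0"
  shows "a = 0" "b = 0"
proof -
  let ?c = "\<lambda>k::nat. if k = 0 then q else if k = 1 then a else b"
  have "(\<Sum>k<3. ?c k * \<tau> j (\<omega> k)) = 0" if "j < 3" for j
    using eq[OF that] \<omega> C.emb_one[OF that] by (simp add: sum_lessThan_3 unital_basis_def)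
  from det_nonzero_kernel[OF C.det_val this] \<omega>
  have "?c k = 0" if "k < 3" for k using that unfolding unital_basis_def by blast
  from this[of 1] this[of 2] show "a = 0" "b = 0" by auto
qed

lemma (in embedded_ring) solve_val:
  assumes "int_basis R n b"
  obtains c where "\<And>i. i < n \<Longrightarrow> (\<Sum>k<n. c k * \<sigma> i (b k)) = t i"
proof -
  obtain F where F: "F \<in> carrier_mat n n" "emb b * F = 1\<^sub>m n"
    using det_nonzero_solve[OF emb_carrier det_emb_nonzero[OF assms]] by blast
  have "(\<Sum>k<n. (\<Sum>l<n. F $$ (k, l) * t l) * \<sigma> i (b k)) = t i" if i: "i < n" for i
  proof -
    have "(\<Sum>k<n. (\<Sum>l<n. F $$ (k, l) * t l) * \<sigma> i (b k)) = (\<Sum>k<n. \<Sum>l<n. t l * (\<sigma> i (b k) * F $$ (k, l)))"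
      by (simp add: sum_distrib_right sum_distrib_left mult_ac)
    also have "\<dots> = (\<Sum>l<n. t l * (\<Sum>k<n. \<sigma> i (b k) * F $$ (k, l)))"
      by (subst sum.swap) (simp add: sum_distrib_left)
    also have "\<dots> = (\<Sum>l<n. t l * (if i = l then 1 else 0))"
    proof (intro sum.cong refl)
      fix l assume l: "l \<in> {..<n}"
      have "(\<Sum>k<n. \<sigma> i (b k) * F $$ (k, l)) = (emb b * F) $$ (i, l)"
        using mat_mult_entry[OF emb_carrier F(1) i, of l b] l i by (simp add: emb_def)
      then show "t l * (\<Sum>k<n. \<sigma> i (b k) * F $$ (k, l)) = t l * (if i = l then 1 else 0)"
        using F(2) i l by simp
    qed
    also have "\<dots> = t i" using i by (simp add: if_distrib cong: if_cong)
    finally show ?thesis .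
  qed
  then show ?thesis by (rule that)
qed

text \<open>Pairs with the same forms are, up to relabelling, affinely equivalent: the common zeros of the
  pencil determine \<open>\<sigma>\<close> up to an affine map, the pencil then determines \<open>\<tau>\<close>, and comparing the two
  discriminants, which scale by \<open>\<kappa>\<^sup>6\<close> and \<open>\<kappa>\<^sup>8\<close>, gives \<open>\<kappa>\<^sup>2 = 1\<close>.\<close>

theorem same_forms_rigid:
  assumes P: "embedded_pair R \<sigma> C \<tau> \<phi>" and P': "embedded_pair R' \<sigma>' C' \<tau>' \<phi>'"
    and \<alpha>: "unital_basis 4 R \<alpha>" and \<omega>: "unital_basis 3 C \<omega>"
    and \<alpha>': "unital_basis 4 R' \<alpha>'" and \<omega>': "unital_basis 3 C' \<omega>'"
    and forms: "\<And>m k l. m \<in> {1, 2} \<Longrightarrow> 1 \<le> k \<Longrightarrow> k \<le> l \<Longrightarrow> l \<le> 3 \<Longrightarrow>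
        form_coeff R C \<phi> \<alpha> \<omega> m k l = form_coeff R' C' \<phi>' \<alpha>' \<omega>' m k l"
  obtains \<pi> \<rho> \<kappa> c d where "bij_betw \<pi> {..<4} {..<4::nat}" "bij_betw \<rho> {..<3} {..<3::nat}"
    "embedded_pair R' (\<lambda>i. \<sigma>' (\<pi> i)) C' (\<lambda>j. \<tau>' (\<rho> j)) \<phi>'"
    "\<kappa> = 1 \<or> \<kappa> = (-1 :: int)"
    "\<And>i k. i < 4 \<Longrightarrow> k < 4 \<Longrightarrow> \<sigma>' (\<pi> i) (\<alpha>' k) = of_int \<kappa> * \<sigma> i (\<alpha> k) + of_int (c k)"
    "\<And>j k. j < 3 \<Longrightarrow> k < 3 \<Longrightarrow> \<tau>' (\<rho> j) (\<omega>' k) = \<tau> j (\<omega> k) + of_int (d k)"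
proof -
  interpret P: embedded_pair R \<sigma> C \<tau> \<phi> by (rule P)
  interpret P': embedded_pair R' \<sigma>' C' \<tau>' \<phi>' by (rule P')
  let ?S = "\<lambda>i k. \<sigma> i (\<alpha> k)" and ?S' = "\<lambda>i k. \<sigma>' i (\<alpha>' k)"
  let ?A = "qform (form_coeff R C \<phi> \<alpha> \<omega> 1)" and ?B = "qform (form_coeff R C \<phi> \<alpha> \<omega> 2)"
  have A': "qform (form_coeff R' C' \<phi>' \<alpha>' \<omega>' 1) = ?A" "qform (form_coeff R' C' \<phi>' \<alpha>' \<omega>' 2) = ?B"
    by (auto simp: qform_def fun_eq_iff forms)
  have b: "int_basis R 4 \<alpha>" "int_basis R' 4 \<alpha>'" "int_basis C 3 \<omega>" "int_basis C' 3 \<omega>'"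
    using \<alpha> \<alpha>' \<omega> \<omega>' by (auto simp: unital_basis_def)
  have special: "\<forall>j<3. resolv (val ?S' v) j = resolv (val ?S' v) 0"
    if sp: "\<forall>j<3. resolv (val ?S v) j = resolv (val ?S v) 0" for v
  proof -
    obtain q where q: "\<And>j. j < 3 \<Longrightarrow> resolv (val ?S v) j = q + ?A v * \<tau> j (\<omega> 1) + ?B v * \<tau> j (\<omega> 2)"
      using P.resolv_qform[OF \<alpha> \<omega>, of v] by blast
    have "(q - resolv (val ?S v) 0) + ?A v * \<tau> j (\<omega> 1) + ?B v * \<tau> j (\<omega> 2) = 0" if "j < 3" for j
      using q[OF that] sp[rule_format, OF that] by (simp add: algebra_simps)
    from P.pencil_zero[OF \<omega> this] have z: "?A v = 0" "?B v = 0" by blast+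
    obtain q' where q': "\<And>j. j < 3 \<Longrightarrow> resolv (val ?S' v) j = q' + ?A v * \<tau>' j (\<omega>' 1) + ?B v * \<tau>' j (\<omega>' 2)"
      using P'.resolv_qform[OF \<alpha>' \<omega>', of v] unfolding A' by blast
    then have r: "resolv (val ?S' v) j = q'" if "j < 3" for j using that z by simp
    show ?thesis
    proof (intro allI impI)
      fix j :: nat assume "j < 3"
      then show "resolv (val ?S' v) j = resolv (val ?S' v) 0" using r[of j] r[of 0] by simp
    qed
  qed
  obtain \<pi> \<kappa> \<delta> where \<pi>: "bij_betw \<pi> {..<4} {..<4}" and \<kappa>0: "\<kappa> \<noteq> 0" and
    aff: "\<And>i k. i < 4 \<Longrightarrow> k < 4 \<Longrightarrow> \<sigma>' (\<pi> i) (\<alpha>' k) = \<kappa> * \<sigma> i (\<alpha> k) + \<delta> k"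
  proof (rule rigid_linear[of ?S ?S'])
    show "det (mat 4 4 (\<lambda>(i, k). ?S i k)) \<noteq> 0" by (rule P.R.det_val[OF b(1)])
    show "det (mat 4 4 (\<lambda>(i, k). ?S' i k)) \<noteq> 0" by (rule P'.R.det_val[OF b(2)])
    show "\<sigma> i (\<alpha> 0) = 1" "\<sigma>' i (\<alpha>' 0) = 1" if "i < 4" for i
      using \<alpha> \<alpha>' P.R.emb_one[OF that] P'.R.emb_one[OF that] by (auto simp: unital_basis_def)
    show "\<forall>j<3. resolv (val ?S' v) j = resolv (val ?S' v) 0"
      if "\<forall>j<3. resolv (val ?S v) j = resolv (val ?S v) 0" for v using special[OF that] .
  qed blast
  obtain \<rho> where \<rho>: "bij_betw \<rho> {..<3} {..<3::nat}"
    and Q: "embedded_pair R' (\<lambda>i. \<sigma>' (\<pi> i)) C' (\<lambda>j. \<tau>' (\<rho> j)) \<phi>'"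
    using P'.relabel[OF \<pi>] by blast
  define s t where "s i = \<sigma>' (\<pi> i)" and "t j = \<tau>' (\<rho> j)" for i j
  have Q: "embedded_pair R' s C' t \<phi>'" using Q by (simp add: s_def[abs_def] t_def[abs_def])
  interpret Q: embedded_pair R' s C' t \<phi>' by (rule Q)
  have aff: "s i (\<alpha>' k) = \<kappa> * \<sigma> i (\<alpha> k) + \<delta> k" if "i < 4" "k < 4" for i k
    using aff that by (simp add: s_def)
  let ?T = "\<lambda>i k. s i (\<alpha>' k)"
  have val_aff: "val ?T v i = \<kappa> * val ?S v i + (\<Sum>k<4. v k * \<delta> k)" if "i < 4" for v i
    using that by (simp add: val_def aff distrib_left sum.distrib sum_distrib_left mult_ac)
  have lin: "\<exists>e. \<forall>j<3. ?A v * (t j (\<omega>' 1) - \<kappa>\<^sup>2 * \<tau> j (\<omega> 1)) + ?B v * (t j (\<omega>' 2) - \<kappa>\<^sup>2 * \<tau> j (\<omega> 2)) = e" for v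
  proof -
    obtain q where q: "\<And>j. j < 3 \<Longrightarrow> resolv (val ?S v) j = q + ?A v * \<tau> j (\<omega> 1) + ?B v * \<tau> j (\<omega> 2)"
      using P.resolv_qform[OF \<alpha> \<omega>, of v] by blast
    obtain q' where q': "\<And>j. j < 3 \<Longrightarrow> resolv (val ?T v) j = q' + ?A v * t j (\<omega>' 1) + ?B v * t j (\<omega>' 2)"
      using Q.resolv_qform[OF \<alpha>' \<omega>', of v] unfolding A' by blast
    define l where "l = (\<Sum>k<4. v k * \<delta> k)"
    have "resolv (val ?T v) j = \<kappa>\<^sup>2 * resolv (val ?S v) j
        + (2 * l\<^sup>2 + \<kappa> * l * (val ?S v 0 + val ?S v 1 + val ?S v 2 + val ?S v 3))" for j
      by (rule resolv_affine) (simp add: val_aff l_def)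
    then show ?thesis
      by (intro exI[of _ "\<kappa>\<^sup>2 * q + (2 * l\<^sup>2 + \<kappa> * l * (val ?S v 0 + val ?S v 1 + val ?S v 2 + val ?S v 3)) - q'"])
        (use q q' in \<open>simp add: algebra_simps\<close>)
  qed
  \<comment> \<open>The sums of the idempotents 0, 1 and 0, 2 have the resolvent vectors (1, 0, 0)
    and (0, 1, 0). Hence the pairs of values of the two forms at \<open>v1\<close> and
    \<open>v2\<close> are linearly independent, and the relations \<open>lin\<close> at these points
    can be solved for the new cubic basis.\<close>
  obtain v1 where v1: "\<And>i. i < 4 \<Longrightarrow> val ?S v1 i = (if i < 2 then 1 else 0)"
    using P.R.solve_val[OF b(1), of "\<lambda>i. if i < 2 then 1 else 0"] unfolding val_def by blast
  obtain v2 where v2: "\<And>i. i < 4 \<Longrightarrow> val ?S v2 i = (if i = 0 \<or> i = 2 then 1 else 0)"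
    using P.R.solve_val[OF b(1), of "\<lambda>i. if i = 0 \<or> i = 2 then 1 else 0"] unfolding val_def by blast
  have r1: "resolv (val ?S v1) j = (if j = 0 then 1 else 0)" and r2: "resolv (val ?S v2) j = (if j = 1 then 1 else 0)"
    for j by (simp_all add: resolv_def v1 v2)
  obtain q1 where q1: "\<And>j. j < 3 \<Longrightarrow> resolv (val ?S v1) j = q1 + ?A v1 * \<tau> j (\<omega> 1) + ?B v1 * \<tau> j (\<omega> 2)"
    using P.resolv_qform[OF \<alpha> \<omega>, of v1] by blast
  obtain q2 where q2: "\<And>j. j < 3 \<Longrightarrow> resolv (val ?S v2) j = q2 + ?A v2 * \<tau> j (\<omega> 1) + ?B v2 * \<tau> j (\<omega> 2)"
    using P.resolv_qform[OF \<alpha> \<omega>, of v2] by blast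
  define D where "D = ?A v1 * ?B v2 - ?A v2 * ?B v1"
  have comb: "x * (if j = 0 then 1 else 0) + y * (if j = 1 then 1 else 0) = (x * q1 + y * q2)
      + (x * ?A v1 + y * ?A v2) * \<tau> j (\<omega> 1) + (x * ?B v1 + y * ?B v2) * \<tau> j (\<omega> 2)" if "j < 3" for x y j
    using q1[OF that] q2[OF that] unfolding r1 r2 by (simp add: algebra_simps)
  have nontriv: "x = 0 \<and> y = 0" if "x * ?A v1 + y * ?A v2 = 0" "x * ?B v1 + y * ?B v2 = 0" for x y
    using comb[of 0 x y] comb[of 1 x y] comb[of 2 x y] that by simp
  have D: "D \<noteq> 0"
  proof
    assume "D = 0"
    then have "?A v2 = 0 \<and> - ?A v1 = 0" "?B v2 = 0 \<and> - ?B v1 = 0"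
      using nontriv[of "?A v2" "- ?A v1"] nontriv[of "?B v2" "- ?B v1"] by (simp_all add: D_def algebra_simps)
    then show False using nontriv[of 1 0] by simp
  qed
  obtain e1 where e1: "\<And>j. j < 3 \<Longrightarrow> ?A v1 * (t j (\<omega>' 1) - \<kappa>\<^sup>2 * \<tau> j (\<omega> 1)) + ?B v1 * (t j (\<omega>' 2) - \<kappa>\<^sup>2 * \<tau> j (\<omega> 2)) = e1"
    using lin[of v1] by blast
  obtain e2 where e2: "\<And>j. j < 3 \<Longrightarrow> ?A v2 * (t j (\<omega>' 1) - \<kappa>\<^sup>2 * \<tau> j (\<omega> 1)) + ?B v2 * (t j (\<omega>' 2) - \<kappa>\<^sup>2 * \<tau> j (\<omega> 2)) = e2"
    using lin[of v2] by blast
  \<comment> \<open>The first two cases solve the equations by Cramer's rule with determinant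
    \<open>D\<close>. The last one makes the affine relation hold for \<open>\<omega> 0\<close>,
    where both sides must be 1.\<close>
  define \<eta> where "\<eta> k = (if k = 1 then (?B v2 * e1 - ?B v1 * e2) / D else if k = 2 then (?A v1 * e2 - ?A v2 * e1) / D else 1 - \<kappa>\<^sup>2)" for k :: nat
  have \<tau>aff: "t j (\<omega>' k) = \<kappa>\<^sup>2 * \<tau> j (\<omega> k) + \<eta> k" if "j < 3" "k < 3" for j k
  proof -
    have "D * (t j (\<omega>' 1) - \<kappa>\<^sup>2 * \<tau> j (\<omega> 1)) = ?B v2 * e1 - ?B v1 * e2"
      unfolding e1[OF that(1), symmetric] e2[OF that(1), symmetric] D_def by (simp add: algebra_simps)
    then have 1: "t j (\<omega>' 1) = \<kappa>\<^sup>2 * \<tau> j (\<omega> 1) + \<eta> 1" using D by (simp add: \<eta>_def field_simps)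
    have "D * (t j (\<omega>' 2) - \<kappa>\<^sup>2 * \<tau> j (\<omega> 2)) = ?A v1 * e2 - ?A v2 * e1"
      unfolding e1[OF that(1), symmetric] e2[OF that(1), symmetric] D_def by (simp add: algebra_simps)
    then have 2: "t j (\<omega>' 2) = \<kappa>\<^sup>2 * \<tau> j (\<omega> 2) + \<eta> 2" using D by (simp add: \<eta>_def field_simps)
    have 0: "t j (\<omega>' 0) = \<kappa>\<^sup>2 * \<tau> j (\<omega> 0) + \<eta> 0"
      using \<omega> \<omega>' P.C.emb_one[OF that(1)] Q.C.emb_one[OF that(1)] by (simp add: unital_basis_def \<eta>_def)
    show ?thesis using that(2) 0 1 2 unfolding less_3_cases by blast
  qed
  have one: "\<sigma> i (\<alpha> 0) = 1" "s i (\<alpha>' 0) = 1" if "i < 4" for i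
    using \<alpha> \<alpha>' P.R.emb_one[OF that] Q.R.emb_one[OF that] by (auto simp: unital_basis_def)
  have one3: "\<tau> j (\<omega> 0) = 1" "t j (\<omega>' 0) = 1" if "j < 3" for j
    using \<omega> \<omega>' P.C.emb_one[OF that] Q.C.emb_one[OF that] by (auto simp: unital_basis_def)
  have "det (Q.R.emb \<alpha>') = \<kappa> ^ 3 * det (P.R.emb \<alpha>)"
    using det_affine[of 4 ?S ?T \<kappa> \<delta>] one aff by (simp add: P.R.emb_def Q.R.emb_def)
  then have "complex_of_int (ring_disc 4 R') = \<kappa> ^ 6 * of_int (ring_disc 4 R)"
    using P.R.ring_disc_eq[OF b(1)] Q.R.ring_disc_eq[OF b(2)] by (simp add: power_mult_distrib flip: power_mult)
  moreover have "det (Q.C.emb \<omega>') = (\<kappa>\<^sup>2) ^ 2 * det (P.C.emb \<omega>)"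
    using det_affine[of 3 "\<lambda>j k. \<tau> j (\<omega> k)" "\<lambda>j k. t j (\<omega>' k)" "\<kappa>\<^sup>2" \<eta>] one3 \<tau>aff
    by (simp add: P.C.emb_def Q.C.emb_def)
  then have "complex_of_int (ring_disc 3 C') = \<kappa> ^ 8 * of_int (ring_disc 3 C)"
    using P.C.ring_disc_eq[OF b(3)] Q.C.ring_disc_eq[OF b(4)] by (simp add: power_mult_distrib flip: power_mult)
  ultimately have "\<kappa> ^ 8 = \<kappa> ^ 6"
    using P.disc_eq Q.disc_eq P.R.disc_nonzero by simp
  then have "\<kappa> ^ 6 * (\<kappa>\<^sup>2 - 1) = 0" by (simp add: algebra_simps flip: power_add)
  then have "\<kappa>\<^sup>2 = 1" using \<kappa>0 by simp
  then have \<kappa>1: "\<kappa> = 1 \<or> \<kappa> = -1" by (simp add: power2_eq_1_iff)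
  have closed: "\<alpha> k \<in> carrier R" "\<alpha>' k \<in> carrier R'" if "k < 4" for k
    using P.R.basis_closed[OF b(1)] Q.R.basis_closed[OF b(2)] that by auto
  have closed3: "\<omega> k \<in> carrier C" "\<omega>' k \<in> carrier C'" if "k < 3" for k
    using P.C.basis_closed[OF b(3)] Q.C.basis_closed[OF b(4)] that by auto
  have "\<forall>k\<in>{..<4}. \<exists>c :: int. \<delta> k = of_int c"
  proof
    fix k :: nat assume "k \<in> {..<4}"
    then have "\<delta> k \<in> \<int>"
      using translation_integral[OF P.R.embedded_ring_axioms Q.R.embedded_ring_axioms _ closed \<kappa>1, of k k "\<delta> k"] aff
      by simp
    then show "\<exists>c :: int. \<delta> k = of_int c" by (auto elim: Ints_cases)
  qed
  then obtain c :: "nat \<Rightarrow> int" where c: "\<And>k. k < 4 \<Longrightarrow> \<delta> k = of_int (c k)" by (metis lessThan_iff)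
  have "\<forall>k\<in>{..<3}. \<exists>c :: int. \<eta> k = of_int c"
  proof
    fix k :: nat assume k: "k \<in> {..<3}"
    then have "\<eta> k \<in> \<int>"
      using translation_integral[OF P.C.embedded_ring_axioms Q.C.embedded_ring_axioms _ closed3, of k k 1 "\<eta> k"] \<tau>aff \<open>\<kappa>\<^sup>2 = 1\<close>
      by simp
    then show "\<exists>c :: int. \<eta> k = of_int c" by (auto elim: Ints_cases)
  qed
  then obtain d :: "nat \<Rightarrow> int" where d: "\<And>k. k < 3 \<Longrightarrow> \<eta> k = of_int (d k)" by (metis lessThan_iff)
  show ?thesis
  proof (rule that[OF \<pi> \<rho>, of "if \<kappa> = 1 then 1 else -1" c d])
    show "embedded_pair R' (\<lambda>i. \<sigma>' (\<pi> i)) C' (\<lambda>j. \<tau>' (\<rho> j)) \<phi>'"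
      using Q by (simp add: s_def[abs_def] t_def[abs_def])
    show "\<sigma>' (\<pi> i) (\<alpha>' k) = of_int (if \<kappa> = 1 then 1 else -1) * \<sigma> i (\<alpha> k) + of_int (c k)" if "i < 4" "k < 4" for i k
      using aff[OF that] \<kappa>1 c that by (auto simp: s_def)
    show "\<tau>' (\<rho> j) (\<omega>' k) = \<tau> j (\<omega> k) + of_int (d k)" if "j < 3" "k < 3" for j k
      using \<tau>aff[OF that] \<open>\<kappa>\<^sup>2 = 1\<close> d that by (auto simp: t_def)
  qed auto
qed

section \<open>From affine equivalence to isomorphic pairs\<close>

lemma lattice_affine:
  fixes \<kappa> :: int and c :: "nat \<Rightarrow> int"
  assumes R: "embedded_ring n R \<sigma>" and R': "embedded_ring n R' s"
    and \<alpha>: "int_basis R n \<alpha>" and \<alpha>': "\<alpha>' \<in> {..<n} \<rightarrow> carrier R'" and \<kappa>: "\<kappa> * \<kappa> = 1"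
    and aff: "\<And>i k. i < n \<Longrightarrow> k < n \<Longrightarrow> s i (\<alpha>' k) = of_int \<kappa> * \<sigma> i (\<alpha> k) + of_int (c k)"
    and x: "x \<in> carrier R"
  shows "\<exists>y\<in>carrier R'. \<forall>i<n. s i y = \<sigma> i x"
proof -
  interpret R: embedded_ring n R \<sigma> by (rule R)
  interpret R': embedded_ring n R' s by (rule R')
  obtain m where m: "\<And>i. i < n \<Longrightarrow> \<sigma> i x = (\<Sum>k<n. of_int (m k) * \<sigma> i (\<alpha> k))"
    using R.basis_coords[OF \<alpha> x] by blast
  \<comment> \<open>This inverts the affine map: as \<kappa> is its own inverse, multiplying the
    coordinates by \<kappa> restores \<open>x\<close> up to an integer, which is subtracted as a
    multiple of 1.\<close>
  let ?y = "int_comb R' n \<alpha>' (\<lambda>k. \<kappa> * m k) \<oplus>\<^bsub>R'\<^esub> [(- (\<kappa> * (\<Sum>k<n. m k * c k)))] \<cdot>\<^bsub>R'\<^esub> \<one>\<^bsub>R'\<^esub>"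
  have cl: "int_comb R' n \<alpha>' (\<lambda>k. \<kappa> * m k) \<in> carrier R'" by (rule R'.closed_int_comb[OF \<alpha>'])
  have "s i ?y = \<sigma> i x" if i: "i < n" for i
  proof -
    have "s i ?y = (\<Sum>k<n. of_int (\<kappa> * m k) * s i (\<alpha>' k)) - of_int (\<kappa> * (\<Sum>k<n. m k * c k))"
      using i cl by (simp add: R'.emb_add R'.emb_int_mult R'.emb_one R'.emb_int_comb[OF i \<alpha>'])
    also have "(\<Sum>k<n. of_int (\<kappa> * m k) * s i (\<alpha>' k))
        = (\<Sum>k<n. of_int (\<kappa> * \<kappa>) * (of_int (m k) * \<sigma> i (\<alpha> k))) + of_int \<kappa> * (\<Sum>k<n. of_int (m k * c k))"
      using i by (simp add: aff sum.distrib sum_distrib_left algebra_simps)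
    also have "(\<Sum>k<n. of_int (\<kappa> * \<kappa>) * (of_int (m k) * \<sigma> i (\<alpha> k))) = \<sigma> i x"
      unfolding \<kappa> by (simp add: m[OF i])
    finally show ?thesis by simp
  qed
  then show ?thesis using cl by (intro bexI[of _ ?y]) auto
qed

text \<open>Both rings are identified with their common image in complex \<open>n\<close>-space; the
  bijection respects the operations because the embeddings do and are injective.\<close>

lemma ring_iso_of_lattice:
  assumes R: "embedded_ring n R \<sigma>" and R': "embedded_ring n R' s"
    and ex: "\<And>x. x \<in> carrier R \<Longrightarrow> \<exists>y\<in>carrier R'. \<forall>i<n. s i y = \<sigma> i x"
    and ex': "\<And>y. y \<in> carrier R' \<Longrightarrow> \<exists>x\<in>carrier R. \<forall>i<n. \<sigma> i x = s i y"
  obtains h where "h \<in> ring_iso R R'" "\<And>x i. x \<in> carrier R \<Longrightarrow> i < n \<Longrightarrow> s i (h x) = \<sigma> i x"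
proof -
  interpret R: embedded_ring n R \<sigma> by (rule R)
  interpret R': embedded_ring n R' s by (rule R')
  obtain h where h: "\<And>x. x \<in> carrier R \<Longrightarrow> h x \<in> carrier R'"
    "\<And>x i. x \<in> carrier R \<Longrightarrow> i < n \<Longrightarrow> s i (h x) = \<sigma> i x"
    using ex by metis
  have "h \<in> Ring.ring_hom R R'"
    by (rule ring_hom_memI)
      (auto intro!: R'.emb_inj simp: h R.emb_mult R.emb_add R.emb_one R'.emb_mult R'.emb_add R'.emb_one)
  moreover have "bij_betw h (carrier R) (carrier R')"
    unfolding bij_betw_def
  proof
    show "inj_on h (carrier R)" using h(2) by (metis inj_onI R.emb_inj)
    have "y \<in> h ` carrier R" if y: "y \<in> carrier R'" for y
    proof -
      obtain x where "x \<in> carrier R" "\<forall>i<n. \<sigma> i x = s i y" using ex'[OF y] by blast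
      then have "h x = y" using h y by (intro R'.emb_inj) auto
      then show ?thesis using \<open>x \<in> carrier R\<close> by blast
    qed
    then show "h ` carrier R = carrier R'" using h(1) by blast
  qed
  ultimately have "h \<in> ring_iso R R'" by (simp add: ring_iso_def)
  then show ?thesis using h(2) by (rule that)
qed

text \<open>A common sign and integral translations do not change a lattice that contains 1, so
  after relabelling the two rings have the same image, and so have their resolvents. The maps \<phi>
  and \<phi>' correspond because both are determined by the coordinates.\<close>

theorem same_forms_iso:
  fixes R R' C C' :: "int list ring"
  assumes P: "(R, C, \<phi>) \<in> quartic_pairs" and P': "(R', C', \<phi>') \<in> quartic_pairs"
    and \<alpha>: "unital_basis 4 R \<alpha>" and \<omega>: "unital_basis 3 C \<omega>"
    and \<alpha>': "unital_basis 4 R' \<alpha>'" and \<omega>': "unital_basis 3 C' \<omega>'"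
    and forms: "\<And>m k l. m \<in> {1, 2} \<Longrightarrow> 1 \<le> k \<Longrightarrow> k \<le> l \<Longrightarrow> l \<le> 3 \<Longrightarrow>
        form_coeff R C \<phi> \<alpha> \<omega> m k l = form_coeff R' C' \<phi>' \<alpha>' \<omega>' m k l"
  shows "((R, C, \<phi>), (R', C', \<phi>')) \<in> pair_iso"
proof -
  obtain \<sigma> \<tau> where st: "embedded_pair R \<sigma> C \<tau> \<phi>" using quartic_pairsE[OF P] .
  obtain \<sigma>' \<tau>' where st': "embedded_pair R' \<sigma>' C' \<tau>' \<phi>'" using quartic_pairsE[OF P'] .
  obtain \<pi> \<rho> \<kappa> c d where Q: "embedded_pair R' (\<lambda>i. \<sigma>' (\<pi> i)) C' (\<lambda>j. \<tau>' (\<rho> j)) \<phi>'"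
    and \<kappa>: "\<kappa> = 1 \<or> \<kappa> = (-1 :: int)"
    and aff: "\<And>i k. i < 4 \<Longrightarrow> k < 4 \<Longrightarrow> \<sigma>' (\<pi> i) (\<alpha>' k) = of_int \<kappa> * \<sigma> i (\<alpha> k) + of_int (c k)"
    and aff3: "\<And>j k. j < 3 \<Longrightarrow> k < 3 \<Longrightarrow> \<tau>' (\<rho> j) (\<omega>' k) = \<tau> j (\<omega> k) + of_int (d k)"
  proof (rule same_forms_rigid[OF st st' \<alpha> \<omega> \<alpha>' \<omega>'], goal_cases)
    case (1 m k l) show ?case by (rule forms[OF 1(2-5)])
  next
    case (2 \<pi> \<rho> \<kappa> c d) show ?case by (rule 2(1)[OF 2(4-7)])
  qed
  define s t where "s i = \<sigma>' (\<pi> i)" and "t j = \<tau>' (\<rho> j)" for i j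
  interpret P: embedded_pair R \<sigma> C \<tau> \<phi> by (rule st)
  have Q': "embedded_pair R' s C' t \<phi>'" using Q by (simp add: s_def[abs_def] t_def[abs_def])
  interpret Q: embedded_pair R' s C' t \<phi>' by (rule Q')
  have b: "int_basis R 4 \<alpha>" "int_basis R' 4 \<alpha>'" "int_basis C 3 \<omega>" "int_basis C' 3 \<omega>'"
    using \<alpha> \<alpha>' \<omega> \<omega>' by (auto simp: unital_basis_def)
  have kk: "\<kappa> * \<kappa> = 1" using \<kappa> by auto
  obtain h where h: "h \<in> ring_iso R R'" "\<And>x i. x \<in> carrier R \<Longrightarrow> i < 4 \<Longrightarrow> s i (h x) = \<sigma> i x"
  proof (rule ring_iso_of_lattice[OF P.R.embedded_ring_axioms Q.R.embedded_ring_axioms])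
    show "\<exists>y\<in>carrier R'. \<forall>i<4. s i y = \<sigma> i x" if "x \<in> carrier R" for x
      by (rule lattice_affine[OF P.R.embedded_ring_axioms Q.R.embedded_ring_axioms b(1) Q.R.basis_closed[OF b(2)] kk _ that, where c = c])
        (simp add: aff s_def)
    show "\<exists>x\<in>carrier R. \<forall>i<4. \<sigma> i x = s i y" if "y \<in> carrier R'" for y
      by (rule lattice_affine[OF Q.R.embedded_ring_axioms P.R.embedded_ring_axioms b(2) P.R.basis_closed[OF b(1)] kk _ that, where c = "\<lambda>k. - \<kappa> * c k"])
        (use \<kappa> in \<open>auto simp: aff s_def\<close>)
  qed blast
  obtain g where g: "g \<in> ring_iso C C'" "\<And>x j. x \<in> carrier C \<Longrightarrow> j < 3 \<Longrightarrow> t j (g x) = \<tau> j x"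
  proof (rule ring_iso_of_lattice[OF P.C.embedded_ring_axioms Q.C.embedded_ring_axioms])
    show "\<exists>y\<in>carrier C'. \<forall>i<3. t i y = \<tau> i x" if "x \<in> carrier C" for x
      by (rule lattice_affine[OF P.C.embedded_ring_axioms Q.C.embedded_ring_axioms b(3) Q.C.basis_closed[OF b(4)] _ _ that, where \<kappa> = 1 and c = d])
        (simp_all add: aff3 t_def)
    show "\<exists>x\<in>carrier C. \<forall>i<3. \<tau> i x = t i y" if "y \<in> carrier C'" for y
      by (rule lattice_affine[OF Q.C.embedded_ring_axioms P.C.embedded_ring_axioms b(4) P.C.basis_closed[OF b(3)] _ _ that, where \<kappa> = 1 and c = "\<lambda>k. - d k"])
        (simp_all add: aff3 t_def)
  qed blast
  have hc: "h x \<in> carrier R'" if "x \<in> carrier R" for x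
    using h(1) that by (auto simp: ring_iso_def intro: ring_hom_closed)
  have gc: "g x \<in> carrier C'" if "x \<in> carrier C" for x
    using g(1) that by (auto simp: ring_iso_def intro: ring_hom_closed)
  have "g (\<phi> x) = \<phi>' (h x)" if x: "x \<in> carrier R" for x
  proof (rule Q.C.emb_inj)
    have \<phi>x: "\<phi> x \<in> carrier C" using P.\<phi>_closed x by auto
    then show "g (\<phi> x) \<in> carrier C'" by (rule gc)
    show "\<phi>' (h x) \<in> carrier C'" using Q.\<phi>_closed hc[OF x] by auto
    fix j :: nat assume j: "j < 3"
    have "t j (\<phi>' (h x)) = resolv (\<lambda>i. s i (h x)) j" by (rule Q.\<phi>_eq[OF hc[OF x] j])
    also have "\<dots> = resolv (\<lambda>i. \<sigma> i x) j" by (rule resolv_cong) (rule h(2)[OF x])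
    finally show "t j (g (\<phi> x)) = t j (\<phi>' (h x))" using g(2)[OF \<phi>x j] P.\<phi>_eq[OF x j] by simp
  qed
  then show ?thesis using P P' h(1) g(1) unfolding pair_iso_def by blast
qed

lemma quartic_pairs_rings:
  assumes "(R, C, \<phi>) \<in> quartic_pairs"
  shows "Ring.ring R" "Ring.ring C" "\<phi> \<in> carrier R \<rightarrow> carrier C"
  using assms by (auto simp: quartic_pairs_def rank_ring_def cubic_resolvent_def cring_def)

lemma equiv_pair_iso: "equiv quartic_pairs pair_iso"
proof (rule equivI)
  show "pair_iso \<subseteq> quartic_pairs \<times> quartic_pairs" by (auto simp: pair_iso_def)
  show "refl_on quartic_pairs pair_iso"
  proof (rule refl_onI)
    fix P assume P: "P \<in> quartic_pairs"
    obtain R C \<phi> where P': "P = (R, C, \<phi>)" by (cases P)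
    have "id \<in> ring_iso R R" "id \<in> ring_iso C C"
      by (auto intro!: ring_iso_memI)
    then show "(P, P) \<in> pair_iso" using P unfolding P' pair_iso_def
      by (auto intro!: bexI[of _ id])
  qed
  show "sym pair_iso"
  proof (rule symI)
    fix P Q assume PQ: "(P, Q) \<in> pair_iso"
    obtain R C \<phi> R' C' \<phi>' where e: "P = (R, C, \<phi>)" "Q = (R', C', \<phi>')" by (cases P, cases Q)
    from PQ obtain h g where hg: "h \<in> ring_iso R R'" "g \<in> ring_iso C C'" "\<And>x. x \<in> carrier R \<Longrightarrow> g (\<phi> x) = \<phi>' (h x)"
      and mem: "(R, C, \<phi>) \<in> quartic_pairs" "(R', C', \<phi>') \<in> quartic_pairs" unfolding e pair_iso_def by auto
    let ?h = "inv_into (carrier R) h" and ?g = "inv_into (carrier C) g"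
    have bij: "bij_betw h (carrier R) (carrier R')" "bij_betw g (carrier C) (carrier C')"
      using hg by (auto simp: ring_iso_def)
    have "?g (\<phi>' y) = \<phi> (?h y)" if "y \<in> carrier R'" for y
    proof -
      have x: "?h y \<in> carrier R" "h (?h y) = y" using bij(1) that
        by (auto simp: bij_betw_def inv_into_into f_inv_into_f)
      have "\<phi> (?h y) \<in> carrier C" using quartic_pairs_rings(3)[OF mem(1)] x by auto
      then show ?thesis using hg(3)[OF x(1)] x(2) bij(2) by (metis bij_betw_inv_into_left)
    qed
    then show "(Q, P) \<in> pair_iso"
      using ring_iso_set_sym[OF quartic_pairs_rings(1)[OF mem(1)] hg(1)]
        ring_iso_set_sym[OF quartic_pairs_rings(2)[OF mem(1)] hg(2)] mem
      unfolding e pair_iso_def by blast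
  qed
  show "trans pair_iso"
  proof (rule transI)
    fix P Q S assume PQ: "(P, Q) \<in> pair_iso" "(Q, S) \<in> pair_iso"
    obtain R C \<phi> R' C' \<phi>' R'' C'' \<phi>'' where e: "P = (R, C, \<phi>)" "Q = (R', C', \<phi>')" "S = (R'', C'', \<phi>'')"
      by (cases P, cases Q, cases S)
    from PQ(1) obtain h g where hg: "h \<in> ring_iso R R'" "g \<in> ring_iso C C'" "\<And>x. x \<in> carrier R \<Longrightarrow> g (\<phi> x) = \<phi>' (h x)"
      and mem: "(R, C, \<phi>) \<in> quartic_pairs" unfolding e pair_iso_def by auto
    from PQ(2) obtain h' g' where hg': "h' \<in> ring_iso R' R''" "g' \<in> ring_iso C' C''" "\<And>x. x \<in> carrier R' \<Longrightarrow> g' (\<phi>' x) = \<phi>'' (h' x)"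
      and mem': "(R'', C'', \<phi>'') \<in> quartic_pairs" unfolding e pair_iso_def by auto
    have "(g' \<circ> g) (\<phi> x) = \<phi>'' ((h' \<circ> h) x)" if "x \<in> carrier R" for x
      using hg(3) hg'(3) that ring_hom_closed[of h R R' x] hg(1) by (simp add: ring_iso_def)
    then show "(P, S) \<in> pair_iso"
      using ring_iso_set_trans[OF hg(1) hg'(1)] ring_iso_set_trans[OF hg(2) hg'(2)] mem mem'
      unfolding e pair_iso_def by blast
  qed
qed

text \<open>An isomorphism need not respect given labellings, so a labelling is transported along
  it. The pulled back homomorphisms are distinct, and there are as many as \<open>R\<close>
  has.\<close>

lemma embedded_pullback:
  assumes R: "embedded_ring n R \<sigma>" and R': "embedded_ring n R' s" and h: "h \<in> ring_iso R R'"
  shows "embedded_ring n R (\<lambda>i. restrict (\<lambda>x. s i (h x)) (carrier R))"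
proof -
  interpret R: embedded_ring n R \<sigma> by (rule R)
  interpret R': embedded_ring n R' s by (rule R')
  let ?p = "\<lambda>i. restrict (\<lambda>x. s i (h x)) (carrier R)"
  have hh: "h \<in> Ring.ring_hom R R'" "bij_betw h (carrier R) (carrier R')" using h by (auto simp: ring_iso_def)
  have hc: "h x \<in> carrier R'" if "x \<in> carrier R" for x using ring_hom_closed[OF hh(1) that] .
  have "?p i \<in> complex_homs R" if i: "i < n" for i
  proof -
    have "?p i \<in> Ring.ring_hom R complex_ring"
      by (rule ring_hom_memI)
        (simp_all add: i hc ring_hom_mult[OF hh(1)] ring_hom_add[OF hh(1)] ring_hom_one[OF hh(1)]
           R'.emb_mult R'.emb_add R'.emb_one)
    then show ?thesis by (simp add: complex_homs_def)
  qed
  moreover have "inj_on ?p {..<n}"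
  proof (rule inj_onI)
    fix i j assume ij: "i \<in> {..<n}" "j \<in> {..<n}" "?p i = ?p j"
    have "s i = s j"
    proof (rule complex_homs_eqI)
      show "s i \<in> complex_homs R'" "s j \<in> complex_homs R'" using ij R'.enum by (auto simp: bij_betw_def)
      fix y assume "y \<in> carrier R'"
      then obtain x where "x \<in> carrier R" "y = h x" using hh(2) by (auto simp: bij_betw_def)
      then show "s i y = s j y" using fun_cong[OF ij(3), of x] by simp
    qed
    then show "i = j" using R'.enum ij by (auto simp: bij_betw_def inj_on_def)
  qed
  moreover have "card (complex_homs R) = n" "finite (complex_homs R)"
    using R.enum bij_betw_same_card bij_betw_finite by fastforce+
  ultimately have "bij_betw ?p {..<n} (complex_homs R)"
    by (simp add: bij_betw_def card_image card_subset_eq image_subset_iff)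
  then show ?thesis using R.rank by unfold_locales
qed

lemma int_basis_iso:
  assumes R: "embedded_ring n R \<sigma>" and R': "embedded_ring n R' s" and h: "h \<in> ring_iso R R'"
    and b: "int_basis R n b"
  shows "int_basis R' n (\<lambda>k. h (b k))"
proof -
  let ?p = "\<lambda>i. restrict (\<lambda>x. s i (h x)) (carrier R)"
  interpret R: embedded_ring n R ?p by (rule embedded_pullback[OF R R' h])
  interpret R': embedded_ring n R' s by (rule R')
  have hh: "h \<in> Ring.ring_hom R R'" "bij_betw h (carrier R) (carrier R')" using h by (auto simp: ring_iso_def)
  have bc: "b k \<in> carrier R" if "k < n" for k using R.basis_closed[OF b] that by auto
  show ?thesis
  proof (rule R'.int_basisI)
    show "(\<lambda>k. h (b k)) \<in> {..<n} \<rightarrow> carrier R'" using bc ring_hom_closed[OF hh(1)] by auto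
    fix y assume "y \<in> carrier R'"
    then obtain x where x: "x \<in> carrier R" "y = h x" using hh(2) by (auto simp: bij_betw_def)
    obtain c where c: "\<And>i. i < n \<Longrightarrow> ?p i x = (\<Sum>k<n. of_int (c k) * ?p i (b k))"
      using R.basis_coords[OF b x(1)] by blast
    show "\<exists>c :: nat \<Rightarrow> int. \<forall>i<n. s i y = (\<Sum>k<n. of_int (c k) * s i (h (b k)))"
      using c x bc by (intro exI[of _ c]) simp
  qed
qed

definition form_witness :: "('a, 'm) ring_scheme \<Rightarrow> ('b, 'k) ring_scheme \<Rightarrow> ('a \<Rightarrow> 'b) \<Rightarrow>
    ternary_form \<Rightarrow> ternary_form \<Rightarrow> (nat \<Rightarrow> 'a) \<Rightarrow> (nat \<Rightarrow> 'b) \<Rightarrow> bool" where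
  "form_witness R C \<phi> A B \<alpha> \<omega> \<longleftrightarrow> unital_basis 4 R \<alpha> \<and> unital_basis 3 C \<omega> \<and>
     (\<forall>x y z. \<exists>k :: int.
        \<phi> ([x] \<cdot>\<^bsub>R\<^esub> \<alpha> 1 \<oplus>\<^bsub>R\<^esub> [y] \<cdot>\<^bsub>R\<^esub> \<alpha> 2 \<oplus>\<^bsub>R\<^esub> [z] \<cdot>\<^bsub>R\<^esub> \<alpha> 3) =
        [k] \<cdot>\<^bsub>C\<^esub> \<one>\<^bsub>C\<^esub> \<oplus>\<^bsub>C\<^esub> [A x y z] \<cdot>\<^bsub>C\<^esub> \<omega> 1 \<oplus>\<^bsub>C\<^esub> [B x y z] \<cdot>\<^bsub>C\<^esub> \<omega> 2)"

lemma has_forms_iff: "has_forms (R, C, \<phi>) A B \<longleftrightarrow> (\<exists>\<alpha> \<omega>. form_witness R C \<phi> A B \<alpha> \<omega>)"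
  by (auto simp: has_forms_def form_witness_def unital_basis_def)

lemma (in embedded_ring) coord_eqI:
  assumes b: "int_basis R n b" and x: "x \<in> carrier R" and k: "k < n"
    and eq: "\<And>i. i < n \<Longrightarrow> \<sigma> i x = (\<Sum>k<n. of_int (c k) * \<sigma> i (b k))"
  shows "coord R n b x k = c k"
proof -
  have "(\<Sum>k<n. of_int (coord R n b x k - c k) * \<sigma> i (b k)) = 0" if "i < n" for i
    using eq[OF that] emb_coord[OF b x that] by (simp add: left_diff_distrib sum_subtractf)
  from det_nonzero_kernel[OF det_val[OF b] this k]
  have "complex_of_int (coord R n b x k - c k) = 0" .
  then show ?thesis by simp
qed

lemma (in embedded_pair) form_witness_coord:
  assumes w: "form_witness R C \<phi> A B \<alpha> \<omega>" and x: "x \<in> carrier R"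
    and eq: "\<And>i. i < 4 \<Longrightarrow> \<sigma> i x = of_int a * \<sigma> i (\<alpha> 1) + of_int b * \<sigma> i (\<alpha> 2) + of_int c * \<sigma> i (\<alpha> 3)"
  shows "coord C 3 \<omega> (\<phi> x) 1 = A a b c" "coord C 3 \<omega> (\<phi> x) 2 = B a b c"
proof -
  have ba: "int_basis R 4 \<alpha>" "int_basis C 3 \<omega>" "\<omega> 0 = \<one>\<^bsub>C\<^esub>"
    using w by (auto simp: form_witness_def unital_basis_def)
  have \<alpha>c: "\<alpha> 1 \<in> carrier R" "\<alpha> 2 \<in> carrier R" "\<alpha> 3 \<in> carrier R"
    using R.basis_closed[OF ba(1)] by (auto simp: Pi_def)
  have \<omega>c: "\<omega> 1 \<in> carrier C" "\<omega> 2 \<in> carrier C"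
    using C.basis_closed[OF ba(2)] by (auto simp: Pi_def)
  obtain k :: int where k: "\<phi> ([a] \<cdot>\<^bsub>R\<^esub> \<alpha> 1 \<oplus>\<^bsub>R\<^esub> [b] \<cdot>\<^bsub>R\<^esub> \<alpha> 2 \<oplus>\<^bsub>R\<^esub> [c] \<cdot>\<^bsub>R\<^esub> \<alpha> 3) =
        [k] \<cdot>\<^bsub>C\<^esub> \<one>\<^bsub>C\<^esub> \<oplus>\<^bsub>C\<^esub> [A a b c] \<cdot>\<^bsub>C\<^esub> \<omega> 1 \<oplus>\<^bsub>C\<^esub> [B a b c] \<cdot>\<^bsub>C\<^esub> \<omega> 2"
    using w unfolding form_witness_def by blast
  have "x = [a] \<cdot>\<^bsub>R\<^esub> \<alpha> 1 \<oplus>\<^bsub>R\<^esub> [b] \<cdot>\<^bsub>R\<^esub> \<alpha> 2 \<oplus>\<^bsub>R\<^esub> [c] \<cdot>\<^bsub>R\<^esub> \<alpha> 3"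
    by (rule R.emb_inj) (simp_all add: x eq \<alpha>c R.emb_add R.emb_int_mult del: One_nat_def)
  then have "\<tau> j (\<phi> x) = (\<Sum>l<3. of_int ((\<lambda>l. if l = 0 then k else if l = 1 then A a b c else B a b c) l) * \<tau> j (\<omega> l))"
    if "j < 3" for j
    using k that by (simp add: C.emb_add C.emb_int_mult C.emb_one \<omega>c ba(3) sum_lessThan_3 del: One_nat_def)
  note coords = C.coord_eqI[OF ba(2) _ _ this]
  have "\<phi> x \<in> carrier C" using \<phi>_closed x by auto
  then show "coord C 3 \<omega> (\<phi> x) 1 = A a b c" "coord C 3 \<omega> (\<phi> x) 2 = B a b c"
    using coords[of 1] coords[of 2] by simp_all
qed

text \<open>\<open>A\<close> and \<open>B\<close> are arbitrary functions here, so the coefficients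
  are expressed by polarization. What matters is that the right-hand sides involve only
  \<open>A\<close> and \<open>B\<close>, not the pair.\<close>

lemma (in embedded_pair) form_witness_coeff:
  assumes w: "form_witness R C \<phi> A B \<alpha> \<omega>" and kl: "1 \<le> k" "k \<le> l" "l \<le> 3"
  defines "\<delta> \<equiv> \<lambda>k i. if i = k then 1 else 0 :: int"
  shows "form_coeff R C \<phi> \<alpha> \<omega> 1 k l = (if k = l then A (\<delta> k 1) (\<delta> k 2) (\<delta> k 3)
      else A (\<delta> k 1 + \<delta> l 1) (\<delta> k 2 + \<delta> l 2) (\<delta> k 3 + \<delta> l 3) - A (\<delta> k 1) (\<delta> k 2) (\<delta> k 3) - A (\<delta> l 1) (\<delta> l 2) (\<delta> l 3))"
    and "form_coeff R C \<phi> \<alpha> \<omega> 2 k l = (if k = l then B (\<delta> k 1) (\<delta> k 2) (\<delta> k 3)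
      else B (\<delta> k 1 + \<delta> l 1) (\<delta> k 2 + \<delta> l 2) (\<delta> k 3 + \<delta> l 3) - B (\<delta> k 1) (\<delta> k 2) (\<delta> k 3) - B (\<delta> l 1) (\<delta> l 2) (\<delta> l 3))"
proof -
  have ba: "int_basis R 4 \<alpha>" using w by (auto simp: form_witness_def unital_basis_def)
  have \<alpha>c: "\<alpha> k \<in> carrier R" if "1 \<le> k" "k \<le> 3" for k
    using R.basis_closed[OF ba] that by (auto simp: Pi_def)
  have s: "\<sigma> i (\<alpha> k) = of_int (\<delta> k 1) * \<sigma> i (\<alpha> 1) + of_int (\<delta> k 2) * \<sigma> i (\<alpha> 2) + of_int (\<delta> k 3) * \<sigma> i (\<alpha> 3)"
    if "1 \<le> k" "k \<le> 3" for k i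
  proof -
    have "k = 1 \<or> k = 2 \<or> k = 3" using that by auto
    then show ?thesis by (auto simp: \<delta>_def)
  qed
  have c1: "coord C 3 \<omega> (\<phi> (\<alpha> k)) 1 = A (\<delta> k 1) (\<delta> k 2) (\<delta> k 3)"
    "coord C 3 \<omega> (\<phi> (\<alpha> k)) 2 = B (\<delta> k 1) (\<delta> k 2) (\<delta> k 3)" if "1 \<le> k" "k \<le> 3" for k
    using form_witness_coord[OF w \<alpha>c[OF that] s[OF that]] .
  have c2: "coord C 3 \<omega> (\<phi> (\<alpha> k \<oplus>\<^bsub>R\<^esub> \<alpha> l)) 1 = A (\<delta> k 1 + \<delta> l 1) (\<delta> k 2 + \<delta> l 2) (\<delta> k 3 + \<delta> l 3)"
    "coord C 3 \<omega> (\<phi> (\<alpha> k \<oplus>\<^bsub>R\<^esub> \<alpha> l)) 2 = B (\<delta> k 1 + \<delta> l 1) (\<delta> k 2 + \<delta> l 2) (\<delta> k 3 + \<delta> l 3)"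
  proof -
    have k3: "1 \<le> l" "k \<le> 3" using kl by auto
    have "\<alpha> k \<oplus>\<^bsub>R\<^esub> \<alpha> l \<in> carrier R" using \<alpha>c kl k3 by simp
    moreover have "\<sigma> i (\<alpha> k \<oplus>\<^bsub>R\<^esub> \<alpha> l) = of_int (\<delta> k 1 + \<delta> l 1) * \<sigma> i (\<alpha> 1)
        + of_int (\<delta> k 2 + \<delta> l 2) * \<sigma> i (\<alpha> 2) + of_int (\<delta> k 3 + \<delta> l 3) * \<sigma> i (\<alpha> 3)" if "i < 4" for i
      unfolding R.emb_add[OF that \<alpha>c[OF kl(1) k3(2)] \<alpha>c[OF k3(1) kl(3)]] s[OF kl(1) k3(2)] s[OF k3(1) kl(3)]
      by (simp add: algebra_simps)
    ultimately show "coord C 3 \<omega> (\<phi> (\<alpha> k \<oplus>\<^bsub>R\<^esub> \<alpha> l)) 1 = A (\<delta> k 1 + \<delta> l 1) (\<delta> k 2 + \<delta> l 2) (\<delta> k 3 + \<delta> l 3)"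
      "coord C 3 \<omega> (\<phi> (\<alpha> k \<oplus>\<^bsub>R\<^esub> \<alpha> l)) 2 = B (\<delta> k 1 + \<delta> l 1) (\<delta> k 2 + \<delta> l 2) (\<delta> k 3 + \<delta> l 3)"
      using form_witness_coord[OF w] by blast+
  qed
  have "1 \<le> l" "k \<le> 3" using kl by auto
  then show "form_coeff R C \<phi> \<alpha> \<omega> 1 k l = (if k = l then A (\<delta> k 1) (\<delta> k 2) (\<delta> k 3)
      else A (\<delta> k 1 + \<delta> l 1) (\<delta> k 2 + \<delta> l 2) (\<delta> k 3 + \<delta> l 3) - A (\<delta> k 1) (\<delta> k 2) (\<delta> k 3) - A (\<delta> l 1) (\<delta> l 2) (\<delta> l 3))"
    "form_coeff R C \<phi> \<alpha> \<omega> 2 k l = (if k = l then B (\<delta> k 1) (\<delta> k 2) (\<delta> k 3)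
      else B (\<delta> k 1 + \<delta> l 1) (\<delta> k 2 + \<delta> l 2) (\<delta> k 3 + \<delta> l 3) - B (\<delta> k 1) (\<delta> k 2) (\<delta> k 3) - B (\<delta> l 1) (\<delta> l 2) (\<delta> l 3))"
    using kl by (simp_all only: form_coeff_def c1 c2)
qed

text \<open>One inclusion is the injectivity of the parametrization, \<open>same_forms_iso\<close>;
  the other transports the bases along an isomorphism.\<close>

theorem pair_class_eq:
  assumes P: "P \<in> pair_class A B"
  shows "pair_class A B = pair_iso `` {P}"
proof -
  obtain R C \<phi> where e: "P = (R, C, \<phi>)" by (cases P)
  have Pq: "(R, C, \<phi>) \<in> quartic_pairs" and "has_forms (R, C, \<phi>) A B"
    using P by (auto simp: pair_class_def e)
  then obtain \<alpha> \<omega> where w: "form_witness R C \<phi> A B \<alpha> \<omega>" by (auto simp: has_forms_iff)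
  obtain \<sigma> \<tau> where st: "embedded_pair R \<sigma> C \<tau> \<phi>" using quartic_pairsE[OF Pq] .
  interpret P: embedded_pair R \<sigma> C \<tau> \<phi> by (rule st)
  show ?thesis
  proof (intro equalityI subsetI)
    fix Q assume Q: "Q \<in> pair_class A B"
    obtain R' C' \<phi>' where e': "Q = (R', C', \<phi>')" by (cases Q)
    have Qq: "(R', C', \<phi>') \<in> quartic_pairs" and "has_forms (R', C', \<phi>') A B"
      using Q by (auto simp: pair_class_def e')
    then obtain \<alpha>' \<omega>' where w': "form_witness R' C' \<phi>' A B \<alpha>' \<omega>'" by (auto simp: has_forms_iff)
    obtain \<sigma>' \<tau>' where st': "embedded_pair R' \<sigma>' C' \<tau>' \<phi>'" using quartic_pairsE[OF Qq] .
    interpret Q: embedded_pair R' \<sigma>' C' \<tau>' \<phi>' by (rule st')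
    have "((R, C, \<phi>), (R', C', \<phi>')) \<in> pair_iso"
    proof (rule same_forms_iso[OF Pq Qq])
      fix m k l :: nat assume "m \<in> {1, 2}" "1 \<le> k" "k \<le> l" "l \<le> 3"
      then show "form_coeff R C \<phi> \<alpha> \<omega> m k l = form_coeff R' C' \<phi>' \<alpha>' \<omega>' m k l"
        using P.form_witness_coeff[OF w, of k l] Q.form_witness_coeff[OF w', of k l] by auto
    qed (use w w' in \<open>auto simp: form_witness_def\<close>)
    then show "Q \<in> pair_iso `` {P}" by (simp add: e e')
  next
    fix Q assume Q: "Q \<in> pair_iso `` {P}"
    obtain R' C' \<phi>' where e': "Q = (R', C', \<phi>')" by (cases Q)
    from Q obtain h g where Qq: "(R', C', \<phi>') \<in> quartic_pairs" and
      hg: "h \<in> ring_iso R R'" "g \<in> ring_iso C C'" "\<And>x. x \<in> carrier R \<Longrightarrow> g (\<phi> x) = \<phi>' (h x)"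
      unfolding e e' pair_iso_def by auto
    obtain \<sigma>' \<tau>' where st': "embedded_pair R' \<sigma>' C' \<tau>' \<phi>'" using quartic_pairsE[OF Qq] .
    interpret Q: embedded_pair R' \<sigma>' C' \<tau>' \<phi>' by (rule st')
    interpret pR: embedded_ring 4 R "\<lambda>i. restrict (\<lambda>x. \<sigma>' i (h x)) (carrier R)"
      by (rule embedded_pullback[OF P.R.embedded_ring_axioms Q.R.embedded_ring_axioms hg(1)])
    interpret pC: embedded_ring 3 C "\<lambda>i. restrict (\<lambda>x. \<tau>' i (g x)) (carrier C)"
      by (rule embedded_pullback[OF P.C.embedded_ring_axioms Q.C.embedded_ring_axioms hg(2)])
    have hom: "h \<in> Ring.ring_hom R R'" "g \<in> Ring.ring_hom C C'" using hg by (auto simp: ring_iso_def)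
    have ba: "int_basis R 4 \<alpha>" "\<alpha> 0 = \<one>\<^bsub>R\<^esub>" "int_basis C 3 \<omega>" "\<omega> 0 = \<one>\<^bsub>C\<^esub>"
      using w by (auto simp: form_witness_def unital_basis_def)
    have \<alpha>c: "\<alpha> 1 \<in> carrier R" "\<alpha> 2 \<in> carrier R" "\<alpha> 3 \<in> carrier R"
      using P.R.basis_closed[OF ba(1)] by (auto simp: Pi_def)
    have \<omega>c: "\<omega> 1 \<in> carrier C" "\<omega> 2 \<in> carrier C"
      using P.C.basis_closed[OF ba(3)] by (auto simp: Pi_def)
    note cl = ring_hom_closed[OF hom(1)] ring_hom_closed[OF hom(2)]
    have pm: "\<sigma>' i (h ([a] \<cdot>\<^bsub>R\<^esub> x)) = of_int a * \<sigma>' i (h x)" if "i < 4" "x \<in> carrier R" for i x and a :: int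
      using pR.emb_int_mult[OF that] that by simp
    have pm3: "\<tau>' i (g ([a] \<cdot>\<^bsub>C\<^esub> x)) = of_int a * \<tau>' i (g x)" if "i < 3" "x \<in> carrier C" for i x and a :: int
      using pC.emb_int_mult[OF that] that by simp
    have "form_witness R' C' \<phi>' A B (\<lambda>k. h (\<alpha> k)) (\<lambda>k. g (\<omega> k))"
      unfolding form_witness_def unital_basis_def
    proof (intro conjI allI)
      show "int_basis R' 4 (\<lambda>k. h (\<alpha> k))"
        by (rule int_basis_iso[OF P.R.embedded_ring_axioms Q.R.embedded_ring_axioms hg(1) ba(1)])
      show "int_basis C' 3 (\<lambda>k. g (\<omega> k))"
        by (rule int_basis_iso[OF P.C.embedded_ring_axioms Q.C.embedded_ring_axioms hg(2) ba(3)])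
      show "h (\<alpha> 0) = \<one>\<^bsub>R'\<^esub>" "g (\<omega> 0) = \<one>\<^bsub>C'\<^esub>"
        using ring_hom_one[OF hom(1)] ring_hom_one[OF hom(2)] ba by auto
      fix a b c :: int
      let ?x = "[a] \<cdot>\<^bsub>R\<^esub> \<alpha> 1 \<oplus>\<^bsub>R\<^esub> [b] \<cdot>\<^bsub>R\<^esub> \<alpha> 2 \<oplus>\<^bsub>R\<^esub> [c] \<cdot>\<^bsub>R\<^esub> \<alpha> 3"
      let ?x' = "[a] \<cdot>\<^bsub>R'\<^esub> h (\<alpha> 1) \<oplus>\<^bsub>R'\<^esub> [b] \<cdot>\<^bsub>R'\<^esub> h (\<alpha> 2) \<oplus>\<^bsub>R'\<^esub> [c] \<cdot>\<^bsub>R'\<^esub> h (\<alpha> 3)"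
      obtain k :: int where k: "\<phi> ?x =
        [k] \<cdot>\<^bsub>C\<^esub> \<one>\<^bsub>C\<^esub> \<oplus>\<^bsub>C\<^esub> [A a b c] \<cdot>\<^bsub>C\<^esub> \<omega> 1 \<oplus>\<^bsub>C\<^esub> [B a b c] \<cdot>\<^bsub>C\<^esub> \<omega> 2" (is "_ = ?y")
        using w unfolding form_witness_def by blast
      let ?y' = "[k] \<cdot>\<^bsub>C'\<^esub> \<one>\<^bsub>C'\<^esub> \<oplus>\<^bsub>C'\<^esub> [A a b c] \<cdot>\<^bsub>C'\<^esub> g (\<omega> 1) \<oplus>\<^bsub>C'\<^esub> [B a b c] \<cdot>\<^bsub>C'\<^esub> g (\<omega> 2)"
      have xc: "?x \<in> carrier R" using \<alpha>c by simp
      have "h ?x = ?x'"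
        by (rule Q.R.emb_inj) (simp_all add: \<alpha>c cl ring_hom_add[OF hom(1)] Q.R.emb_add Q.R.emb_int_mult pm del: One_nat_def)
      moreover have "g ?y = ?y'"
        by (rule Q.C.emb_inj) (simp_all add: \<omega>c cl ring_hom_add[OF hom(2)] ring_hom_one[OF hom(2)] Q.C.emb_add Q.C.emb_int_mult Q.C.emb_one pm3 del: One_nat_def)
      ultimately have "\<phi>' ?x' = ?y'" using hg(3)[OF xc] k by simp
      then show "\<exists>k :: int. \<phi>' ?x' = [k] \<cdot>\<^bsub>C'\<^esub> \<one>\<^bsub>C'\<^esub> \<oplus>\<^bsub>C'\<^esub> [A a b c] \<cdot>\<^bsub>C'\<^esub> g (\<omega> 1) \<oplus>\<^bsub>C'\<^esub> [B a b c] \<cdot>\<^bsub>C'\<^esub> g (\<omega> 2)"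
        by blast
    qed
    then show "Q \<in> pair_class A B" using Qq by (auto simp: pair_class_def has_forms_iff e')
  qed
qed

section \<open>The pair of a monic quartic polynomial\<close>

lemma det_2: "det (mat 2 2 (\<lambda>(i, k). f i k)) = f 0 0 * f 1 1 - f 0 1 * (f 1 0 :: 'a :: comm_ring_1)"
  by (subst laplace_expansion_column[of _ 2 0])
    (auto simp: cofactor_def mat_delete_def numeral_2_eq_2 det_single algebra_simps)

lemma det_3: "det (mat 3 3 (\<lambda>(i, k). f i k)) =
   f 0 0 * (f 1 1 * f 2 2 - f 1 2 * f 2 1) - f 1 0 * (f 0 1 * f 2 2 - f 0 2 * f 2 1)
   + f 2 0 * (f 0 1 * f 1 2 - f 0 2 * (f 1 1 :: 'a :: comm_ring_1))"
proof -
  let ?A = "mat 3 3 (\<lambda>(i, k). f i k)"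
  have d: "mat_delete ?A i 0 = mat 2 2 (\<lambda>(k, l). f (insert_index i k) (Suc l))" if "i < 3" for i
    using that by (auto simp: mat_delete_def insert_index_def)
  have "det ?A = (\<Sum>i<3. ?A $$ (i, 0) * cofactor ?A i 0)"
    by (rule laplace_expansion_column) auto
  also have "\<dots> = f 0 0 * det (mat 2 2 (\<lambda>(k, l). f (insert_index 0 k) (Suc l)))
      - f 1 0 * det (mat 2 2 (\<lambda>(k, l). f (insert_index 1 k) (Suc l)))
      + f 2 0 * det (mat 2 2 (\<lambda>(k, l). f (insert_index 2 k) (Suc l)))"
    by (simp add: sum_lessThan_3 cofactor_def d)
  finally show ?thesis
    unfolding det_2 by (simp add: insert_index_def eval_nat_numeral)
qed

lemma det_4_ones:
  assumes "\<And>i. i < 4 \<Longrightarrow> f i 0 = (1 :: 'a :: comm_ring_1)"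
  defines "m \<equiv> \<lambda>a b c. f a 1 * (f b 2 * f c 3 - f b 3 * f c 2) - f b 1 * (f a 2 * f c 3 - f a 3 * f c 2)
   + f c 1 * (f a 2 * f b 3 - f a 3 * f b 2)"
  shows "det (mat 4 4 (\<lambda>(i, k). f i k)) = m 1 2 3 - m 0 2 3 + m 0 1 3 - m 0 1 2"
proof -
  let ?A = "mat 4 4 (\<lambda>(i, k). f i k)"
  have d: "mat_delete ?A i 0 = mat 3 3 (\<lambda>(k, l). f (insert_index i k) (Suc l))" if "i < 4" for i
    using that by (auto simp: mat_delete_def insert_index_def)
  have "det ?A = (\<Sum>i<4. ?A $$ (i, 0) * cofactor ?A i 0)"
    by (rule laplace_expansion_column) auto
  also have "\<dots> = det (mat 3 3 (\<lambda>(k, l). f (insert_index 0 k) (Suc l)))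
      - det (mat 3 3 (\<lambda>(k, l). f (insert_index 1 k) (Suc l)))
      + det (mat 3 3 (\<lambda>(k, l). f (insert_index 2 k) (Suc l)))
      - det (mat 3 3 (\<lambda>(k, l). f (insert_index 3 k) (Suc l)))"
    by (simp add: sum_lessThan_4 cofactor_def d assms(1))
  finally show ?thesis
    unfolding det_3 by (simp add: insert_index_def m_def eval_nat_numeral)
qed

text \<open>The polynomial is presented by an ordered list of roots, since the resolvent map refers
  to labelled conjugates.\<close>

locale quartic_roots =
  fixes f1 f2 f3 f4 :: int and t :: "nat \<Rightarrow> complex"
  assumes vieta: "of_int f1 = - (t 0 + t 1 + t 2 + t 3)"
    "of_int f2 = t 0 * t 1 + t 0 * t 2 + t 0 * t 3 + t 1 * t 2 + t 1 * t 3 + t 2 * t 3"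
    "of_int f3 = - (t 0 * t 1 * t 2 + t 0 * t 1 * t 3 + t 0 * t 2 * t 3 + t 1 * t 2 * t 3)"
    "of_int f4 = t 0 * t 1 * t 2 * t 3"
    and distinct: "inj_on t {..<4}"
begin

definition rbase :: "nat \<Rightarrow> nat \<Rightarrow> complex" where
  "rbase i k = (if k = 0 then 1 else if k = 1 then t i else if k = 2 then (t i)\<^sup>2 + of_int f1 * t i
     else (t i) ^ 3 + of_int f1 * (t i)\<^sup>2 + of_int f2 * t i)"

definition cubic_root :: "nat \<Rightarrow> complex" where
  "cubic_root = resolv t"

definition cbase :: "nat \<Rightarrow> nat \<Rightarrow> complex" where
  "cbase j k = (if k = 0 then 1 else if k = 1 then cubic_root j
     else (cubic_root j)\<^sup>2 - of_int f2 * cubic_root j)"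

definition vdm :: complex where
  "vdm = (t 1 - t 0) * (t 2 - t 0) * (t 3 - t 0) * (t 2 - t 1) * (t 3 - t 1) * (t 3 - t 2)"

lemma vdm_nonzero: "vdm \<noteq> 0"
  using inj_on_eq_iff[OF distinct] by (simp add: vdm_def)

lemma det_rbase: "det (mat 4 4 (\<lambda>(i, k). rbase i k)) = vdm"
  by (subst det_4_ones) (simp_all add: rbase_def vdm_def algebra_simps power2_eq_square power3_eq_cube)

text \<open>A difference of two roots of the cubic resolvent is a product of two differences of
  roots of the quartic, so both determinants are, up to sign, the same product. This is the equality
  of the two discriminants.\<close>

lemma det_cbase: "det (mat 3 3 (\<lambda>(j, k). cbase j k)) = - vdm"
  by (subst det_3) (simp add: cbase_def vdm_def cubic_root_def resolv_def algebra_simps power2_eq_square power3_eq_cube)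

lemma t_quartic:
  assumes "i < 4"
  shows "(t i) ^ 4 + of_int f1 * (t i) ^ 3 + of_int f2 * (t i)\<^sup>2 + of_int f3 * t i + of_int f4 = 0"
proof -
  have "(t i) ^ 4 + of_int f1 * (t i) ^ 3 + of_int f2 * (t i)\<^sup>2 + of_int f3 * t i + of_int f4
    = (t i - t 0) * (t i - t 1) * (t i - t 2) * (t i - t 3)"
    unfolding vieta by (simp add: algebra_simps power2_eq_square power3_eq_cube power4_eq_xxxx)
  then show ?thesis using assms unfolding less_4_cases by auto
qed

text \<open>This is the classical resolvent cubic. Its coefficients are integers, so the cubic
  lattice is closed under multiplication.\<close>

lemma cubic_root_cubic:
  assumes "j < 3"
  shows "(cubic_root j) ^ 3 - of_int f2 * (cubic_root j)\<^sup>2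
     + of_int (f1 * f3 - 4 * f4) * cubic_root j - of_int (f1\<^sup>2 * f4 + f3\<^sup>2 - 4 * f2 * f4) = 0"
proof -
  have "(cubic_root j) ^ 3 - of_int f2 * (cubic_root j)\<^sup>2
     + of_int (f1 * f3 - 4 * f4) * cubic_root j - of_int (f1\<^sup>2 * f4 + f3\<^sup>2 - 4 * f2 * f4)
    = (cubic_root j - (t 0 * t 1 + t 2 * t 3)) * (cubic_root j - (t 0 * t 2 + t 1 * t 3)) * (cubic_root j - (t 0 * t 3 + t 1 * t 2))"
    by (simp add: vieta algebra_simps power2_eq_square power3_eq_cube)
  then show ?thesis using assms unfolding less_3_cases cubic_root_def resolv_def by auto
qed

lemma rbase_mult:
  assumes i: "i < 4"
  shows "rbase i 1 * rbase i 1 = rbase i 2 - of_int f1 * rbase i 1"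
    "rbase i 1 * rbase i 2 = rbase i 3 - of_int f2 * rbase i 1"
    "rbase i 1 * rbase i 3 = - of_int f3 * rbase i 1 - of_int f4"
    "rbase i 2 * rbase i 2 = - of_int f4 - of_int f3 * rbase i 1 - of_int f2 * rbase i 2 + of_int f1 * rbase i 3"
    "rbase i 2 * rbase i 3 = - of_int (f1 * f4) - of_int f4 * rbase i 1 - of_int f3 * rbase i 2"
    "rbase i 3 * rbase i 3 = - of_int (f2 * f4) - of_int f4 * rbase i 2 - of_int f3 * rbase i 3"
proof -
  let ?P = "(t i) ^ 4 + of_int f1 * (t i) ^ 3 + of_int f2 * (t i)\<^sup>2 + of_int f3 * t i + of_int f4"
  \<comment> \<open>In each relation below the difference of both sides is a polynomial multiple of
    the quartic at \<open>t i\<close>; the supplied \<open>c\<close> is the quotient.\<close>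
  have eqI: "x = y" if "x - y = c * ?P" for x y c using that t_quartic[OF i] by simp
  note s = rbase_def algebra_simps power2_eq_square power3_eq_cube power4_eq_xxxx
  show "rbase i 1 * rbase i 1 = rbase i 2 - of_int f1 * rbase i 1" by (simp add: s)
  show "rbase i 1 * rbase i 2 = rbase i 3 - of_int f2 * rbase i 1" by (simp add: s)
  show "rbase i 1 * rbase i 3 = - of_int f3 * rbase i 1 - of_int f4"
    by (rule eqI[of _ _ 1]) (simp add: s)
  show "rbase i 2 * rbase i 2 = - of_int f4 - of_int f3 * rbase i 1 - of_int f2 * rbase i 2 + of_int f1 * rbase i 3"
    by (rule eqI[of _ _ 1]) (simp add: s)
  show "rbase i 2 * rbase i 3 = - of_int (f1 * f4) - of_int f4 * rbase i 1 - of_int f3 * rbase i 2"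
    by (rule eqI[of _ _ "t i + of_int f1"]) (simp add: s)
  show "rbase i 3 * rbase i 3 = - of_int (f2 * f4) - of_int f4 * rbase i 2 - of_int f3 * rbase i 3"
    by (rule eqI[of _ _ "(t i)\<^sup>2 + of_int f1 * t i + of_int f2"]) (simp add: s)
qed

lemma cbase_mult:
  assumes j: "j < 3"
  shows "cbase j 1 * cbase j 1 = cbase j 2 + of_int f2 * cbase j 1"
    "cbase j 1 * cbase j 2 = - of_int (f1 * f3 - 4 * f4) * cbase j 1 + of_int (f1\<^sup>2 * f4 + f3\<^sup>2 - 4 * f2 * f4)"
    "cbase j 2 * cbase j 2 = - of_int (f1 * f3 - 4 * f4) * cbase j 2 + of_int (f1\<^sup>2 * f4 + f3\<^sup>2 - 4 * f2 * f4) * cbase j 1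
        - of_int (f2 * (f1\<^sup>2 * f4 + f3\<^sup>2 - 4 * f2 * f4))"
proof -
  define p q where "p = f1 * f3 - 4 * f4" and "q = f1\<^sup>2 * f4 + f3\<^sup>2 - 4 * f2 * f4"
  let ?P = "(cubic_root j) ^ 3 - of_int f2 * (cubic_root j)\<^sup>2 + of_int p * cubic_root j - of_int q"
  have "?P = 0" using cubic_root_cubic[OF j] unfolding p_def q_def .
  then have eqI: "x = y" if "x - y = c * ?P" for x y c using that by simp
  note s = cbase_def algebra_simps power2_eq_square power3_eq_cube
  show "cbase j 1 * cbase j 1 = cbase j 2 + of_int f2 * cbase j 1" by (simp add: s)
  show "cbase j 1 * cbase j 2 = - of_int (f1 * f3 - 4 * f4) * cbase j 1 + of_int (f1\<^sup>2 * f4 + f3\<^sup>2 - 4 * f2 * f4)"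
    unfolding p_def[symmetric] q_def[symmetric] by (rule eqI[of _ _ 1]) (simp add: s)
  show "cbase j 2 * cbase j 2 = - of_int (f1 * f3 - 4 * f4) * cbase j 2 + of_int (f1\<^sup>2 * f4 + f3\<^sup>2 - 4 * f2 * f4) * cbase j 1
        - of_int (f2 * (f1\<^sup>2 * f4 + f3\<^sup>2 - 4 * f2 * f4))"
    unfolding p_def[symmetric] q_def[symmetric]
    by (rule eqI[of _ _ "cubic_root j - of_int f2"]) (simp add: s)
qed

lemma rbase_lattice: "lattice_order 4 rbase"
proof
  show "det (mat 4 4 (\<lambda>(i, k). rbase i k)) \<noteq> 0" using det_rbase vdm_nonzero by simp
  have comb: "\<exists>m :: nat \<Rightarrow> int. \<forall>i<4. v i = (\<Sum>l<4. of_int (m l) * rbase i l)"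
    if "\<And>i. i < 4 \<Longrightarrow> v i = of_int a + of_int b * rbase i 1 + of_int c * rbase i 2 + of_int d * rbase i 3"
    for v :: "nat \<Rightarrow> complex" and a b c d :: int
    by (rule exI[of _ "\<lambda>l. if l = 0 then a else if l = 1 then b else if l = 2 then c else d"])
      (use that in \<open>simp add: sum_lessThan_4 rbase_def[of _ 0] del: One_nat_def\<close>)
  have le: "\<exists>m :: nat \<Rightarrow> int. \<forall>i<4. rbase i j * rbase i k = (\<Sum>l<4. of_int (m l) * rbase i l)"
    if jk: "j \<le> k" "k < 4" for j k
  proof -
    consider "j = 0" "k = 0" | "j = 0" "k = 1" | "j = 0" "k = 2" | "j = 0" "k = 3" | "j = 1" "k = 1" | "j = 1" "k = 2"
      | "j = 1" "k = 3" | "j = 2" "k = 2" | "j = 2" "k = 3" | "j = 3" "k = 3"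
      using jk less_4_cases[of j] less_4_cases[of k] by auto
    then show ?thesis
    proof cases
      case 1 then show ?thesis by (intro comb[of _ 1 0 0 0]) (simp add: rbase_def)
    next
      case 2 then show ?thesis by (intro comb[of _ 0 1 0 0]) (simp add: rbase_def)
    next
      case 3 then show ?thesis by (intro comb[of _ 0 0 1 0]) (simp add: rbase_def)
    next
      case 4 then show ?thesis by (intro comb[of _ 0 0 0 1]) (simp add: rbase_def)
    next
      case 5 then show ?thesis by (intro comb[of _ 0 "- f1" 1 0]) (simp add: rbase_mult del: One_nat_def)
    next
      case 6 then show ?thesis by (intro comb[of _ 0 "- f2" 0 1]) (simp add: rbase_mult del: One_nat_def)
    next
      case 7 then show ?thesis by (intro comb[of _ "- f4" "- f3" 0 0]) (simp add: rbase_mult del: One_nat_def)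
    next
      case 8 then show ?thesis by (intro comb[of _ "- f4" "- f3" "- f2" f1]) (simp add: rbase_mult del: One_nat_def)
    next
      case 9 then show ?thesis by (intro comb[of _ "- (f1 * f4)" "- f4" "- f3" 0]) (simp add: rbase_mult del: One_nat_def)
    next
      case 10 then show ?thesis by (intro comb[of _ "- (f2 * f4)" 0 "- f4" "- f3"]) (simp add: rbase_mult del: One_nat_def)
    qed
  qed
  show "\<exists>m :: nat \<Rightarrow> int. \<forall>i<4. rbase i j * rbase i k = (\<Sum>l<4. of_int (m l) * rbase i l)"
    if "j < 4" "k < 4" for j k
    using le[of j k] le[of k j] that by (cases "j \<le> k") (simp_all add: mult.commute)
qed (auto simp: rbase_def)

lemma cbase_lattice: "lattice_order 3 cbase"
proof
  show "det (mat 3 3 (\<lambda>(i, k). cbase i k)) \<noteq> 0" using det_cbase vdm_nonzero by simp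
  have comb: "\<exists>m :: nat \<Rightarrow> int. \<forall>i<3. v i = (\<Sum>l<3. of_int (m l) * cbase i l)"
    if "\<And>i. i < 3 \<Longrightarrow> v i = of_int a + of_int b * cbase i 1 + of_int c * cbase i 2"
    for v :: "nat \<Rightarrow> complex" and a b c :: int
    by (rule exI[of _ "\<lambda>l. if l = 0 then a else if l = 1 then b else c"])
      (use that in \<open>simp add: sum_lessThan_3 cbase_def[of _ 0] del: One_nat_def\<close>)
  let ?p = "f1 * f3 - 4 * f4" and ?q = "f1\<^sup>2 * f4 + f3\<^sup>2 - 4 * f2 * f4"
  have le: "\<exists>m :: nat \<Rightarrow> int. \<forall>i<3. cbase i j * cbase i k = (\<Sum>l<3. of_int (m l) * cbase i l)"
    if jk: "j \<le> k" "k < 3" for j k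
  proof -
    consider "j = 0" "k = 0" | "j = 0" "k = 1" | "j = 0" "k = 2" | "j = 1" "k = 1" | "j = 1" "k = 2" | "j = 2" "k = 2"
      using jk less_3_cases[of j] less_3_cases[of k] by auto
    then show ?thesis
    proof cases
      case 1 then show ?thesis by (intro comb[of _ 1 0 0]) (simp add: cbase_def)
    next
      case 2 then show ?thesis by (intro comb[of _ 0 1 0]) (simp add: cbase_def)
    next
      case 3 then show ?thesis by (intro comb[of _ 0 0 1]) (simp add: cbase_def)
    next
      case 4 then show ?thesis by (intro comb[of _ 0 f2 1]) (simp add: cbase_mult del: One_nat_def)
    next
      case 5 then show ?thesis by (intro comb[of _ ?q "- ?p" 0]) (simp add: cbase_mult del: One_nat_def)
    next
      case 6 then show ?thesis by (intro comb[of _ "- (f2 * ?q)" ?q "- ?p"]) (simp add: cbase_mult del: One_nat_def)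
    qed
  qed
  show "\<exists>m :: nat \<Rightarrow> int. \<forall>i<3. cbase i j * cbase i k = (\<Sum>l<3. of_int (m l) * cbase i l)"
    if "j < 3" "k < 3" for j k
    using le[of j k] le[of k j] that by (cases "j \<le> k") (simp_all add: mult.commute)
qed (auto simp: cbase_def)

definition RR :: "int list ring" where "RR = lat_ring 4 rbase"
definition CC :: "int list ring" where "CC = lat_ring 3 cbase"

text \<open>The coordinate of \<phi> at 1. The forms do not see it, but \<phi> has to be an actual
  map into \<open>CC\<close>.\<close>

definition phi_const :: "int \<Rightarrow> int \<Rightarrow> int \<Rightarrow> int \<Rightarrow> int" where
  "phi_const k x y z = 2 * k\<^sup>2 - k * (f1 * x + 2 * f2 * y + 3 * f3 * z) + f3 * x * y + 4 * f4 * x * z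
     + (f1 * f3 - 2 * f4) * y\<^sup>2 + (f2 * f3 + f1 * f4) * y * z + f3\<^sup>2 * z\<^sup>2"

definition AA :: ternary_form where
  "AA x y z = x\<^sup>2 + f1 * x * y + f2 * y\<^sup>2 + f3 * y * z + f4 * z\<^sup>2"

definition \<Phi> :: "int list \<Rightarrow> int list" where
  "\<Phi> xs = [phi_const (xs ! 0) (xs ! 1) (xs ! 2) (xs ! 3), AA (xs ! 1) (xs ! 2) (xs ! 3),
     form_B (xs ! 1) (xs ! 2) (xs ! 3)]"

text \<open>By \<open>resolv_expand\<close> it is enough to know the traces of the basis vectors and
  the resolvents of these vectors and of their pairwise sums, which are polynomial identities in the
  roots.\<close>

lemma resolv_pencil:
  fixes k x y z :: complex
  assumes j: "j < 3"
  shows "resolv (\<lambda>i. k + x * rbase i 1 + y * rbase i 2 + z * rbase i 3) j =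
     (2 * k\<^sup>2 - k * (of_int f1 * x + 2 * of_int f2 * y + 3 * of_int f3 * z) + of_int f3 * x * y + 4 * of_int f4 * x * z
     + (of_int f1 * of_int f3 - 2 * of_int f4) * y\<^sup>2 + (of_int f2 * of_int f3 + of_int f1 * of_int f4) * y * z + (of_int f3)\<^sup>2 * z\<^sup>2)
     + (x\<^sup>2 + of_int f1 * x * y + of_int f2 * y\<^sup>2 + of_int f3 * y * z + of_int f4 * z\<^sup>2) * cbase j 1
     + (y\<^sup>2 - x * z) * cbase j 2"
proof -
  note d = rbase_def cbase_def cubic_root_def vieta
  have tr: "rbase 0 1 + rbase 1 1 + rbase 2 1 + rbase 3 1 = - of_int f1"
    "rbase 0 2 + rbase 1 2 + rbase 2 2 + rbase 3 2 = - 2 * of_int f2"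
    "rbase 0 3 + rbase 1 3 + rbase 2 3 + rbase 3 3 = - 3 * of_int f3"
    by (simp_all add: d algebra_simps power2_eq_square power3_eq_cube)
  have sq: "resolv (\<lambda>i. rbase i 1) j = cbase j 1"
    "resolv (\<lambda>i. rbase i 2) j = (of_int f1 * of_int f3 - 2 * of_int f4) + of_int f2 * cbase j 1 + cbase j 2"
    "resolv (\<lambda>i. rbase i 3) j = (of_int f3)\<^sup>2 + of_int f4 * cbase j 1"
    using j unfolding less_3_cases by (elim disjE; simp add: d resolv_def algebra_simps power2_eq_square power3_eq_cube)+
  have cross: "resolv (\<lambda>i. rbase i 1 + rbase i 2) j - resolv (\<lambda>i. rbase i 1) j - resolv (\<lambda>i. rbase i 2) j
      = of_int f3 + of_int f1 * cbase j 1"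
    "resolv (\<lambda>i. rbase i 1 + rbase i 3) j - resolv (\<lambda>i. rbase i 1) j - resolv (\<lambda>i. rbase i 3) j
      = 4 * of_int f4 - cbase j 2"
    "resolv (\<lambda>i. rbase i 2 + rbase i 3) j - resolv (\<lambda>i. rbase i 2) j - resolv (\<lambda>i. rbase i 3) j
      = of_int f2 * of_int f3 + of_int f1 * of_int f4 + of_int f3 * cbase j 1"
    using j unfolding less_3_cases by (elim disjE; simp add: d resolv_def algebra_simps power2_eq_square power3_eq_cube)+
  show ?thesis unfolding resolv_expand tr unfolding cross unfolding sq by (simp add: algebra_simps)
qed

end

context quartic_roots
begin

interpretation L4: lattice_order 4 rbase by (rule rbase_lattice)
interpretation L3: lattice_order 3 cbase by (rule cbase_lattice)

definition \<sigma>R :: "nat \<Rightarrow> int list \<Rightarrow> complex" where "\<sigma>R = lat_hom 4 rbase"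
definition \<tau>C :: "nat \<Rightarrow> int list \<Rightarrow> complex" where "\<tau>C = lat_hom 3 cbase"

lemma carriers: "carrier RR = {xs. length xs = 4}" "carrier CC = {xs. length xs = 3}"
  by (simp_all add: RR_def CC_def)

lemma embedded_RR: "embedded_ring 4 RR \<sigma>R"
  unfolding RR_def \<sigma>R_def by (rule L4.embedded_lat)

lemma embedded_CC: "embedded_ring 3 CC \<tau>C"
  unfolding CC_def \<tau>C_def by (rule L3.embedded_lat)

lemma \<sigma>R_eq: "length xs = 4 \<Longrightarrow> \<sigma>R i xs =
    of_int (xs ! 0) + of_int (xs ! 1) * rbase i 1 + of_int (xs ! 2) * rbase i 2 + of_int (xs ! 3) * rbase i 3"
  by (simp add: \<sigma>R_def lat_hom_eq lat_eval_def sum_lessThan_4 rbase_def[of _ 0] del: One_nat_def)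

lemma \<tau>C_eq: "length xs = 3 \<Longrightarrow> \<tau>C j xs = of_int (xs ! 0) + of_int (xs ! 1) * cbase j 1 + of_int (xs ! 2) * cbase j 2"
  by (simp add: \<tau>C_def lat_hom_eq lat_eval_def sum_lessThan_3 cbase_def[of _ 0] del: One_nat_def)

lemma unital_unit: "unital_basis 4 RR (unit_list 4)" "unital_basis 3 CC (unit_list 3)"
  using L4.int_basis_unit L3.int_basis_unit
  by (auto simp: unital_basis_def RR_def CC_def) (simp_all add: lat_ring_def unit_list_def)

lemma \<sigma>R_unit: "k < 4 \<Longrightarrow> \<sigma>R i (unit_list 4 k) = rbase i k"
  by (simp add: \<sigma>R_def lat_hom_eq lat_eval_unit)

lemma \<tau>C_unit: "k < 3 \<Longrightarrow> \<tau>C j (unit_list 3 k) = cbase j k"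
  by (simp add: \<tau>C_def lat_hom_eq lat_eval_unit)

lemma disc_RR: "of_int (ring_disc 4 RR) = vdm\<^sup>2"
proof -
  interpret embedded_ring 4 RR \<sigma>R by (rule embedded_RR)
  have "emb (unit_list 4) = mat 4 4 (\<lambda>(i, k). rbase i k)"
    by (rule eq_matI) (auto simp: emb_def \<sigma>R_unit)
  then show ?thesis using ring_disc_eq[of "unit_list 4"] unital_unit det_rbase by (simp add: unital_basis_def)
qed

lemma disc_CC: "of_int (ring_disc 3 CC) = vdm\<^sup>2"
proof -
  interpret embedded_ring 3 CC \<tau>C by (rule embedded_CC)
  have "emb (unit_list 3) = mat 3 3 (\<lambda>(i, k). cbase i k)"
    by (rule eq_matI) (auto simp: emb_def \<tau>C_unit)
  then show ?thesis using ring_disc_eq[of "unit_list 3"] unital_unit det_cbase by (simp add: unital_basis_def)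
qed

lemma embedded_pair: "embedded_pair RR \<sigma>R CC \<tau>C \<Phi>"
proof -
  interpret R: embedded_ring 4 RR \<sigma>R by (rule embedded_RR)
  interpret C: embedded_ring 3 CC \<tau>C by (rule embedded_CC)
  show ?thesis
  proof unfold_locales
    have "complex_of_int (ring_disc 3 CC) = of_int (ring_disc 4 RR)" by (simp only: disc_RR disc_CC)
    then show "ring_disc 3 CC = ring_disc 4 RR" by simp
    show "\<Phi> \<in> carrier RR \<rightarrow> carrier CC" by (auto simp: carriers \<Phi>_def)
    fix x j assume x: "x \<in> carrier RR" and j: "j < (3::nat)"
    have "resolv (\<lambda>i. \<sigma>R i x) j = resolv (\<lambda>i. of_int (x ! 0) + of_int (x ! 1) * rbase i 1
        + of_int (x ! 2) * rbase i 2 + of_int (x ! 3) * rbase i 3) j"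
      using x by (intro resolv_cong) (simp add: \<sigma>R_eq carriers del: One_nat_def)
    also have "\<dots> = \<tau>C j (\<Phi> x)"
      unfolding resolv_pencil[OF j] \<Phi>_def
      by (subst \<tau>C_eq) (simp_all add: phi_const_def AA_def form_B_def)
    finally show "\<tau>C j (\<Phi> x) = resolv (\<lambda>i. \<sigma>R i x) j" ..
  qed
qed

lemma form_witness: "form_witness RR CC \<Phi> AA form_B (unit_list 4) (unit_list 3)"
  unfolding form_witness_def
proof (intro conjI unital_unit allI)
  interpret P: embedded_pair RR \<sigma>R CC \<tau>C \<Phi> by (rule embedded_pair)
  fix x y z :: int
  let ?v = "[x] \<cdot>\<^bsub>RR\<^esub> unit_list 4 1 \<oplus>\<^bsub>RR\<^esub> [y] \<cdot>\<^bsub>RR\<^esub> unit_list 4 2 \<oplus>\<^bsub>RR\<^esub> [z] \<cdot>\<^bsub>RR\<^esub> unit_list 4 3"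
  have u: "unit_list 4 k \<in> carrier RR" "unit_list 3 k \<in> carrier CC" for k by (simp_all add: carriers)
  have v: "?v = [0, x, y, z]"
    by (rule P.R.emb_inj)
      (simp_all add: P.R.emb_add P.R.emb_int_mult u \<sigma>R_unit, simp_all add: carriers \<sigma>R_eq)
  have "\<Phi> [0, x, y, z] = [phi_const 0 x y z] \<cdot>\<^bsub>CC\<^esub> \<one>\<^bsub>CC\<^esub> \<oplus>\<^bsub>CC\<^esub> [AA x y z] \<cdot>\<^bsub>CC\<^esub> unit_list 3 1 \<oplus>\<^bsub>CC\<^esub> [form_B x y z] \<cdot>\<^bsub>CC\<^esub> unit_list 3 2"
    by (rule P.C.emb_inj)
      (simp_all add: P.C.emb_add P.C.emb_int_mult P.C.emb_one u \<tau>C_unit \<Phi>_def, simp_all add: carriers \<tau>C_eq)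
  then show "\<exists>k :: int. \<Phi> ?v = [k] \<cdot>\<^bsub>CC\<^esub> \<one>\<^bsub>CC\<^esub> \<oplus>\<^bsub>CC\<^esub> [AA x y z] \<cdot>\<^bsub>CC\<^esub> unit_list 3 1 \<oplus>\<^bsub>CC\<^esub> [form_B x y z] \<cdot>\<^bsub>CC\<^esub> unit_list 3 2"
    unfolding v by blast
qed

lemma model_in_class: "(RR, CC, \<Phi>) \<in> pair_class AA form_B"
  using form_witness quartic_pairsI[OF embedded_pair] by (auto simp: pair_class_def has_forms_iff)

lemma pair_disc_model: "pair_disc (RR, CC, \<Phi>) = (cmod vdm)\<^sup>2"
  using arg_cong[OF disc_RR, of cmod] by (simp add: pair_disc_def norm_power)

end

section \<open>Monic polynomials, their roots and their classes\<close>

definition monic_quartic :: "int \<Rightarrow> int \<Rightarrow> int \<Rightarrow> int \<Rightarrow> int poly" where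
  "monic_quartic f1 f2 f3 f4 = [:f4, f3, f2, f1, 1:]"

lemma monic_quartic_coeffs:
  "coeff (monic_quartic f1 f2 f3 f4) 4 = 1" "coeff (monic_quartic f1 f2 f3 f4) 3 = f1"
  "coeff (monic_quartic f1 f2 f3 f4) 2 = f2" "coeff (monic_quartic f1 f2 f3 f4) 1 = f3"
  "coeff (monic_quartic f1 f2 f3 f4) 0 = f4" "degree (monic_quartic f1 f2 f3 f4) = 4"
  "lead_coeff (monic_quartic f1 f2 f3 f4) = 1"
  by (simp_all add: monic_quartic_def eval_nat_numeral)

lemma monic_quarticE:
  assumes "degree f = 4" "lead_coeff f = 1"
  shows "f = monic_quartic (coeff f 3) (coeff f 2) (coeff f 1) (coeff f 0)"
proof (rule poly_eqI)
  fix n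
  show "coeff f n = coeff (monic_quartic (coeff f 3) (coeff f 2) (coeff f 1) (coeff f 0)) n"
  proof (cases "n \<le> 4")
    case True
    then have "n = 0 \<or> n = 1 \<or> n = 2 \<or> n = 3 \<or> n = 4" by auto
    then show ?thesis using assms by (auto simp: monic_quartic_coeffs simp del: One_nat_def)
  next
    case False
    then show ?thesis using assms(1) by (simp add: coeff_eq_0 monic_quartic_coeffs)
  qed
qed

definition has_roots :: "int poly \<Rightarrow> (nat \<Rightarrow> complex) \<Rightarrow> bool" where
  "has_roots f t \<longleftrightarrow> map_poly of_int f = [:- t 0, 1:] * [:- t 1, 1:] * [:- t 2, 1:] * [:- t 3, 1:]"

lemma roots_exist:
  assumes "degree f = 4" "lead_coeff f = 1"
  obtains t where "has_roots f t"
proof -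
  let ?f = "map_poly of_int f :: complex poly"
  have d: "degree ?f = 4" "lead_coeff ?f = 1" using assms by simp_all
  then obtain A where A: "size A = 4" "?f = (\<Prod>x\<in>#A. [:-x, 1:])"
    using alg_closed_imp_factorization[of ?f] by fastforce
  obtain xs where xs: "mset xs = A" using ex_mset by blast
  then have "length xs = 4" using A(1) by auto
  then obtain a b c d where "xs = [a, b, c, d]"
    by (auto simp: length_Suc_conv eval_nat_numeral)
  then have "?f = [:-a, 1:] * [:-b, 1:] * [:-c, 1:] * [:-d, 1:]"
    using A(2) xs by (auto simp: algebra_simps)
  then have "has_roots f ((!) [a, b, c, d])" by (simp add: has_roots_def)
  then show ?thesis by (rule that)
qed

lemma has_roots_vieta:
  assumes "has_roots (monic_quartic f1 f2 f3 f4) t"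
  shows "of_int f1 = - (t 0 + t 1 + t 2 + t 3)"
    "of_int f2 = t 0 * t 1 + t 0 * t 2 + t 0 * t 3 + t 1 * t 2 + t 1 * t 3 + t 2 * t 3"
    "of_int f3 = - (t 0 * t 1 * t 2 + t 0 * t 1 * t 3 + t 0 * t 2 * t 3 + t 1 * t 2 * t 3)"
    "of_int f4 = t 0 * t 1 * t 2 * t 3"
proof -
  have "[:of_int f4, of_int f3, of_int f2, of_int f1, 1:] = [:- t 0, 1:] * [:- t 1, 1:] * [:- t 2, 1:] * [:- t 3, 1:]"
    using assms by (simp add: has_roots_def monic_quartic_def of_int_hom.map_poly_pCons_hom)
  then show "of_int f1 = - (t 0 + t 1 + t 2 + t 3)"
    "of_int f2 = t 0 * t 1 + t 0 * t 2 + t 0 * t 3 + t 1 * t 2 + t 1 * t 3 + t 2 * t 3"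
    "of_int f3 = - (t 0 * t 1 * t 2 + t 0 * t 1 * t 3 + t 0 * t 2 * t 3 + t 1 * t 2 * t 3)"
    "of_int f4 = t 0 * t 1 * t 2 * t 3"
    by (simp_all add: algebra_simps)
qed

lemma has_roots_poly: "has_roots f t \<Longrightarrow> poly (map_poly of_int f) x = (x - t 0) * (x - t 1) * (x - t 2) * (x - t 3)"
  by (simp add: has_roots_def algebra_simps)

lemma inj_on_4_iff: "inj_on t {..<4::nat} \<longleftrightarrow> t 0 \<noteq> t 1 \<and> t 0 \<noteq> t 2 \<and> t 0 \<noteq> t 3 \<and> t 1 \<noteq> t 2 \<and> t 1 \<noteq> t 3 \<and> t 2 \<noteq> t 3"
  unfolding lessThan_numerals(1)[symmetric] by (auto simp: inj_on_def)

lemma pderiv_roots: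
  assumes "has_roots f t"
  shows "poly (pderiv (map_poly of_int f)) x = (x - t 1) * (x - t 2) * (x - t 3) + (x - t 0) * (x - t 2) * (x - t 3)
     + (x - t 0) * (x - t 1) * (x - t 3) + (x - t 0) * (x - t 1) * (x - t 2)"
  using assms unfolding has_roots_def by (simp add: pderiv_mult pderiv_pCons algebra_simps)

text \<open>Only the vanishing of \<open>monic_disc\<close> has to be understood, since sizes are
  measured by the product of root differences. The resultant vanishes exactly when the polynomial
  and its derivative share a root.\<close>

lemma monic_disc_nonzero_iff:
  assumes "degree f = 4" "lead_coeff f = 1" and t: "has_roots f t"
  shows "monic_disc f \<noteq> 0 \<longleftrightarrow> inj_on t {..<4}"
proof -
  let ?f = "map_poly of_int f :: complex poly"
  have f0: "?f \<noteq> 0" using assms by auto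
  have "monic_disc f = 0 \<longleftrightarrow> resultant f (pderiv f) = 0"
    by (simp add: monic_disc_def)
  also have "\<dots> \<longleftrightarrow> resultant ?f (pderiv ?f) = 0"
    by (simp add: of_int_hom.resultant_hom flip: of_int_hom.map_poly_pderiv)
  also have "\<dots> \<longleftrightarrow> degree (gcd ?f (pderiv ?f)) \<noteq> 0"
    by (rule div_exp_Lazard_gcd.resultant_0_gcd)
  also have "\<dots> \<longleftrightarrow> (\<exists>x. poly ?f x = 0 \<and> poly (pderiv ?f) x = 0)"
  proof
    assume "degree (gcd ?f (pderiv ?f)) \<noteq> 0"
    then obtain x where "poly (gcd ?f (pderiv ?f)) x = 0"
      using alg_closed_imp_poly_has_root by blast
    then have "[:- x, 1:] dvd gcd ?f (pderiv ?f)" by (simp only: poly_eq_0_iff_dvd)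
    then have "[:- x, 1:] dvd ?f" "[:- x, 1:] dvd pderiv ?f" by simp_all
    then show "\<exists>x. poly ?f x = 0 \<and> poly (pderiv ?f) x = 0"
      by (intro exI[of _ x]) (simp only: poly_eq_0_iff_dvd)
  next
    assume "\<exists>x. poly ?f x = 0 \<and> poly (pderiv ?f) x = 0"
    then obtain x where "[:-x, 1:] dvd ?f" "[:-x, 1:] dvd pderiv ?f"
      by (auto simp only: poly_eq_0_iff_dvd)
    then have "[:-x, 1:] dvd gcd ?f (pderiv ?f)" by (rule gcd_greatest)
    moreover have "gcd ?f (pderiv ?f) \<noteq> 0" using f0 by simp
    ultimately have "degree [:-x, 1:] \<le> degree (gcd ?f (pderiv ?f))" by (rule dvd_imp_degree_le)
    then show "degree (gcd ?f (pderiv ?f)) \<noteq> 0" by simp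
  qed
  also have "\<dots> \<longleftrightarrow> \<not> inj_on t {..<4}"
  proof -
    have "poly ?f x = 0 \<longleftrightarrow> x \<in> {t 0, t 1, t 2, t 3}" for x by (simp add: has_roots_poly[OF t])
    then have "(\<exists>x. poly ?f x = 0 \<and> poly (pderiv ?f) x = 0) \<longleftrightarrow> (\<exists>x\<in>{t 0, t 1, t 2, t 3}. poly (pderiv ?f) x = 0)"
      by blast
    also have "\<dots> \<longleftrightarrow> t 0 = t 1 \<or> t 0 = t 2 \<or> t 0 = t 3 \<or> t 1 = t 2 \<or> t 1 = t 3 \<or> t 2 = t 3"
    proof -
      have "poly (pderiv ?f) (t 0) = (t 0 - t 1) * (t 0 - t 2) * (t 0 - t 3)"
        "poly (pderiv ?f) (t 1) = (t 1 - t 0) * (t 1 - t 2) * (t 1 - t 3)"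
        "poly (pderiv ?f) (t 2) = (t 2 - t 0) * (t 2 - t 1) * (t 2 - t 3)"
        "poly (pderiv ?f) (t 3) = (t 3 - t 0) * (t 3 - t 1) * (t 3 - t 2)"
        by (simp_all add: pderiv_roots[OF t])
      then have "(\<exists>x\<in>{t 0, t 1, t 2, t 3}. poly (pderiv ?f) x = 0) \<longleftrightarrow>
          ((t 0 = t 1 \<or> t 0 = t 2) \<or> t 0 = t 3) \<or> ((t 1 = t 0 \<or> t 1 = t 2) \<or> t 1 = t 3) \<or>
          ((t 2 = t 0 \<or> t 2 = t 1) \<or> t 2 = t 3) \<or> ((t 3 = t 0 \<or> t 3 = t 1) \<or> t 3 = t 2)"
        by (simp only: bex_simps mult_eq_0_iff right_minus_eq) blast
      then show ?thesis by metis
    qed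
    finally show ?thesis unfolding inj_on_4_iff by blast
  qed
  finally show ?thesis by blast
qed

lemma F4_monE:
  assumes "f \<in> F4_mon"
  obtains f1 f2 f3 f4 t where "f = monic_quartic f1 f2 f3 f4" "has_roots f t" "quartic_roots f1 f2 f3 f4 t"
proof -
  have f: "degree f = 4" "lead_coeff f = 1" "monic_disc f \<noteq> 0" using assms by (auto simp: F4_mon_def)
  obtain t where t: "has_roots f t" using roots_exist[OF f(1,2)] .
  have e: "f = monic_quartic (coeff f 3) (coeff f 2) (coeff f 1) (coeff f 0)" by (rule monic_quarticE[OF f(1,2)])
  have "quartic_roots (coeff f 3) (coeff f 2) (coeff f 1) (coeff f 0) t"
    using has_roots_vieta[of "coeff f 3" "coeff f 2" "coeff f 1" "coeff f 0" t] t e monic_disc_nonzero_iff[OF f(1,2) t] f(3)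
    by unfold_locales auto
  with e t show ?thesis by (rule that)
qed

lemma (in quartic_roots) psi_mon_eq: "psi_mon (monic_quartic f1 f2 f3 f4) = pair_class AA form_B"
proof -
  have "form_A (homogenization (monic_quartic f1 f2 f3 f4)) = AA"
    using monic_quartic_coeffs[of f1 f2 f3 f4]
    by (simp add: fun_eq_iff form_A_def AA_def homogenization_def)
  then show ?thesis by (simp add: psi_mon_def psi_form_def)
qed

lemma (in quartic_roots) psi_mon_class: "psi_mon (monic_quartic f1 f2 f3 f4) = pair_iso `` {(RR, CC, \<Phi>)}"
  using psi_mon_eq pair_class_eq[OF model_in_class] by simp

lemma psi_mon_quotient: "psi_mon ` F4_mon \<subseteq> quartic_pairs // pair_iso"
proof
  fix K assume "K \<in> psi_mon ` F4_mon"
  then obtain f where f: "f \<in> F4_mon" "K = psi_mon f" by blast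
  obtain f1 f2 f3 f4 t where "f = monic_quartic f1 f2 f3 f4" "quartic_roots f1 f2 f3 f4 t"
    by (rule F4_monE[OF f(1)])
  then interpret quartic_roots f1 f2 f3 f4 t by simp
  have "(RR, CC, \<Phi>) \<in> quartic_pairs" by (rule quartic_pairsI[OF embedded_pair])
  then show "K \<in> quartic_pairs // pair_iso"
    using psi_mon_class f \<open>f = _\<close> by (auto simp: quotient_def)
qed

section \<open>Reduced bases and successive minima\<close>

context embedded_ring
begin

lemma basis_replace:
  fixes c :: "nat \<Rightarrow> int"
  assumes b: "int_basis R n b" and j: "j < n" and cj: "c j = 1 \<or> c j = -1" and u: "u \<in> carrier R"
    and ueq: "\<And>i. i < n \<Longrightarrow> \<sigma> i u = (\<Sum>l<n. of_int (c l) * \<sigma> i (b l))"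
  shows "int_basis R n (b(j := u))"
proof (rule int_basisI)
  show "b(j := u) \<in> {..<n} \<rightarrow> carrier R" using basis_closed[OF b] u by auto
  fix x assume x: "x \<in> carrier R"
  obtain d where d: "\<And>i. i < n \<Longrightarrow> \<sigma> i x = (\<Sum>k<n. of_int (d k) * \<sigma> i (b k))"
    using basis_coords[OF b x] by blast
  have cc: "c j * c j = 1" using cj by auto
  \<comment> \<open>The old vector \<open>b j\<close> is \<open>c j\<close> times \<open>u\<close>
    minus the other terms, because \<open>c j\<close> is its own inverse; these are the resulting
    coordinates of \<open>x\<close>.\<close>
  let ?d = "\<lambda>l. if l = j then d j * c j else d l - d j * c j * c l"
  have "\<sigma> i x = (\<Sum>k<n. of_int (?d k) * \<sigma> i ((b(j := u)) k))" if i: "i < n" for i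
  proof -
    let ?T = "{..<n} - {j}"
    have "(\<Sum>k<n. of_int (?d k) * \<sigma> i ((b(j := u)) k))
        = of_int (d j * c j) * \<sigma> i u + (\<Sum>k\<in>?T. of_int (d k - d j * c j * c k) * \<sigma> i (b k))"
      using j by (subst sum.remove[of _ j]) (auto intro!: sum.cong)
    also have "\<sigma> i u = of_int (c j) * \<sigma> i (b j) + (\<Sum>k\<in>?T. of_int (c k) * \<sigma> i (b k))"
      using j ueq[OF i] by (simp add: sum.remove[of _ j])
    also have "(\<Sum>k\<in>?T. of_int (d k - d j * c j * c k) * \<sigma> i (b k))
        = (\<Sum>k\<in>?T. of_int (d k) * \<sigma> i (b k)) - of_int (d j * c j) * (\<Sum>k\<in>?T. of_int (c k) * \<sigma> i (b k))"
      by (simp add: left_diff_distrib sum_subtractf sum_distrib_left mult.assoc)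
    also have "of_int (d j * c j) * (of_int (c j) * \<sigma> i (b j) + (\<Sum>k\<in>?T. of_int (c k) * \<sigma> i (b k)))
        + ((\<Sum>k\<in>?T. of_int (d k) * \<sigma> i (b k)) - of_int (d j * c j) * (\<Sum>k\<in>?T. of_int (c k) * \<sigma> i (b k)))
        = of_int (d j * (c j * c j)) * \<sigma> i (b j) + (\<Sum>k\<in>?T. of_int (d k) * \<sigma> i (b k))"
      by (simp add: distrib_left mult.assoc)
    also have "\<dots> = (\<Sum>k<n. of_int (d k) * \<sigma> i (b k))"
      unfolding cc using j by (subst sum.remove[of "{..<n}" j]) auto
    also have "\<dots> = \<sigma> i x" using d[OF i] by (rule sym)
    finally show ?thesis ..
  qed
  then show "\<exists>c :: nat \<Rightarrow> int. \<forall>i<n. \<sigma> i x = (\<Sum>k<n. of_int (c k) * \<sigma> i ((b(j := u)) k))"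
    by (intro exI[of _ ?d]) blast
qed

lemma basis_permute:
  assumes b: "int_basis R n b" and p: "bij_betw p {..<n} {..<n}"
  shows "int_basis R n (\<lambda>k. b (p k))"
proof (rule int_basisI)
  show "(\<lambda>k. b (p k)) \<in> {..<n} \<rightarrow> carrier R" using basis_closed[OF b] bij_betwE[OF p] by auto
  fix x assume x: "x \<in> carrier R"
  obtain d where d: "\<And>i. i < n \<Longrightarrow> \<sigma> i x = (\<Sum>k<n. of_int (d k) * \<sigma> i (b k))"
    using basis_coords[OF b x] by blast
  have "\<sigma> i x = (\<Sum>k<n. of_int (d (p k)) * \<sigma> i (b (p k)))" if i: "i < n" for i
    unfolding d[OF i] using sum.reindex_bij_betw[OF p, of "\<lambda>k. of_int (d k) * \<sigma> i (b k)"] by (rule sym)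
  then show "\<exists>c :: nat \<Rightarrow> int. \<forall>i<n. \<sigma> i x = (\<Sum>k<n. of_int (c k) * \<sigma> i (b (p k)))"
    by (intro exI[of _ "\<lambda>k. d (p k)"]) blast
qed

text \<open>Euclid's algorithm on the coordinates from \<open>k\<close> on.\<close>

lemma concentrate_coords:
  fixes c :: "nat \<Rightarrow> int"
  assumes "int_basis R n b" "\<And>i. i < n \<Longrightarrow> \<sigma> i u = (\<Sum>l<n. of_int (c l) * \<sigma> i (b l))"
    "k \<le> l" "l < n" "c l \<noteq> 0"
  shows "\<exists>b' c' l'. int_basis R n b' \<and> (\<forall>j<k. b' j = b j) \<and> k \<le> l' \<and> l' < n \<and> c' l' \<noteq> 0 \<and>
    (\<forall>j. k \<le> j \<longrightarrow> j < n \<longrightarrow> j \<noteq> l' \<longrightarrow> c' j = 0) \<and>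
    (\<forall>i<n. \<sigma> i u = (\<Sum>l<n. of_int (c' l :: int) * \<sigma> i (b' l)))"
  using assms
proof (induction "\<Sum>j\<in>{k..<n}. nat \<bar>c j\<bar>" arbitrary: b c l rule: less_induct)
  case less
  note b = less.prems(1) and u = less.prems(2) and l = less.prems(3-5)
  show ?case
  proof (cases "\<exists>i j. k \<le> i \<and> i < n \<and> k \<le> j \<and> j < n \<and> i \<noteq> j \<and> c i \<noteq> 0 \<and> c j \<noteq> 0")
    case False
    then have "\<forall>j. k \<le> j \<longrightarrow> j < n \<longrightarrow> j \<noteq> l \<longrightarrow> c j = 0" using l by blast
    then show ?thesis using b u l by blast
  next
    case True
    then obtain i j where ij: "k \<le> i" "i < n" "k \<le> j" "j < n" "i \<noteq> j" "c i \<noteq> 0" "c j \<noteq> 0" "\<bar>c j\<bar> \<le> \<bar>c i\<bar>"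
      by (metis linear)
    \<comment> \<open>One subtractive step: adding \<open>s\<close> times \<open>b i\<close> to
      \<open>b j\<close> keeps the vector \<open>u\<close> if \<open>c i\<close> is replaced by
      \<open>c i - s * c j\<close>. With this sign, the modulus of \<open>c i\<close> drops by that
      of \<open>c j\<close>.\<close>
    define s where "s = sgn (c i) * sgn (c j)"
    have dec: "\<bar>c i - s * c j\<bar> < \<bar>c i\<bar>" using ij(6-8) by (auto simp: s_def sgn_if split: if_splits)
    let ?v = "b j \<oplus>\<^bsub>R\<^esub> [s] \<cdot>\<^bsub>R\<^esub> b i"
    have bc: "b i \<in> carrier R" "b j \<in> carrier R" using basis_closed[OF b] ij by auto
    let ?c = "c(i := c i - s * c j)" and ?b = "b(j := ?v)"
    have v: "\<sigma> m ?v = \<sigma> m (b j) + of_int s * \<sigma> m (b i)" if "m < n" for m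
      using bc that by (simp add: emb_add emb_int_mult)
    have sumij: "(\<Sum>l<n. f l) = f i + f j + (\<Sum>l\<in>{..<n} - {i, j}. f l)" for f :: "nat \<Rightarrow> complex"
    proof -
      have "{..<n} - {i} - {j} = {..<n} - {i, j}" by blast
      then show ?thesis using ij sum.remove[of "{..<n}" i f] sum.remove[of "{..<n} - {i}" j f] by simp
    qed
    have "int_basis R n ?b"
    proof (rule basis_replace[OF b ij(4), of "\<lambda>l. if l = j then 1 else if l = i then s else 0"])
      fix m assume m: "m < n"
      show "\<sigma> m ?v = (\<Sum>l<n. of_int (if l = j then 1 else if l = i then s else 0) * \<sigma> m (b l))"
        unfolding v[OF m] sumij using ij by simp
    qed (use bc in auto)
    moreover have "\<sigma> m u = (\<Sum>l<n. of_int (?c l) * \<sigma> m (?b l))" if m: "m < n" for m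
    proof -
      have "(\<Sum>l\<in>{..<n} - {i, j}. of_int (?c l) * \<sigma> m (?b l)) = (\<Sum>l\<in>{..<n} - {i, j}. of_int (c l) * \<sigma> m (b l))"
        by (intro sum.cong) auto
      then show ?thesis unfolding u[OF m] sumij using ij v[OF m] by (simp add: algebra_simps)
    qed
    moreover have "(\<Sum>j\<in>{k..<n}. nat \<bar>?c j\<bar>) < (\<Sum>j\<in>{k..<n}. nat \<bar>c j\<bar>)"
      using ij dec by (intro sum_strict_mono_ex1) auto
    moreover have "?c j \<noteq> 0" using ij by simp
    ultimately obtain b' c' l' where b': "int_basis R n b'" "\<forall>m<k. b' m = ?b m" "k \<le> l'" "l' < n" "c' l' \<noteq> 0"
      "\<forall>j. k \<le> j \<longrightarrow> j < n \<longrightarrow> j \<noteq> l' \<longrightarrow> c' j = 0"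
      "\<forall>i<n. \<sigma> i u = (\<Sum>l<n. of_int (c' l :: int) * \<sigma> i (b' l))"
      using less.hyps[of ?c ?b j] ij by blast
    moreover have "\<forall>m<k. b' m = b m" using b'(2) ij by auto
    ultimately show ?thesis by blast
  qed
qed

text \<open>Once the coordinates of \<open>u\<close> from \<open>k\<close> on sit in a single entry
  \<open>m\<close>, the earlier ones are divided by \<open>m\<close> with remainder. The quotients
  go into the new basis vector, so that \<open>u\<close> is \<open>m\<close> times this vector plus
  remainders no larger than \<open>m\<close>; this makes the new vector short.\<close>

lemma basis_step:
  fixes c :: "nat \<Rightarrow> int"
  assumes b: "int_basis R n b" and u: "\<And>i. i < n \<Longrightarrow> \<sigma> i u = (\<Sum>l<n. of_int (c l) * \<sigma> i (b l))"
    and l: "k \<le> l" "l < n" "c l \<noteq> 0"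
  obtains b' m r where "int_basis R n b'" "\<And>j. j < k \<Longrightarrow> b' j = b j" "m \<noteq> (0::int)"
    "\<And>j. j < k \<Longrightarrow> \<bar>r j\<bar> \<le> \<bar>m\<bar>"
    "\<And>i. i < n \<Longrightarrow> of_int m * \<sigma> i (b' k) = \<sigma> i u - (\<Sum>j<k. of_int (r j) * \<sigma> i (b j))"
proof -
  obtain b1 c1 l1 where b1: "int_basis R n b1" "\<forall>j<k. b1 j = b j" "k \<le> l1" "l1 < n" "c1 l1 \<noteq> 0"
    "\<forall>j. k \<le> j \<longrightarrow> j < n \<longrightarrow> j \<noteq> l1 \<longrightarrow> c1 j = 0"
    "\<forall>i<n. \<sigma> i u = (\<Sum>l<n. of_int (c1 l :: int) * \<sigma> i (b1 l))"
    using concentrate_coords[of b u c k l] b u l by blast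
  have kn: "k < n" using b1 by linarith
  define m where "m = c1 l1"
  have uk: "\<sigma> i u = (\<Sum>j<k. of_int (c1 j) * \<sigma> i (b j)) + of_int m * \<sigma> i (b1 l1)" if i: "i < n" for i
  proof -
    have "\<sigma> i u = (\<Sum>l\<in>{..<k} \<union> {l1}. of_int (c1 l) * \<sigma> i (b1 l))"
      unfolding b1(7)[rule_format, OF i] using b1 kn by (intro sum.mono_neutral_right) (auto simp: not_less)
    also have "\<dots> = (\<Sum>l<k. of_int (c1 l) * \<sigma> i (b1 l)) + of_int m * \<sigma> i (b1 l1)"
      using b1(3) by (subst sum.union_disjoint) (auto simp: m_def)
    also have "(\<Sum>l<k. of_int (c1 l) * \<sigma> i (b1 l)) = (\<Sum>j<k. of_int (c1 j) * \<sigma> i (b j))"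
      using b1(2) by (intro sum.cong) auto
    finally show ?thesis .
  qed
  \<comment> \<open>The transposition that moves the surviving index to position
    \<open>k\<close>.\<close>
  let ?p = "id(k := l1, l1 := k)"
  define b2 where "b2 j = b1 (?p j)" for j
  have "bij_betw ?p {..<n} {..<n}"
    using kn b1(4) by (intro bij_betwI[of _ _ _ ?p]) auto
  then have b2: "int_basis R n b2" unfolding b2_def by (rule basis_permute[OF b1(1)])
  have b2k: "b2 k = b1 l1" and b2j: "b2 j = b j" if "j < k" for j
    using b1(2,3) that by (auto simp: b2_def)
  have b2k: "b2 k = b1 l1" by (auto simp: b2_def)
  define q where "q j = c1 j div m" for j
  let ?d = "\<lambda>l. if l < k then q l else if l = k then 1 else 0"
  define w where "w = int_comb R n b2 ?d"
  have w: "w \<in> carrier R" unfolding w_def by (rule closed_int_comb[OF basis_closed[OF b2]])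
  have weq: "\<sigma> i w = (\<Sum>l<n. of_int (?d l) * \<sigma> i (b2 l))" if "i < n" for i
    unfolding w_def by (rule emb_int_comb[OF that basis_closed[OF b2]])
  have weq': "\<sigma> i w = (\<Sum>j<k. of_int (q j) * \<sigma> i (b j)) + \<sigma> i (b1 l1)" if i: "i < n" for i
  proof -
    have "\<sigma> i w = (\<Sum>l\<in>{..<k} \<union> {k}. of_int (?d l) * \<sigma> i (b2 l))"
      unfolding weq[OF i] using kn by (intro sum.mono_neutral_right) (auto simp: not_less)
    also have "\<dots> = (\<Sum>l<k. of_int (?d l) * \<sigma> i (b2 l)) + \<sigma> i (b1 l1)"
      by (subst sum.union_disjoint) (auto simp: b2k)
    also have "(\<Sum>l<k. of_int (?d l) * \<sigma> i (b2 l)) = (\<Sum>j<k. of_int (q j) * \<sigma> i (b j))"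
      using b2j by (intro sum.cong) auto
    finally show ?thesis .
  qed
  have mnz: "m \<noteq> 0" using b1(5) by (simp add: m_def)
  show ?thesis
  proof (rule that[of "b2(k := w)" m "\<lambda>j. c1 j mod m"])
    show "int_basis R n (b2(k := w))"
      using basis_replace[OF b2 kn _ w weq] by simp
    show "(b2(k := w)) j = b j" if "j < k" for j using b2j that by simp
    show "\<bar>c1 j mod m\<bar> \<le> \<bar>m\<bar>" for j
      using abs_mod_less[OF mnz, of "c1 j"] by simp
    show "of_int m * \<sigma> i ((b2(k := w)) k) = \<sigma> i u - (\<Sum>j<k. of_int (c1 j mod m) * \<sigma> i (b j))" if i: "i < n" for i
    proof -
      have "of_int (c1 j mod m) = of_int (c1 j) - of_int m * (of_int (q j) :: complex)" for j
        unfolding q_def minus_mult_div_eq_mod[symmetric] by simp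
      then have "(\<Sum>j<k. of_int (c1 j mod m) * \<sigma> i (b j))
          = (\<Sum>j<k. of_int (c1 j) * \<sigma> i (b j)) - of_int m * (\<Sum>j<k. of_int (q j) * \<sigma> i (b j))"
        by (simp add: left_diff_distrib sum_subtractf sum_distrib_left mult.assoc)
      then show ?thesis
        by (simp add: weq'[OF i] uk[OF i] distrib_left)
    qed
  qed (rule mnz)
qed

lemma unital_basis_exists:
  assumes n: "0 < n"
  obtains b where "unital_basis n R b"
proof -
  obtain b where b: "int_basis R n b" using obtain_basis .
  obtain c where c: "\<one>\<^bsub>R\<^esub> = int_comb R n b c" using basis_comb[OF b one_closed] .
  have one: "\<sigma> i \<one>\<^bsub>R\<^esub> = (\<Sum>l<n. of_int (c l) * \<sigma> i (b l))" if "i < n" for i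
    using emb_int_comb[OF that basis_closed[OF b], of c] c by metis
  have "\<exists>l<n. c l \<noteq> 0"
  proof (rule ccontr)
    assume "\<not> ?thesis"
    then have "\<sigma> 0 \<one>\<^bsub>R\<^esub> = 0" using one[OF n] by simp
    then show False using emb_one[OF n] by simp
  qed
  then obtain l where l: "l < n" "c l \<noteq> 0" by blast
  obtain b' m r where b': "int_basis R n b'" "m \<noteq> (0::int)"
    "\<And>i. i < n \<Longrightarrow> of_int m * \<sigma> i (b' 0) = \<sigma> i \<one>\<^bsub>R\<^esub> - (\<Sum>j<(0::nat). of_int (r j) * \<sigma> i (b j))"
    by (rule basis_step[OF b one le0 l]) auto
  have m: "of_int m * \<sigma> i (b' 0) = 1" if "i < n" for i using b'(3)[OF that] emb_one[OF that] by simp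
  have bc: "b' 0 \<in> carrier R" using basis_closed[OF b'(1)] n by auto
  obtain d where d: "\<And>i. i < n \<Longrightarrow> \<sigma> i (b' 0 \<otimes>\<^bsub>R\<^esub> b' 0) = (\<Sum>k<n. of_int (d k) * \<sigma> i (b' k))"
    using basis_coords[OF b'(1), of "b' 0 \<otimes>\<^bsub>R\<^esub> b' 0"] bc by blast
  \<comment> \<open>\<open>b' 0 = m * (b' 0)\<^sup>2\<close> has the integral coordinate \<open>m * d 0\<close>, so \<open>m\<close> is a unit.\<close>
  have "(\<Sum>k<n. of_int (m * d k - (if k = 0 then 1 else 0)) * \<sigma> i (b' k)) = 0" if i: "i < n" for i
  proof -
    have "(\<Sum>k<n. of_int (m * d k - (if k = 0 then 1 else 0)) * \<sigma> i (b' k))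
        = (\<Sum>k<n. of_int m * (of_int (d k) * \<sigma> i (b' k)) - (if k = 0 then \<sigma> i (b' 0) else 0))"
      by (intro sum.cong) (auto simp: algebra_simps)
    also have "\<dots> = of_int m * (\<Sum>k<n. of_int (d k) * \<sigma> i (b' k)) - (\<Sum>k<n. (if k = 0 then \<sigma> i (b' 0) else 0))"
      by (simp add: sum_subtractf sum_distrib_left)
    also have "\<dots> = of_int m * \<sigma> i (b' 0 \<otimes>\<^bsub>R\<^esub> b' 0) - \<sigma> i (b' 0)"
      using n by (simp add: d[OF i])
    also have "\<dots> = (of_int m * \<sigma> i (b' 0)) * \<sigma> i (b' 0) - \<sigma> i (b' 0)"
      using emb_mult[OF i bc bc] by simp
    finally show ?thesis using m[OF i] by simp
  qed
  from det_nonzero_kernel[OF det_val[OF b'(1)] this n]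
  have "complex_of_int (m * d 0 - 1) = 0" by (simp only: if_True refl)
  then have "complex_of_int (m * d 0) = 1" by (simp only: of_int_diff of_int_1 right_minus_eq)
  then have "m * d 0 = 1" by (simp only: of_int_eq_1_iff)
  then have m1: "m = 1 \<or> m = -1" by (auto simp: zmult_eq_1_iff)
  have "int_basis R n (b'(0 := \<one>\<^bsub>R\<^esub>))"
  proof (rule basis_replace[OF b'(1) n, of "\<lambda>k. if k = 0 then m else 0"])
    fix i assume i: "i < n"
    show "\<sigma> i \<one>\<^bsub>R\<^esub> = (\<Sum>l<n. of_int (if l = 0 then m else 0) * \<sigma> i (b' l))"
      using m[OF i] emb_one[OF i] n by (simp add: if_distrib[of of_int] if_distrib[of "\<lambda>x. x * _"] cong: if_cong)
  qed (use m1 in auto)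
  then show ?thesis by (intro that[of "b'(0 := \<one>\<^bsub>R\<^esub>)"]) (simp add: unital_basis_def)
qed

text \<open>Of \<open>K + 1\<close> independent vectors of length at most \<open>\<rho> K\<close>,
  one leaves the span of the first \<open>K\<close> basis vectors. \<open>basis_step\<close>
  replaces it by a basis vector, up to remainders bounded by \<open>m\<close>, and division by the
  modulus of \<open>m\<close> gives the recursive bound.\<close>

lemma reduced_basis_aux:
  fixes \<rho> :: "nat \<Rightarrow> real"
  assumes n: "0 < n" and \<rho>: "\<And>k. 0 < k \<Longrightarrow> k < n \<Longrightarrow> succ_min n R k < \<rho> k" and K: "1 \<le> K" "K \<le> n"
  shows "\<exists>b. unital_basis n R b \<and>
    (\<forall>k i. 0 < k \<longrightarrow> k < K \<longrightarrow> i < n \<longrightarrow> cmod (\<sigma> i (b k)) \<le> n * \<rho> k + (\<Sum>j<k. cmod (\<sigma> i (b j))))"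
  using K
proof (induction K rule: dec_induct)
  case base
  then show ?case using unital_basis_exists[OF n] by fastforce
next
  case (step K)
  then obtain b where b: "unital_basis n R b" and
    bd: "\<And>k i. 0 < k \<Longrightarrow> k < K \<Longrightarrow> i < n \<Longrightarrow> cmod (\<sigma> i (b k)) \<le> n * \<rho> k + (\<Sum>j<k. cmod (\<sigma> i (b j)))"
    by auto
  have bb: "int_basis R n b" using b by (simp add: unital_basis_def)
  have K: "0 < K" "K < n" using step by auto
  obtain v where v: "v \<in> {..<K + 1} \<rightarrow> carrier R" "int_independent R (K + 1) v"
    "\<And>j. j \<le> K \<Longrightarrow> ring_length n R (v j) \<le> \<rho> K"
    by (rule succ_min_lessE[OF K(2) \<rho>[OF K]]) blast
  obtain j l c where jl: "j \<le> K" "K \<le> l" "l < n" "c l \<noteq> 0" "v j = int_comb R n b c"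
    by (rule independent_escapes[OF bb v(1,2) K(2)]) blast
  have u: "\<sigma> i (v j) = (\<Sum>l<n. of_int (c l) * \<sigma> i (b l))" if "i < n" for i
    unfolding jl(5) by (rule emb_int_comb[OF that basis_closed[OF bb]])
  obtain b' m r where b': "int_basis R n b'" "\<And>j. j < K \<Longrightarrow> b' j = b j" "m \<noteq> (0::int)"
    "\<And>j. j < K \<Longrightarrow> \<bar>r j\<bar> \<le> \<bar>m\<bar>"
    "\<And>i. i < n \<Longrightarrow> of_int m * \<sigma> i (b' K) = \<sigma> i (v j) - (\<Sum>j<K. of_int (r j) * \<sigma> i (b j))"
  proof (rule basis_step[OF bb u jl(2-4)], goal_cases)
    case (2 b' m r) show ?case by (rule 2(1)[OF 2(2-6)])
  qed
  have new: "cmod (\<sigma> i (b' K)) \<le> n * \<rho> K + (\<Sum>j<K. cmod (\<sigma> i (b' j)))" if i: "i < n" for i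
  proof -
    have "\<bar>real_of_int m\<bar> * cmod (\<sigma> i (b' K)) = cmod (of_int m * \<sigma> i (b' K))" by (simp add: norm_mult)
    also have "\<dots> \<le> cmod (\<sigma> i (v j)) + cmod (\<Sum>j<K. of_int (r j) * \<sigma> i (b j))"
      unfolding b'(5)[OF i] by (rule norm_triangle_ineq4)
    also have "\<dots> \<le> n * \<rho> K + (\<Sum>j<K. \<bar>real_of_int m\<bar> * cmod (\<sigma> i (b j)))"
    proof (intro add_mono)
      show "cmod (\<sigma> i (v j)) \<le> n * \<rho> K" using emb_le[OF i v(3)[OF jl(1)]] .
      show "cmod (\<Sum>j<K. of_int (r j) * \<sigma> i (b j)) \<le> (\<Sum>j<K. \<bar>real_of_int m\<bar> * cmod (\<sigma> i (b j)))"
      proof (rule sum_norm_le)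
        fix j assume "j \<in> {..<K}"
        then have "\<bar>r j\<bar> \<le> \<bar>m\<bar>" using b'(4)[of j] by simp
          then have "\<bar>real_of_int (r j)\<bar> \<le> \<bar>real_of_int m\<bar>" by (metis of_int_abs of_int_le_iff)
        then show "cmod (of_int (r j) * \<sigma> i (b j)) \<le> \<bar>real_of_int m\<bar> * cmod (\<sigma> i (b j))"
          by (simp add: norm_mult mult_right_mono)
      qed
    qed
    also have "\<dots> \<le> \<bar>real_of_int m\<bar> * (n * \<rho> K) + (\<Sum>j<K. \<bar>real_of_int m\<bar> * cmod (\<sigma> i (b j)))"
    proof -
      have "1 \<le> \<bar>real_of_int m\<bar>" using b'(3) by linarith
      moreover have "0 \<le> n * \<rho> K" using ring_length_nonneg[of "v j"] v(3)[OF jl(1)] by simp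
      ultimately show ?thesis using mult_right_mono[of 1 "\<bar>real_of_int m\<bar>" "n * \<rho> K"] by simp
    qed
    also have "\<dots> = \<bar>real_of_int m\<bar> * (n * \<rho> K + (\<Sum>j<K. cmod (\<sigma> i (b' j))))"
      using b'(2) by (simp add: distrib_left sum_distrib_left)
    finally show ?thesis using b'(3) by simp
  qed
  have "cmod (\<sigma> i (b' k)) \<le> n * \<rho> k + (\<Sum>j<k. cmod (\<sigma> i (b' j)))" if "0 < k" "k < Suc K" "i < n" for k i
  proof (cases "k = K")
    case True then show ?thesis using new that by simp
  next
    case False
    then show ?thesis using bd[of k i] b'(2) that by simp
  qed
  moreover have "unital_basis n R b'" using b b'(1,2) K by (simp add: unital_basis_def)
  ultimately show ?case by blast
qed

text \<open>Solves the recursion of \<open>reduced_basis_aux\<close>: the powers of 2 below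
  \<open>2 ^ k\<close> add up to \<open>2 ^ k - 1\<close>. The value \<open>\<rho> 0\<close> bounds
  the unit, with which the basis starts.\<close>

lemma reduced_basis:
  fixes \<rho> :: "nat \<Rightarrow> real"
  assumes n: "0 < n" and \<rho>: "\<And>k. 0 < k \<Longrightarrow> k < n \<Longrightarrow> succ_min n R k < \<rho> k"
    and mono: "\<And>j k. j \<le> k \<Longrightarrow> k < n \<Longrightarrow> \<rho> j \<le> \<rho> k" and one: "1 \<le> \<rho> 0"
  obtains b where "unital_basis n R b" "\<And>k i. k < n \<Longrightarrow> i < n \<Longrightarrow> cmod (\<sigma> i (b k)) \<le> real (n + 1) * 2 ^ k * \<rho> k"
proof -
  obtain b where b: "unital_basis n R b" and
    bd: "\<And>k i. 0 < k \<Longrightarrow> k < n \<Longrightarrow> i < n \<Longrightarrow> cmod (\<sigma> i (b k)) \<le> n * \<rho> k + (\<Sum>j<k. cmod (\<sigma> i (b j)))"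
    using reduced_basis_aux[OF n \<rho>, of n] n by auto
  have "cmod (\<sigma> i (b k)) \<le> real (n + 1) * 2 ^ k * \<rho> k" if i: "i < n" and "k < n" for i k
    using \<open>k < n\<close>
  proof (induction k rule: less_induct)
    case (less k)
    show ?case
    proof (cases "k = 0")
      case True
      have "1 * 1 \<le> real (n + 1) * \<rho> 0" using one by (intro mult_mono) auto
      then show ?thesis using True b emb_one[OF i] by (simp add: unital_basis_def algebra_simps)
    next
      case False
      have "(\<Sum>j<k. cmod (\<sigma> i (b j))) \<le> (\<Sum>j<k. real (n + 1) * 2 ^ j * \<rho> k)"
      proof (rule sum_mono)
        fix j assume "j \<in> {..<k}"
        then have j: "j < k" by simp
        have "cmod (\<sigma> i (b j)) \<le> real (n + 1) * 2 ^ j * \<rho> j" using less.IH[OF j] j less.prems by simp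
        also have "\<dots> \<le> real (n + 1) * 2 ^ j * \<rho> k" using mono[of j k] j less.prems by (intro mult_left_mono) auto
        finally show "cmod (\<sigma> i (b j)) \<le> real (n + 1) * 2 ^ j * \<rho> k" .
      qed
      also have "\<dots> = (n + 1) * \<rho> k * (\<Sum>j<k. 2 ^ j)" by (simp add: sum_distrib_left mult_ac)
      also have "(\<Sum>j<k. 2 ^ j) = (2::real) ^ k - 1" by (simp add: geometric_sum)
      finally have "cmod (\<sigma> i (b k)) \<le> n * \<rho> k + (n + 1) * \<rho> k * (2 ^ k - 1)"
        using bd[of k i] False less.prems i by simp
      also have "\<dots> \<le> real (n + 1) * 2 ^ k * \<rho> k" using one mono[of 0 k] less.prems by (simp add: algebra_simps)
      finally show ?thesis .
    qed
  qed
  with b show ?thesis by (rule that)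
qed

text \<open>Among \<open>k + 1\<close> independent vectors, one has a nonzero coordinate at some
  \<open>l \<ge> k\<close>. This coordinate has modulus at least 1, while Cramer's rule bounds it by
  a multiple of the length.\<close>

lemma succ_min_ge:
  fixes B :: "nat \<Rightarrow> real"
  assumes b: "int_basis R n b" and B: "\<And>i j. i < n \<Longrightarrow> j < n \<Longrightarrow> cmod (\<sigma> i (b j)) \<le> B j"
    and pos: "\<And>j. j < n \<Longrightarrow> 0 < B j" and k: "k < n"
    and c: "\<And>l. k \<le> l \<Longrightarrow> l < n \<Longrightarrow> c * (fact n * real n * (\<Prod>j\<in>{..<n}-{l}. B j)) \<le> sqrt \<bar>real_of_int (ring_disc n R)\<bar>"
  shows "c \<le> succ_min n R k"
proof (rule le_succ_min[OF k])
  fix v r assume v: "v \<in> {..<k + 1} \<rightarrow> carrier R" "int_independent R (k + 1) v"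
    "\<And>j. j \<le> k \<Longrightarrow> ring_length n R (v j) \<le> r"
  obtain j l d where jl: "j \<le> k" "k \<le> l" "l < n" "d l \<noteq> 0" "v j = int_comb R n b d"
    by (rule independent_escapes[OF b v(1,2) k]) blast
  let ?D = "sqrt \<bar>real_of_int (ring_disc n R)\<bar>" and ?P = "\<Prod>j\<in>{..<n}-{l}. B j"
  have P: "0 < ?P" using pos by (intro prod_pos) auto
  have "?D \<le> \<bar>real_of_int (d l)\<bar> * ?D" using jl(4) mult_right_mono[of 1 "\<bar>real_of_int (d l)\<bar>" ?D] by simp
  also have "\<dots> \<le> fact n * (n * r) * ?P"
    using v(3)[OF jl(1)] jl(5) emb_le by (intro coord_bound[OF b B _ jl(3)]) auto
  finally have "?D \<le> r * (fact n * real n * ?P)" by (simp only: mult_ac)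
  with c[OF jl(2,3)] have "c * (fact n * real n * ?P) \<le> r * (fact n * real n * ?P)" by (rule order_trans)
  moreover have "0 < fact n * real n * ?P" using P k by simp
  ultimately show "c \<le> r" by (rule mult_right_le_imp_le)
qed

end

section \<open>Size estimates for the explicit pair\<close>

lemma quartic_root_bound:
  fixes x a b c d :: complex and h :: real
  assumes root: "x ^ 4 + a * x ^ 3 + b * x\<^sup>2 + c * x + d = 0" and h: "0 < h"
    and bd: "cmod a \<le> h" "cmod b \<le> h\<^sup>2" "cmod c \<le> h ^ 3" "cmod d \<le> h ^ 4"
  shows "cmod x \<le> 2 * h"
proof (rule ccontr)
  let ?r = "cmod x"
  assume "\<not> ?r \<le> 2 * h"
  then have r: "h \<le> ?r / 2" "0 < ?r" using h by auto
  have "x ^ 4 = - (a * x ^ 3 + b * x\<^sup>2 + c * x + d)" using root by (simp only: eq_neg_iff_add_eq_0 add.assoc)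
  then have "?r ^ 4 = cmod (a * x ^ 3 + b * x\<^sup>2 + c * x + d)"
    by (metis norm_minus_cancel norm_power)
  also have "\<dots> \<le> cmod a * ?r ^ 3 + cmod b * ?r\<^sup>2 + cmod c * ?r + cmod d"
    by (intro norm_triangle_mono order_trans[OF norm_triangle_ineq] add_mono) (simp_all add: norm_mult norm_power)
  also have "\<dots> \<le> (?r / 2) * ?r ^ 3 + (?r / 2)\<^sup>2 * ?r\<^sup>2 + (?r / 2) ^ 3 * ?r + (?r / 2) ^ 4"
  proof (intro add_mono mult_right_mono)
    show "cmod a \<le> ?r / 2" using bd(1) r by linarith
    show "cmod b \<le> (?r / 2)\<^sup>2" using bd(2) power_mono[OF r(1), of 2] h by linarith
    show "cmod c \<le> (?r / 2) ^ 3" using bd(3) power_mono[OF r(1), of 3] h by linarith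
    show "cmod d \<le> (?r / 2) ^ 4" using bd(4) power_mono[OF r(1), of 4] h by linarith
  qed auto
  \<comment> \<open>The sum 1/2 + 1/4 + 1/8 + 1/16 stays below 1, which is why the factor 2 in the
    root bound suffices.\<close>
  also have "\<dots> = (15 / 16) * ?r ^ 4"
    by (simp add: power2_eq_square power3_eq_cube power4_eq_xxxx field_simps)
  finally show False using r(2) by simp
qed

text \<open>The tolerance \<open>\<epsilon> / ln T\<close> on the logarithmic scale absorbs
  multiplicative constants: if a minimum and the discriminant have the expected orders of magnitude
  up to constants, the logarithms are off by a bounded amount only.\<close>

lemma log_close:
  fixes c C \<delta> D H L \<Delta> :: real
  assumes "0 < c" "0 < \<delta>" "1 \<le> C" "1 \<le> D" "1 \<le> H" "e \<le> 12"
    and l: "c * H ^ e \<le> L" "L \<le> C * H ^ e" and d: "\<delta> * H ^ 12 \<le> \<Delta>" "\<Delta> \<le> D * H ^ 12"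
  shows "\<bar>ln L - e / 12 * ln \<Delta>\<bar> \<le> \<bar>ln c\<bar> + ln C + \<bar>ln \<delta>\<bar> + ln D"
proof -
  have H: "0 < H" "0 \<le> ln H" using assms by auto
  have pos: "0 < L" "0 < \<Delta>"
    using l(1) d(1) mult_pos_pos[OF assms(1) zero_less_power[OF H(1), of e]]
      mult_pos_pos[OF assms(2) zero_less_power[OF H(1), of 12]] by linarith+
  have "ln (c * H ^ e) \<le> ln L" "ln L \<le> ln (C * H ^ e)"
    using l pos assms H by (simp_all add: ln_mono)
  then have 1: "ln c + e * ln H \<le> ln L" "ln L \<le> ln C + e * ln H"
    using assms H by (simp_all add: ln_mult ln_realpow)
  have "ln (\<delta> * H ^ 12) \<le> ln \<Delta>" "ln \<Delta> \<le> ln (D * H ^ 12)"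
    using d pos assms H by (simp_all add: ln_mono)
  then have 2: "ln \<delta> + 12 * ln H \<le> ln \<Delta>" "ln \<Delta> \<le> ln D + 12 * ln H"
    using assms H by (simp_all add: ln_mult ln_realpow)
  have e: "0 \<le> real e / 12" "real e / 12 \<le> 1" using assms(6) by auto
  have "\<bar>ln \<Delta> - 12 * ln H\<bar> \<le> \<bar>ln \<delta>\<bar> + ln D" using 2 assms(4) ln_ge_zero[OF assms(4)] by linarith
  then have "real e / 12 * \<bar>ln \<Delta> - 12 * ln H\<bar> \<le> 1 * (\<bar>ln \<delta>\<bar> + ln D)"
    using e by (intro mult_mono) auto
  then have "\<bar>real e / 12 * (ln \<Delta> - 12 * ln H)\<bar> \<le> \<bar>ln \<delta>\<bar> + ln D"
    by (simp add: abs_mult)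
  then have 3: "\<bar>real e / 12 * ln \<Delta> - e * ln H\<bar> \<le> \<bar>ln \<delta>\<bar> + ln D" by (simp add: right_diff_distrib)
  have "\<bar>ln L - e * ln H\<bar> \<le> \<bar>ln c\<bar> + ln C" using 1 ln_ge_zero[OF assms(3)] by linarith
  then show ?thesis using 3 by linarith
qed

definition exps :: exponents where "exps = (1/12, 1/6, 1/4, 1/6, 1/3)"

text \<open>Collects the constants of \<open>succ_min_bounds\<close> and \<open>vdm_bound\<close>,
  as they enter \<open>log_close\<close>. The denominators are \<open>fact n * n\<close> times the
  constants of the other \<open>n - 1\<close> basis vectors, for \<open>n = 4\<close> and
  \<open>n = 3\<close>.\<close>

definition close_const :: "real \<Rightarrow> real" where
  "close_const \<delta> = \<bar>ln (sqrt \<delta> / (24 * 4 * 14 ^ 3))\<bar> + \<bar>ln (sqrt \<delta> / (6 * 3 * 72 ^ 2))\<bar> + ln 72 + \<bar>ln \<delta>\<bar> + ln (4096 ^ 2)"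

lemma close_iff:
  "close exps \<epsilon> T (R, C, \<phi>) \<longleftrightarrow> (let L = ln (pair_disc (R, C, \<phi>)) in
     \<bar>ln (succ_min 4 R 1) / L - 1/12\<bar> \<le> \<epsilon> / ln T \<and> \<bar>ln (succ_min 4 R 2) / L - 1/6\<bar> \<le> \<epsilon> / ln T \<and>
     \<bar>ln (succ_min 4 R 3) / L - 1/4\<bar> \<le> \<epsilon> / ln T \<and> \<bar>ln (succ_min 3 C 1) / L - 1/6\<bar> \<le> \<epsilon> / ln T \<and>
     \<bar>ln (succ_min 3 C 2) / L - 1/3\<bar> \<le> \<epsilon> / ln T)"
  unfolding close_def exps_def Let_def log_def by simp

text \<open>A bounded error in the logarithm becomes closeness as soon as the logarithm of the
  discriminant is comparable with \<open>ln T\<close>.\<close>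

lemma close_quotient:
  fixes L K T p l :: real
  assumes "\<bar>l - p * L\<bar> \<le> K" "0 < L" "1 < T" "K * ln T \<le> \<epsilon> * L"
  shows "\<bar>l / L - p\<bar> \<le> \<epsilon> / ln T"
proof -
  have "l / L - p = (l - p * L) / L" using assms(2) by (simp add: field_simps)
  then have "\<bar>l / L - p\<bar> = \<bar>l - p * L\<bar> / L" using assms(2) by (simp only: abs_divide)
  also have "\<dots> \<le> K / L" using assms by (intro divide_right_mono) auto
  also have "\<dots> \<le> \<epsilon> / ln T" using assms by (simp add: field_simps)
  finally show ?thesis .
qed

locale bounded_quartic = quartic_roots +
  fixes h :: real
  assumes h: "1 \<le> h" and coeff_bounds: "\<bar>real_of_int f1\<bar> \<le> h" "\<bar>real_of_int f2\<bar> \<le> h\<^sup>2" "\<bar>real_of_int f3\<bar> \<le> h ^ 3" "\<bar>real_of_int f4\<bar> \<le> h ^ 4"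
begin

lemma t_bound: "i < 4 \<Longrightarrow> cmod (t i) \<le> 2 * h"
  using quartic_root_bound[OF t_quartic, of i h] coeff_bounds h by (simp add: norm_of_int)

text \<open>With roots of modulus at most \<open>2 * h\<close>, the three terms of the last basis
  vector contribute 8 + 4 + 2 = 14.\<close>

lemma rbase_bound: "i < 4 \<Longrightarrow> k < 4 \<Longrightarrow> cmod (rbase i k) \<le> 14 * h ^ k"
proof -
  assume i: "i < 4" and k: "k < 4"
  let ?r = "cmod (t i)"
  have r: "?r \<le> 2 * h" by (rule t_bound[OF i])
  have r2: "?r\<^sup>2 \<le> 4 * h\<^sup>2" using power_mono[OF r, of 2] by (simp add: power_mult_distrib)
  have r3: "?r ^ 3 \<le> 8 * h ^ 3" using power_mono[OF r, of 3] by (simp add: power_mult_distrib)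
  have a: "\<bar>real_of_int f1\<bar> * ?r \<le> h * (2 * h)" "\<bar>real_of_int f1\<bar> * ?r\<^sup>2 \<le> h * (4 * h\<^sup>2)"
     "\<bar>real_of_int f2\<bar> * ?r \<le> h\<^sup>2 * (2 * h)"
    using coeff_bounds r r2 h by (auto intro!: mult_mono)
  have n2: "cmod (rbase i 2) \<le> ?r\<^sup>2 + \<bar>real_of_int f1\<bar> * ?r"
    unfolding rbase_def by (simp, rule order_trans[OF norm_triangle_ineq]) (simp add: norm_mult norm_power)
  have n3: "cmod (rbase i 3) \<le> ?r ^ 3 + \<bar>real_of_int f1\<bar> * ?r\<^sup>2 + \<bar>real_of_int f2\<bar> * ?r"
    unfolding rbase_def by (simp, intro order_trans[OF norm_triangle_ineq] add_mono) (simp_all add: norm_mult norm_power)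
  have "cmod (rbase i 0) \<le> 14 * h ^ 0" "cmod (rbase i 1) \<le> 14 * h ^ 1"
    using r h by (simp_all add: rbase_def)
  moreover have "cmod (rbase i 2) \<le> 14 * h\<^sup>2"
    using n2 r2 a(1) zero_le_power2[of h] unfolding power2_eq_square by linarith
  moreover have "cmod (rbase i 3) \<le> 14 * h ^ 3"
    using n3 r3 a(2,3) by (simp add: power2_eq_square power3_eq_cube)
  ultimately show ?thesis using k unfolding less_4_cases by auto
qed

lemma cubic_root_bound: "j < 3 \<Longrightarrow> cmod (cubic_root j) \<le> 8 * h\<^sup>2"
proof -
  assume j: "j < 3"
  have p: "cmod (t a * t b) \<le> 4 * h\<^sup>2" if "a < 4" "b < 4" for a b
  proof -
    have "cmod (t a) * cmod (t b) \<le> (2 * h) * (2 * h)" using t_bound that h by (intro mult_mono) auto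
    then show ?thesis by (simp add: norm_mult power2_eq_square)
  qed
  have s: "cmod (t a * t b + t c * t d) \<le> 8 * h\<^sup>2" if "a < 4" "b < 4" "c < 4" "d < 4" for a b c d
    using norm_triangle_ineq[of "t a * t b" "t c * t d"] p[OF that(1,2)] p[OF that(3,4)] by linarith
  show ?thesis using j s unfolding less_3_cases cubic_root_def resolv_def by auto
qed

text \<open>With resolvent roots of modulus at most 8 times the square of \<open>h\<close>, the two
  terms of the last vector contribute 64 + 8 = 72.\<close>

lemma cbase_bound: "j < 3 \<Longrightarrow> k < 3 \<Longrightarrow> cmod (cbase j k) \<le> 72 * h ^ (2 * k)"
proof -
  assume j: "j < 3" and k: "k < 3"
  let ?w = "cmod (cubic_root j)"
  have w: "?w \<le> 8 * h\<^sup>2" by (rule cubic_root_bound[OF j])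
  have w2: "?w\<^sup>2 \<le> 64 * h ^ 4" using power_mono[OF w, of 2] by (simp add: power_mult_distrib)
  have a: "\<bar>real_of_int f2\<bar> * ?w \<le> h\<^sup>2 * (8 * h\<^sup>2)" using coeff_bounds w h by (intro mult_mono) auto
  have n2: "cmod (cbase j 2) \<le> ?w\<^sup>2 + \<bar>real_of_int f2\<bar> * ?w"
    unfolding cbase_def by (simp, rule order_trans[OF norm_triangle_ineq4]) (simp add: norm_mult norm_power)
  have "?w \<le> 72 * h\<^sup>2" using w zero_le_power2[of h] by linarith
  then have "cmod (cbase j 0) \<le> 72 * h ^ (2 * 0)" "cmod (cbase j 1) \<le> 72 * h ^ (2 * 1)"
    by (simp_all add: cbase_def)
  moreover have "cmod (cbase j 2) \<le> 72 * h ^ (2 * 2)"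
    using n2 w2 a by (simp add: power2_eq_square power4_eq_xxxx)
  ultimately show ?thesis using k unfolding less_3_cases by auto
qed

lemma vdm_bound: "(cmod vdm)\<^sup>2 \<le> 4096\<^sup>2 * h ^ 12"
proof -
  have d: "cmod (t a - t b) \<le> 4 * h" if "a < 4" "b < 4" for a b
    using norm_triangle_ineq4[of "t a" "t b"] t_bound[OF that(1)] t_bound[OF that(2)] by linarith
  have "cmod vdm \<le> (4 * h) * (4 * h) * (4 * h) * (4 * h) * (4 * h) * (4 * h)"
    unfolding vdm_def norm_mult using h by (intro mult_mono d) auto
  also have "\<dots> = 4096 * h ^ 6" by (simp add: eval_nat_numeral)
  finally have "(cmod vdm)\<^sup>2 \<le> (4096 * h ^ 6)\<^sup>2" by (intro power_mono) auto
  then show ?thesis by (simp add: power_mult_distrib flip: power_mult)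
qed

text \<open>The bounds for the basis vectors other than the \<open>l\<close>-th multiply to a
  constant times \<open>h ^ (6 - l)\<close>, and to \<open>h ^ (6 - 2 * l)\<close> in the cubic
  ring. Against a covolume of order \<open>h ^ 6\<close>, a nonzero coordinate at
  \<open>l \<ge> k\<close> costs a length of order at least \<open>h ^ k\<close>, respectively
  \<open>h ^ (2 * k)\<close>.\<close>

lemma succ_min_bounds:
  assumes \<delta>: "0 < \<delta>" "\<delta> * h ^ 12 \<le> (cmod vdm)\<^sup>2"
  shows "k < 4 \<Longrightarrow> sqrt \<delta> / (24 * 4 * 14 ^ 3) * h ^ k \<le> succ_min 4 RR k"
    and "k < 4 \<Longrightarrow> succ_min 4 RR k \<le> 14 * h ^ k"
    and "k < 3 \<Longrightarrow> sqrt \<delta> / (6 * 3 * 72 ^ 2) * h ^ (2 * k) \<le> succ_min 3 CC k"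
    and "k < 3 \<Longrightarrow> succ_min 3 CC k \<le> 72 * h ^ (2 * k)"
proof -
  interpret R: embedded_ring 4 RR \<sigma>R by (rule embedded_RR)
  interpret C: embedded_ring 3 CC \<tau>C by (rule embedded_CC)
  have b: "int_basis RR 4 (unit_list 4)" "int_basis CC 3 (unit_list 3)"
    using unital_unit by (auto simp: unital_basis_def)
  have disc: "sqrt \<bar>real_of_int (ring_disc 4 RR)\<bar> = cmod vdm" "sqrt \<bar>real_of_int (ring_disc 3 CC)\<bar> = cmod vdm"
    using arg_cong[OF disc_RR, of cmod] arg_cong[OF disc_CC, of cmod] by (simp_all add: norm_power)
  have vd: "sqrt \<delta> * h ^ 6 \<le> cmod vdm"
  proof -
    have "sqrt (\<delta> * h ^ 12) = sqrt \<delta> * h ^ 6"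
      using \<delta>(1) h by (intro real_sqrt_unique) (simp_all add: power_mult_distrib flip: power_mult)
    then show ?thesis using real_sqrt_le_mono[OF \<delta>(2)] by simp
  qed
  have Bk: "cmod (\<sigma>R i (unit_list 4 k)) \<le> 14 * h ^ k" if "i < 4" "k < 4" for i k
    using rbase_bound[OF that] \<sigma>R_unit[OF that(2)] by simp
  have Bk3: "cmod (\<tau>C i (unit_list 3 k)) \<le> 72 * h ^ (2 * k)" if "i < 3" "k < 3" for i k
    using cbase_bound[OF that] \<tau>C_unit[OF that(2)] by simp
  have hm: "h ^ a \<le> h ^ b" if "a \<le> b" for a b using power_increasing[OF that h] .
  have pos: "0 \<le> h ^ a" for a using h by simp
  { assume k: "k < 4"
    show "succ_min 4 RR k \<le> 14 * h ^ k"
    proof (rule R.succ_min_le[OF b(1) k])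
      fix j assume j: "j \<le> k"
      have "14 * h ^ j \<le> 14 * h ^ k" using hm[OF j] by simp
      then show "ring_length 4 RR (unit_list 4 j) \<le> 14 * h ^ k"
        using order_trans[OF Bk[of _ j]] j k by (intro R.ring_length_le) auto
    qed
    show "sqrt \<delta> / (24 * 4 * 14 ^ 3) * h ^ k \<le> succ_min 4 RR k"
    proof (rule R.succ_min_ge[OF b(1) Bk _ k])
      show "0 < 14 * h ^ j" for j using h by simp
      fix l :: nat assume l: "k \<le> l" "l < 4"
      have P: "(\<Prod>j\<in>{..<4} - {l}. 14 * h ^ j) = 14 ^ 3 * h ^ (6 - l)"
        using l(2) unfolding less_4_cases lessThan_numerals(1)[symmetric]
        by (elim disjE) (simp_all add: insert_Diff_if eval_nat_numeral)
      have "sqrt \<delta> / (24 * 4 * 14 ^ 3) * h ^ k * (fact 4 * 4 * (14 ^ 3 * h ^ (6 - l))) = sqrt \<delta> * h ^ (k + (6 - l))"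
        by (simp add: fact_numeral power_add)
      also have "\<dots> \<le> sqrt \<delta> * h ^ 6" using l \<delta>(1) by (intro mult_left_mono hm) auto
      also note vd
      finally show "sqrt \<delta> / (24 * 4 * 14 ^ 3) * h ^ k * (fact 4 * real 4 * (\<Prod>j\<in>{..<4} - {l}. 14 * h ^ j))
          \<le> sqrt \<bar>real_of_int (ring_disc 4 RR)\<bar>" unfolding P disc by simp
    qed }
  { assume k: "k < 3"
    show "succ_min 3 CC k \<le> 72 * h ^ (2 * k)"
    proof (rule C.succ_min_le[OF b(2) k])
      fix j assume j: "j \<le> k"
      have "72 * h ^ (2 * j) \<le> 72 * h ^ (2 * k)" using hm[of "2 * j" "2 * k"] j by simp
      then show "ring_length 3 CC (unit_list 3 j) \<le> 72 * h ^ (2 * k)"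
        using order_trans[OF Bk3[of _ j]] j k by (intro C.ring_length_le) auto
    qed
    show "sqrt \<delta> / (6 * 3 * 72 ^ 2) * h ^ (2 * k) \<le> succ_min 3 CC k"
    proof (rule C.succ_min_ge[OF b(2) Bk3 _ k])
      show "0 < 72 * h ^ (2 * j)" for j using h by simp
      fix l :: nat assume l: "k \<le> l" "l < 3"
      have P: "(\<Prod>j\<in>{..<3} - {l}. 72 * h ^ (2 * j)) = 72 ^ 2 * h ^ (6 - 2 * l)"
        using l(2) unfolding less_3_cases lessThan_numerals(2)[symmetric]
        by (elim disjE) (simp_all add: insert_Diff_if eval_nat_numeral)
      have "sqrt \<delta> / (6 * 3 * 72 ^ 2) * h ^ (2 * k) * (fact 3 * 3 * (72 ^ 2 * h ^ (6 - 2 * l))) = sqrt \<delta> * h ^ (2 * k + (6 - 2 * l))"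
        by (simp add: fact_numeral power_add)
      also have "\<dots> \<le> sqrt \<delta> * h ^ 6" using l \<delta>(1) by (intro mult_left_mono hm) auto
      also note vd
      finally show "sqrt \<delta> / (6 * 3 * 72 ^ 2) * h ^ (2 * k) * (fact 3 * real 3 * (\<Prod>j\<in>{..<3} - {l}. 72 * h ^ (2 * j)))
          \<le> sqrt \<bar>real_of_int (ring_disc 3 CC)\<bar>" unfolding P disc by simp
    qed }
qed

lemma model_close:
  assumes \<delta>: "0 < \<delta>" "\<delta> * h ^ 12 \<le> (cmod vdm)\<^sup>2"
    and T: "1 < (cmod vdm)\<^sup>2" "1 < T" "close_const \<delta> * ln T \<le> \<epsilon> * ln ((cmod vdm)\<^sup>2)"
  shows "close exps \<epsilon> T (RR, CC, \<Phi>)"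
proof -
  let ?L = "ln ((cmod vdm)\<^sup>2)"
  note b = succ_min_bounds[OF \<delta>]
  have l72: "ln 14 \<le> ln (72::real)" "0 \<le> ln (72::real)" by simp_all
  have R: "\<bar>ln (succ_min 4 RR k) - k / 12 * ?L\<bar> \<le> close_const \<delta>" if "k < 4" for k
  proof -
    have "\<bar>ln (succ_min 4 RR k) - k / 12 * ?L\<bar>
        \<le> \<bar>ln (sqrt \<delta> / (24 * 4 * 14 ^ 3))\<bar> + ln 14 + \<bar>ln \<delta>\<bar> + ln (4096\<^sup>2)"
      by (rule log_close[OF _ \<delta>(1) _ _ h _ b(1,2)[OF that] \<delta>(2) vdm_bound]) (use \<delta> that in auto)
    then show ?thesis unfolding close_const_def using l72 by linarith
  qed
  have C: "\<bar>ln (succ_min 3 CC k) - real (2 * k) / 12 * ?L\<bar> \<le> close_const \<delta>" if "k < 3" for k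
  proof -
    have "\<bar>ln (succ_min 3 CC k) - real (2 * k) / 12 * ?L\<bar>
        \<le> \<bar>ln (sqrt \<delta> / (6 * 3 * 72 ^ 2))\<bar> + ln 72 + \<bar>ln \<delta>\<bar> + ln (4096\<^sup>2)"
      by (rule log_close[OF _ \<delta>(1) _ _ h _ b(3,4)[OF that] \<delta>(2) vdm_bound]) (use \<delta> that in auto)
    then show ?thesis unfolding close_const_def using l72 by linarith
  qed
  have L: "0 < ?L" using T(1) by (rule ln_gt_zero)
  note q = close_quotient[OF _ L T(2,3)]
  have "\<bar>ln (succ_min 4 RR 1) / ?L - 1/12\<bar> \<le> \<epsilon> / ln T" using R[of 1] by (intro q) simp
  moreover have "\<bar>ln (succ_min 4 RR 2) / ?L - 1/6\<bar> \<le> \<epsilon> / ln T" using R[of 2] by (intro q) simp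
  moreover have "\<bar>ln (succ_min 4 RR 3) / ?L - 1/4\<bar> \<le> \<epsilon> / ln T" using R[of 3] by (intro q) simp
  moreover have "\<bar>ln (succ_min 3 CC 1) / ?L - 1/6\<bar> \<le> \<epsilon> / ln T" using C[of 1] by (intro q) simp
  moreover have "\<bar>ln (succ_min 3 CC 2) / ?L - 1/3\<bar> \<le> \<epsilon> / ln T" using C[of 2] by (intro q) simp
  ultimately show ?thesis unfolding close_iff pair_disc_model Let_def by blast
qed

end

section \<open>Small discriminants are rare\<close>

text \<open>Repeats \<open>vdm\<close> outside the locale, where roots may coincide.\<close>

definition vandermonde :: "(nat \<Rightarrow> complex) \<Rightarrow> complex" where
  "vandermonde t = (t 1 - t 0) * (t 2 - t 0) * (t 3 - t 0) * (t 2 - t 1) * (t 3 - t 1) * (t 3 - t 2)"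

lemma (in quartic_roots) vdm_eq: "vdm = vandermonde t"
  by (simp add: vdm_def vandermonde_def)

lemma vandermonde_nonzero_iff: "vandermonde t \<noteq> 0 \<longleftrightarrow> inj_on t {..<4}"
  unfolding inj_on_4_iff vandermonde_def by auto

lemma monic_quartic_F4_mon:
  assumes "has_roots (monic_quartic f1 f2 f3 f4) t"
  shows "monic_quartic f1 f2 f3 f4 \<in> F4_mon \<longleftrightarrow> vandermonde t \<noteq> 0"
  using monic_disc_nonzero_iff[OF _ _ assms] monic_quartic_coeffs(6,7)[of f1 f2 f3 f4]
  by (simp add: F4_mon_def vandermonde_nonzero_iff)

lemma has_roots_quartic_roots:
  assumes "has_roots (monic_quartic f1 f2 f3 f4) t" "vandermonde t \<noteq> 0"
  shows "quartic_roots f1 f2 f3 f4 t"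
  using has_roots_vieta[OF assms(1)] assms(2) by unfold_locales (auto simp: vandermonde_nonzero_iff)

lemma cubic_roots_exist:
  fixes a b c d :: complex
  assumes "a \<noteq> 0"
  obtains s where "\<And>x. d + c * x + b * x\<^sup>2 + a * x ^ 3 = a * ((x - s 0) * (x - s 1) * (x - s (2::nat)))"
proof -
  let ?p = "[:d, c, b, a:]"
  have "degree ?p = 3" "lead_coeff ?p = a" "?p \<noteq> 0" using assms by simp_all
  then obtain A where A: "size A = 3" "?p = smult a (\<Prod>x\<in>#A. [:-x, 1:])"
    using alg_closed_imp_factorization[of ?p] by fastforce
  obtain xs where xs: "mset xs = A" using ex_mset by blast
  then have "length xs = 3" using A(1) by auto
  then obtain u v w where uvw: "xs = [u, v, w]"
    by (auto simp: length_Suc_conv eval_nat_numeral)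
  have "?p = smult a ([:-u, 1:] * [:-v, 1:] * [:-w, 1:])"
    using A(2) xs uvw by (auto simp: algebra_simps)
  then have "poly ?p x = a * ((x - u) * (x - v) * (x - w))" for x by (simp only: poly_smult poly_mult) simp
  note e = this
  have "d + c * x + b * x\<^sup>2 + a * x ^ 3 = a * ((x - u) * (x - v) * (x - w))" for x
    using e[of x] by (simp add: algebra_simps power2_eq_square power3_eq_cube)
  then show ?thesis by (intro that[of "(!) [u, v, w]"]) simp
qed

text \<open>The discriminant is \<open>256\<close> times the product of the values of \<open>f\<close> at its critical points, and
  these points do not depend on the constant coefficient.\<close>

lemma disc_constant_coeff:
  fixes f1 f2 f3 :: int
  obtains \<beta> :: "nat \<Rightarrow> complex" where "\<And>f4 t. has_roots (monic_quartic f1 f2 f3 f4) t \<Longrightarrow>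
     (cmod (vandermonde t))\<^sup>2 = 256 * (cmod (of_int f4 - \<beta> 0) * cmod (of_int f4 - \<beta> 1) * cmod (of_int f4 - \<beta> 2))"
proof -
  \<comment> \<open>The derivative does not involve \<open>f4\<close>, so its roots
    \<open>s j\<close>, and with them the \<open>\<beta> j\<close>, are the same for all
    \<open>f4\<close>.\<close>
  obtain s :: "nat \<Rightarrow> complex" where s: "\<And>x :: complex. of_int f3 + (2 * of_int f2) * x + (3 * of_int f1) * x\<^sup>2 + 4 * x ^ 3 = 4 * ((x - s 0) * (x - s 1) * (x - s (2::nat)))"
  proof (rule cubic_roots_exist[of 4 "of_int f3" "2 * of_int f2" "3 * of_int f1"], goal_cases)
    case 1 show ?case by simp
  next
    case (2 s) show ?case by (rule 2(1)[OF 2(2)])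
  qed
  define \<beta> where "\<beta> j = - (s j ^ 4 + of_int f1 * s j ^ 3 + of_int f2 * (s j)\<^sup>2 + of_int f3 * s j)" for j
  show ?thesis
  proof (rule that[of \<beta>])
    fix f4 t assume t: "has_roots (monic_quartic f1 f2 f3 f4) t"
    let ?f = "map_poly of_int (monic_quartic f1 f2 f3 f4) :: complex poly"
    have f: "?f = [:of_int f4, of_int f3, of_int f2, of_int f1, 1:]"
      by (simp add: monic_quartic_def of_int_hom.map_poly_pCons_hom)
    have d: "poly (pderiv ?f) x = 4 * ((x - s 0) * (x - s 1) * (x - s 2))" for x
      unfolding s[symmetric] f by (simp add: pderiv_pCons algebra_simps power2_eq_square power3_eq_cube)
    have v: "of_int f4 - \<beta> j = (s j - t 0) * (s j - t 1) * (s j - t 2) * (s j - t 3)" for j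
      unfolding has_roots_poly[OF t, symmetric] f \<beta>_def
      by (simp add: algebra_simps power2_eq_square power3_eq_cube power4_eq_xxxx)
    have p: "poly (pderiv ?f) (t 0) = (t 0 - t 1) * (t 0 - t 2) * (t 0 - t 3)"
      "poly (pderiv ?f) (t 1) = (t 1 - t 0) * (t 1 - t 2) * (t 1 - t 3)"
      "poly (pderiv ?f) (t 2) = (t 2 - t 0) * (t 2 - t 1) * (t 2 - t 3)"
      "poly (pderiv ?f) (t 3) = (t 3 - t 0) * (t 3 - t 1) * (t 3 - t 2)"
      by (simp_all add: pderiv_roots[OF t])
    \<comment> \<open>The leading coefficient 4 of the derivative occurs at four roots and gives
      256. The product of all distances between roots and critical points then regroups into the
      values of the polynomial at the critical points.\<close>
    have "(cmod (vandermonde t))\<^sup>2 = cmod (poly (pderiv ?f) (t 0)) * cmod (poly (pderiv ?f) (t 1))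
        * cmod (poly (pderiv ?f) (t 2)) * cmod (poly (pderiv ?f) (t 3))"
      unfolding p vandermonde_def by (simp add: norm_mult power2_eq_square norm_minus_commute mult_ac)
    also have "\<dots> = 256 * (cmod (of_int f4 - \<beta> 0) * cmod (of_int f4 - \<beta> 1) * cmod (of_int f4 - \<beta> 2))"
      unfolding d v by (simp add: norm_mult norm_minus_commute mult_ac)
    finally show "(cmod (vandermonde t))\<^sup>2 = 256 * (cmod (of_int f4 - \<beta> 0) * cmod (of_int f4 - \<beta> 1) * cmod (of_int f4 - \<beta> 2))" .
  qed
qed

lemma card_int_near:
  fixes x r :: real
  assumes "0 \<le> r"
  shows "finite {n :: int. \<bar>of_int n - x\<bar> < r}" "real (card {n :: int. \<bar>of_int n - x\<bar> < r}) \<le> 2 * r + 1"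
proof -
  have sub: "{n :: int. \<bar>of_int n - x\<bar> < r} \<subseteq> {\<lceil>x - r\<rceil>..\<lfloor>x + r\<rfloor>}"
    by (auto simp: ceiling_le_iff le_floor_iff)
  then show "finite {n :: int. \<bar>of_int n - x\<bar> < r}" using finite_subset by blast
  have "card {n :: int. \<bar>of_int n - x\<bar> < r} \<le> card {\<lceil>x - r\<rceil>..\<lfloor>x + r\<rfloor>}"
    using sub by (intro card_mono) auto
  also have "\<dots> = nat (\<lfloor>x + r\<rfloor> - \<lceil>x - r\<rceil> + 1)" by simp
  finally have "real (card {n :: int. \<bar>of_int n - x\<bar> < r}) \<le> real (nat (\<lfloor>x + r\<rfloor> - \<lceil>x - r\<rceil> + 1))" by simp
  also have "\<dots> \<le> 2 * r + 1" using assms by linarith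
  finally show "real (card {n :: int. \<bar>of_int n - x\<bar> < r}) \<le> 2 * r + 1" .
qed

definition int_box :: "real \<Rightarrow> int set" where
  "int_box x = {n. \<bar>of_int n\<bar> \<le> x}"

lemma int_box_eq: "int_box x = {-\<lfloor>x\<rfloor>..\<lfloor>x\<rfloor>}"
proof (rule Set.set_eqI)
  fix n
  have "\<bar>of_int n\<bar> \<le> x \<longleftrightarrow> n \<le> \<lfloor>x\<rfloor> \<and> - n \<le> \<lfloor>x\<rfloor>"
    unfolding le_floor_iff abs_le_iff by simp
  then show "n \<in> int_box x \<longleftrightarrow> n \<in> {-\<lfloor>x\<rfloor>..\<lfloor>x\<rfloor>}" unfolding int_box_def by auto
qed

lemma int_box_finite: "finite (int_box x)"
  by (simp add: int_box_eq)

lemma card_int_box: "0 \<le> x \<Longrightarrow> real (card (int_box x)) = 2 * of_int \<lfloor>x\<rfloor> + 1"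
  by (simp add: int_box_eq)

lemma card_int_box_ge: "1 \<le> x \<Longrightarrow> x \<le> real (card (int_box x))"
  using card_int_box[of x] real_of_int_floor_add_one_gt[of x] by linarith

lemma card_int_box_le: "0 \<le> x \<Longrightarrow> real (card (int_box x)) \<le> 2 * x + 1"
  using card_int_box[of x] of_int_floor_le[of x] by linarith

text \<open>The modulus does not depend on the order of the roots, so any list of roots decides. For
  positive \<open>E\<close> the polynomials with repeated roots are included.\<close>

definition small_disc :: "real \<Rightarrow> int \<Rightarrow> int \<Rightarrow> int \<Rightarrow> int \<Rightarrow> bool" where
  "small_disc E f1 f2 f3 f4 \<longleftrightarrow> (\<exists>t. has_roots (monic_quartic f1 f2 f3 f4) t \<and> (cmod (vandermonde t))\<^sup>2 < E)"

text \<open>If a product of three factors is below \<open>r ^ 3\<close>, some factor is below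
  \<open>r\<close>; this confines \<open>f4\<close> to one of three intervals of length
  \<open>2 * r\<close>.\<close>

lemma card_small_disc_fiber:
  fixes r :: real
  assumes r: "0 \<le> r"
  shows "finite {f4. small_disc (256 * r ^ 3) f1 f2 f3 f4}"
    "real (card {f4. small_disc (256 * r ^ 3) f1 f2 f3 f4}) \<le> 3 * (2 * r + 1)"
proof -
  obtain \<beta> :: "nat \<Rightarrow> complex" where \<beta>: "\<And>f4 t. has_roots (monic_quartic f1 f2 f3 f4) t \<Longrightarrow>
     (cmod (vandermonde t))\<^sup>2 = 256 * (cmod (of_int f4 - \<beta> 0) * cmod (of_int f4 - \<beta> 1) * cmod (of_int f4 - \<beta> 2))"
    using disc_constant_coeff[of f1 f2 f3] by blast
  let ?N = "\<lambda>j. {n :: int. \<bar>of_int n - Re (\<beta> j)\<bar> < r}"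
  have sub: "{f4. small_disc (256 * r ^ 3) f1 f2 f3 f4} \<subseteq> ?N 0 \<union> ?N 1 \<union> ?N 2"
  proof
    fix f4 assume "f4 \<in> {f4. small_disc (256 * r ^ 3) f1 f2 f3 f4}"
    then have lt: "cmod (of_int f4 - \<beta> 0) * cmod (of_int f4 - \<beta> 1) * cmod (of_int f4 - \<beta> 2) < r ^ 3"
      using \<beta> by (auto simp: small_disc_def)
    have near: "f4 \<in> ?N j" if "cmod (of_int f4 - \<beta> j) < r" for j
      using that abs_Re_le_cmod[of "of_int f4 - \<beta> j"] by simp
    have "cmod (of_int f4 - \<beta> 0) < r \<or> cmod (of_int f4 - \<beta> 1) < r \<or> cmod (of_int f4 - \<beta> 2) < r"
    proof (rule ccontr)
      assume "\<not> ?thesis"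
      then have "r * r * r \<le> cmod (of_int f4 - \<beta> 0) * cmod (of_int f4 - \<beta> 1) * cmod (of_int f4 - \<beta> 2)"
        using r by (intro mult_mono) auto
      then show False using lt by (simp add: power3_eq_cube)
    qed
    then show "f4 \<in> ?N 0 \<union> ?N 1 \<union> ?N 2" using near by blast
  qed
  have fin: "finite (?N 0 \<union> ?N 1 \<union> ?N 2)" using card_int_near(1)[OF r] by blast
  show "finite {f4. small_disc (256 * r ^ 3) f1 f2 f3 f4}" using finite_subset[OF sub fin] .
  have "card {f4. small_disc (256 * r ^ 3) f1 f2 f3 f4} \<le> card (?N 0 \<union> ?N 1 \<union> ?N 2)"
    by (rule card_mono[OF fin sub])
  also have "\<dots> \<le> card (?N 0) + card (?N 1) + card (?N 2)"
    by (rule order_trans[OF card_Un_le]) (simp add: card_Un_le)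
  finally have "real (card {f4. small_disc (256 * r ^ 3) f1 f2 f3 f4})
      \<le> real (card (?N 0)) + real (card (?N 1)) + real (card (?N 2))" by (simp flip: of_nat_add)
  also have "\<dots> \<le> (2 * r + 1) + (2 * r + 1) + (2 * r + 1)"
    by (intro add_mono card_int_near(2)[OF r])
  finally show "real (card {f4. small_disc (256 * r ^ 3) f1 f2 f3 f4}) \<le> 3 * (2 * r + 1)" by simp
qed

lemma card_small_disc:
  fixes r :: real
  assumes r: "0 \<le> r" and G: "finite G"
  shows "real (card {((f1, f2, f3), f4) |f1 f2 f3 f4. (f1, f2, f3) \<in> G \<and> f4 \<in> I \<and> small_disc (256 * r ^ 3) f1 f2 f3 f4})
    \<le> card G * (3 * (2 * r + 1))"
proof -
  let ?S = "\<lambda>g. case g of (f1, f2, f3) \<Rightarrow> {f4. small_disc (256 * r ^ 3) f1 f2 f3 f4}"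
  have S: "finite (?S g)" "real (card (?S g)) \<le> 3 * (2 * r + 1)" for g
    using card_small_disc_fiber[OF r] by (cases g; simp)+
  have "card {((f1, f2, f3), f4) |f1 f2 f3 f4. (f1, f2, f3) \<in> G \<and> f4 \<in> I \<and> small_disc (256 * r ^ 3) f1 f2 f3 f4} \<le> card (Sigma G ?S)"
    using G S by (intro card_mono finite_SigmaI) auto
  also have "\<dots> = (\<Sum>g\<in>G. card (?S g))" using G S by (intro card_SigmaI) auto
  finally have "real (card {((f1, f2, f3), f4) |f1 f2 f3 f4. (f1, f2, f3) \<in> G \<and> f4 \<in> I \<and> small_disc (256 * r ^ 3) f1 f2 f3 f4})
     \<le> (\<Sum>g\<in>G. real (card (?S g)))" by (simp flip: of_nat_sum)
  also have "\<dots> \<le> (\<Sum>g\<in>G. 3 * (2 * r + 1))" using S by (intro sum_mono) blast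
  finally show ?thesis by simp
qed

definition quartic_of :: "(int \<times> int \<times> int) \<times> int \<Rightarrow> int poly" where
  "quartic_of = (\<lambda>((f1, f2, f3), f4). monic_quartic f1 f2 f3 f4)"

lemma inj_quartic_of: "inj quartic_of"
proof (rule injI)
  fix x y assume "quartic_of x = quartic_of y"
  then show "x = y" by (cases x, cases y) (auto simp: quartic_of_def monic_quartic_def)
qed

definition coeff_box :: "real \<Rightarrow> ((int \<times> int \<times> int) \<times> int) set" where
  "coeff_box h = (int_box h \<times> int_box (h\<^sup>2) \<times> int_box (h ^ 3)) \<times> int_box (h ^ 4)"

lemma H_r_le_iff:
  assumes "0 \<le> T"
  shows "H_r (monic_quartic f1 f2 f3 f4) \<le> T \<longleftrightarrow> ((f1, f2, f3), f4) \<in> coeff_box T"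
proof -
  have r: "root i \<bar>x\<bar> \<le> T \<longleftrightarrow> \<bar>x\<bar> \<le> T ^ i" if "0 < i" for i x
    using real_root_le_iff[OF that, of "\<bar>x\<bar>" "T ^ i"] that assms by (simp add: real_root_power_cancel)
  have "{1..4} = {1, 2, 3, 4 :: nat}" by auto
  then have "H_r (monic_quartic f1 f2 f3 f4) \<le> T \<longleftrightarrow> (\<forall>i\<in>{1, 2, 3, 4}. root i \<bar>of_int (coeff (monic_quartic f1 f2 f3 f4) (4 - i))\<bar> \<le> T)"
    unfolding H_r_def by simp
  also have "\<dots> \<longleftrightarrow> \<bar>real_of_int f1\<bar> \<le> T ^ 1 \<and> \<bar>real_of_int f2\<bar> \<le> T\<^sup>2 \<and> \<bar>real_of_int f3\<bar> \<le> T ^ 3 \<and> \<bar>real_of_int f4\<bar> \<le> T ^ 4"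
    using r[of 1 "of_int f1"] r[of 2 "of_int f2"] r[of 3 "of_int f3"] r[of 4 "of_int f4"] monic_quartic_coeffs[of f1 f2 f3 f4]
    by simp
  finally show ?thesis by (simp add: coeff_box_def int_box_def)
qed

lemma finite_coeff_box: "finite (coeff_box h)"
  by (simp add: coeff_box_def int_box_finite)

lemma F4_mon_height:
  assumes "0 \<le> T"
  shows "{f \<in> F4_mon. H_r f \<le> T} = quartic_of ` coeff_box T \<inter> F4_mon"
proof (intro equalityI subsetI)
  fix f assume f: "f \<in> {f \<in> F4_mon. H_r f \<le> T}"
  obtain f1 f2 f3 f4 where e: "f = monic_quartic f1 f2 f3 f4"
    by (rule F4_monE[of f]) (use f in auto)
  then have "((f1, f2, f3), f4) \<in> coeff_box T" using f H_r_le_iff[OF assms] by simp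
  then show "f \<in> quartic_of ` coeff_box T \<inter> F4_mon"
    using f e by (auto simp: quartic_of_def intro!: rev_image_eqI)
next
  fix f assume "f \<in> quartic_of ` coeff_box T \<inter> F4_mon"
  then show "f \<in> {f \<in> F4_mon. H_r f \<le> T}" by (auto simp: quartic_of_def H_r_le_iff[OF assms])
qed

lemma finite_height: "finite {f \<in> F4_mon. H_r f \<le> T}"
proof -
  have "{f \<in> F4_mon. H_r f \<le> T} \<subseteq> {f \<in> F4_mon. H_r f \<le> \<bar>T\<bar>}" by auto
  moreover have "finite {f \<in> F4_mon. H_r f \<le> \<bar>T\<bar>}"
    using F4_mon_height[of "\<bar>T\<bar>"] finite_coeff_box[of "\<bar>T\<bar>"] by simp
  ultimately show ?thesis by (rule finite_subset)
qed

lemma large_disc_close: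
  assumes box: "((f1, f2, f3), f4) \<in> coeff_box h" and h: "1 \<le> h" and \<delta>: "0 < \<delta>"
    and large: "\<not> small_disc (\<delta> * h ^ 12) f1 f2 f3 f4"
  obtains t where "bounded_quartic f1 f2 f3 f4 t h" "\<delta> * h ^ 12 \<le> (cmod (vandermonde t))\<^sup>2"
    "has_roots (monic_quartic f1 f2 f3 f4) t"
proof -
  obtain t where t: "has_roots (monic_quartic f1 f2 f3 f4) t"
    using roots_exist[OF monic_quartic_coeffs(6,7)[of f1 f2 f3 f4]] .
  then have ge: "\<delta> * h ^ 12 \<le> (cmod (vandermonde t))\<^sup>2" using large by (auto simp: small_disc_def not_less)
  moreover have "0 < \<delta> * h ^ 12" using \<delta> h by simp
  ultimately have "vandermonde t \<noteq> 0" by auto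
  then interpret quartic_roots f1 f2 f3 f4 t by (rule has_roots_quartic_roots[OF t])
  have "bounded_quartic f1 f2 f3 f4 t h"
    using box h by unfold_locales (auto simp: coeff_box_def int_box_def)
  then show ?thesis using ge t by (rule that)
qed

text \<open>The set \<open>G\<close> of admissible first three coefficients is a parameter because
  both limits use this set: with the full box for the first, with vanishing cubic coefficient for
  the second. The threshold is the one of \<open>card_small_disc_fiber\<close> for
  \<open>r = c * h ^ 4\<close>, so that \<open>c\<close> controls the proportion of the values
  \<open>f4\<close> that are lost.\<close>

definition good_box :: "(int \<times> int \<times> int) set \<Rightarrow> real \<Rightarrow> real \<Rightarrow> ((int \<times> int \<times> int) \<times> int) set" where
  "good_box G c h = {((f1, f2, f3), f4) |f1 f2 f3 f4. (f1, f2, f3) \<in> G \<and> f4 \<in> int_box (h ^ 4) \<and>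
     \<not> small_disc (256 * c ^ 3 * h ^ 12) f1 f2 f3 f4}"

lemma card_good_box:
  assumes "0 \<le> c" "1 \<le> h" "finite G"
  shows "real (card G) * (real (card (int_box (h ^ 4))) - 3 * (2 * c * h ^ 4 + 1)) \<le> real (card (good_box G c h))"
proof -
  let ?r = "c * h ^ 4"
  have r: "256 * ?r ^ 3 = 256 * c ^ 3 * h ^ 12" by (simp add: power_mult_distrib flip: power_mult)
  let ?B = "{((f1, f2, f3), f4) |f1 f2 f3 f4. (f1, f2, f3) \<in> G \<and> f4 \<in> int_box (h ^ 4) \<and> small_disc (256 * ?r ^ 3) f1 f2 f3 f4}"
  have B: "real (card ?B) \<le> card G * (3 * (2 * ?r + 1))"
    using assms by (intro card_small_disc) auto
  have u: "good_box G c h \<union> ?B = G \<times> int_box (h ^ 4)" unfolding good_box_def r by auto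
  have fin: "finite (G \<times> int_box (h ^ 4))" using assms int_box_finite by simp
  have "card (G \<times> int_box (h ^ 4)) \<le> card (good_box G c h) + card ?B"
    unfolding u[symmetric] by (rule card_Un_le)
  then have "card G * card (int_box (h ^ 4)) \<le> card (good_box G c h) + card ?B"
    by (simp add: card_cartesian_product)
  then have "real (card G) * real (card (int_box (h ^ 4))) \<le> real (card (good_box G c h)) + real (card ?B)"
    by (simp flip: of_nat_add of_nat_mult)
  then show ?thesis using B by (simp add: algebra_simps)
qed

lemma finite_good_box: "finite G \<Longrightarrow> finite (good_box G c h)"
  by (rule finite_subset[of _ "G \<times> int_box (h ^ 4)"]) (auto simp: good_box_def int_box_finite)

lemma good_box_props:
  assumes x: "x \<in> good_box G c h" and G: "G \<subseteq> int_box h \<times> int_box (h\<^sup>2) \<times> int_box (h ^ 3)"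
    and c: "0 < c" and h: "1 \<le> h"
  obtains f1 f2 f3 f4 t where "x = ((f1, f2, f3), f4)" "bounded_quartic f1 f2 f3 f4 t h"
    "256 * c ^ 3 * h ^ 12 \<le> (cmod (vandermonde t))\<^sup>2" "quartic_of x \<in> F4_mon" "x \<in> coeff_box h"
    "has_roots (monic_quartic f1 f2 f3 f4) t"
proof -
  obtain f1 f2 f3 f4 where e: "x = ((f1, f2, f3), f4)" "(f1, f2, f3) \<in> G" "f4 \<in> int_box (h ^ 4)"
    "\<not> small_disc (256 * c ^ 3 * h ^ 12) f1 f2 f3 f4" using x by (auto simp: good_box_def)
  have box: "((f1, f2, f3), f4) \<in> coeff_box h" using e(2,3) G by (auto simp: coeff_box_def)
  have \<delta>: "0 < 256 * c ^ 3" using c by simp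
  obtain t where t: "bounded_quartic f1 f2 f3 f4 t h" "256 * c ^ 3 * h ^ 12 \<le> (cmod (vandermonde t))\<^sup>2"
    "has_roots (monic_quartic f1 f2 f3 f4) t"
    by (rule large_disc_close[OF box h \<delta> e(4)])
  have "0 < 256 * c ^ 3 * h ^ 12" using \<delta> h by simp
  then have "vandermonde t \<noteq> 0" using t(2) by auto
  then have "quartic_of x \<in> F4_mon" using monic_quartic_F4_mon[OF t(3)] by (simp add: quartic_of_def e(1))
  then show ?thesis using that[OF e(1) t(1,2) _ _ t(3)] box e(1) by simp
qed

section \<open>The first limit\<close>

definition mon_ratio :: "real \<Rightarrow> real \<Rightarrow> real" where
  "mon_ratio \<epsilon> T = real (card {f \<in> F4_mon. H_r f \<le> T \<and> class_close exps \<epsilon> T (psi_mon f)}) /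
     real (card {f \<in> F4_mon. H_r f \<le> T})"

lemma mon_ratio_le: "mon_ratio \<epsilon> T \<le> 1"
proof -
  have "card {f \<in> F4_mon. H_r f \<le> T \<and> class_close exps \<epsilon> T (psi_mon f)} \<le> card {f \<in> F4_mon. H_r f \<le> T}"
    by (rule card_mono[OF finite_height]) auto
  then show ?thesis unfolding mon_ratio_def
    by (cases "card {f \<in> F4_mon. H_r f \<le> T} = 0") (simp_all add: divide_le_eq_1)
qed

lemma quartic_of_close:
  assumes b: "bounded_quartic f1 f2 f3 f4 t h" and \<delta>: "0 < \<delta>" "\<delta> * h ^ 12 \<le> (cmod (vandermonde t))\<^sup>2"
    and T: "1 < (cmod (vandermonde t))\<^sup>2" "1 < T" "close_const \<delta> * ln T \<le> \<epsilon> * ln ((cmod (vandermonde t))\<^sup>2)"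
  obtains P where "P \<in> quartic_pairs" "psi_mon (monic_quartic f1 f2 f3 f4) = pair_iso `` {P}" "close exps \<epsilon> T P"
    "pair_disc P = (cmod (vandermonde t))\<^sup>2" "P \<in> psi_mon (monic_quartic f1 f2 f3 f4)"
proof -
  interpret bounded_quartic f1 f2 f3 f4 t h by (rule b)
  show ?thesis
  proof (rule that[of "(RR, CC, \<Phi>)"])
    show q: "(RR, CC, \<Phi>) \<in> quartic_pairs" by (rule quartic_pairsI[OF embedded_pair])
    show c: "psi_mon (monic_quartic f1 f2 f3 f4) = pair_iso `` {(RR, CC, \<Phi>)}" by (rule psi_mon_class)
    show "close exps \<epsilon> T (RR, CC, \<Phi>)" using model_close[OF \<delta>(1)] \<delta>(2) T by (simp add: vdm_eq)
    show "pair_disc (RR, CC, \<Phi>) = (cmod (vandermonde t))\<^sup>2" by (simp add: pair_disc_model vdm_eq)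
    show "(RR, CC, \<Phi>) \<in> psi_mon (monic_quartic f1 f2 f3 f4)"
      using equiv_class_self[OF equiv_pair_iso q] c by simp
  qed
qed

lemma ratio_ge:
  fixes u m a b :: real
  assumes "u * m \<le> b" "0 \<le> b" "a \<le> m" "b \<le> a" "0 < m"
  shows "u \<le> b / a"
proof (cases "0 < u")
  case True
  have "u * a \<le> u * m" using True assms(3) by simp
  moreover have "0 < a" using mult_pos_pos[OF True assms(5)] assms(1,4) by linarith
  ultimately show ?thesis using assms(1) by (simp add: le_divide_eq)
next
  case False
  moreover have "0 \<le> b / a" using assms(2,4) by simp
  ultimately show ?thesis by linarith
qed

lemma mon_ratio_ge:
  assumes c: "0 < c" "c \<le> 1 / 8" and \<epsilon>: "close_const (256 * c ^ 3) \<le> \<epsilon>" "0 \<le> \<epsilon>"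
    and T: "1 / (256 * c ^ 3) \<le> T" "1 < T"
  shows "1 - (6 * c + 3 / T ^ 4) \<le> mon_ratio \<epsilon> T"
proof -
  let ?\<delta> = "256 * c ^ 3"
  let ?G = "int_box T \<times> int_box (T\<^sup>2) \<times> int_box (T ^ 3)"
  let ?A = "{f \<in> F4_mon. H_r f \<le> T}" and ?Ac = "{f \<in> F4_mon. H_r f \<le> T \<and> class_close exps \<epsilon> T (psi_mon f)}"
  have \<delta>: "0 < ?\<delta>" using c by simp
  have G: "finite ?G" by (simp add: int_box_finite)
  have T0: "0 \<le> T" "1 \<le> T" using T by auto
  have "quartic_of ` good_box ?G c T \<subseteq> ?Ac"
  proof
    fix f assume "f \<in> quartic_of ` good_box ?G c T"
    then obtain x where x: "x \<in> good_box ?G c T" "f = quartic_of x" by blast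
    obtain f1 f2 f3 f4 t where e: "x = ((f1, f2, f3), f4)" "bounded_quartic f1 f2 f3 f4 t T"
      "?\<delta> * T ^ 12 \<le> (cmod (vandermonde t))\<^sup>2" "quartic_of x \<in> F4_mon" "x \<in> coeff_box T"
      by (rule good_box_props[OF x(1) subset_refl c(1) T0(2)])
    have f: "f = monic_quartic f1 f2 f3 f4" using x e by (simp add: quartic_of_def)
    \<comment> \<open>Here \<open>T\<close> bounds the height and is also the parameter of
      closeness. A discriminant of at least \<open>T\<close> already makes its logarithm large
      enough, and this follows from the much larger bound of order \<open>T ^ 12\<close>.\<close>
    have "1 \<le> ?\<delta> * T" using T(1) \<delta> by (simp add: field_simps)
    also have "\<dots> \<le> ?\<delta> * T ^ 11" using \<delta> T0 power_increasing[of 1 11 T] by (intro mult_left_mono) auto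
    finally have "1 * T \<le> (?\<delta> * T ^ 11) * T" using T0 by (intro mult_right_mono) auto
    also have "\<dots> = ?\<delta> * T ^ 12" by (simp add: eval_nat_numeral)
    also note e(3)
    finally have D: "T \<le> (cmod (vandermonde t))\<^sup>2" by simp
    have "close_const ?\<delta> * ln T \<le> \<epsilon> * ln T" using \<epsilon> T by (intro mult_right_mono) auto
    also have "\<dots> \<le> \<epsilon> * ln ((cmod (vandermonde t))\<^sup>2)" using D T \<epsilon> by (intro mult_left_mono ln_mono) auto
    finally have K: "close_const ?\<delta> * ln T \<le> \<epsilon> * ln ((cmod (vandermonde t))\<^sup>2)" .
    have D1: "1 < (cmod (vandermonde t))\<^sup>2" using D T by linarith
    obtain P where "close exps \<epsilon> T P" "P \<in> psi_mon f"
      unfolding f by (rule quartic_of_close[OF e(2) \<delta> e(3) D1 T(2) K])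
    then have "class_close exps \<epsilon> T (psi_mon f)" by (auto simp: class_close_def)
    moreover have "f \<in> ?A" unfolding F4_mon_height[OF T0(1)] using x(2) e(4,5) by blast
    ultimately show "f \<in> ?Ac" by blast
  qed
  then have "card (quartic_of ` good_box ?G c T) \<le> card ?Ac"
    by (intro card_mono) (auto intro: finite_subset[OF _ finite_height])
  then have ge: "card (good_box ?G c T) \<le> card ?Ac"
    using card_image[OF inj_on_subset[OF inj_quartic_of subset_UNIV]] by metis
  have "card ?A \<le> card (coeff_box T)"
    unfolding F4_mon_height[OF T0(1)]
    by (rule order_trans[OF card_mono card_image_le]) (auto simp: finite_coeff_box)
  also have "\<dots> = card ?G * card (int_box (T ^ 4))" by (simp add: coeff_box_def card_cartesian_product)
  finally have le: "card ?A \<le> card ?G * card (int_box (T ^ 4))" .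
  define N g where "N = real (card (int_box (T ^ 4)))" and "g = real (card ?G)"
  have N: "T ^ 4 \<le> N" unfolding N_def using T0 by (intro card_int_box_ge) auto
  have T4: "0 < T ^ 4" using T by simp
  have "g * (N - 3 * (2 * c * T ^ 4 + 1)) \<le> real (card (good_box ?G c T))"
    unfolding N_def g_def by (rule card_good_box[OF less_imp_le[OF c(1)] T0(2) G])
  also have "\<dots> \<le> real (card ?Ac)" using ge by (rule of_nat_mono)
  finally have gb: "g * (N - 3 * (2 * c * T ^ 4 + 1)) \<le> real (card ?Ac)" .
  have ab: "real (card ?A) \<le> g * N" using of_nat_mono[OF le, where 'a = real] by (simp only: of_nat_mult N_def g_def)
  \<comment> \<open>The three excluded intervals are compared with the number
    \<open>N \<ge> T ^ 4\<close> of all values of \<open>f4\<close>.\<close>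
  have "3 * (2 * c * T ^ 4 + 1) \<le> (6 * c + 3 / T ^ 4) * N"
  proof -
    have "3 * (2 * c * T ^ 4 + 1) = (6 * c + 3 / T ^ 4) * T ^ 4" using T by (simp add: distrib_right distrib_left)
    also have "\<dots> \<le> (6 * c + 3 / T ^ 4) * N" using N c T4 by (intro mult_left_mono) auto
    finally show ?thesis .
  qed
  then have "g * ((1 - (6 * c + 3 / T ^ 4)) * N) \<le> g * (N - 3 * (2 * c * T ^ 4 + 1))"
    by (intro mult_left_mono) (auto simp: g_def algebra_simps)
  with gb have key: "(1 - (6 * c + 3 / T ^ 4)) * (g * N) \<le> real (card ?Ac)" by (simp add: mult_ac)
  have "card ?Ac \<le> card ?A" by (rule card_mono[OF finite_height]) auto
  moreover have "0 < g * N"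
  proof (rule mult_pos_pos)
    have "(0, 0, 0) \<in> ?G" using T0 by (simp add: int_box_def)
    then show "0 < g" unfolding g_def using G card_gt_0_iff[of ?G] by fastforce
    show "0 < N" using N T4 by linarith
  qed
  ultimately show ?thesis
    unfolding mon_ratio_def by (intro ratio_ge[OF key _ ab]) auto
qed

lemma mon_ratio_tendsto: "((\<lambda>\<epsilon>. Liminf at_top (\<lambda>T. ereal (mon_ratio \<epsilon> T))) \<longlongrightarrow> 1) at_top"
proof (rule order_tendstoI)
  fix a :: ereal assume a: "1 < a"
  have "Liminf at_top (\<lambda>T. ereal (mon_ratio \<epsilon> T)) \<le> Liminf at_top (\<lambda>T::real. 1)" for \<epsilon>
    by (intro Liminf_mono always_eventually) (simp add: mon_ratio_le one_ereal_def)
  then show "eventually (\<lambda>\<epsilon>. Liminf at_top (\<lambda>T. ereal (mon_ratio \<epsilon> T)) < a) at_top"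
    using a by (intro always_eventually) (auto simp: Liminf_const intro: le_less_trans)
next
  fix a :: ereal assume "a < 1"
  then obtain b where b: "a < ereal b" "ereal b < 1" using ereal_dense2 by blast
  \<comment> \<open>The 7 is made of the \<open>6 * c\<close> lost to the intervals and one more
    \<open>c\<close>, which bounds \<open>3 / T ^ 4\<close> once
    \<open>T \<ge> 3 / c\<close>.\<close>
  define c where "c = min (1 / 8) ((1 - b) / 7)"
  have c: "0 < c" "c \<le> 1 / 8" "7 * c \<le> 1 - b" using b(2) by (auto simp: c_def one_ereal_def min_def)
  have key: "a < Liminf at_top (\<lambda>T. ereal (mon_ratio \<epsilon> T))" if \<epsilon>: "close_const (256 * c ^ 3) \<le> \<epsilon>" "0 \<le> \<epsilon>" for \<epsilon>
  proof -
    have "eventually (\<lambda>T. ereal b \<le> ereal (mon_ratio \<epsilon> T)) at_top"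
      using eventually_ge_at_top[of "1 / (256 * c ^ 3)"] eventually_gt_at_top[of 1] eventually_ge_at_top[of "3 / c"]
    proof eventually_elim
      case (elim T)
      have "T ^ 1 \<le> T ^ 4" using elim(2) by (intro power_increasing) auto
      then have "3 / T ^ 4 \<le> 3 / T" using elim(2) by (intro divide_left_mono) auto
      also have "\<dots> \<le> c" using elim c by (simp add: field_simps)
      finally show ?case using mon_ratio_ge[OF c(1,2) \<epsilon> elim(1,2)] c(3) by simp
    qed
    then have "ereal b \<le> Liminf at_top (\<lambda>T. ereal (mon_ratio \<epsilon> T))" by (rule Liminf_bounded)
    then show ?thesis using b(1) by (rule less_le_trans[rotated])
  qed
  show "eventually (\<lambda>\<epsilon>. a < Liminf at_top (\<lambda>T. ereal (mon_ratio \<epsilon> T))) at_top"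
    using eventually_ge_at_top[of "close_const (256 * c ^ 3)"] eventually_ge_at_top[of 0]
    by eventually_elim (rule key)
qed

text \<open>The polynomials \<open>x ^ 4 + a\<close> with positive \<open>a\<close> suffice: the
  derivative vanishes only at 0, which is not a root.\<close>

lemma infinite_F4_mon: "infinite F4_mon"
proof
  assume fin: "finite F4_mon"
  have "monic_quartic 0 0 0 (int (Suc n)) \<in> F4_mon" for n
  proof -
    let ?a = "int (Suc n)"
    obtain t where t: "has_roots (monic_quartic 0 0 0 ?a) t"
      using roots_exist[OF monic_quartic_coeffs(6,7)[of 0 0 0 ?a]] .
    let ?f = "map_poly of_int (monic_quartic 0 0 0 ?a) :: complex poly"
    have f: "?f = [:of_int ?a, 0, 0, 0, 1:]"
      by (simp add: monic_quartic_def of_int_hom.map_poly_pCons_hom)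
    have "poly (pderiv ?f) (t i) \<noteq> 0" if "i \<in> {0, 1, 2, 3}" for i
    proof
      assume "poly (pderiv ?f) (t i) = 0"
      then have "t i = 0" unfolding f by (simp add: pderiv_pCons)
      moreover have "poly ?f (t i) = 0" unfolding has_roots_poly[OF t] using that by auto
      ultimately show False unfolding f using of_nat_neq_0[of n, where 'a = complex] by simp
    qed
    from this[of 0] this[of 1] this[of 2] have "inj_on t {..<4}"
      unfolding pderiv_roots[OF t] inj_on_4_iff by auto
    then show ?thesis using monic_quartic_F4_mon[OF t] vandermonde_nonzero_iff by blast
  qed
  then have "range (\<lambda>n. monic_quartic 0 0 0 (int (Suc n))) \<subseteq> F4_mon" by blast
  then have "finite (range (\<lambda>n. monic_quartic 0 0 0 (int (Suc n))))" using fin by (rule finite_subset)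
  moreover have "inj (\<lambda>n. monic_quartic 0 0 0 (int (Suc n)))" by (rule injI) (simp add: monic_quartic_def)
  ultimately show False using finite_imageD infinite_UNIV_nat by blast
qed

section \<open>Counting close pairs\<close>

lemma (in embedded_pair) form_coeff_comb:
  assumes \<alpha>: "unital_basis 4 R \<alpha>" and \<omega>: "unital_basis 3 C \<omega>" and kl: "k < 4" "l < 4" and j: "j < 3"
  shows "(\<Sum>m<3. of_int (form_coeff R C \<phi> \<alpha> \<omega> m k l) * \<tau> j (\<omega> m)) =
    (if k = l then resolv (\<lambda>i. \<sigma> i (\<alpha> k)) j
     else resolv (\<lambda>i. \<sigma> i (\<alpha> k) + \<sigma> i (\<alpha> l)) j - resolv (\<lambda>i. \<sigma> i (\<alpha> k)) j - resolv (\<lambda>i. \<sigma> i (\<alpha> l)) j)"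
proof -
  have \<alpha>c: "\<alpha> k \<in> carrier R" "\<alpha> l \<in> carrier R"
    using R.basis_closed[of \<alpha>] \<alpha> kl by (auto simp: unital_basis_def Pi_def)
  have e: "(\<Sum>m<3. of_int (coord C 3 \<omega> (\<phi> x) m) * \<tau> j (\<omega> m)) = resolv (\<lambda>i. \<sigma> i x) j" if "x \<in> carrier R" for x
  proof -
    have "int_basis C 3 \<omega>" "\<phi> x \<in> carrier C" using \<omega> \<phi>_closed that by (auto simp: unital_basis_def)
    from C.emb_coord[OF this j] \<phi>_eq[OF that j] show ?thesis by (rule trans[OF sym])
  qed
  have s: "resolv (\<lambda>i. \<sigma> i (\<alpha> k) + \<sigma> i (\<alpha> l)) j = resolv (\<lambda>i. \<sigma> i (\<alpha> k \<oplus>\<^bsub>R\<^esub> \<alpha> l)) j"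
    by (intro resolv_cong) (simp add: R.emb_add \<alpha>c)
  show ?thesis
    unfolding s using e[OF \<alpha>c(1)] e[OF \<alpha>c(2)] e[of "\<alpha> k \<oplus>\<^bsub>R\<^esub> \<alpha> l"] \<alpha>c
    by (simp add: form_coeff_def left_diff_distrib sum_subtractf)
qed

lemma resolv_bound:
  assumes "\<And>i. i < 4 \<Longrightarrow> cmod (v i) \<le> a" "0 \<le> a"
  shows "cmod (resolv v j) \<le> 4 * (a * a)"
proof -
  have p: "cmod (v i * v k) \<le> a * a" if "i < 4" "k < 4" for i k
    unfolding norm_mult using assms that by (intro mult_mono) auto
  have "cmod (v i * v k + v l * v m) \<le> 2 * (a * a)" if "i < 4" "k < 4" "l < 4" "m < 4" for i k l m
    using norm_triangle_ineq[of "v i * v k" "v l * v m"] p[OF that(1,2)] p[OF that(3,4)] by linarith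
  then have "cmod (resolv v j) \<le> 2 * (a * a)" by (simp add: resolv_def)
  moreover have "0 \<le> a * a" using assms(2) by simp
  ultimately show ?thesis by linarith
qed

text \<open>Bounding the polar form by the product \<open>a * b\<close>, rather than by the square
  of the larger factor, yields the exponent \<open>k + l\<close> on which the count of forms
  depends.\<close>

lemma resolv_polar_bound:
  assumes "\<And>i. i < 4 \<Longrightarrow> cmod (v i) \<le> a" "\<And>i. i < 4 \<Longrightarrow> cmod (w i) \<le> b" "0 \<le> a" "0 \<le> b"
  shows "cmod (resolv (\<lambda>i. v i + w i) j - resolv v j - resolv w j) \<le> 4 * (a * b)"
proof -
  have p: "cmod (v i * w k) \<le> a * b" if "i < 4" "k < 4" for i k
    unfolding norm_mult using assms that by (intro mult_mono) auto
  have s: "cmod (v i * w k + v k * w i + (v l * w m + v m * w l)) \<le> 4 * (a * b)"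
    if "i < 4" "k < 4" "l < 4" "m < 4" for i k l m
  proof -
    have "cmod (v i * w k + v k * w i + (v l * w m + v m * w l))
        \<le> (cmod (v i * w k) + cmod (v k * w i)) + (cmod (v l * w m) + cmod (v m * w l))"
      by (intro order_trans[OF norm_triangle_ineq] add_mono norm_triangle_ineq)
    then show ?thesis using p[OF that(1,2)] p[OF that(2,1)] p[OF that(3,4)] p[OF that(4,3)] by linarith
  qed
  have e: "resolv (\<lambda>i. v i + w i) j - resolv v j - resolv w j = (if j = 0 then v 0 * w 1 + v 1 * w 0 + (v 2 * w 3 + v 3 * w 2)
      else if j = 1 then v 0 * w 2 + v 2 * w 0 + (v 1 * w 3 + v 3 * w 1) else v 0 * w 3 + v 3 * w 0 + (v 1 * w 2 + v 2 * w 1))"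
    by (simp add: resolv_def algebra_simps)
  show ?thesis unfolding e using s[of 0 1 2 3] s[of 0 2 1 3] s[of 0 3 1 2] by simp
qed

text \<open>Where \<open>k + l < 2 * m\<close>, the truncated exponent is \<open>0\<close>.\<close>

lemma (in embedded_pair) form_coeff_bound:
  fixes s B :: real
  assumes \<alpha>: "unital_basis 4 R \<alpha>" and \<omega>: "unital_basis 3 C \<omega>" and s: "1 \<le> s" "0 < B"
    and b\<alpha>: "\<And>i k. i < 4 \<Longrightarrow> k < 4 \<Longrightarrow> cmod (\<sigma> i (\<alpha> k)) \<le> B * s ^ k"
    and b\<omega>: "\<And>j k. j < 3 \<Longrightarrow> k < 3 \<Longrightarrow> cmod (\<tau> j (\<omega> k)) \<le> B * s ^ (2 * k)"
    and disc: "s ^ 6 \<le> sqrt \<bar>real_of_int (ring_disc 3 C)\<bar>"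
    and m: "m \<in> {1, 2}" and kl: "1 \<le> k" "k \<le> l" "l \<le> 3"
  shows "\<bar>real_of_int (form_coeff R C \<phi> \<alpha> \<omega> m k l)\<bar> \<le> 24 * B ^ 4 * s ^ (k + l - 2 * m)"
proof -
  have kl4: "k < 4" "l < 4" using kl by auto
  let ?c = "\<lambda>m. complex_of_int (form_coeff R C \<phi> \<alpha> \<omega> m k l)"
  let ?r = "4 * ((B * s ^ k) * (B * s ^ l))"
  have \<omega>b: "int_basis C 3 \<omega>" using \<omega> by (simp add: unital_basis_def)
  have r: "cmod (\<Sum>m<3. ?c m * \<tau> j (\<omega> m)) \<le> ?r" if j: "j < 3" for j
  proof (cases "k = l")
    case True
    then show ?thesis unfolding form_coeff_comb[OF \<alpha> \<omega> kl4 j]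
      using resolv_bound[of "\<lambda>i. \<sigma> i (\<alpha> k)" "B * s ^ k" j] b\<alpha>[OF _ kl4(1)] s by simp
  next
    case False
    then show ?thesis unfolding form_coeff_comb[OF \<alpha> \<omega> kl4 j]
      using resolv_polar_bound[of "\<lambda>i. \<sigma> i (\<alpha> k)" "B * s ^ k" "\<lambda>i. \<sigma> i (\<alpha> l)" "B * s ^ l" j] b\<alpha> kl4 s by simp
  qed
  have d: "cmod (det (mat 3 3 (\<lambda>(j, k). \<tau> j (\<omega> k)))) = sqrt \<bar>real_of_int (ring_disc 3 C)\<bar>"
    using C.disc_cmod[OF \<omega>b] unfolding C.emb_def by (metis norm_ge_zero real_sqrt_unique)
  have m3: "m < 3" using m by auto
  have "\<bar>real_of_int (form_coeff R C \<phi> \<alpha> \<omega> m k l)\<bar> * s ^ 6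
      \<le> \<bar>real_of_int (form_coeff R C \<phi> \<alpha> \<omega> m k l)\<bar> * sqrt \<bar>real_of_int (ring_disc 3 C)\<bar>"
    by (intro mult_left_mono disc) auto
  also have "\<dots> = cmod (?c m) * cmod (det (mat 3 3 (\<lambda>(j, k). \<tau> j (\<omega> k))))" unfolding d by simp
  also have "\<dots> \<le> fact 3 * ?r * (\<Prod>j\<in>{..<3} - {m}. B * s ^ (2 * j))"
    using m3 by (intro cramer_bound b\<omega> r) auto
  also have "(\<Prod>j\<in>{..<3} - {m}. B * s ^ (2 * j)) = B\<^sup>2 * s ^ (6 - 2 * m)"
    using m unfolding lessThan_numerals(2)[symmetric] by (auto simp: insert_Diff_if power2_eq_square)
  also have "fact 3 * ?r * (B\<^sup>2 * s ^ (6 - 2 * m)) = 24 * B ^ 4 * s ^ (k + l + (6 - 2 * m))"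
    by (simp add: fact_numeral power_add power2_eq_square power4_eq_xxxx)
  also have "\<dots> \<le> 24 * B ^ 4 * s ^ ((k + l - 2 * m) + 6)"
    using s m kl by (intro mult_left_mono power_increasing) auto
  also have "\<dots> = (24 * B ^ 4 * s ^ (k + l - 2 * m)) * s ^ 6" by (simp add: power_add)
  finally show ?thesis by (rule mult_right_le_imp_le) (use s in simp)
qed

text \<open>A unipotent change of basis. If the \<open>k\<close>-th vector has length of order
  \<open>s ^ k\<close>, then \<open>a\<close> and \<open>b\<close> of order \<open>s\<close> and
  \<open>c\<close> of order \<open>s ^ 2\<close> preserve these orders. Multiples of 1 are not
  added, since the forms would not change.\<close>

definition shift4 :: "('a, 'm) ring_scheme \<Rightarrow> (nat \<Rightarrow> 'a) \<Rightarrow> int \<Rightarrow> int \<Rightarrow> int \<Rightarrow> nat \<Rightarrow> 'a" where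
  "shift4 R \<alpha> a b c = \<alpha>(3 := (\<alpha> 3 \<oplus>\<^bsub>R\<^esub> [b] \<cdot>\<^bsub>R\<^esub> \<alpha> 2) \<oplus>\<^bsub>R\<^esub> [c] \<cdot>\<^bsub>R\<^esub> \<alpha> 1, 2 := \<alpha> 2 \<oplus>\<^bsub>R\<^esub> [a] \<cdot>\<^bsub>R\<^esub> \<alpha> 1)"

definition shift3 :: "('a, 'm) ring_scheme \<Rightarrow> (nat \<Rightarrow> 'a) \<Rightarrow> int \<Rightarrow> nat \<Rightarrow> 'a" where
  "shift3 R \<omega> d = \<omega>(2 := \<omega> 2 \<oplus>\<^bsub>R\<^esub> [d] \<cdot>\<^bsub>R\<^esub> \<omega> 1)"

lemma shift4_emb:
  assumes "embedded_ring 4 R \<sigma>" and \<alpha>: "unital_basis 4 R \<alpha>" and i: "i < 4"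
  shows "\<sigma> i (shift4 R \<alpha> a b c 0) = 1" "\<sigma> i (shift4 R \<alpha> a b c 1) = \<sigma> i (\<alpha> 1)"
    "\<sigma> i (shift4 R \<alpha> a b c 2) = \<sigma> i (\<alpha> 2) + of_int a * \<sigma> i (\<alpha> 1)"
    "\<sigma> i (shift4 R \<alpha> a b c 3) = \<sigma> i (\<alpha> 3) + of_int b * \<sigma> i (\<alpha> 2) + of_int c * \<sigma> i (\<alpha> 1)"
proof -
  interpret embedded_ring 4 R \<sigma> by fact
  have \<alpha>c: "\<alpha> 1 \<in> carrier R" "\<alpha> 2 \<in> carrier R" "\<alpha> 3 \<in> carrier R"
    using basis_closed[of \<alpha>] \<alpha> by (auto simp: unital_basis_def Pi_def)
  show "\<sigma> i (shift4 R \<alpha> a b c 0) = 1" "\<sigma> i (shift4 R \<alpha> a b c 1) = \<sigma> i (\<alpha> 1)"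
    "\<sigma> i (shift4 R \<alpha> a b c 2) = \<sigma> i (\<alpha> 2) + of_int a * \<sigma> i (\<alpha> 1)"
    "\<sigma> i (shift4 R \<alpha> a b c 3) = \<sigma> i (\<alpha> 3) + of_int b * \<sigma> i (\<alpha> 2) + of_int c * \<sigma> i (\<alpha> 1)"
    using \<alpha> i \<alpha>c by (simp_all add: shift4_def unital_basis_def emb_add emb_int_mult emb_one del: One_nat_def)
qed

lemma shift3_emb:
  assumes "embedded_ring 3 R \<sigma>" and \<alpha>: "unital_basis 3 R \<alpha>" and i: "i < 3"
  shows "\<sigma> i (shift3 R \<alpha> d 0) = 1" "\<sigma> i (shift3 R \<alpha> d 1) = \<sigma> i (\<alpha> 1)"
    "\<sigma> i (shift3 R \<alpha> d 2) = \<sigma> i (\<alpha> 2) + of_int d * \<sigma> i (\<alpha> 1)"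
proof -
  interpret embedded_ring 3 R \<sigma> by fact
  have \<alpha>c: "\<alpha> 1 \<in> carrier R" "\<alpha> 2 \<in> carrier R"
    using basis_closed[of \<alpha>] \<alpha> by (auto simp: unital_basis_def Pi_def)
  show "\<sigma> i (shift3 R \<alpha> d 0) = 1" "\<sigma> i (shift3 R \<alpha> d 1) = \<sigma> i (\<alpha> 1)"
    "\<sigma> i (shift3 R \<alpha> d 2) = \<sigma> i (\<alpha> 2) + of_int d * \<sigma> i (\<alpha> 1)"
    using \<alpha> i \<alpha>c by (simp_all add: shift3_def unital_basis_def emb_add emb_int_mult emb_one del: One_nat_def)
qed

lemma unital_basis_shift4:
  assumes "embedded_ring 4 R \<sigma>" and \<alpha>: "unital_basis 4 R \<alpha>"
  shows "unital_basis 4 R (shift4 R \<alpha> a b c)"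
proof -
  interpret embedded_ring 4 R \<sigma> by fact
  have \<alpha>b: "int_basis R 4 \<alpha>" "\<alpha> 0 = \<one>\<^bsub>R\<^esub>" using \<alpha> by (auto simp: unital_basis_def)
  have \<alpha>c: "\<alpha> 1 \<in> carrier R" "\<alpha> 2 \<in> carrier R" "\<alpha> 3 \<in> carrier R"
    using basis_closed[OF \<alpha>b(1)] by (auto simp: Pi_def)
  let ?w = "(\<alpha> 3 \<oplus>\<^bsub>R\<^esub> [b] \<cdot>\<^bsub>R\<^esub> \<alpha> 2) \<oplus>\<^bsub>R\<^esub> [c] \<cdot>\<^bsub>R\<^esub> \<alpha> 1" and ?u = "\<alpha> 2 \<oplus>\<^bsub>R\<^esub> [a] \<cdot>\<^bsub>R\<^esub> \<alpha> 1"
  have 1: "int_basis R 4 (\<alpha>(3 := ?w))"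
    by (rule basis_replace[OF \<alpha>b(1), of 3 "\<lambda>l. if l = 3 then 1 else if l = 2 then b else if l = 1 then c else 0"])
      (simp_all add: \<alpha>c sum_lessThan_4 emb_add emb_int_mult del: One_nat_def)
  have "int_basis R 4 ((\<alpha>(3 := ?w))(2 := ?u))"
    by (rule basis_replace[OF 1, of 2 "\<lambda>l. if l = 2 then 1 else if l = 1 then a else 0"])
      (simp_all add: \<alpha>c sum_lessThan_4 emb_add emb_int_mult del: One_nat_def)
  then show ?thesis using \<alpha>b(2) by (simp add: unital_basis_def shift4_def)
qed

lemma unital_basis_shift3:
  assumes "embedded_ring 3 R \<sigma>" and \<alpha>: "unital_basis 3 R \<alpha>"
  shows "unital_basis 3 R (shift3 R \<alpha> d)"
proof -
  interpret embedded_ring 3 R \<sigma> by fact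
  have \<alpha>b: "int_basis R 3 \<alpha>" "\<alpha> 0 = \<one>\<^bsub>R\<^esub>" using \<alpha> by (auto simp: unital_basis_def)
  have \<alpha>c: "\<alpha> 1 \<in> carrier R" "\<alpha> 2 \<in> carrier R"
    using basis_closed[OF \<alpha>b(1)] by (auto simp: Pi_def)
  let ?u = "\<alpha> 2 \<oplus>\<^bsub>R\<^esub> [d] \<cdot>\<^bsub>R\<^esub> \<alpha> 1"
  have "int_basis R 3 (\<alpha>(2 := ?u))"
    by (rule basis_replace[OF \<alpha>b(1), of 2 "\<lambda>l. if l = 2 then 1 else if l = 1 then d else 0"])
      (simp_all add: \<alpha>c sum_lessThan_3 emb_add emb_int_mult del: One_nat_def)
  then show ?thesis using \<alpha>b(2) by (simp add: unital_basis_def shift3_def)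
qed

text \<open>Independence modulo constants: the complex constant \<open>e\<close> is absorbed as a
  coefficient of the vector 1.\<close>

lemma (in embedded_ring) unital_independent:
  fixes x :: "nat \<Rightarrow> int" and e :: complex
  assumes b: "unital_basis n R b" and eq: "\<And>i. i < n \<Longrightarrow> (\<Sum>k\<in>{1..<n}. of_int (x k) * \<sigma> i (b k)) = e"
    and k: "1 \<le> k" "k < n"
  shows "x k = 0"
proof -
  have bb: "int_basis R n b" using b by (simp add: unital_basis_def)
  let ?c = "\<lambda>k. if k = 0 then - e else of_int (x k)"
  have n: "0 < n" using k by simp
  have "(\<Sum>k<n. ?c k * \<sigma> i (b k)) = 0" if i: "i < n" for i
  proof -
    have "(\<Sum>k<n. ?c k * \<sigma> i (b k)) = ?c 0 * \<sigma> i (b 0) + (\<Sum>k\<in>{1..<n}. ?c k * \<sigma> i (b k))"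
      unfolding lessThan_atLeast0 using sum.atLeast_Suc_lessThan[OF n, of "\<lambda>k. ?c k * \<sigma> i (b k)"] by simp
    also have "(\<Sum>k\<in>{1..<n}. ?c k * \<sigma> i (b k)) = e"
      unfolding eq[OF i, symmetric] by (intro sum.cong) auto
    finally show ?thesis using b emb_one[OF i] by (simp add: unital_basis_def)
  qed
  from det_nonzero_kernel[OF det_val[OF bb] this k(2)] show ?thesis using k by simp
qed

lemma sum_from_1: "(\<Sum>k\<in>{1..<4}. f k) = f 1 + f 2 + f (3::nat)" "(\<Sum>k\<in>{1..<3}. f k) = f 1 + f (2::nat)"
  by (simp_all add: eval_nat_numeral)

text \<open>Since the relabelling and the sign determine a change of basis that preserves the forms, boundedly
  many shifts of a basis have the same forms.\<close>

definition codes :: "((nat \<Rightarrow> nat) \<times> (nat \<Rightarrow> nat) \<times> int) set" where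
  "codes = (\<Pi>\<^sub>E i\<in>{..<4}. {..<4}) \<times> (\<Pi>\<^sub>E i\<in>{..<3}. {..<3}) \<times> {1, -1}"

lemma finite_codes: "finite codes"
  unfolding codes_def by (intro finite_cartesian_product finite_PiE) auto

lemma card_shift_fiber:
  assumes P: "embedded_pair R \<sigma> C \<tau> \<phi>" and \<alpha>: "unital_basis 4 R \<alpha>" and \<omega>: "unital_basis 3 C \<omega>"
    and same: "\<And>a b c d a' b' c' d' m k l. (a, b, c, d) \<in> S \<Longrightarrow> (a', b', c', d') \<in> S \<Longrightarrow> m \<in> {1, 2} \<Longrightarrow>
      1 \<le> k \<Longrightarrow> k \<le> l \<Longrightarrow> l \<le> 3 \<Longrightarrow>
      form_coeff R C \<phi> (shift4 R \<alpha> a b c) (shift3 C \<omega> d) m k l = form_coeff R C \<phi> (shift4 R \<alpha> a' b' c') (shift3 C \<omega> d') m k l"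
  shows "finite S \<and> card S \<le> card codes"
proof (cases "S = {}")
  case True
  then show ?thesis by simp
next
  case False
  interpret P: embedded_pair R \<sigma> C \<tau> \<phi> by (rule P)
  note E4 = P.R.embedded_ring_axioms and E3 = P.C.embedded_ring_axioms
  obtain a0 b0 c0 d0 where g0: "(a0, b0, c0, d0) \<in> S" using False by auto
  let ?A = "\<lambda>(a, b, c, d). shift4 R \<alpha> a b c" and ?W = "\<lambda>(a, b, c, d). shift3 C \<omega> d"
  \<comment> \<open>One shift in \<open>S\<close> is fixed as a base point, and every other one is
    related to it by a relabelling, a sign and translations. In the cubic ring only the vector with
    index 2 depends on the shift.\<close>
  define Q where "Q g \<pi> \<rho> \<kappa> \<longleftrightarrow> (\<pi>, \<rho>, \<kappa>) \<in> codes \<and> \<pi> ` {..<4} = {..<4} \<and> \<rho> ` {..<3} = {..<3} \<and> (\<forall>k<4. \<exists>e. \<forall>i<4. \<sigma> (\<pi> i) (?A g k) = of_int \<kappa> * \<sigma> i (shift4 R \<alpha> a0 b0 c0 k) + e)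
     \<and> (\<exists>e. \<forall>j<3. \<tau> (\<rho> j) (?W g 2) = \<tau> j (shift3 C \<omega> d0 2) + e)" for g \<pi> \<rho> and \<kappa> :: int
  have "\<exists>\<pi> \<rho> \<kappa>. Q g \<pi> \<rho> \<kappa>" if g: "g \<in> S" for g
  proof -
    obtain a b c d where e: "g = (a, b, c, d)" by (cases g)
    obtain \<pi> \<rho> \<kappa> x y where r: "bij_betw \<pi> {..<4} {..<4::nat}" "bij_betw \<rho> {..<3} {..<3::nat}"
      "\<kappa> = 1 \<or> \<kappa> = (-1 :: int)"
      "\<And>i k. i < 4 \<Longrightarrow> k < 4 \<Longrightarrow> \<sigma> (\<pi> i) (shift4 R \<alpha> a b c k) = of_int \<kappa> * \<sigma> i (shift4 R \<alpha> a0 b0 c0 k) + of_int (x k)"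
      "\<And>j k. j < 3 \<Longrightarrow> k < 3 \<Longrightarrow> \<tau> (\<rho> j) (shift3 C \<omega> d k) = \<tau> j (shift3 C \<omega> d0 k) + of_int (y k)"
    proof (rule same_forms_rigid[OF P P unital_basis_shift4[OF E4 \<alpha>, of a0 b0 c0] unital_basis_shift3[OF E3 \<omega>, of d0]
        unital_basis_shift4[OF E4 \<alpha>, of a b c] unital_basis_shift3[OF E3 \<omega>, of d]], goal_cases)
      case (1 m k l) show ?case by (rule same[OF g0 g[unfolded e] 1(2-5)])
    next
      case (2 \<pi> \<rho> \<kappa> x y) show ?case by (rule 2(1)[OF 2(2,3,5,6,7)])
    qed
    let ?p = "restrict \<pi> {..<4}" and ?r = "restrict \<rho> {..<3}"
    have im: "\<pi> ` {..<4} = {..<4}" "\<rho> ` {..<3} = {..<3}" using r(1,2) by (auto simp: bij_betw_def)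
    then have "?p \<in> (\<Pi>\<^sub>E i\<in>{..<4}. {..<4})" "?r \<in> (\<Pi>\<^sub>E i\<in>{..<3}. {..<3})"
      unfolding restrict_PiE_iff by blast+
    then have c: "(?p, ?r, \<kappa>) \<in> codes" using r(3) by (simp add: codes_def)
    have "?p ` {..<4} = {..<4}" "?r ` {..<3} = {..<3}" using im by simp_all
    moreover have "\<exists>e. \<forall>i<4. \<sigma> (?p i) (shift4 R \<alpha> a b c k) = of_int \<kappa> * \<sigma> i (shift4 R \<alpha> a0 b0 c0 k) + e" if "k < 4" for k
      using r(4)[OF _ that] by (intro exI[of _ "of_int (x k)"]) simp
    moreover have "\<exists>e. \<forall>j<3. \<tau> (?r j) (shift3 C \<omega> d 2) = \<tau> j (shift3 C \<omega> d0 2) + e"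
      using r(5)[of _ 2] by (intro exI[of _ "of_int (y 2)"]) simp
    ultimately have "Q g ?p ?r \<kappa>" unfolding Q_def e prod.case using c by blast
    then show ?thesis by blast
  qed
  then obtain p r k where Q: "\<And>g. g \<in> S \<Longrightarrow> Q g (p g) (r g) (k g)" by metis
  define code where "code g = (p g, r g, k g)" for g
  have "inj_on code S"
  proof (rule inj_onI)
    fix g g' assume g: "g \<in> S" "g' \<in> S" "code g = code g'"
    obtain a b c d a' b' c' d' where e: "g = (a, b, c, d)" "g' = (a', b', c', d')" by (cases g, cases g')
    define \<pi> \<rho> \<kappa> where q: "\<pi> = p g" "\<rho> = r g" "\<kappa> = k g"
    have q': "p g' = \<pi>" "r g' = \<rho>" "k g' = \<kappa>" using g(3) by (simp_all add: code_def q)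
    note Q = Q[OF g(1), folded q, unfolded Q_def] Q[OF g(2), unfolded q' Q_def]
    note A1 = Q(1)[unfolded e prod.case, THEN conjunct2, THEN conjunct2, THEN conjunct2, THEN conjunct1, rule_format]
    note A2 = Q(2)[unfolded e prod.case, THEN conjunct2, THEN conjunct2, THEN conjunct2, THEN conjunct1, rule_format]
    note W1 = Q(1)[unfolded e prod.case, THEN conjunct2, THEN conjunct2, THEN conjunct2, THEN conjunct2]
    note W2 = Q(2)[unfolded e prod.case, THEN conjunct2, THEN conjunct2, THEN conjunct2, THEN conjunct2]
    have ims: "\<pi> ` {..<4} = {..<4}" "\<rho> ` {..<3} = {..<3}" using Q(1) by simp_all
    have "i \<in> \<pi> ` {..<4}" if "i < 4" for i unfolding ims using that by simp
    then have im1: "\<exists>i'<4. \<pi> i' = i" if "i < 4" for i using that by force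
    have "j \<in> \<rho> ` {..<3}" if "j < 3" for j unfolding ims using that by simp
    then have im2: "\<exists>j'<3. \<rho> j' = j" if "j < 3" for j using that by force
    \<comment> \<open>For two shifts with the same code, the relations to the base point subtract:
      corresponding basis vectors differ by constants only, and independence modulo constants makes
      the parameters equal.\<close>
    have diff: "\<exists>e. \<forall>i<4. \<sigma> i (shift4 R \<alpha> a b c k) - \<sigma> i (shift4 R \<alpha> a' b' c' k) = e" if k: "k < 4" for k
    proof -
      obtain x y where xy: "\<forall>i<4. \<sigma> (\<pi> i) (shift4 R \<alpha> a b c k) = of_int \<kappa> * \<sigma> i (shift4 R \<alpha> a0 b0 c0 k) + x"
        "\<forall>i<4. \<sigma> (\<pi> i) (shift4 R \<alpha> a' b' c' k) = of_int \<kappa> * \<sigma> i (shift4 R \<alpha> a0 b0 c0 k) + y"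
        using A1[OF k] A2[OF k] by (elim exE) (rule that)
      have "\<sigma> i (shift4 R \<alpha> a b c k) - \<sigma> i (shift4 R \<alpha> a' b' c' k) = x - y" if i: "i < 4" for i
      proof -
        obtain i' where "i' < 4" "\<pi> i' = i" using im1[OF i] by blast
        then show ?thesis using xy[rule_format, of i'] by simp
      qed
      then show ?thesis by blast
    qed
    obtain e2 where d2: "\<And>i. i < 4 \<Longrightarrow> \<sigma> i (shift4 R \<alpha> a b c 2) - \<sigma> i (shift4 R \<alpha> a' b' c' 2) = e2"
      using diff[of 2] by auto
    have e2: "(\<Sum>k\<in>{1..<4}. of_int ((if k = 1 then a - a' else 0)) * \<sigma> i (\<alpha> k)) = e2" if "i < 4" for i
      using d2[OF that, unfolded shift4_emb[OF E4 \<alpha> that]] unfolding sum_from_1 by (simp add: algebra_simps del: One_nat_def)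
    have a: "a = a'"
      using P.R.unital_independent[OF \<alpha>, where x = "\<lambda>k. if k = 1 then a - a' else 0" and k = 1, OF e2] by simp
    obtain e3 where d3: "\<And>i. i < 4 \<Longrightarrow> \<sigma> i (shift4 R \<alpha> a b c 3) - \<sigma> i (shift4 R \<alpha> a' b' c' 3) = e3"
      using diff[of 3] by auto
    have e3: "(\<Sum>k\<in>{1..<4}. of_int ((if k = 1 then c - c' else if k = 2 then b - b' else 0)) * \<sigma> i (\<alpha> k)) = e3" if "i < 4" for i
      using d3[OF that, unfolded shift4_emb[OF E4 \<alpha> that]] unfolding sum_from_1 by (simp add: algebra_simps del: One_nat_def)
    note ind = P.R.unital_independent[OF \<alpha>, where x = "\<lambda>k. if k = 1 then c - c' else if k = 2 then b - b' else 0"]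
    have bc: "b = b'" "c = c'" using ind[where k = 1, OF e3] ind[where k = 2, OF e3] by simp_all
    obtain x y where xy: "\<forall>j<3. \<tau> (\<rho> j) (shift3 C \<omega> d 2) = \<tau> j (shift3 C \<omega> d0 2) + x"
        "\<forall>j<3. \<tau> (\<rho> j) (shift3 C \<omega> d' 2) = \<tau> j (shift3 C \<omega> d0 2) + y"
      using W1 W2 by (elim exE) (rule that)
    have d4: "\<tau> j (shift3 C \<omega> d 2) - \<tau> j (shift3 C \<omega> d' 2) = x - y" if j: "j < 3" for j
    proof -
      obtain j' where "j' < 3" "\<rho> j' = j" using im2[OF j] by blast
      then show ?thesis using xy[rule_format, of j'] by simp
    qed
    have e4: "(\<Sum>k\<in>{1..<3}. of_int ((if k = 1 then d - d' else 0)) * \<tau> j (\<omega> k)) = x - y" if "j < 3" for j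
      using d4[OF that, unfolded shift3_emb[OF E3 \<omega> that]] unfolding sum_from_1 by (simp add: algebra_simps del: One_nat_def)
    have "d = d'"
      using P.C.unital_independent[OF \<omega>, where x = "\<lambda>k. if k = 1 then d - d' else 0" and k = 1, OF e4] by simp
    then show "g = g'" using a bc by (simp add: e)
  qed
  moreover have "code ` S \<subseteq> codes" using Q by (auto simp: code_def Q_def)
  ultimately show ?thesis using finite_codes inj_on_finite card_inj_on_le by blast
qed

text \<open>\<open>M\<close> bounds the ratios of the successive minima to their expected sizes at the scale \<open>s\<close>, where the
  discriminant is at least \<open>s ^ 12\<close>.\<close>

definition short_pair :: "real \<Rightarrow> nat \<Rightarrow> res_pair \<Rightarrow> bool" where
  "short_pair M s = (\<lambda>(R, C, \<phi>). (R, C, \<phi>) \<in> quartic_pairs \<and> real s ^ 12 \<le> pair_disc (R, C, \<phi>) \<and>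
     (\<forall>k\<in>{1, 2, 3}. succ_min 4 R k < M * (2 * real s) ^ k) \<and> (\<forall>k\<in>{1, 2}. succ_min 3 C k < M * (2 * real s) ^ (2 * k)))"

text \<open>The constant is \<open>320 = 5 * 4 ^ 3\<close>: the factors \<open>4 + 1\<close> and
  \<open>2 ^ k\<close> come from \<open>reduced_basis\<close>, a second \<open>2 ^ k\<close> from
  measuring the minima at the scale \<open>2 * s\<close>. The cubic analogue
  \<open>4 * 8 ^ 2\<close> is smaller.\<close>

definition reduced_data :: "real \<Rightarrow> nat \<Rightarrow> int list ring \<Rightarrow> int list ring \<Rightarrow> (int list \<Rightarrow> int list) \<Rightarrow>
    (nat \<Rightarrow> int list \<Rightarrow> complex) \<Rightarrow> (nat \<Rightarrow> int list \<Rightarrow> complex) \<Rightarrow> (nat \<Rightarrow> int list) \<Rightarrow> (nat \<Rightarrow> int list) \<Rightarrow> bool" where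
  "reduced_data M s R C \<phi> \<sigma> \<tau> \<alpha> \<omega> \<longleftrightarrow> embedded_pair R \<sigma> C \<tau> \<phi> \<and> unital_basis 4 R \<alpha> \<and> unital_basis 3 C \<omega> \<and>
     (\<forall>i<4. \<forall>k<4. cmod (\<sigma> i (\<alpha> k)) \<le> 320 * M * real s ^ k) \<and>
     (\<forall>j<3. \<forall>k<3. cmod (\<tau> j (\<omega> k)) \<le> 320 * M * real s ^ (2 * k)) \<and>
     real s ^ 6 \<le> sqrt \<bar>real_of_int (ring_disc 3 C)\<bar>"

lemma short_pair_reduced:
  assumes P: "short_pair M s (R, C, \<phi>)" and M: "1 \<le> M" and s: "1 \<le> s"
  obtains \<sigma> \<tau> \<alpha> \<omega> where "reduced_data M s R C \<phi> \<sigma> \<tau> \<alpha> \<omega>"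
proof -
  have q: "(R, C, \<phi>) \<in> quartic_pairs" "real s ^ 12 \<le> pair_disc (R, C, \<phi>)"
    "\<And>k. k \<in> {1, 2, 3} \<Longrightarrow> succ_min 4 R k < M * (2 * real s) ^ k"
    "\<And>k. k \<in> {1, 2} \<Longrightarrow> succ_min 3 C k < M * (2 * real s) ^ (2 * k)"
    using P by (auto simp: short_pair_def)
  obtain \<sigma> \<tau> where st: "embedded_pair R \<sigma> C \<tau> \<phi>" using quartic_pairsE[OF q(1)] .
  interpret embedded_pair R \<sigma> C \<tau> \<phi> by (rule st)
  have s1: "1 \<le> 2 * real s" using s by simp
  obtain \<alpha> where \<alpha>: "unital_basis 4 R \<alpha>" "\<And>k i. k < 4 \<Longrightarrow> i < 4 \<Longrightarrow> cmod (\<sigma> i (\<alpha> k)) \<le> real (4 + 1) * 2 ^ k * (M * (2 * real s) ^ k)"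
  proof (rule R.reduced_basis[of "\<lambda>k. M * (2 * real s) ^ k"], goal_cases)
    case (2 k) then show ?case using q(3)[of k] by (auto simp: less_4_cases)
  next
    case (3 j k) then show ?case using M s1 by (intro mult_left_mono power_increasing) auto
  next
    case (5 b) then show ?case by blast
  qed (use M in auto)
  obtain \<omega> where \<omega>: "unital_basis 3 C \<omega>" "\<And>k i. k < 3 \<Longrightarrow> i < 3 \<Longrightarrow> cmod (\<tau> i (\<omega> k)) \<le> real (3 + 1) * 2 ^ k * (M * (2 * real s) ^ (2 * k))"
  proof (rule C.reduced_basis[of "\<lambda>k. M * (2 * real s) ^ (2 * k)"], goal_cases)
    case (2 k) then show ?case using q(4)[of k] by (auto simp: less_3_cases)
  next
    case (3 j k) then show ?case using M s1 by (intro mult_left_mono power_increasing) auto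
  next
    case (5 b) then show ?case by blast
  qed (use M in auto)
  have "cmod (\<sigma> i (\<alpha> k)) \<le> 320 * M * real s ^ k" if ik: "i < 4" "k < 4" for i k
  proof -
    have "(4::real) ^ k \<le> 4 ^ 3" using ik by (intro power_increasing) auto
    have "real (4 + 1) * 2 ^ k * (M * (2 * real s) ^ k) = 5 * (2 * 2) ^ k * M * real s ^ k"
      unfolding power_mult_distrib by simp
    also have "\<dots> \<le> 5 * 4 ^ 3 * M * real s ^ k"
      using M \<open>(4::real) ^ k \<le> 4 ^ 3\<close> by (intro mult_right_mono) auto
    also have "\<dots> = 320 * M * real s ^ k" by simp
    finally show ?thesis by (rule order_trans[OF \<alpha>(2)[OF ik(2,1)]])
  qed
  moreover have "cmod (\<tau> j (\<omega> k)) \<le> 320 * M * real s ^ (2 * k)" if jk: "j < 3" "k < 3" for j k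
  proof -
    have "(8::real) ^ k \<le> 8 ^ 2" using jk by (intro power_increasing) auto
    have "real (3 + 1) * 2 ^ k * (M * (2 * real s) ^ (2 * k)) = 4 * (2 * 2\<^sup>2) ^ k * M * real s ^ (2 * k)"
      unfolding power_mult_distrib power_mult by simp
    also have "\<dots> \<le> 4 * 8 ^ 2 * M * real s ^ (2 * k)"
      using M \<open>(8::real) ^ k \<le> 8 ^ 2\<close> by (intro mult_right_mono) auto
    also have "\<dots> \<le> 320 * M * real s ^ (2 * k)" using M by (intro mult_right_mono) auto
    finally show ?thesis by (rule order_trans[OF \<omega>(2)[OF jk(2,1)]])
  qed
  moreover have "real s ^ 6 \<le> sqrt \<bar>real_of_int (ring_disc 3 C)\<bar>"
    by (rule real_le_rsqrt) (use q(2) disc_eq in \<open>simp add: pair_disc_def flip: power_mult\<close>)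
  ultimately have "reduced_data M s R C \<phi> \<sigma> \<tau> \<alpha> \<omega>"
    unfolding reduced_data_def using st \<alpha>(1) \<omega>(1) by blast
  then show ?thesis by (rule that)
qed

definition form_index :: "(nat \<times> nat \<times> nat) set" where
  "form_index = {(1,1,1), (1,1,2), (1,1,3), (1,2,2), (1,2,3), (1,3,3), (2,1,1), (2,1,2), (2,1,3), (2,2,2), (2,2,3), (2,3,3)}"

lemma form_index_iff: "(m, k, l) \<in> form_index \<longleftrightarrow> m \<in> {1, 2} \<and> 1 \<le> k \<and> k \<le> l \<and> l \<le> 3"
proof
  assume "m \<in> {1, 2} \<and> 1 \<le> k \<and> k \<le> l \<and> l \<le> 3"
  then have "m = 1 \<or> m = 2" "k = 1 \<or> k = 2 \<or> k = 3" "l = 1 \<or> l = 2 \<or> l = 3" "k \<le> l" by auto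
  then show "(m, k, l) \<in> form_index" unfolding form_index_def by (elim disjE) simp_all
qed (auto simp: form_index_def)

definition form_box :: "real \<Rightarrow> nat \<Rightarrow> (nat \<times> nat \<times> nat \<Rightarrow> int) set" where
  "form_box E s = (\<Pi>\<^sub>E (m, k, l)\<in>form_index. int_box (E * real s ^ (k + l - 2 * m)))"

lemma finite_form_box: "finite (form_box E s)"
  unfolding form_box_def by (rule finite_PiE) (auto simp: form_index_def int_box_finite)

lemma card_form_box:
  assumes "1 \<le> E" "1 \<le> s"
  shows "real (card (form_box E s)) \<le> (3 * E) ^ 12 * real s ^ 15"
proof -
  have "real (card (form_box E s)) = (\<Prod>(m, k, l)\<in>form_index. real (card (int_box (E * real s ^ (k + l - 2 * m)))))"
    unfolding form_box_def by (subst card_PiE) (auto simp: form_index_def case_prod_beta)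
  also have "\<dots> \<le> (\<Prod>(m, k, l)\<in>form_index. 3 * E * real s ^ (k + l - 2 * m))"
  proof (rule prod_mono, clarify)
    fix m k l :: nat
    have "1 * 1 \<le> E * real s ^ (k + l - 2 * m)" using assms by (intro mult_mono) auto
    then show "0 \<le> real (card (int_box (E * real s ^ (k + l - 2 * m)))) \<and>
        real (card (int_box (E * real s ^ (k + l - 2 * m)))) \<le> 3 * E * real s ^ (k + l - 2 * m)"
      using card_int_box_le[of "E * real s ^ (k + l - 2 * m)"] by simp
  qed
  \<comment> \<open>The exponents are 0, 1, 2, 2, 3, 4 for the first form and, after truncation, 0,
    0, 0, 0, 1, 2 for the second; they add up to 12 + 3.\<close>
  also have "\<dots> = (3 * E) ^ 12 * real s ^ 15"
    unfolding form_index_def by (simp add: eval_nat_numeral mult_ac)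
  finally show ?thesis .
qed

text \<open>The parameters are as large as the lengths of the basis vectors permit; the total of
  \<open>s ^ 6\<close> is exactly the excess of the \<open>s ^ 15\<close> forms over the
  \<open>s ^ 9\<close> classes.\<close>

definition shift_box :: "nat \<Rightarrow> (int \<times> int \<times> int \<times> int) set" where
  "shift_box s = {0..<int s} \<times> {0..<int s} \<times> {0..<int s ^ 2} \<times> {0..<int s ^ 2}"

lemma card_shift_box: "card (shift_box s) = s ^ 6"
  by (simp add: shift_box_def card_cartesian_product flip: of_nat_power) (simp flip: power_add power_Suc)

definition shifted_forms where
  "shifted_forms R C \<phi> \<alpha> \<omega> = (\<lambda>(a, b, c, d). restrict (\<lambda>(m, k, l).
     form_coeff R C \<phi> (shift4 R \<alpha> a b c) (shift3 C \<omega> d) m k l) form_index)"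

lemma shifted_forms_eqD:
  assumes "shifted_forms R C \<phi> \<alpha> \<omega> (a, b, c, d) = shifted_forms R' C' \<phi>' \<alpha>' \<omega>' (a', b', c', d')"
    "m \<in> {1, 2}" "1 \<le> k" "k \<le> l" "l \<le> 3"
  shows "form_coeff R C \<phi> (shift4 R \<alpha> a b c) (shift3 C \<omega> d) m k l
    = form_coeff R' C' \<phi>' (shift4 R' \<alpha>' a' b' c') (shift3 C' \<omega>' d') m k l"
  using fun_cong[OF assms(1), of "(m, k, l)"] assms(2-) form_index_iff[of m k l] by (simp add: shifted_forms_def)

text \<open>A shifted vector is a sum of at most three terms of the same order, whence
  \<open>960 = 3 * 320\<close>.\<close>

lemma shifted_forms_box:
  assumes rd: "reduced_data M s R C \<phi> \<sigma> \<tau> \<alpha> \<omega>" and M: "1 \<le> M" and s: "1 \<le> s" and g: "g \<in> shift_box s"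
  shows "shifted_forms R C \<phi> \<alpha> \<omega> g \<in> form_box (24 * (960 * M) ^ 4) s"
proof -
  obtain a b c d where e: "g = (a, b, c, d)" by (cases g)
  have P: "embedded_pair R \<sigma> C \<tau> \<phi>" and \<alpha>: "unital_basis 4 R \<alpha>" and \<omega>: "unital_basis 3 C \<omega>"
    and b4: "\<And>i k. i < 4 \<Longrightarrow> k < 4 \<Longrightarrow> cmod (\<sigma> i (\<alpha> k)) \<le> 320 * M * real s ^ k"
    and b3: "\<And>j k. j < 3 \<Longrightarrow> k < 3 \<Longrightarrow> cmod (\<tau> j (\<omega> k)) \<le> 320 * M * real s ^ (2 * k)"
    and disc: "real s ^ 6 \<le> sqrt \<bar>real_of_int (ring_disc 3 C)\<bar>"
    using rd by (auto simp: reduced_data_def)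
  interpret P: embedded_pair R \<sigma> C \<tau> \<phi> by (rule P)
  define B where "B = 320 * M"
  have B: "0 < B" using M by (simp add: B_def)
  have gb: "\<bar>real_of_int a\<bar> \<le> real s" "\<bar>real_of_int b\<bar> \<le> real s" "\<bar>real_of_int c\<bar> \<le> real s ^ 2" "\<bar>real_of_int d\<bar> \<le> real s ^ 2"
  proof -
    have "a < int s" "b < int s" "c < int s ^ 2" "d < int s ^ 2" "0 \<le> a" "0 \<le> b" "0 \<le> c" "0 \<le> d"
      using g by (auto simp: e shift_box_def)
    then have "real_of_int a < real_of_int (int s)" "real_of_int b < real_of_int (int s)"
      "real_of_int c < real_of_int (int s ^ 2)" "real_of_int d < real_of_int (int s ^ 2)"
      by (simp_all only: of_int_less_iff)
    then show "\<bar>real_of_int a\<bar> \<le> real s" "\<bar>real_of_int b\<bar> \<le> real s" "\<bar>real_of_int c\<bar> \<le> real s ^ 2" "\<bar>real_of_int d\<bar> \<le> real s ^ 2"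
      using \<open>0 \<le> a\<close> \<open>0 \<le> b\<close> \<open>0 \<le> c\<close> \<open>0 \<le> d\<close> by simp_all
  qed
  have prod: "cmod (of_int x * z) \<le> u * v" if "\<bar>real_of_int x\<bar> \<le> u" "cmod z \<le> v" for x z u v
    unfolding norm_mult using that by (intro mult_mono) (auto intro: order_trans[OF abs_ge_zero])
  have s4: "cmod (\<sigma> i (shift4 R \<alpha> a b c k)) \<le> (960 * M) * real s ^ k" if i: "i < 4" and k: "k < 4" for i k
  proof -
    note b = b4[OF i, folded B_def]
    note em = shift4_emb[OF P.R.embedded_ring_axioms \<alpha> i]
    have "1 \<le> 3 * B" using M by (simp add: B_def)
    then have 0: "cmod (\<sigma> i (shift4 R \<alpha> a b c 0)) \<le> 3 * B * real s ^ 0" by (simp add: em)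
    have "B * real s ^ 1 \<le> 3 * B * real s ^ 1" using B by (intro mult_right_mono) auto
    then have 1: "cmod (\<sigma> i (shift4 R \<alpha> a b c 1)) \<le> 3 * B * real s ^ 1" using b[of 1] em(2) by simp
    have "cmod (\<sigma> i (shift4 R \<alpha> a b c 2)) \<le> B * real s ^ 2 + real s * (B * real s ^ 1)"
      unfolding em by (intro order_trans[OF norm_triangle_ineq] add_mono prod gb b) auto
    also have "\<dots> = 2 * B * real s ^ 2" by (simp add: power2_eq_square)
    also have "\<dots> \<le> 3 * B * real s ^ 2" using B by (intro mult_right_mono) auto
    finally have 2: "cmod (\<sigma> i (shift4 R \<alpha> a b c 2)) \<le> 3 * B * real s ^ 2" .
    have "cmod (\<sigma> i (shift4 R \<alpha> a b c 3)) \<le> B * real s ^ 3 + real s * (B * real s ^ 2) + real s ^ 2 * (B * real s ^ 1)"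
      unfolding em by (intro order_trans[OF norm_triangle_ineq] add_mono prod gb b) auto
    also have "\<dots> = 3 * B * real s ^ 3" by (simp add: power2_eq_square power3_eq_cube)
    finally have 3: "cmod (\<sigma> i (shift4 R \<alpha> a b c 3)) \<le> 3 * B * real s ^ 3" .
    have "cmod (\<sigma> i (shift4 R \<alpha> a b c k)) \<le> 3 * B * real s ^ k" using k 0 1 2 3 unfolding less_4_cases by blast
    then show ?thesis by (simp add: B_def)
  qed
  have s3: "cmod (\<tau> j (shift3 C \<omega> d k)) \<le> (960 * M) * real s ^ (2 * k)" if j: "j < 3" and k: "k < 3" for j k
  proof -
    note b = b3[OF j, folded B_def]
    note em = shift3_emb[OF P.C.embedded_ring_axioms \<omega> j]
    have "1 \<le> 3 * B" using M by (simp add: B_def)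
    then have 0: "cmod (\<tau> j (shift3 C \<omega> d 0)) \<le> 3 * B * real s ^ (2 * 0)" by (simp add: em)
    have "B * real s ^ (2 * 1) \<le> 3 * B * real s ^ (2 * 1)" using B by (intro mult_right_mono) auto
    then have 1: "cmod (\<tau> j (shift3 C \<omega> d 1)) \<le> 3 * B * real s ^ (2 * 1)" using b[of 1] em(2) by simp
    have "cmod (\<tau> j (shift3 C \<omega> d 2)) \<le> B * real s ^ (2 * 2) + real s ^ 2 * (B * real s ^ (2 * 1))"
      unfolding em by (intro order_trans[OF norm_triangle_ineq] add_mono prod gb b) auto
    also have "\<dots> = 2 * B * real s ^ (2 * 2)" by (simp add: power2_eq_square power4_eq_xxxx)
    also have "\<dots> \<le> 3 * B * real s ^ (2 * 2)" using B by (intro mult_right_mono) auto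
    finally have 2: "cmod (\<tau> j (shift3 C \<omega> d 2)) \<le> 3 * B * real s ^ (2 * 2)" .
    have "cmod (\<tau> j (shift3 C \<omega> d k)) \<le> 3 * B * real s ^ (2 * k)" using k 0 1 2 unfolding less_3_cases by blast
    then show ?thesis by (simp add: B_def)
  qed
  have "form_coeff R C \<phi> (shift4 R \<alpha> a b c) (shift3 C \<omega> d) m k l \<in> int_box (24 * (960 * M) ^ 4 * real s ^ (k + l - 2 * m))"
    if "(m, k, l) \<in> form_index" for m k l
  proof -
    have mkl: "m \<in> {1, 2}" "1 \<le> k" "k \<le> l" "l \<le> 3" using that form_index_iff by blast+
    show ?thesis
      unfolding int_box_def mem_Collect_eq
      by (rule P.form_coeff_bound[OF unital_basis_shift4[OF P.R.embedded_ring_axioms \<alpha>]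
            unital_basis_shift3[OF P.C.embedded_ring_axioms \<omega>] _ _ s4 s3 disc mkl]) (use s M in auto)
  qed
  then show ?thesis unfolding e form_box_def shifted_forms_def by auto
qed

lemma card_le_fibers:
  assumes A: "finite A" and B: "finite B" and f: "f ` A \<subseteq> B" and fib: "\<And>y. card {x \<in> A. f x = y} \<le> N"
  shows "card A \<le> N * card B"
proof -
  have "card A \<le> card (\<Union>y\<in>B. {x \<in> A. f x = y})" using A B f by (intro card_mono) auto
  also have "\<dots> \<le> (\<Sum>y\<in>B. card {x \<in> A. f x = y})" by (rule card_UN_le[OF B])
  also have "\<dots> \<le> (\<Sum>y\<in>B. N)" by (intro sum_mono fib)
  finally show ?thesis by (simp add: mult.commute)
qed

definition scale_const :: "real \<Rightarrow> real" where
  "scale_const M = real (card codes) * (3 * (24 * (960 * M) ^ 4)) ^ 12"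

text \<open>Each class is counted once for each of the \<open>s ^ 6\<close> shifts of a reduced basis, in a box of
  about \<open>s ^ 15\<close> pairs of forms.\<close>

lemma card_short_classes:
  assumes M: "1 \<le> M" and s: "1 \<le> s"
  shows "finite ({P. short_pair M s P} // pair_iso)"
    and "real (card ({P. short_pair M s P} // pair_iso)) \<le> scale_const M * real s ^ 9"
proof -
  let ?E = "24 * (960 * M) ^ 4"
  have E: "1 \<le> ?E"
  proof -
    have "(1::real) ^ 4 \<le> (960 * M) ^ 4" using M by (intro power_mono) auto
    then show ?thesis by simp
  qed
  \<comment> \<open>It is not known beforehand that there are finitely many classes, so the bound is
    proved uniformly for finite sets \<open>G\<close> of classes.\<close>
  have fin: "real (card G) \<le> scale_const M * real s ^ 9" if G: "G \<subseteq> {P. short_pair M s P} // pair_iso" "finite G" for G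
  proof -
    have "\<exists>R C \<phi> \<sigma> \<tau> \<alpha> \<omega>. K = pair_iso `` {(R, C, \<phi>)} \<and> (R, C, \<phi>) \<in> quartic_pairs \<and> reduced_data M s R C \<phi> \<sigma> \<tau> \<alpha> \<omega>" if "K \<in> G" for K
    proof -
      obtain P where P: "short_pair M s P" "K = pair_iso `` {P}" using G \<open>K \<in> G\<close> by (auto simp: quotient_def)
      obtain R C \<phi> where e: "P = (R, C, \<phi>)" by (cases P)
      obtain \<sigma> \<tau> \<alpha> \<omega> where "reduced_data M s R C \<phi> \<sigma> \<tau> \<alpha> \<omega>" using short_pair_reduced[OF P(1)[unfolded e] M s] .
      moreover have "(R, C, \<phi>) \<in> quartic_pairs" using P(1) by (simp add: e short_pair_def)
      ultimately show ?thesis using P(2) e by blast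
    qed
    then obtain R C \<phi> \<sigma> \<tau> \<alpha> \<omega> where ch: "\<And>K. K \<in> G \<Longrightarrow> K = pair_iso `` {(R K, C K, \<phi> K)}"
      "\<And>K. K \<in> G \<Longrightarrow> (R K, C K, \<phi> K) \<in> quartic_pairs"
      "\<And>K. K \<in> G \<Longrightarrow> reduced_data M s (R K) (C K) (\<phi> K) (\<sigma> K) (\<tau> K) (\<alpha> K) (\<omega> K)" by metis
    have rd: "embedded_pair (R K) (\<sigma> K) (C K) (\<tau> K) (\<phi> K)" "unital_basis 4 (R K) (\<alpha> K)" "unital_basis 3 (C K) (\<omega> K)" if "K \<in> G" for K
      using ch(3)[OF that] by (auto simp: reduced_data_def)
    define F where "F = (\<lambda>(K, g). shifted_forms (R K) (C K) (\<phi> K) (\<alpha> K) (\<omega> K) g)"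
    let ?X = "G \<times> shift_box s"
    have finX: "finite ?X" using G by (simp add: shift_box_def)
    have FX: "F ` ?X \<subseteq> form_box ?E s"
      using shifted_forms_box[OF ch(3) M s] by (auto simp: F_def)
    have fib: "card {x \<in> ?X. F x = y} \<le> card codes" for y
    proof (cases "{x \<in> ?X. F x = y} = {}")
      case True
      show ?thesis unfolding True by simp
    next
      case False
      then obtain K0 g0 where x0: "K0 \<in> G" "g0 \<in> shift_box s" "F (K0, g0) = y" by auto
      obtain a0 b0 c0 d0 where g0: "g0 = (a0, b0, c0, d0)" by (cases g0)
      let ?S = "{g \<in> shift_box s. F (K0, g) = y}"
      \<comment> \<open>Equal forms force isomorphic pairs, so a fiber of \<open>F\<close> lies over
        a single class and consists of shifts of one basis.\<close>
      have "K = K0" if x: "K \<in> G" "g \<in> shift_box s" "F (K, g) = y" for K g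
      proof -
        obtain a b c d where g: "g = (a, b, c, d)" by (cases g)
        have "shifted_forms (R K) (C K) (\<phi> K) (\<alpha> K) (\<omega> K) (a, b, c, d) = shifted_forms (R K0) (C K0) (\<phi> K0) (\<alpha> K0) (\<omega> K0) (a0, b0, c0, d0)"
          using x x0 by (simp add: F_def g g0)
        note eq = shifted_forms_eqD[OF this]
        interpret A: embedded_pair "R K" "\<sigma> K" "C K" "\<tau> K" "\<phi> K" by (rule rd(1)[OF x(1)])
        interpret B: embedded_pair "R K0" "\<sigma> K0" "C K0" "\<tau> K0" "\<phi> K0" by (rule rd(1)[OF x0(1)])
        have "((R K, C K, \<phi> K), (R K0, C K0, \<phi> K0)) \<in> pair_iso"
          by (rule same_forms_iso[OF ch(2)[OF x(1)] ch(2)[OF x0(1)]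
              unital_basis_shift4[OF A.R.embedded_ring_axioms rd(2)[OF x(1)], of a b c] unital_basis_shift3[OF A.C.embedded_ring_axioms rd(3)[OF x(1)], of d]
              unital_basis_shift4[OF B.R.embedded_ring_axioms rd(2)[OF x0(1)], of a0 b0 c0] unital_basis_shift3[OF B.C.embedded_ring_axioms rd(3)[OF x0(1)], of d0] eq])
        from equiv_class_eq[OF equiv_pair_iso this] show ?thesis using ch(1)[OF x(1)] ch(1)[OF x0(1)] by simp
      qed
      then have "{x \<in> ?X. F x = y} \<subseteq> Pair K0 ` ?S" by auto
      moreover have S: "finite ?S \<and> card ?S \<le> card codes"
      proof (rule card_shift_fiber[OF rd[OF x0(1)]], goal_cases)
        case (1 a b c d a' b' c' d' m k l)
        have "shifted_forms (R K0) (C K0) (\<phi> K0) (\<alpha> K0) (\<omega> K0) (a, b, c, d) = shifted_forms (R K0) (C K0) (\<phi> K0) (\<alpha> K0) (\<omega> K0) (a', b', c', d')"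
          using 1(1,2) by (simp add: F_def)
        from shifted_forms_eqD[OF this 1(3-6)] show ?case .
      qed
      ultimately have "card {x \<in> ?X. F x = y} \<le> card (Pair K0 ` ?S)" by (intro card_mono) auto
      also have "\<dots> \<le> card ?S" by (rule card_image_le) (use S in blast)
      finally show ?thesis using S by linarith
    qed
    have "card ?X \<le> card codes * card (form_box ?E s)"
      by (rule card_le_fibers[OF finX finite_form_box FX fib])
    then have "card G * s ^ 6 \<le> card codes * card (form_box ?E s)"
      by (simp add: card_cartesian_product card_shift_box)
    then have "real (card G * s ^ 6) \<le> real (card codes * card (form_box ?E s))" by (rule of_nat_mono)
    also have "\<dots> \<le> real (card codes) * ((3 * ?E) ^ 12 * real s ^ 15)"
      unfolding of_nat_mult by (intro mult_left_mono card_form_box[OF E s]) auto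
    also have "\<dots> = (scale_const M * real s ^ 9) * real s ^ 6"
      by (simp add: scale_const_def flip: power_add)
    finally have "real (card G) * real s ^ 6 \<le> (scale_const M * real s ^ 9) * real s ^ 6" by simp
    then show ?thesis by (rule mult_right_le_imp_le) (use s in simp)
  qed
  have "finite ({P. short_pair M s P} // pair_iso) \<and> card ({P. short_pair M s P} // pair_iso) \<le> nat \<lfloor>scale_const M * real s ^ 9\<rfloor>"
  proof (rule finite_if_finite_subsets_card_bdd)
    show "card G \<le> nat \<lfloor>scale_const M * real s ^ 9\<rfloor>" if "G \<subseteq> {P. short_pair M s P} // pair_iso" "finite G" for G
      using fin[OF that] by (simp add: le_nat_floor)
  qed
  then show f: "finite ({P. short_pair M s P} // pair_iso)" by blast
  show "real (card ({P. short_pair M s P} // pair_iso)) \<le> scale_const M * real s ^ 9"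
    by (rule fin[OF subset_refl f])
qed

lemma dyadic_scale:
  fixes y :: real
  assumes "1 \<le> y"
  obtains j :: nat where "2 ^ j \<le> y" "y < 2 ^ (j + 1)"
proof -
  define k where "k = nat \<lfloor>y\<rfloor>"
  have k: "1 \<le> k" "real k \<le> y" "y < real k + 1" using assms by (auto simp: k_def le_nat_iff le_floor_iff)
  obtain j where "2 ^ j \<le> k" "k < 2 ^ (j + 1)" using ex_power_ivl1[of 2 k] k(1) by auto
  then have "real (2 ^ j) \<le> real k" "real (k + 1) \<le> real (2 ^ (j + 1))" by (simp_all only: of_nat_le_iff)
  then have "(2::real) ^ j \<le> real k" "real k + 1 \<le> (2::real) ^ (j + 1)" by (simp_all only: of_nat_power of_nat_add of_nat_numeral of_nat_1)
  then show ?thesis using k by (intro that[of j]) linarith+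
qed

lemma pair_disc_ge_1:
  assumes "P \<in> quartic_pairs" shows "1 \<le> pair_disc P"
proof -
  obtain R C \<phi> where e: "P = (R, C, \<phi>)" by (cases P)
  have "ring_disc 4 R \<noteq> 0" using assms by (auto simp: e quartic_pairs_def nondegenerate_def)
  then have "1 \<le> \<bar>ring_disc 4 R\<bar>" by simp
  then show ?thesis unfolding e pair_disc_def by simp
qed

text \<open>As \<open>L \<le> ln T\<close>, the tolerance costs at most the factor
  \<open>exp \<epsilon>\<close>; the factor 2 makes the inequality strict. Nonpositive
  \<open>l\<close> is treated apart, because its logarithm carries no information.\<close>

lemma minimum_less:
  fixes l :: real
  assumes "\<bar>ln l / L - p\<bar> \<le> \<epsilon> / ln T" "0 < L" "L \<le> ln T" "0 \<le> \<epsilon>"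
  shows "l < 2 * exp \<epsilon> * exp (p * L)"
proof (cases "0 < l")
  case True
  have T: "0 < ln T" using assms by linarith
  have "ln l / L \<le> p + \<epsilon> / ln T" using assms(1) by linarith
  then have "ln l \<le> (p + \<epsilon> / ln T) * L" using assms(2) by (simp add: pos_divide_le_eq)
  also have "\<dots> = p * L + \<epsilon> * (L / ln T)" by (simp add: distrib_right)
  also have "\<dots> \<le> p * L + \<epsilon> * 1" using assms T by (intro add_left_mono mult_left_mono) auto
  finally have "exp (ln l) \<le> exp (\<epsilon> + p * L)" by simp
  then have "l \<le> exp \<epsilon> * exp (p * L)" using True by (simp add: exp_add)
  also have "\<dots> < 2 * exp \<epsilon> * exp (p * L)" by simp
  finally show ?thesis .
next
  case False
  have "0 < 2 * exp \<epsilon> * exp (p * L)" by simp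
  then show ?thesis using False by linarith
qed

lemma close_short_pair:
  assumes P: "P \<in> quartic_pairs" "pair_disc P \<le> T" "close exps \<epsilon> T P" and \<epsilon>: "0 \<le> \<epsilon>"
    and T: "1 < T" "12 * \<epsilon> < ln T"
  obtains j where "short_pair (2 * exp \<epsilon>) (2 ^ j) P" "2 ^ j \<le> exp (ln T / 12)"
proof -
  obtain R C \<phi> where e: "P = (R, C, \<phi>)" by (cases P)
  define L where "L = ln (pair_disc P)"
  have D: "1 \<le> pair_disc P" by (rule pair_disc_ge_1[OF P(1)])
  have T0: "0 < ln T" using T by simp
  have c: "\<bar>ln (succ_min 4 R 1) / L - 1/12\<bar> \<le> \<epsilon> / ln T" "\<bar>ln (succ_min 4 R 2) / L - 1/6\<bar> \<le> \<epsilon> / ln T"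
     "\<bar>ln (succ_min 4 R 3) / L - 1/4\<bar> \<le> \<epsilon> / ln T" "\<bar>ln (succ_min 3 C 1) / L - 1/6\<bar> \<le> \<epsilon> / ln T"
     "\<bar>ln (succ_min 3 C 2) / L - 1/3\<bar> \<le> \<epsilon> / ln T"
    using P(3) unfolding e close_iff Let_def L_def by blast+
  have small: "\<epsilon> / ln T < 1 / 12" using T T0 by (simp add: field_simps)
  \<comment> \<open>For discriminant 1 the quotient by \<open>L = 0\<close> would be 0 by
    convention, and closeness would require \<open>1 / 12 \<le> \<epsilon> / ln T\<close>.\<close>
  have "L \<noteq> 0" using c(1) small by auto
  moreover have "0 \<le> L" using D by (simp add: L_def)
  ultimately have L: "0 < L" by simp
  have LT: "L \<le> ln T" unfolding L_def using P(2) D by (intro ln_mono) auto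
  \<comment> \<open>The twelfth root of the discriminant is the natural scale. The dyadic
    \<open>s = 2 ^ j\<close> satisfies \<open>s \<le> y < 2 * s\<close>, which is why
    \<open>short_pair\<close> has \<open>s\<close> in the bound for the discriminant and
    \<open>2 * s\<close> in those for the minima.\<close>
  define y where "y = exp (L / 12)"
  have y: "1 \<le> y" using L by (simp add: y_def)
  have yp: "exp (real k / 12 * L) = y ^ k" for k by (simp add: y_def exp_of_nat_mult[symmetric] mult_ac)
  have y12: "y ^ 12 = pair_disc P" using yp[of 12] D by (simp add: L_def)
  obtain j where j: "2 ^ j \<le> y" "y < 2 ^ (j + 1)" by (rule dyadic_scale[OF y])
  have mono: "2 * exp \<epsilon> * y ^ k \<le> 2 * exp \<epsilon> * (2 * real (2 ^ j)) ^ k" for k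
    using j y by (intro mult_left_mono power_mono) auto
  have m: "l < 2 * exp \<epsilon> * (2 * real (2 ^ j)) ^ k" if "\<bar>ln l / L - real k / 12\<bar> \<le> \<epsilon> / ln T" for l k
    using minimum_less[OF that L LT \<epsilon>] mono[of k] unfolding yp by linarith
  have "real (2 ^ j) ^ 12 \<le> pair_disc P" unfolding y12[symmetric] using j by (intro power_mono) auto
  moreover have "succ_min 4 R 1 < 2 * exp \<epsilon> * (2 * real (2 ^ j)) ^ 1" using c(1) by (intro m) simp
  moreover have "succ_min 4 R 2 < 2 * exp \<epsilon> * (2 * real (2 ^ j)) ^ 2" using c(2) by (intro m) simp
  moreover have "succ_min 4 R 3 < 2 * exp \<epsilon> * (2 * real (2 ^ j)) ^ 3" using c(3) by (intro m) simp
  moreover have "succ_min 3 C 1 < 2 * exp \<epsilon> * (2 * real (2 ^ j)) ^ (2 * 1)" using c(4) by (intro m) simp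
  moreover have "succ_min 3 C 2 < 2 * exp \<epsilon> * (2 * real (2 ^ j)) ^ (2 * 2)" using c(5) by (intro m) simp
  ultimately have "short_pair (2 * exp \<epsilon>) (2 ^ j) P"
    using P(1) unfolding e short_pair_def prod.case by blast
  moreover have "y \<le> exp (ln T / 12)" using LT by (simp add: y_def)
  then have "2 ^ j \<le> exp (ln T / 12)" using j by linarith
  ultimately show ?thesis by (rule that)
qed

lemma sum_powers_le:
  fixes q :: real assumes "2 \<le> q" shows "(\<Sum>j\<le>J. q ^ j) \<le> 2 * q ^ J"
proof (induction J)
  case (Suc J)
  have "2 * q ^ J \<le> q * q ^ J" using assms by (intro mult_right_mono) auto
  then show ?case using Suc by simp
qed simp

text \<open>The bounds for the dyadic scales form a geometric series, dominated by the term at the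
  largest scale, which is at most the twelfth root of \<open>T\<close>.\<close>

lemma card_F4_le:
  assumes \<epsilon>: "0 \<le> \<epsilon>" and T: "1 < T" "12 * \<epsilon> < ln T"
  shows "finite (F4 exps \<epsilon> T)" "real (card (F4 exps \<epsilon> T)) \<le> 2 * scale_const (2 * exp \<epsilon>) * exp (ln T / 12) ^ 9"
proof -
  let ?M = "2 * exp \<epsilon>" and ?z = "exp (ln T / 12)"
  have M: "1 \<le> ?M" using \<epsilon> one_le_exp_iff[of \<epsilon>] by linarith
  have z: "1 \<le> ?z" using T by simp
  obtain J where J: "2 ^ J \<le> ?z" "?z < 2 ^ (J + 1)" by (rule dyadic_scale[OF z])
  let ?U = "\<Union>j\<le>J. {P. short_pair ?M (2 ^ j) P} // pair_iso"
  have sub: "F4 exps \<epsilon> T \<subseteq> ?U"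
  proof
    fix K assume "K \<in> F4 exps \<epsilon> T"
    then obtain P where P: "P \<in> quartic_pairs" "pair_disc P \<le> T" "close exps \<epsilon> T P" "K = pair_iso `` {P}"
      by (auto simp: F4_def quotient_def)
    obtain j where j: "short_pair ?M (2 ^ j) P" "2 ^ j \<le> ?z" by (rule close_short_pair[OF P(1-3) \<epsilon> T])
    have "(2::real) ^ j < 2 ^ (J + 1)" using j(2) J(2) by linarith
    then have "j < J + 1" by (rule power_less_imp_less_exp[rotated]) simp
    then have "j \<in> {..J}" by simp
    moreover have "K \<in> {P. short_pair ?M (2 ^ j) P} // pair_iso" unfolding P(4) by (rule quotientI) (simp add: j(1))
    ultimately show "K \<in> ?U" by (rule UN_I)
  qed
  have s: "(1::nat) \<le> 2 ^ j" for j by simp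
  have pw: "(2 ^ 9) ^ j = ((2::real) ^ j) ^ 9" for j by (simp only: power_mult[symmetric] mult.commute)
  have fin: "finite ?U" using card_short_classes(1)[OF M s] by blast
  show "finite (F4 exps \<epsilon> T)" by (rule finite_subset[OF sub fin])
  have "card (F4 exps \<epsilon> T) \<le> card ?U" by (rule card_mono[OF fin sub])
  also have "\<dots> \<le> (\<Sum>j\<le>J. card ({P. short_pair ?M (2 ^ j) P} // pair_iso))" by (rule card_UN_le) simp
  finally have "real (card (F4 exps \<epsilon> T)) \<le> real (\<Sum>j\<le>J. card ({P. short_pair ?M (2 ^ j) P} // pair_iso))"
    by (rule of_nat_mono)
  also have "\<dots> \<le> (\<Sum>j\<le>J. scale_const ?M * (2 ^ 9) ^ j)"
    unfolding of_nat_sum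
  proof (rule sum_mono)
    fix j
    show "real (card ({P. short_pair ?M (2 ^ j) P} // pair_iso)) \<le> scale_const ?M * (2 ^ 9) ^ j"
      using card_short_classes(2)[OF M s[of j]] unfolding pw by (simp only: of_nat_power of_nat_numeral)
  qed
  also have "\<dots> = scale_const ?M * (\<Sum>j\<le>J. (2 ^ 9) ^ j)" by (simp add: sum_distrib_left)
  also have "\<dots> \<le> scale_const ?M * (2 * (2 ^ 9) ^ J)"
    by (intro mult_left_mono sum_powers_le) (auto simp: scale_const_def)
  also have "(2 ^ 9) ^ J = ((2::real) ^ J) ^ 9" by (rule pw)
  also have "scale_const ?M * (2 * ((2::real) ^ J) ^ 9) \<le> scale_const ?M * (2 * ?z ^ 9)"
    using J by (intro mult_left_mono power_mono) (auto simp: scale_const_def)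
  finally show "real (card (F4 exps \<epsilon> T)) \<le> 2 * scale_const ?M * ?z ^ 9" by simp
qed

text \<open>A generator of small length is \<open>m\<^sub>0 + m\<^sub>1 \<theta>\<close>, since \<open>\<lambda>\<^sub>2\<close> is large.\<close>

lemma same_class_scaled:
  assumes A: "bounded_quartic 0 f2 f3 f4 t h" and B: "bounded_quartic 0 g2 g3 g4 u h"
    and \<delta>: "0 < \<delta>" "\<delta> * h ^ 12 \<le> (cmod (vandermonde t))\<^sup>2" and large: "48 * 14 ^ 3 < sqrt \<delta> * h"
    and same: "psi_mon (monic_quartic 0 f2 f3 f4) = psi_mon (monic_quartic 0 g2 g3 g4)"
  obtains m :: int where "g2 = m\<^sup>2 * f2" "g3 = m ^ 3 * f3" "g4 = m ^ 4 * f4"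
proof -
  interpret A: bounded_quartic 0 f2 f3 f4 t h by (rule A)
  interpret B: bounded_quartic 0 g2 g3 g4 u h by (rule B)
  have "pair_iso `` {(B.RR, B.CC, B.\<Phi>)} = pair_iso `` {(A.RR, A.CC, A.\<Phi>)}"
    unfolding B.psi_mon_class[symmetric] A.psi_mon_class[symmetric] by (rule same[symmetric])
  then have "(B.RR, B.CC, B.\<Phi>) \<in> pair_iso `` {(A.RR, A.CC, A.\<Phi>)}"
    using equiv_class_self[OF equiv_pair_iso quartic_pairsI[OF B.embedded_pair]] by (rule subst)
  then obtain k where k: "k \<in> ring_iso A.RR B.RR" by (auto simp: pair_iso_def)
  interpret R: embedded_ring 4 A.RR A.\<sigma>R by (rule A.embedded_RR)
  let ?p = "\<lambda>i. restrict (\<lambda>x. B.\<sigma>R i (k x)) (carrier A.RR)"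
  interpret p: embedded_ring 4 A.RR ?p by (rule embedded_pullback[OF A.embedded_RR B.embedded_RR k])
  \<comment> \<open>The homomorphisms pulled back along \<open>k\<close> are those of the first ring
    in another order.\<close>
  obtain \<pi> where \<pi>: "bij_betw \<pi> {..<4} {..<4}" "\<And>i. i < 4 \<Longrightarrow> ?p i = A.\<sigma>R (\<pi> i)"
  proof (rule that[of "\<lambda>i. inv_into {..<4} A.\<sigma>R (?p i)"])
    show "bij_betw (\<lambda>i. inv_into {..<4} A.\<sigma>R (?p i)) {..<4} {..<4}"
      using bij_betw_trans[OF p.enum bij_betw_inv_into[OF R.enum]] by (simp add: comp_def)
    show "?p i = A.\<sigma>R (inv_into {..<4} A.\<sigma>R (?p i))" if i: "i < 4" for i
    proof (rule sym, rule f_inv_into_f)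
      have "?p i \<in> complex_homs A.RR" by (rule bij_betwE[OF p.enum, rule_format]) (simp add: i)
      then show "?p i \<in> A.\<sigma>R ` {..<4}" unfolding bij_betw_imp_surj_on[OF R.enum] .
    qed
  qed
  have "bij_betw k (carrier A.RR) (carrier B.RR)" using k by (simp add: ring_iso_def)
  moreover have "unit_list 4 1 \<in> carrier B.RR" by (simp add: B.carriers)
  ultimately obtain x where x: "x \<in> carrier A.RR" "k x = unit_list 4 1" by (metis bij_betw_imp_surj_on imageE)
  have ux: "u i = A.\<sigma>R (\<pi> i) x" if i: "i < 4" for i
  proof -
    have "(restrict (\<lambda>x. B.\<sigma>R i (k x)) (carrier A.RR)) x = A.\<sigma>R (\<pi> i) x" by (rule fun_cong[OF \<pi>(2)[OF i]])
    then have "A.\<sigma>R (\<pi> i) x = B.\<sigma>R i (unit_list 4 1)" by (simp only: restrict_apply' x)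
    also have "\<dots> = B.rbase i 1" by (rule B.\<sigma>R_unit) simp
    also have "\<dots> = u i" by (simp only: B.rbase_def) simp
    finally show ?thesis by (rule sym)
  qed
  have len: "length x = 4" using x(1) by (simp add: A.carriers)
  have b: "int_basis A.RR 4 (unit_list 4)" using A.unital_unit by (simp add: unital_basis_def)
  have xc: "x = int_comb A.RR 4 (unit_list 4) (\<lambda>k. x ! k)"
  proof (rule R.emb_inj[OF x(1)])
    show "int_comb A.RR 4 (unit_list 4) (\<lambda>k. x ! k) \<in> carrier A.RR" by (rule R.closed_int_comb[OF R.basis_closed[OF b]])
    fix i :: nat assume i: "i < 4"
    show "A.\<sigma>R i x = A.\<sigma>R i (int_comb A.RR 4 (unit_list 4) (\<lambda>k. x ! k))"
      unfolding R.emb_int_comb[OF i R.basis_closed[OF b]]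
      by (simp add: A.\<sigma>R_eq[OF len] sum_lessThan_4 A.\<sigma>R_unit A.rbase_def[of _ 0] del: One_nat_def)
  qed
  have bound: "cmod (A.\<sigma>R i (int_comb A.RR 4 (unit_list 4) (\<lambda>k. x ! k))) \<le> 2 * h" if i: "i < 4" for i
  proof -
    obtain i' where "i' < 4" "\<pi> i' = i" using \<pi>(1) i by (metis bij_betw_def imageE lessThan_iff)
    then show ?thesis using ux[of i'] B.t_bound[of i'] xc by simp
  qed
  have D: "sqrt \<delta> * h ^ 6 \<le> sqrt \<bar>real_of_int (ring_disc 4 A.RR)\<bar>"
  proof -
    have "sqrt (\<delta> * h ^ 12) = sqrt \<delta> * h ^ 6"
      using \<delta>(1) A.h by (intro real_sqrt_unique) (simp_all add: power_mult_distrib flip: power_mult)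
    moreover have "\<bar>real_of_int (ring_disc 4 A.RR)\<bar> = (cmod (vandermonde t))\<^sup>2"
      using A.pair_disc_model by (simp add: pair_disc_def A.vdm_eq)
    ultimately show ?thesis using real_sqrt_le_mono[OF \<delta>(2)] by simp
  qed
  \<comment> \<open>A coordinate at \<open>l \<ge> 2\<close> would give \<open>h ^ 6\<close> at most
    a constant times \<open>h ^ (7 - l)\<close>, hence times \<open>h ^ 5\<close>, since the roots
    \<open>u i\<close> have modulus at most \<open>2 * h\<close>. The constant in
    \<open>large\<close> is \<open>fact 4 * 2 * 14 ^ 3\<close>.\<close>
  have zero: "x ! l = 0" if l: "2 \<le> l" "l < 4" for l
  proof (rule ccontr)
    assume "x ! l \<noteq> 0"
    then have "1 \<le> \<bar>x ! l\<bar>" by simp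
    then have "1 \<le> \<bar>real_of_int (x ! l)\<bar>" by (metis of_int_1_le_iff of_int_abs)
    then have "1 * (sqrt \<delta> * h ^ 6) \<le> \<bar>real_of_int (x ! l)\<bar> * sqrt \<bar>real_of_int (ring_disc 4 A.RR)\<bar>"
      using D \<delta> A.h by (intro mult_mono) auto
    also have "\<dots> \<le> fact 4 * (2 * h) * (\<Prod>j\<in>{..<4} - {l}. 14 * h ^ j)"
      by (rule R.coord_bound[OF b _ bound l(2)]) (use A.rbase_bound A.\<sigma>R_unit in auto)
    also have "(\<Prod>j\<in>{..<4} - {l}. 14 * h ^ j) = 14 ^ 3 * h ^ (6 - l)"
      using l(2) unfolding less_4_cases lessThan_numerals(1)[symmetric]
      by (elim disjE) (simp_all add: insert_Diff_if eval_nat_numeral)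
    also have "fact 4 * (2 * h) * (14 ^ 3 * h ^ (6 - l)) = 48 * 14 ^ 3 * h ^ (7 - l)"
      using l by (simp add: fact_numeral Suc_diff_le flip: power_Suc) (simp add: eval_nat_numeral Suc_diff_le)
    also have "\<dots> \<le> 48 * 14 ^ 3 * h ^ 5" using A.h l by (intro mult_left_mono power_increasing) auto
    finally have "(sqrt \<delta> * h) * h ^ 5 \<le> 48 * 14 ^ 3 * h ^ 5" by (simp add: eval_nat_numeral mult_ac)
    then have "sqrt \<delta> * h \<le> 48 * 14 ^ 3" by (rule mult_right_le_imp_le) (use A.h in simp)
    then show False using large by simp
  qed
  define m0 m where "m0 = x ! 0" and "m = x ! 1"
  have um: "u i = of_int m0 + of_int m * t (\<pi> i)" if i: "i < 4" for i
    using ux[OF i] A.\<sigma>R_eq[OF len] zero[of 2] zero[of 3] by (simp add: A.rbase_def m0_def m_def)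
  \<comment> \<open>Both cubic coefficients vanish, so both generators have trace 0, and the
    constant part \<open>m0\<close> must vanish too.\<close>
  have "(\<Sum>i<4. t (\<pi> i)) = (\<Sum>i<4. t i)" by (rule sum.reindex_bij_betw[OF \<pi>(1)])
  moreover have s0: "(\<Sum>i<4. v i) = 0" if "of_int 0 = - (v 0 + v 1 + v 2 + v 3)" for v :: "nat \<Rightarrow> complex"
    using that unfolding sum_lessThan_4 of_int_0 by (rule neg_0_equal_iff_equal[THEN iffD1, THEN sym])
  moreover note s0[OF A.vieta(1)] s0[OF B.vieta(1)]
  moreover have "(\<Sum>i<4. u i) = 4 * of_int m0 + of_int m * (\<Sum>i<4. t (\<pi> i))"
    by (simp add: um sum_lessThan_4 algebra_simps)
  ultimately have "m0 = 0" by (simp only: mult_zero_right add_0_right) simp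
  have poly: "z ^ 4 + of_int g2 * z\<^sup>2 + of_int g3 * z + of_int g4
      = z ^ 4 + of_int (m\<^sup>2 * f2) * z\<^sup>2 + of_int (m ^ 3 * f3) * z + of_int (m ^ 4 * f4)" for z :: complex
  proof -
    have q: "(\<Prod>i<4. z - c * v i) = z ^ 4 + c * a1 * z ^ 3 + c\<^sup>2 * a2 * z\<^sup>2 + c ^ 3 * a3 * z + c ^ 4 * a4"
      if "a1 = - (v 0 + v 1 + v 2 + v 3)" "a2 = v 0 * v 1 + v 0 * v 2 + v 0 * v 3 + v 1 * v 2 + v 1 * v 3 + v 2 * v 3"
        "a3 = - (v 0 * v 1 * v 2 + v 0 * v 1 * v 3 + v 0 * v 2 * v 3 + v 1 * v 2 * v 3)" "a4 = v 0 * v 1 * v 2 * v (3::nat)"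
      for v and c a1 a2 a3 a4 :: complex
      unfolding that
      by (simp add: lessThan_numerals(1)[symmetric] algebra_simps power2_eq_square power3_eq_cube power4_eq_xxxx)
    have "(\<Prod>i<4. z - 1 * u i) = (\<Prod>i<4. z - of_int m * t (\<pi> i))"
      by (intro prod.cong) (auto simp: um \<open>m0 = 0\<close>)
    also have "\<dots> = (\<Prod>i<4. z - of_int m * t i)"
      by (rule prod.reindex_bij_betw[OF \<pi>(1), of "\<lambda>i. z - of_int m * t i"])
    finally have "(\<Prod>i<4. z - 1 * u i) = (\<Prod>i<4. z - of_int m * t i)" .
    then show ?thesis unfolding q[OF A.vieta] q[OF B.vieta] by simp
  qed
  have "complex_of_int g4 = of_int (m ^ 4 * f4)" using poly[of 0] by simp
  then have g4: "g4 = m ^ 4 * f4" by (simp only: of_int_eq_iff)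
  have "of_int g2 + of_int g3 = (of_int (m\<^sup>2 * f2 + m ^ 3 * f3) :: complex)" using poly[of 1] g4 by simp
  moreover have "of_int g2 - of_int g3 = (of_int (m\<^sup>2 * f2 - m ^ 3 * f3) :: complex)" using poly[of "-1"] g4 by simp
  ultimately have "g2 + g3 = m\<^sup>2 * f2 + m ^ 3 * f3" "g2 - g3 = m\<^sup>2 * f2 - m ^ 3 * f3"
    by (simp_all only: of_int_add[symmetric] of_int_diff[symmetric] of_int_eq_iff)
  then have "g2 = m\<^sup>2 * f2" "g3 = m ^ 3 * f3" by linarith+
  then show ?thesis using g4 by (rule that)
qed

text \<open>Scaling in both directions shows that a positive power of \<open>n * m\<close> fixes a
  nonzero coefficient; one exists, since otherwise all roots would be 0 and not distinct. So
  \<open>m\<close> is 1 or -1, and the sign affects only the coefficient of odd weight.\<close>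

lemma same_class_coeffs:
  assumes A: "bounded_quartic 0 f2 f3 f4 t h" and B: "bounded_quartic 0 g2 g3 g4 u h"
    and \<delta>: "0 < \<delta>" "\<delta> * h ^ 12 \<le> (cmod (vandermonde t))\<^sup>2" "\<delta> * h ^ 12 \<le> (cmod (vandermonde u))\<^sup>2"
    and large: "48 * 14 ^ 3 < sqrt \<delta> * h"
    and same: "psi_mon (monic_quartic 0 f2 f3 f4) = psi_mon (monic_quartic 0 g2 g3 g4)"
  shows "g2 = f2 \<and> (g3 = f3 \<or> g3 = - f3) \<and> g4 = f4"
proof -
  interpret A: bounded_quartic 0 f2 f3 f4 t h by (rule A)
  obtain m where m: "g2 = m\<^sup>2 * f2" "g3 = m ^ 3 * f3" "g4 = m ^ 4 * f4"
    by (rule same_class_scaled[OF A B \<delta>(1,2) large same])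
  obtain n where n: "f2 = n\<^sup>2 * g2" "f3 = n ^ 3 * g3" "f4 = n ^ 4 * g4"
    by (rule same_class_scaled[OF B A \<delta>(1,3) large same[symmetric]])
  have e: "f2 = (n * m)\<^sup>2 * f2" "f3 = (n * m) ^ 3 * f3" "f4 = (n * m) ^ 4 * f4"
    using m n by (simp_all add: power_mult_distrib mult.assoc)
  have "f2 \<noteq> 0 \<or> f3 \<noteq> 0 \<or> f4 \<noteq> 0"
  proof (rule ccontr)
    assume "\<not> ?thesis"
    then have "t 0 = 0" "t 1 = 0" using A.t_quartic[of 0] A.t_quartic[of 1] by simp_all
    then show False using A.distinct unfolding inj_on_4_iff by simp
  qed
  moreover have "a = 1" if "x = a * x" "x \<noteq> 0" for a x :: int using that by simp
  ultimately have "(n * m)\<^sup>2 = 1 \<or> (n * m) ^ 3 = 1 \<or> (n * m) ^ 4 = 1"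
    using e by blast
  then obtain k :: nat where k: "0 < k" "(n * m) ^ k = 1"
    by (elim disjE; intro that[of 2] that[of 3] that[of 4]; simp)
  then have "\<bar>n * m\<bar> ^ k = 1 ^ k" by (simp flip: power_abs)
  then have "\<bar>n * m\<bar> = 1" by (rule power_eq_imp_eq_base) (use k in auto)
  then have "m dvd 1" using zdvd1_eq[of "n * m"] by (metis dvd_trans dvd_triv_right)
  then have "\<bar>m\<bar> = 1" by simp
  then have "m = 1 \<or> m = -1" by linarith
  then show ?thesis using m by auto
qed

section \<open>The second limit: many classes of monic quartics\<close>

lemma card_good_box_ge:
  assumes h: "2 \<le> h" "24 \<le> h ^ 4"
  shows "h ^ 9 / 2 \<le> real (card (good_box ({0} \<times> int_box (h\<^sup>2) \<times> int_box (h ^ 3)) (1 / 16) h))"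
proof -
  let ?G = "{0::int} \<times> int_box (h\<^sup>2) \<times> int_box (h ^ 3)"
  have h1: "1 \<le> h" using h by simp
  have "h\<^sup>2 * h ^ 3 \<le> real (card (int_box (h\<^sup>2))) * real (card (int_box (h ^ 3)))"
    using h1 by (intro mult_mono card_int_box_ge one_le_power) auto
  then have G: "h ^ 5 \<le> real (card ?G)"
    by (simp add: card_cartesian_product flip: power_add)
  have "h ^ 4 \<le> real (card (int_box (h ^ 4)))" using h1 by (intro card_int_box_ge one_le_power)
  \<comment> \<open>With \<open>c = 1 / 16\<close> the excluded values number at most
    \<open>3 / 8 * h ^ 4 + 3\<close>; half of the box remains if
    \<open>h ^ 4 \<ge> 24\<close>.\<close>
  then have I: "h ^ 4 / 2 \<le> real (card (int_box (h ^ 4))) - 3 * (2 * (1 / 16) * h ^ 4 + 1)"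
    using h(2) by (simp add: field_simps)
  have "h ^ 9 / 2 = h ^ 5 * (h ^ 4 / 2)" by (simp flip: power_add)
  also have "\<dots> \<le> real (card ?G) * (real (card (int_box (h ^ 4))) - 3 * (2 * (1 / 16) * h ^ 4 + 1))"
    using h1 by (intro mult_mono[OF G I]) auto
  also have "\<dots> \<le> real (card (good_box ?G (1 / 16) h))"
    using h1 by (intro card_good_box) (auto simp: int_box_finite)
  finally show ?thesis .
qed

text \<open>\<open>(4 * h) ^ 12\<close> is the bound of \<open>vdm_bound\<close> for discriminants
  at height \<open>h\<close>. For the discriminant constant 1/16, \<open>same_class_coeffs\<close>
  demands that \<open>h\<close> exceed \<open>4 * 48 * 14 ^ 3 = 526848\<close>.\<close>

lemma mon_classes_ge:
  assumes h: "600000 \<le> h" and \<epsilon>: "2 * close_const (1 / 16) \<le> \<epsilon>" "0 \<le> \<epsilon>" and fin: "finite (F4 exps \<epsilon> ((4 * h) ^ 12))"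
  shows "h ^ 9 / 4 \<le> real (card {K \<in> F4 exps \<epsilon> ((4 * h) ^ 12). K \<in> psi_mon ` F4_mon})"
proof -
  let ?T = "(4 * h) ^ 12" and ?G = "{0::int} \<times> int_box (h\<^sup>2) \<times> int_box (h ^ 3)"
  let ?A = "good_box ?G (1 / 16) h" and ?B = "{K \<in> F4 exps \<epsilon> ((4 * h) ^ 12). K \<in> psi_mon ` F4_mon}"
  have h1: "1 \<le> h" using h by simp
  have "h ^ 1 \<le> h ^ 4" using h by (intro power_increasing) auto
  then have h4: "24 \<le> h ^ 4" using h by simp
  have G: "?G \<subseteq> int_box h \<times> int_box (h\<^sup>2) \<times> int_box (h ^ 3)" using h1 by (auto simp: int_box_def)
  have c: "256 * (1 / 16) ^ 3 = (1 / 16 :: real)" by (simp add: power3_eq_cube)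
  have "(16::real) ^ 12 \<le> h ^ 12" using h by (intro power_mono) auto
  then have h12: "4 ^ 16 \<le> h ^ 12" by simp
  have T: "1 < ?T" using h1 by (intro one_less_power) auto
  have props: "\<exists>f2 f3 f4 t. x = ((0, f2, f3), f4) \<and> bounded_quartic 0 f2 f3 f4 t h \<and> 1 / 16 * h ^ 12 \<le> (cmod (vandermonde t))\<^sup>2 \<and>
      quartic_of x \<in> F4_mon" if x: "x \<in> ?A" for x
  proof (rule good_box_props[OF x G _ h1], goal_cases)
    case (2 f1 f2 f3 f4 t)
    have "f1 = 0" using x 2(1) by (auto simp: good_box_def)
    then show ?case using 2(1-4) unfolding c by blast
  qed simp
  have sub: "(\<lambda>x. psi_mon (quartic_of x)) ` ?A \<subseteq> ?B"
  proof
    fix K assume "K \<in> (\<lambda>x. psi_mon (quartic_of x)) ` ?A"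
    then obtain x where x: "x \<in> ?A" "K = psi_mon (quartic_of x)" by blast
    obtain f2 f3 f4 t where e: "x = ((0, f2, f3), f4)" "bounded_quartic 0 f2 f3 f4 t h"
      "1 / 16 * h ^ 12 \<le> (cmod (vandermonde t))\<^sup>2" "quartic_of x \<in> F4_mon" using props[OF x(1)] by blast
    interpret bounded_quartic 0 f2 f3 f4 t h by (rule e(2))
    let ?D = "(cmod (vandermonde t))\<^sup>2"
    have DT: "?D \<le> ?T" using vdm_bound unfolding vdm_eq by (simp add: power_mult_distrib)
    have "1 < 1 / 16 * h ^ 12" using h12 by simp
    then have D1: "1 < ?D" using e(3) by (rule less_le_trans)
    \<comment> \<open>The discriminant is at least \<open>h ^ 12 / 16\<close>, and
      \<open>4 ^ 16 \<le> h ^ 12\<close>, so \<open>T\<close> is at most its square. This is the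
      origin of the factor 2 before \<open>close_const\<close>.\<close>
    have "?T = 4 ^ 12 * h ^ 12" by (simp add: power_mult_distrib)
    also have "\<dots> \<le> (h ^ 12 / 4 ^ 4) * h ^ 12" using h12 h1 by (intro mult_right_mono) auto
    also have "\<dots> = (1 / 16 * h ^ 12)\<^sup>2" by (simp add: power2_eq_square)
    also have "\<dots> \<le> ?D\<^sup>2" using e(3) h1 by (intro power_mono) auto
    finally have "?T \<le> ?D\<^sup>2" .
    then have "ln ?T \<le> ln (?D\<^sup>2)" using T by (intro ln_mono) auto
    also have "\<dots> = 2 * ln ?D" using D1 by (subst ln_realpow) auto
    finally have lnT: "ln ?T \<le> 2 * ln ?D" .
    have cc: "0 \<le> close_const (1 / 16)"
      unfolding close_const_def by (intro add_nonneg_nonneg abs_ge_zero ln_ge_zero) simp_all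
    have "close_const (1 / 16) * ln ?T \<le> close_const (1 / 16) * (2 * ln ?D)" by (rule mult_left_mono[OF lnT cc])
    also have "\<dots> = (2 * close_const (1 / 16)) * ln ?D" by simp
    also have "\<dots> \<le> \<epsilon> * ln ?D" using \<epsilon> D1 by (intro mult_right_mono) auto
    finally have close: "close_const (1 / 16) * ln ?T \<le> \<epsilon> * ln ?D" .
    obtain P where P: "P \<in> quartic_pairs" "psi_mon (monic_quartic 0 f2 f3 f4) = pair_iso `` {P}"
        "Defs.close exps \<epsilon> ?T P" "pair_disc P = ?D"
      by (rule quartic_of_close[OF e(2) _ e(3) D1 T close]) simp
    have K: "K = pair_iso `` {P}" using x(2) P(2) e(1) by (simp add: quartic_of_def)
    have "K \<in> F4 exps \<epsilon> ?T" unfolding F4_def K by (rule quotientI) (use P DT in simp)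
    moreover have "K \<in> psi_mon ` F4_mon" using x(2) e(4) by (rule image_eqI)
    ultimately show "K \<in> ?B" by simp
  qed
  have finA: "finite ?A" by (intro finite_good_box) (simp add: int_box_finite)
  \<comment> \<open>Replacing the variable by its negative changes only the sign of
    \<open>f3\<close>, so two polynomials in the box may share a class.\<close>
  have fib: "card {x \<in> ?A. psi_mon (quartic_of x) = K} \<le> 2" for K
  proof (cases "{x \<in> ?A. psi_mon (quartic_of x) = K} = {}")
    case True
    show ?thesis unfolding True by simp
  next
    case False
    then obtain x where x: "x \<in> ?A" "psi_mon (quartic_of x) = K" by blast
    obtain f2 f3 f4 t where e: "x = ((0, f2, f3), f4)" "bounded_quartic 0 f2 f3 f4 t h"
      "1 / 16 * h ^ 12 \<le> (cmod (vandermonde t))\<^sup>2" using props[OF x(1)] by blast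
    have "{x \<in> ?A. psi_mon (quartic_of x) = K} \<subseteq> {((0, f2, f3), f4), ((0, f2, - f3), f4)}"
    proof
      fix y assume "y \<in> {x \<in> ?A. psi_mon (quartic_of x) = K}"
      then have y: "y \<in> ?A" "psi_mon (quartic_of y) = K" by blast+
      obtain g2 g3 g4 u where g: "y = ((0, g2, g3), g4)" "bounded_quartic 0 g2 g3 g4 u h"
        "1 / 16 * h ^ 12 \<le> (cmod (vandermonde u))\<^sup>2" using props[OF y(1)] by blast
      have "g2 = f2 \<and> (g3 = f3 \<or> g3 = - f3) \<and> g4 = f4"
      proof (rule same_class_coeffs[OF e(2) g(2) _ e(3) g(3)])
        have "sqrt (1 / 16) = (1 / 4 :: real)" by (rule real_sqrt_unique) (simp_all add: power2_eq_square)
        then show "48 * 14 ^ 3 < sqrt (1 / 16) * h" using h by (simp only:) simp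
        show "psi_mon (monic_quartic 0 f2 f3 f4) = psi_mon (monic_quartic 0 g2 g3 g4)"
          using x(2) y(2) e(1) g(1) by (simp add: quartic_of_def)
      qed simp
      then show "y \<in> {((0, f2, f3), f4), ((0, f2, - f3), f4)}" using g(1) by auto
    qed
    then have "card {x \<in> ?A. psi_mon (quartic_of x) = K} \<le> card {((0::int, f2, f3), f4), ((0, f2, - f3), f4)}"
      by (rule card_mono[rotated]) simp
    also have "\<dots> \<le> 2" by (rule order_trans[OF card_insert_le_m1[of 2]]) simp_all
    finally show ?thesis .
  qed
  have "finite ?B" using fin by simp
  then have "card ?A \<le> 2 * card ?B" by (rule card_le_fibers[OF finA _ sub fib])
  then have "real (card ?A) \<le> 2 * real (card ?B)" by linarith
  then show ?thesis using card_good_box_ge[of h] h h4 by simp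
qed

text \<open>The height is a quarter of the twelfth root of \<open>T\<close>, so the lower and the
  upper count are both multiples of the ninth power of that root. The threshold is
  \<open>2400000 = 4 * 600000\<close>.\<close>

lemma mon_classes_ratio_ge:
  assumes \<epsilon>: "2 * close_const (1 / 16) \<le> \<epsilon>" "0 \<le> \<epsilon>" and T: "1 < T" "12 * \<epsilon> < ln T" "2400000 ^ 12 \<le> T"
  shows "1 / (8 * 4 ^ 9 * scale_const (2 * exp \<epsilon>))
    \<le> real (card {K \<in> F4 exps \<epsilon> T. K \<in> psi_mon ` F4_mon}) / real (card (F4 exps \<epsilon> T))"
proof -
  let ?n = "real (card {K \<in> F4 exps \<epsilon> T. K \<in> psi_mon ` F4_mon})" and ?d = "real (card (F4 exps \<epsilon> T))"
  define z S where "z = exp (ln T / 12)" and "S = scale_const (2 * exp \<epsilon>)"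
  have z12: "(4 * (z / 4)) ^ 12 = T" using T(1) by (simp add: z_def exp_of_nat_mult[symmetric])
  have z0: "0 < z" by (simp add: z_def)
  have "2400000 \<le> z" by (rule power_le_imp_le_base[of _ 11]) (use z12 T z0 in simp_all)
  then have n: "(z / 4) ^ 9 / 4 \<le> ?n"
    using mon_classes_ge[of "z / 4", OF _ \<epsilon>] card_F4_le(1)[OF \<epsilon>(2) T(1,2)] unfolding z12 by simp
  have d: "?d \<le> 2 * S * z ^ 9" unfolding S_def z_def by (rule card_F4_le(2)[OF \<epsilon>(2) T(1,2)])
  have "0 < (z / 4) ^ 9 / 4" using z0 by simp
  then have n0: "0 < ?n" using n by linarith
  have "?n \<le> ?d" using card_F4_le(1)[OF \<epsilon>(2) T(1,2)] by (intro of_nat_mono card_mono) auto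
  then have d0: "0 < ?d" using n0 by linarith
  then have "0 < 2 * S * z ^ 9" using d by linarith
  then have S: "0 < S" using z0 by (simp add: zero_less_mult_iff)
  have "1 / (8 * 4 ^ 9 * S) = ((z / 4) ^ 9 / 4) / (2 * S * z ^ 9)" using z0 S by (simp add: power_divide field_simps)
  also have "\<dots> \<le> ?n / ?d" using n d d0 n0 by (intro frac_le) auto
  finally show ?thesis unfolding S_def .
qed

theorem theorem5p6:
  shows "corresponds_to F4_mon H_r psi_mon (1/12, 1/6, 1/4, 1/6, 1/3)"
proof -
  have pos: "0 < Liminf at_top (\<lambda>T. ereal (real (card {K \<in> F4 exps \<epsilon> T. K \<in> psi_mon ` F4_mon}) / real (card (F4 exps \<epsilon> T))))"
    if \<epsilon>: "max 0 (2 * close_const (1 / 16)) < \<epsilon>" for \<epsilon>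
  proof -
    let ?c = "1 / (8 * 4 ^ 9 * scale_const (2 * exp \<epsilon>))"
    have \<epsilon>': "2 * close_const (1 / 16) \<le> \<epsilon>" "0 \<le> \<epsilon>" using \<epsilon> by auto
    have "codes \<noteq> {}" by (auto simp: codes_def PiE_eq_empty_iff)
    then have "0 < card codes" using finite_codes by (simp add: card_gt_0_iff)
    then have "0 < scale_const (2 * exp \<epsilon>)" by (simp add: scale_const_def)
    then have "0 < ereal ?c" by simp
    also have "ereal ?c \<le> Liminf at_top (\<lambda>T. ereal (real (card {K \<in> F4 exps \<epsilon> T. K \<in> psi_mon ` F4_mon}) / real (card (F4 exps \<epsilon> T))))"
    proof (rule Liminf_bounded)
      show "eventually (\<lambda>T. ereal ?c \<le> ereal (real (card {K \<in> F4 exps \<epsilon> T. K \<in> psi_mon ` F4_mon}) / real (card (F4 exps \<epsilon> T)))) at_top"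
        using eventually_gt_at_top[of 1] eventually_gt_at_top[of "exp (12 * \<epsilon>)"] eventually_ge_at_top[of "2400000 ^ 12"]
      proof eventually_elim
        case (elim T)
        have "12 * \<epsilon> < ln T" using elim(1,2) by (subst exp_less_cancel_iff[symmetric]) simp
        from mon_classes_ratio_ge[OF \<epsilon>' elim(1) this elim(3)] show ?case unfolding ereal_less_eq .
      qed
    qed
    finally show ?thesis .
  qed
  have "\<exists>M. \<forall>\<epsilon>>M. 0 < Liminf at_top (\<lambda>T. ereal (real (card {K \<in> F4 exps \<epsilon> T. K \<in> psi_mon ` F4_mon}) / real (card (F4 exps \<epsilon> T))))"
    by (rule exI[of _ "max 0 (2 * close_const (1 / 16))"], intro allI impI) (rule pos)
  then show ?thesis
    using infinite_F4_mon finite_height psi_mon_quotient mon_ratio_tendsto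
    unfolding corresponds_to_def mon_ratio_def exps_def by simp
qed

end
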